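(* Let $\lambda\in(0,1)$. Let $A_1,\ldots,A_n\in \mathrm{GL}(n)$ be linear reflections of $\mathbb{R}^n$ with associated hyperplanes $H_1,\ldots,H_n$ such that $H_1\cap\ldots\cap H_n=\{o\}$, and let $K$ and $L$ be convex bodies in $\mathbb{R}^n$ that are invariant under $A_1,\ldots,A_n$. Then $$V((1-\lambda)\cdot K +_0 \lambda\cdot L)\geq V(K)^{1-\lambda}\, V(L)^\lambda .$$ In addition, equality holds if and only if, for some $m\geq 1$, $K=K_1+\ldots+K_m$ and $L=L_1+\ldots+L_m$ for compact convex sets $K_1,\ldots,K_m,L_1,\ldots,L_m$ of dimension at least one and invariant under $A_1,\ldots,A_n$, where $\sum_{i=1}^m\dim K_i=n$ and $K_i$ and $L_i$ are homothetic for $i=1,\ldots,m$.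
   Context: A convex body in $\mathbb{R}^n$ is a compact convex set with non-empty interior; $V$ is $n$-dimensional Lebesgue measure; $o$ is the origin; sums of sets are Minkowski sums. A set $X\subset\mathbb{R}^n$ is invariant under $A\in\mathrm{GL}(n)$ if $AX=X$. A map $A\in \mathrm{GL}(n)$ is a linear reflection if $A\neq \mathrm{Id}$, $A^2=\mathrm{Id}$ and $Ax=x$ for all $x$ in some $(n-1)$-dimensional linear subspace $H$; $H$ is the hyperplane associated to $A$. The support function of a compact convex set $K$ is $h_K(u)=\max\{\langle u,y\rangle: y\in K\}$. For convex bodies $K,L$ with $o$ in their interiors (automatically the case under the invariance hypothesis of the claim) and $\lambda\in(0,1)$, the $L_0$-sum is $$(1-\lambda)\cdot K+_0\lambda\cdot L=\{x\in\mathbb{R}^n:\langle x,u\rangle\leq h_K(u)^{1-\lambda}h_L(u)^{\lambda}\ \ \forall u\in S^{n-1}\}.$$ Compact convex sets $M,N$ are homothetic if $N=\gamma M+x$ for some $\gamma>0$ and $x\in\mathbb{R}^n$. *)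

theory Defs
  imports "HOL-Analysis.Analysis" "HOL-Library.Set_Algebras"
begin

text \<open>Sums of sets, both binary and indexed by a finite set, are the Minkowski sums of
  \<^theory>\<open>HOL-Library.Set_Algebras\<close>.\<close>

definition convex_body :: "(real ^ 'n) set \<Rightarrow> bool" where
  "convex_body K \<longleftrightarrow> compact K \<and> convex K \<and> interior K \<noteq> {}"

definition invariant_under :: "real ^ 'n ^ 'n \<Rightarrow> (real ^ 'n) set \<Rightarrow> bool" where
  "invariant_under A X \<longleftrightarrow> (\<lambda>x. A *v x) ` X = X"

text \<open>The reflection need not be orthogonal. The hyperplane \<open>H\<close> is determined by \<open>A\<close>, as
  \<open>A\<close> is not the identity.\<close>

definition linear_reflection :: "real ^ 'n ^ 'n \<Rightarrow> (real ^ 'n) set \<Rightarrow> bool" where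
  "linear_reflection A H \<longleftrightarrow>
     invertible A \<and> A \<noteq> mat 1 \<and> A ** A = mat 1 \<and>
     subspace H \<and> dim H = CARD('n) - 1 \<and> (\<forall>x\<in>H. A *v x = x)"

text \<open>For nonempty compact \<open>K\<close> the supremum is attained, so it is the maximum.\<close>

definition support_function :: "(real ^ 'n) set \<Rightarrow> real ^ 'n \<Rightarrow> real" where
  "support_function K u = (SUP y\<in>K. u \<bullet> y)"

text \<open>\<open>L0_sum l K L\<close> is the \<open>L\<^sub>0\<close>-sum of \<open>K\<close> and \<open>L\<close> with weights \<open>1 - l\<close> and \<open>l\<close>. It is meant for
  convex bodies with the origin in the interior, whose support functions are positive on the unit
  sphere.\<close>

definition L0_sum :: "real \<Rightarrow> (real ^ 'n) set \<Rightarrow> (real ^ 'n) set \<Rightarrow> (real ^ 'n) set" where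
  "L0_sum l K L =
     {x. \<forall>u\<in>sphere 0 1.
        x \<bullet> u \<le> support_function K u powr (1 - l) * support_function L u powr l}"

definition homothetic :: "(real ^ 'n) set \<Rightarrow> (real ^ 'n) set \<Rightarrow> bool" where
  "homothetic M N \<longleftrightarrow> (\<exists>c > 0. \<exists>x. N = (\<lambda>y. c *\<^sub>R y + x) ` M)"

end

theory Submission
  imports Defs "HOL-Probability.Distribution_Functions"
begin

text \<open>
  The inertia form of \<open>K\<close> turns the given reflections into orthogonal ones. The unit normals of all
  orthogonal reflections that preserve \<open>K\<close> and \<open>L\<close> form a closed set \<open>R\<close> that is invariant under its own
  reflections; an infinite \<open>R\<close> contains the unit sphere of a subspace and splits orthogonally, so \<open>R\<close>
  always contains a finite root system that spans the space. Let \<open>u i\<close> be its simple roots, \<open>v i\<close> the dual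
  basis, and \<open>C\<close> the chamber. In the coordinates \<open>x = \<Sum> x\<^sub>i v i\<close> the sets \<open>K \<inter> C\<close> and \<open>L \<inter> C\<close> are
  down-closed in the positive orthant, because every \<open>v i \<bullet> v j\<close> is nonnegative, and by the inequality of
  Hoelder the \<open>L\<^sub>0\<close>-sum contains their coordinatewise geometric product. The inequality follows from
  \<open>V(A\<^sup>1\<^sup>-\<^sup>\<lambda> B\<^sup>\<lambda>) \<ge> V(A)\<^sup>1\<^sup>-\<^sup>\<lambda> V(B)\<^sup>\<lambda>\<close>, which is proved for unions of boxes by cutting with coordinate hyperplanes.

  In the case of equality the cutting argument, applied to the level sets of the functions \<open>\<Prod> x\<^sub>i\<^sup>\<theta>\<^sup>i\<close>, shows that
  \<open>L \<inter> C\<close> is the image of \<open>K \<inter> C\<close> under a diagonal map \<open>d\<close>. The normals of the \<open>L\<^sub>0\<close>-sum must then be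
  supported in the blocks where \<open>d\<close> is constant; hence these blocks are orthogonal, \<open>K\<close> is the sum of
  its projections to them, and \<open>L\<close> is the sum of the multiples of these projections by the values of \<open>d\<close>.
  The blocks are preserved by every reflection that preserves \<open>K\<close> and \<open>L\<close>, because they can be read off
  from the quotient of the support functions.

  Conversely, for \<open>K = \<Sum> K\<^sub>j\<close> and \<open>L = \<Sum> c\<^sub>j K\<^sub>j\<close> the \<open>L\<^sub>0\<close>-sum is contained in \<open>\<Sum> c\<^sub>j\<^sup>\<lambda> K\<^sub>j\<close>. The
  inequality for the factors \<open>c\<^sub>j\<close> and for their inverses determines the volume of the latter body.\<close>

section \<open>Linear images of Lebesgue measure\<close>

text \<open>The cutting argument works in a chamber, and the given reflections may generate an
  infinite group, which has none. Hence the passage to all reflections that preserve both bodies: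
  their normals are stable under their own reflections, and a finite spanning subsystem can be
  extracted from them. The price is that the blocks of the equality case are at first invariant only
  under this subsystem; their invariance under the given reflections has to be recovered from
  \<open>K\<close> and \<open>L\<close> themselves.

  In logarithmic coordinates the product inequality is of Prekopa-Leindler type. Its equality case
  is reached by one-dimensional means: monomials are multiplicative under \<open>gprod\<close>, so
  their distributions on \<open>A\<close> and \<open>B\<close> can be compared level by level, and
  equality makes them agree up to a factor \<open>k\<close>. Expectations of logarithms show that
  \<open>ln k\<close> is linear in the exponents; its coefficients are the logarithms of the entries
  of \<open>d\<close>. Since a convex down-closed body is determined by the maxima of all monomials,
  this identifies \<open>B\<close> as a diagonal image of \<open>A\<close>.\<close>

lemma nn_integral_translate:
  fixes \<nu> :: "'a::euclidean_space measure"
  assumes inv: "\<And>a. distr \<nu> borel ((+) a) = \<nu>" and f: "f \<in> borel_measurable borel"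
      and "sets \<nu> = sets borel"
  shows "(\<integral>\<^sup>+x. f (x + a) \<partial>\<nu>) = (\<integral>\<^sup>+x. f x \<partial>\<nu>)"
proof -
  have [measurable_cong]: "sets \<nu> = sets borel" by fact
  have "(\<integral>\<^sup>+x. f x \<partial>\<nu>) = (\<integral>\<^sup>+x. f x \<partial>(distr \<nu> borel ((+) a)))" by (simp add: inv)
  also have "\<dots> = (\<integral>\<^sup>+x. f (a + x) \<partial>\<nu>)"
    using f by (subst nn_integral_distr) auto
  finally show ?thesis by (simp add: add.commute)
qed

text \<open>Uniqueness of a translation invariant measure by the usual Fubini argument applied to
  \<open>\<integral>\<integral> 1\<^sub>A(x) 1\<^sub>B(x + y)\<close>. It replaces the change of variables formula of the library, which is
  restricted to well-ordered index types.\<close>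

lemma translation_invariant_measure_unique:
  fixes \<nu> :: "'a::euclidean_space measure"
  assumes inv: "\<And>a. distr \<nu> borel ((+) a) = \<nu>" and sets: "sets \<nu> = sets borel"
    and sf: "sigma_finite_measure \<nu>" and [measurable]: "A \<in> sets borel" "B \<in> sets borel"
  shows "emeasure lborel B * emeasure \<nu> A = emeasure lborel A * emeasure \<nu> B"
proof -
  have [measurable_cong]: "sets \<nu> = sets borel" by fact
  interpret N: sigma_finite_measure \<nu> by fact
  interpret pair_sigma_finite \<nu> lborel ..
  have linv: "distr lborel borel ((+) a) = (lborel::'a measure)" for a
    by (simp add: lborel_distr_plus)
  have "emeasure lborel B * emeasure \<nu> A = (\<integral>\<^sup>+x. emeasure lborel B * indicator A x \<partial>\<nu>)"
    by (simp add: nn_integral_cmult_indicator)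
  also have "\<dots> = (\<integral>\<^sup>+x. (\<integral>\<^sup>+y. indicator A x * indicator B (y + x) \<partial>lborel) \<partial>\<nu>)"
  proof (rule nn_integral_cong)
    fix x
    have "(\<integral>\<^sup>+y. indicator B (y + x) \<partial>lborel) = (\<integral>\<^sup>+y. indicator B y \<partial>lborel)"
      by (rule nn_integral_translate[OF linv]) auto
    then show "emeasure lborel B * indicator A x = (\<integral>\<^sup>+y. indicator A x * indicator B (y + x) \<partial>lborel)"
      by (simp add: nn_integral_cmult mult.commute)
  qed
  also have "\<dots> = (\<integral>\<^sup>+y. (\<integral>\<^sup>+x. indicator A x * indicator B (y + x) \<partial>\<nu>) \<partial>lborel)"
    by (subst Fubini') simp_all
  also have "\<dots> = (\<integral>\<^sup>+y. (\<integral>\<^sup>+x. indicator A (x - y) * indicator B x \<partial>\<nu>) \<partial>lborel)"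
  proof (rule nn_integral_cong)
    fix y
    show "(\<integral>\<^sup>+x. indicator A x * indicator B (y + x) \<partial>\<nu>) = (\<integral>\<^sup>+x. indicator A (x - y) * indicator B x \<partial>\<nu>)"
      using nn_integral_translate[OF inv _ sets, of "\<lambda>x. indicator A (x - y) * indicator B x" y]
      by (simp add: add.commute)
  qed
  also have "\<dots> = (\<integral>\<^sup>+x. (\<integral>\<^sup>+y. indicator A (x - y) * indicator B x \<partial>lborel) \<partial>\<nu>)"
    by (subst Fubini') simp_all
  also have "\<dots> = (\<integral>\<^sup>+x. emeasure lborel A * indicator B x \<partial>\<nu>)"
  proof (rule nn_integral_cong)
    fix x
    \<comment> \<open>The variable of integration now occurs as \<open>x - y\<close>, so invariance
      under negation is used besides translation invariance.\<close>
    have neg: "distr lborel borel uminus = (lborel::'a measure)"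
      using lborel_affine[of "-1" "0::'a"] by (simp add: density_1 o_def)
    have "(\<integral>\<^sup>+y. indicator A (x - y) \<partial>lborel) = (\<integral>\<^sup>+y. indicator A (x - y) \<partial>(distr lborel borel uminus))"
      by (simp add: neg)
    also have "\<dots> = (\<integral>\<^sup>+y. indicator A (y + x) \<partial>lborel)"
      by (subst nn_integral_distr) (auto simp: add.commute)
    also have "\<dots> = emeasure lborel A"
      by (subst nn_integral_translate[OF linv]) auto
    finally show "(\<integral>\<^sup>+y. indicator A (x - y) * indicator B x \<partial>lborel) = emeasure lborel A * indicator B x"
      by (simp add: nn_integral_multc)
  qed
  also have "\<dots> = emeasure lborel A * emeasure \<nu> B"
    by (simp add: nn_integral_cmult_indicator)
  finally show ?thesis .
qed

text \<open>Sending a set to the volume of its image under \<open>f\<close> is a translation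
  invariant measure \<open>\<nu>\<close>, because a shift by \<open>a\<close> before
  \<open>f\<close> is a shift by \<open>f a\<close> after it. By uniqueness it is a multiple of
  Lebesgue measure. The factor is the volume of the image of the unit cube: finite by compactness,
  and nonzero because the whole space would be null otherwise.\<close>

lemma linear_image_measure:
  fixes f g :: "'a::euclidean_space \<Rightarrow> 'a"
  assumes f: "linear f" and g: "linear g" and fg: "\<And>x. f (g x) = x" and gf: "\<And>x. g (f x) = x"
  obtains c where "0 < c" and "\<And>A. A \<in> sets borel \<Longrightarrow> f ` A \<in> sets borel"
    and "\<And>A. A \<in> sets borel \<Longrightarrow> emeasure lborel (f ` A) = ennreal c * emeasure lborel A"
proof -
  have [measurable]: "f \<in> borel_measurable borel" "g \<in> borel_measurable borel"
    using f g
        by (auto intro!: borel_measurable_continuous_onI linear_continuous_on linear_conv_bounded_linear[THEN iffD1])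
  define \<nu> where "\<nu> = distr lborel borel g"
  have im: "f ` A = g -` A" for A
    using fg gf by (auto simp: image_iff) metis
  have nu: "emeasure \<nu> A = emeasure lborel (f ` A)" if "A \<in> sets borel" for A
    using that by (simp add: \<nu>_def emeasure_distr im)
  have bor: "f ` A \<in> sets borel" if "A \<in> sets borel" for A
    using measurable_sets[OF \<open>g \<in> _\<close> that] by (simp add: im)
  have inv: "distr \<nu> borel ((+) a) = \<nu>" for a
  proof -
    have "(+) a \<circ> g = g \<circ> (+) (f a)"
      using gf linear_add[OF g] by auto
    then have "distr \<nu> borel ((+) a) = distr (distr lborel borel ((+) (f a))) borel g"
      unfolding \<nu>_def by (simp add: distr_distr)
    then show ?thesis unfolding \<nu>_def by (simp add: lborel_distr_plus)
  qed
  have sets: "sets \<nu> = sets borel" by (simp add: \<nu>_def)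
  \<comment> \<open>\<open>\<nu>\<close> inherits sigma-finiteness from its image under
    \<open>f\<close>, which is Lebesgue measure.\<close>
  have "distr \<nu> lborel f = lborel"
  proof -
    have "distr \<nu> lborel f = distr lborel lborel (f \<circ> g)"
      unfolding \<nu>_def by (subst distr_distr) auto
    also have "\<dots> = lborel" using fg by (simp add: comp_def distr_id2)
    finally show ?thesis .
  qed
  then have sf: "sigma_finite_measure \<nu>"
    using sigma_finite_measure_distr[of \<nu> lborel f] sets
    by (metis \<open>f \<in> borel_measurable borel\<close> measurable_cong_sets sets_lborel sigma_finite_lborel)
  define Q where "Q = cbox (0::'a) One"
  have Q: "emeasure lborel Q = 1" "Q \<in> sets borel"
    by (auto simp: Q_def emeasure_lborel_cbox_eq)
  have eq: "emeasure \<nu> A = emeasure lborel A * emeasure \<nu> Q" if "A \<in> sets borel" for A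
    using translation_invariant_measure_unique[OF inv sets sf that Q(2)] Q(1) by simp
  have "compact (f ` Q)"
    unfolding Q_def using f
        by (intro compact_continuous_image linear_continuous_on) (auto simp: linear_conv_bounded_linear)
  then have fin: "emeasure \<nu> Q < \<infinity>"
    using nu[OF Q(2)] emeasure_compact_finite by metis
  have pos: "emeasure \<nu> Q \<noteq> 0"
  proof
    assume "emeasure \<nu> Q = 0"
    then have "emeasure \<nu> UNIV = 0" using eq[of UNIV] by simp
    then have "emeasure lborel (UNIV::'a set) = 0"
      unfolding \<nu>_def by (subst (asm) emeasure_distr) auto
    then show False by (simp add: emeasure_lborel_UNIV)
  qed
  define c where "c = enn2real (emeasure \<nu> Q)"
  have c: "ennreal c = emeasure \<nu> Q" "0 < c"
    using fin pos by (auto simp: c_def enn2real_positive_iff less_top zero_less_iff_neq_zero)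
  show thesis
  proof
    show "0 < c" by fact
    show "emeasure lborel (f ` A) = ennreal c * emeasure lborel A" if "A \<in> sets borel" for A
      using eq[OF that] nu[OF that] c by (simp add: mult.commute)
  qed (rule bor)
qed

section \<open>Geometric products of sets in the orthant\<close>

lemma powr_mean_le:
  fixes a b l :: real
  assumes "0 < l" "l < 1" "0 \<le> a" "0 \<le> b"
  shows "a powr (1 - l) * b powr l \<le> (1 - l) * a + l * b"
proof (cases "a = 0 \<or> b = 0")
  case True
  then show ?thesis using assms by auto
next
  case False
  then show ?thesis using assms Youngs_inequality_0[of "1 - l" l a b] by simp
qed

lemma powr_mean_scale:
  fixes a b c l :: real
  assumes "0 \<le> a" "0 \<le> b" "0 \<le> c"
  shows "(c * a) powr (1 - l) * (c * b) powr l = c * (a powr (1 - l) * b powr l)"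
proof -
  have "(c * a) powr (1 - l) * (c * b) powr l = (c powr (1 - l) * c powr l) * (a powr (1 - l) * b powr l)"
    using assms by (simp add: powr_mult)
  also have "c powr (1 - l) * c powr l = c" using assms by (simp flip: powr_add)
  finally show ?thesis .
qed

text \<open>Hoelder's inequality with exponents \<open>1 / (1 - l)\<close> and \<open>1 / l\<close>:
  once both sums are normalised to 1, it is the sum of the weighted inequalities between geometric
  and arithmetic mean of the terms. For infinite \<open>I\<close> all sums are 0 by
  convention.\<close>

lemma sum_powr_mean_le:
  fixes f g :: "'i \<Rightarrow> real"
  assumes l: "0 < l" "l < 1" and f: "\<And>i. i \<in> I \<Longrightarrow> 0 \<le> f i" and g: "\<And>i. i \<in> I \<Longrightarrow> 0 \<le> g i"
  shows "(\<Sum>i\<in>I. f i powr (1 - l) * g i powr l) \<le> (\<Sum>i\<in>I. f i) powr (1 - l) * (\<Sum>i\<in>I. g i) powr l"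
proof (cases "finite I \<and> sum f I \<noteq> 0 \<and> sum g I \<noteq> 0")
  case False
  then consider "infinite I" | "finite I" "sum f I = 0" | "finite I" "sum g I = 0" by auto
  then show ?thesis
  proof cases
    case 2
    then have "f i = 0" if "i \<in> I" for i using f that sum_nonneg_eq_0_iff[of I f] by auto
    then show ?thesis by simp
  next
    case 3
    then have "g i = 0" if "i \<in> I" for i using g that sum_nonneg_eq_0_iff[of I g] by auto
    then show ?thesis by simp
  qed simp
next
  case True
  define F G where "F = sum f I" and "G = sum g I"
  have pos: "0 < F" "0 < G"
    unfolding F_def G_def using True sum_nonneg[of I f, OF f] sum_nonneg[of I g, OF g] by auto
  have "f i powr (1 - l) * g i powr l \<le> (F powr (1 - l) * G powr l) * ((1 - l) * (f i / F) + l * (g i / G))"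
    if "i \<in> I" for i
  proof -
    have "(f i / F) powr (1 - l) * (g i / G) powr l \<le> (1 - l) * (f i / F) + l * (g i / G)"
      using powr_mean_le[of l "f i / F" "g i / G"] l f g pos that by simp
    then have "(F powr (1 - l) * G powr l) * ((f i / F) powr (1 - l) * (g i / G) powr l)
       \<le> (F powr (1 - l) * G powr l) * ((1 - l) * (f i / F) + l * (g i / G))"
      by (intro mult_left_mono) auto
    moreover have "(F powr (1 - l) * G powr l) * ((f i / F) powr (1 - l) * (g i / G) powr l) = f i powr (1 - l) * g i powr l"
      using pos f g that by (simp add: powr_divide)
    ultimately show ?thesis by simp
  qed
  then have "(\<Sum>i\<in>I. f i powr (1 - l) * g i powr l)
     \<le> (\<Sum>i\<in>I. (F powr (1 - l) * G powr l) * ((1 - l) * (f i / F) + l * (g i / G)))"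
    by (rule sum_mono)
  also have "\<dots> = (F powr (1 - l) * G powr l) * ((1 - l) * (F / F) + l * (G / G))"
    unfolding F_def G_def
        by (simp only: sum_distrib_left[symmetric] sum.distrib sum_divide_distrib[symmetric])
  also have "\<dots> = F powr (1 - l) * G powr l" using pos by simp
  finally show ?thesis by (simp add: F_def G_def)
qed

definition orthant :: "(real ^ 'n) set" where
  "orthant = {x. \<forall>i. 0 \<le> x $ i}"

definition gprod :: "real \<Rightarrow> real ^ 'n \<Rightarrow> real ^ 'n \<Rightarrow> real ^ 'n" where
  "gprod l x y = (\<chi> i. x $ i powr (1 - l) * y $ i powr l)"

definition gprods :: "real \<Rightarrow> (real ^ 'n) set \<Rightarrow> (real ^ 'n) set \<Rightarrow> (real ^ 'n) set" where
  "gprods l A B = (\<lambda>p. gprod l (fst p) (snd p)) ` (A \<times> B)"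

lemma gprod_nth [simp]: "gprod l x y $ i = x $ i powr (1 - l) * y $ i powr l"
  by (simp add: gprod_def)

lemma gprod_in_gprods: "x \<in> A \<Longrightarrow> y \<in> B \<Longrightarrow> gprod l x y \<in> gprods l A B"
  by (force simp: gprods_def)

lemma gprodsE:
  assumes "z \<in> gprods l A B" obtains x y where "x \<in> A" "y \<in> B" "z = gprod l x y"
  using assms by (auto simp: gprods_def)

lemma gprods_mono: "A \<subseteq> A' \<Longrightarrow> B \<subseteq> B' \<Longrightarrow> gprods l A B \<subseteq> gprods l A' B'"
  by (force simp: gprods_def)

lemma gprods_empty [simp]: "gprods l {} B = {}" "gprods l A {} = {}"
  by (auto simp: gprods_def)

text \<open>Lets an argument that cuts the first factor be applied to the second one, with
  \<open>1 - l\<close> in place of \<open>l\<close>.\<close>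

lemma gprods_swap: "gprods l A B = gprods (1 - l) B A"
proof -
  have "gprod l x y = gprod (1 - l) y x" for x y :: "real^'n"
    by (simp add: gprod_def mult.commute)
  then show ?thesis by (force simp: gprods_def image_iff)
qed

lemma gprods_orthant: "gprods l A B \<subseteq> orthant"
  by (auto simp: gprods_def orthant_def)

lemma closed_orthant [simp]: "closed (orthant :: (real ^ 'n) set)"
  unfolding orthant_def by (intro closed_Collect_all closed_Collect_le continuous_intros)

lemma continuous_on_gprod:
  assumes "0 < l" "l < 1"
  shows "continuous_on (orthant \<times> orthant) (\<lambda>p. gprod l (fst p) (snd p) :: real ^ 'n)"
  unfolding gprod_def
  using assms
      by (intro continuous_on_vec_lambda continuous_on_mult continuous_on_powr' continuous_intros)
     (auto simp: orthant_def)

lemma compact_gprods: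
  assumes "0 < l" "l < 1" "compact A" "compact B" "A \<subseteq> orthant" "B \<subseteq> orthant"
  shows "compact (gprods l A B)"
  unfolding gprods_def
  using assms
      by (intro compact_continuous_image continuous_on_subset[OF continuous_on_gprod] compact_Times) auto

text \<open>In each coordinate the two factors run simultaneously through their intervals; their
  geometric mean moves continuously from the lower to the upper bound, so every value between is
  taken.\<close>

lemma cbox_gprod_subset:
  fixes a b c d :: "real ^ 'n"
  assumes l: "0 < l" "l < 1" and ab: "\<And>i. 0 \<le> a $ i \<and> a $ i \<le> b $ i"
      and cd: "\<And>i. 0 \<le> c $ i \<and> c $ i \<le> d $ i"
  shows "cbox (gprod l a c) (gprod l b d) \<subseteq> gprods l (cbox a b) (cbox c d)"
proof
  fix z assume z: "z \<in> cbox (gprod l a c) (gprod l b d)"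
  have "\<exists>x y. a $ i \<le> x \<and> x \<le> b $ i \<and> c $ i \<le> y \<and> y \<le> d $ i \<and> x powr (1 - l) * y powr l = z $ i" for i
  proof -
    define f where "f s = (a $ i + s * (b $ i - a $ i)) powr (1 - l) * (c $ i + s * (d $ i - c $ i)) powr l"
        for s
    have "\<exists>s\<ge>0. s \<le> 1 \<and> f s = z $ i"
    proof (rule IVT')
      show "f 0 \<le> z $ i" "z $ i \<le> f 1" using z by (auto simp: f_def mem_box_cart)
      show "continuous_on {0..1} f"
        unfolding f_def using l ab[of i] cd[of i]
        by (intro continuous_on_mult continuous_on_powr' continuous_intros) auto
    qed simp
    then obtain s where s: "0 \<le> s" "s \<le> 1" "f s = z $ i" by auto
    have "s * (b $ i - a $ i) \<le> 1 * (b $ i - a $ i)" "s * (d $ i - c $ i) \<le> 1 * (d $ i - c $ i)"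
      using s ab[of i] cd[of i] by (intro mult_right_mono; simp)+
    moreover have "0 \<le> s * (b $ i - a $ i)" "0 \<le> s * (d $ i - c $ i)"
      using s ab[of i] cd[of i] by auto
    ultimately show ?thesis
      using s(3) unfolding f_def
      by (intro exI[of _ "a $ i + s * (b $ i - a $ i)"] exI[of _ "c $ i + s * (d $ i - c $ i)"]) auto
  qed
  then obtain x y where xy: "\<And>i. a $ i \<le> x i \<and> x i \<le> b $ i \<and> c $ i \<le> y i \<and> y i \<le> d $ i \<and> x i powr (1 - l) * y i powr l = z $ i"
    by metis
  have "z = gprod l (\<chi> i. x i) (\<chi> i. y i)" using xy by (simp add: vec_eq_iff)
  then show "z \<in> gprods l (cbox a b) (cbox c d)"
    using xy by (auto simp: mem_box_cart intro!: gprod_in_gprods)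
qed

text \<open>Volumes of boxes are products of side lengths, so the claim reduces to one inequality
  for intervals in each coordinate.\<close>

lemma measure_gprods_box:
  fixes a b c d :: "real ^ 'n"
  assumes l: "0 < l" "l < 1" and ab: "\<And>i. 0 \<le> a $ i \<and> a $ i \<le> b $ i"
      and cd: "\<And>i. 0 \<le> c $ i \<and> c $ i \<le> d $ i"
  shows "measure lebesgue (cbox a b) powr (1 - l) * measure lebesgue (cbox c d) powr l
     \<le> measure lebesgue (gprods l (cbox a b) (cbox c d))"
proof -
  have ne: "cbox a b \<noteq> {}" "cbox c d \<noteq> {}"
    using ab cd by (auto simp: interval_ne_empty_cart)
  have le: "gprod l a c $ i \<le> gprod l b d $ i" for i
    using ab[of i] cd[of i] l by (auto intro!: mult_mono powr_mono2)
  then have ne': "cbox (gprod l a c) (gprod l b d) \<noteq> {}"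
    by (subst interval_ne_empty_cart) blast
  have ineq: "(b $ i - a $ i) powr (1 - l) * (d $ i - c $ i) powr l \<le> gprod l b d $ i - gprod l a c $ i"
      for i
  proof -
    \<comment> \<open>Hoelder for two terms: an upper endpoint is the sum of the lower endpoint and
      the side length.\<close>
    define f g where "f = (\<lambda>t. if t then b $ i - a $ i else a $ i)"
        and "g = (\<lambda>t. if t then d $ i - c $ i else c $ i)"
    have "0 \<le> f t" "0 \<le> g t" for t using ab[of i] cd[of i] by (auto simp: f_def g_def)
    then have "(\<Sum>t\<in>(UNIV::bool set). f t powr (1 - l) * g t powr l) \<le> (\<Sum>t\<in>UNIV. f t) powr (1 - l) * (\<Sum>t\<in>UNIV. g t) powr l"
      using l by (intro sum_powr_mean_le)
    then show ?thesis by (simp add: f_def g_def UNIV_bool)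
  qed
  have "measure lebesgue (cbox a b) powr (1 - l) * measure lebesgue (cbox c d) powr l
    = (\<Prod>i\<in>UNIV. (b $ i - a $ i) powr (1 - l) * (d $ i - c $ i) powr l)"
    using ab cd
        by (simp add: content_cbox_cart[OF ne(1)] content_cbox_cart[OF ne(2)] prod_powr_distrib prod.distrib)
  also have "\<dots> \<le> (\<Prod>i\<in>UNIV. gprod l b d $ i - gprod l a c $ i)"
    using ineq by (intro prod_mono) auto
  also have "\<dots> = measure lebesgue (cbox (gprod l a c) (gprod l b d))"
    using content_cbox_cart[OF ne'] by simp
  also have "\<dots> \<le> measure lebesgue (gprods l (cbox a b) (cbox c d))"
  proof (rule measure_mono_fmeasurable[OF cbox_gprod_subset[OF assms]])
    have "cbox a b \<subseteq> orthant" "cbox c d \<subseteq> orthant"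
      using ab cd by (auto simp: orthant_def mem_box_cart) (meson order_trans)+
    then show "gprods l (cbox a b) (cbox c d) \<in> fmeasurable lebesgue"
      using l by (intro lmeasurable_compact compact_gprods) auto
  qed auto
  finally show ?thesis .
qed

text \<open>The function is the distribution function of the image under \<open>f\<close> of
  Lebesgue measure on \<open>B\<close>. It is continuous because negligible level sets mean that
  this image measure has no atoms.\<close>

lemma level_cdf:
  fixes f :: "'a::euclidean_space \<Rightarrow> real"
  assumes B: "compact B" and f: "continuous_on B f" and null: "\<And>c. negligible {x\<in>B. f x = c}"
  shows "continuous_on UNIV (\<lambda>c. measure lebesgue {x\<in>B. f x \<le> c})"
proof -
  define M where "M = distr (restrict_space lborel B) borel f"
  have Bb: "B \<in> sets borel" using B by (simp add: borel_compact)
  have fm: "f \<in> borel_measurable (restrict_space lborel B)"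
    using borel_measurable_continuous_on_restrict[OF f]
    by (simp cong: measurable_cong_sets add: sets_restrict_space)
  have ms: "measure M X = measure lebesgue {x\<in>B. f x \<in> X}" and mb: "{x\<in>B. f x \<in> X} \<in> sets borel"
      if "X \<in> sets borel" for X
  proof -
    have "f -` X \<inter> space (restrict_space lborel B) \<in> sets (restrict_space lborel B)"
      using fm that by (rule measurable_sets)
    moreover have e: "f -` X \<inter> space (restrict_space lborel B) = {x\<in>B. f x \<in> X}"
      by (auto simp: space_restrict_space)
    ultimately show m: "{x\<in>B. f x \<in> X} \<in> sets borel"
      using Bb by (auto simp: sets_restrict_space_iff)
    have "measure M X = measure (restrict_space lborel B) {x\<in>B. f x \<in> X}"
      unfolding M_def using fm that by (subst measure_distr) (auto simp: e)
    also have "\<dots> = measure lborel {x\<in>B. f x \<in> X}"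
      using Bb by (subst measure_restrict_space) auto
    finally show "measure M X = measure lebesgue {x\<in>B. f x \<in> X}"
      using m by (simp add: measure_completion)
  qed
  have "finite_measure M"
    unfolding M_def
  proof (rule finite_measure.finite_measure_distr[OF _ fm], rule finite_measureI)
    show "emeasure (restrict_space lborel B) (space (restrict_space lborel B)) \<noteq> \<infinity>"
      using Bb emeasure_compact_finite[OF B] by (simp add: emeasure_restrict_space space_restrict_space)
  qed
  then interpret finite_borel_measure M
    by (simp add: finite_borel_measure_def finite_borel_measure_axioms_def M_def)
  have "isCont (cdf M) c" for c
    using null[of c] ms[of "{c}"] by (simp add: isCont_cdf negligible_imp_measure0)
  moreover have "cdf M = (\<lambda>c. measure lebesgue {x\<in>B. f x \<le> c})"
    using ms by (auto simp: cdf_def fun_eq_iff)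
  ultimately show ?thesis by (simp add: continuous_on_eq_continuous_at)
qed

lemma measure_split_level:
  fixes f :: "'a::euclidean_space \<Rightarrow> real"
  assumes B: "compact B" and f: "continuous_on B f" and null: "negligible {x\<in>B. f x = c}"
  shows "compact {x\<in>B. f x \<le> c}" "compact {x\<in>B. c \<le> f x}"
    "measure lebesgue B = measure lebesgue {x\<in>B. f x \<le> c} + measure lebesgue {x\<in>B. c \<le> f x}"
proof -
  show 1: "compact {x\<in>B. f x \<le> c}"
    using continuous_closed_preimage[OF f compact_imp_closed[OF B], of "{..c}"]
    by (intro compact_eq_bounded_closed[THEN iffD2] conjI bounded_subset[OF compact_imp_bounded[OF B]]) (auto simp: Int_def vimage_def)
  show 2: "compact {x\<in>B. c \<le> f x}"
    using continuous_closed_preimage[OF f compact_imp_closed[OF B], of "{c..}"]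
    by (intro compact_eq_bounded_closed[THEN iffD2] conjI bounded_subset[OF compact_imp_bounded[OF B]]) (auto simp: Int_def vimage_def)
  have "{x\<in>B. f x \<le> c} \<inter> {x\<in>B. c \<le> f x} = {x\<in>B. f x = c}" by auto
  moreover have "{x\<in>B. f x \<le> c} \<union> {x\<in>B. c \<le> f x} = B" by auto
  ultimately show "measure lebesgue B = measure lebesgue {x\<in>B. f x \<le> c} + measure lebesgue {x\<in>B. c \<le> f x}"
    using measure_Un3_negligible[of "{x\<in>B. f x \<le> c}" "{x\<in>B. c \<le> f x}" "{}"] 1 2 null
    by (simp add: lmeasurable_compact)
qed

lemma measure_Un_le_negligible:
  fixes X Y P :: "'a::euclidean_space set"
  assumes "X \<in> lmeasurable" "Y \<in> lmeasurable" "P \<in> lmeasurable" "X \<subseteq> P" "Y \<subseteq> P" "negligible (X \<inter> Y)"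
  shows "measure lebesgue X + measure lebesgue Y \<le> measure lebesgue P"
proof -
  have "measure lebesgue X + measure lebesgue Y = measure lebesgue (X \<union> Y)"
    using measure_Un3_negligible[of X Y "{}"] assms by simp
  also have "\<dots> \<le> measure lebesgue P"
    using assms by (intro measure_mono_fmeasurable) auto
  finally show ?thesis .
qed

section \<open>Finite families of boxes and the inequality for their unions\<close>

lemma negligible_coordinate_hyperplane: "negligible {x :: real ^ 'n. x $ i = c}"
proof -
  have "axis i 1 \<in> (Basis :: (real ^ 'n) set)" by (simp add: axis_in_Basis_iff)
  then have "negligible {x :: real ^ 'n. x \<bullet> axis i 1 = c}" by (rule negligible_standard_hyperplane)
  then show ?thesis by (simp add: inner_axis)
qed

text \<open>Boxes may share faces, but each must have interior points: then nonempty families have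
  positive volume, and two different boxes are always separated by a coordinate hyperplane.\<close>

definition boxfam :: "(real ^ 'n) set set \<Rightarrow> bool" where
  "boxfam d \<longleftrightarrow> finite d \<and> (\<forall>k\<in>d. (\<exists>a b. k = cbox a b) \<and> interior k \<noteq> {} \<and> k \<subseteq> orthant) \<and>
     pairwise (\<lambda>k k'. interior k \<inter> interior k' = {}) d"

text \<open>Degenerate pieces are discarded, so that the result is again a \<open>boxfam\<close> and
  the number of boxes drops whenever some box lies on the other side of the cut.\<close>

definition boxcut :: "(real ^ 'n) set \<Rightarrow> (real ^ 'n) set set \<Rightarrow> (real ^ 'n) set set" where
  "boxcut h d = (\<lambda>k. k \<inter> h) ` {k\<in>d. interior (k \<inter> h) \<noteq> {}}"

lemma boxfamE:
  assumes "boxfam d" "k \<in> d"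
  obtains a b where "k = cbox a b" "box a b \<noteq> {}" "cbox a b \<subseteq> orthant"
proof -
  have "\<forall>k\<in>d. (\<exists>a b. k = cbox a b) \<and> interior k \<noteq> {} \<and> k \<subseteq> orthant"
    using assms(1) unfolding boxfam_def by (elim conjE)
  from bspec[OF this assms(2)] obtain a b where ab: "k = cbox a b" "interior k \<noteq> {}" "k \<subseteq> orthant"
    by (elim conjE exE)
  show thesis
  proof (rule that[OF ab(1)])
    show "box a b \<noteq> {}" "cbox a b \<subseteq> orthant" using ab by (simp_all add: interior_cbox)
  qed
qed

lemma boxfam_compact: "boxfam d \<Longrightarrow> compact (\<Union>d)" "boxfam d \<Longrightarrow> \<Union>d \<subseteq> orthant"
  unfolding boxfam_def by (intro compact_Union) auto

lemma measure_boxfam_pos: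
  assumes "boxfam d" "d \<noteq> {}" shows "0 < measure lebesgue (\<Union>d)"
proof -
  from assms obtain k where k: "k \<in> d" "interior k \<noteq> {}" by (auto simp: boxfam_def)
  have "\<not> negligible (\<Union>d)"
    using k open_not_negligible[of "interior k"] interior_subset[of k]
    by (meson Union_upper negligible_subset open_interior order_trans)
  then show ?thesis
    using boxfam_compact(1)[OF assms(1)]
    by (metis lmeasurable_compact negligible_iff_measure measure_nonneg order_le_less)
qed

text \<open>Each box leaves at most one piece, which bounds the number of pieces. The discarded
  pieces are boxes without interior, hence negligible, and so no volume is lost.\<close>

lemma boxcut:
  fixes d :: "(real ^ 'n) set set"
  assumes d: "boxfam d" and h: "\<And>a b. \<exists>a' b'. cbox a b \<inter> h = cbox a' b'" and hc: "closed h"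
  shows "boxfam (boxcut h d)" "card (boxcut h d) \<le> card d"
    "\<And>k. k \<in> d \<Longrightarrow> interior (k \<inter> h) = {} \<Longrightarrow> card (boxcut h d) < card d"
    "\<Union>(boxcut h d) \<subseteq> \<Union>d \<inter> h"
    "measure lebesgue (\<Union>(boxcut h d)) = measure lebesgue (\<Union>d \<inter> h)"
proof -
  have fin: "finite d" using d by (simp add: boxfam_def)
  show bf: "boxfam (boxcut h d)"
    unfolding boxfam_def
  proof (intro conjI ballI)
    show "finite (boxcut h d)" using fin by (simp add: boxcut_def)
    show "pairwise (\<lambda>k k'. interior k \<inter> interior k' = {}) (boxcut h d)"
    proof (rule pairwiseI)
      fix k k' assume "k \<in> boxcut h d" "k' \<in> boxcut h d" "k \<noteq> k'"
      then obtain j j' where j: "k = j \<inter> h" "k' = j' \<inter> h" "j \<in> d" "j' \<in> d" "j \<noteq> j'"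
          by (auto simp: boxcut_def)
      then have "interior j \<inter> interior j' = {}" using d unfolding boxfam_def pairwise_def by blast
      then show "interior k \<inter> interior k' = {}" unfolding j(1,2) interior_Int by blast
    qed
    fix k assume "k \<in> boxcut h d"
    then obtain j where j: "k = j \<inter> h" "j \<in> d" "interior k \<noteq> {}" by (auto simp: boxcut_def)
    then show "interior k \<noteq> {}" by simp
    obtain a b where "j = cbox a b" "j \<subseteq> orthant" using boxfamE[OF d j(2)] by metis
    then show "\<exists>a b. k = cbox a b" "k \<subseteq> orthant" using j h by auto
  qed
  show "card (boxcut h d) \<le> card d"
    unfolding boxcut_def using fin by (intro order_trans[OF card_image_le] card_mono) auto
  show "card (boxcut h d) < card d" if "k \<in> d" "interior (k \<inter> h) = {}" for k
  proof -
    have "card (boxcut h d) \<le> card {k\<in>d. interior (k \<inter> h) \<noteq> {}}"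
      unfolding boxcut_def using fin by (intro card_image_le) auto
    also have "\<dots> < card d" using fin that by (intro psubset_card_mono) auto
    finally show ?thesis .
  qed
  show sub: "\<Union>(boxcut h d) \<subseteq> \<Union>d \<inter> h" by (auto simp: boxcut_def)
  have "\<Union>d \<inter> h - \<Union>(boxcut h d) \<subseteq> \<Union>((\<lambda>k. k \<inter> h) ` {k\<in>d. interior (k \<inter> h) = {}})"
    by (auto simp: boxcut_def)
  moreover have "negligible (\<Union>((\<lambda>k. k \<inter> h) ` {k\<in>d. interior (k \<inter> h) = {}}))"
  proof (rule negligible_Union)
    fix t assume "t \<in> (\<lambda>k. k \<inter> h) ` {k\<in>d. interior (k \<inter> h) = {}}"
    then obtain k where k: "k \<in> d" "t = k \<inter> h" "interior t = {}" by auto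
    obtain a b where "k = cbox a b" using boxfamE[OF d k(1)] by metis
    then obtain a' b' where "t = cbox a' b'" using k(2) h[of a b] by blast
    then show "negligible t" using k by (simp add: negligible_interval)
  qed (use fin in auto)
  ultimately have "negligible (\<Union>d \<inter> h - \<Union>(boxcut h d))" by (rule negligible_subset[rotated])
  moreover have "\<Union>(boxcut h d) - \<Union>d \<inter> h = {}" using sub by auto
  ultimately show "measure lebesgue (\<Union>(boxcut h d)) = measure lebesgue (\<Union>d \<inter> h)"
    using boxfam_compact(1)[OF bf] boxfam_compact(1)[OF d] hc
    by (intro measure_negligible_symdiff lmeasurable_compact) (auto simp: Un_commute compact_Int_closed)
qed

lemma cbox_Int_halfspace:
  fixes a b :: "real ^ 'n"
  shows "\<exists>a' b'. cbox a b \<inter> {x. x $ i \<le> c} = cbox a' b'"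
      "\<exists>a' b'. cbox a b \<inter> {x. c \<le> x $ i} = cbox a' b'"
  using interval_split_cart(1)[of a b i c] interval_split_cart(2)[of a b c i]
  unfolding interval_cbox_cart by blast+

text \<open>The cutting step of Hadwiger and Ohmann. Two boxes of \<open>d1\<close> are separated by
  a coordinate hyperplane; a parallel one cuts the union of \<open>d2\<close> in the same volume
  ratio \<open>p\<close>. On each side the total number of boxes has dropped, so \<open>IH\<close>
  applies to both pairs of parts. The two products lie on opposite sides of the hyperplane at the
  geometric mean of the two positions, hence their volumes add up inside the full product.\<close>

lemma gprods_boxfam_step:
  fixes d1 d2 :: "(real ^ 'n) set set"
  assumes l: "0 < l" "l < 1" and d: "boxfam d1" "boxfam d2" and ne: "d2 \<noteq> {}" and c2: "1 < card d1"
    and IH: "\<And>e1 e2 :: (real ^ 'n) set set. boxfam e1 \<Longrightarrow> boxfam e2 \<Longrightarrow> card e1 + card e2 < card d1 + card d2 \<Longrightarrow>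
       measure lebesgue (\<Union>e1) powr (1 - l) * measure lebesgue (\<Union>e2) powr l \<le> measure lebesgue (gprods l (\<Union>e1) (\<Union>e2))"
  shows "measure lebesgue (\<Union>d1) powr (1 - l) * measure lebesgue (\<Union>d2) powr l \<le> measure lebesgue (gprods l (\<Union>d1) (\<Union>d2))"
proof -
  define A B where "A = \<Union>d1" and "B = \<Union>d2"
  have cA: "compact A" "A \<subseteq> orthant" and cB: "compact B" "B \<subseteq> orthant"
    using boxfam_compact d by (auto simp: A_def B_def)
  have VB: "0 < measure lebesgue B" and VA: "0 < measure lebesgue A"
    using measure_boxfam_pos[OF d(2) ne] measure_boxfam_pos[OF d(1)] c2 unfolding A_def B_def
        by fastforce+
  obtain k1 k2 where k: "k1 \<in> d1" "k2 \<in> d1" "k1 \<noteq> k2"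
    using c2 by (metis One_nat_def card_le_Suc0_iff_eq d(1) boxfam_def not_less)
  obtain kl ku i t where kk: "kl \<in> d1" "ku \<in> d1" "kl \<subseteq> {x. x $ i \<le> t}" "ku \<subseteq> {x. t \<le> x $ i}"
  proof -
    obtain a b where k1: "k1 = cbox a b" "box a b \<noteq> {}" using boxfamE[OF d(1) k(1)] by metis
    obtain a' b' where k2: "k2 = cbox a' b'" "box a' b' \<noteq> {}" using boxfamE[OF d(1) k(2)] by metis
    have "interior k1 \<inter> interior k2 = {}" using d(1) k unfolding boxfam_def pairwise_def by blast
    then have "box a b \<inter> box a' b' = {}" using k1 k2 by simp
    moreover have "\<And>i. a $ i < b $ i" "\<And>i. a' $ i < b' $ i" using k1(2) k2(2)
        by (auto simp: interval_ne_empty_cart)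
    ultimately obtain i where "b $ i \<le> a' $ i \<or> b' $ i \<le> a $ i"
      unfolding disjoint_interval_cart by (metis not_le)
    then show ?thesis
    proof
      assume "b $ i \<le> a' $ i"
      then show ?thesis using k1 k2
          by (intro that[OF k(1) k(2), of i "b $ i"]) (auto simp: mem_box_cart intro: order_trans)
    next
      assume "b' $ i \<le> a $ i"
      then show ?thesis using k1 k2
          by (intro that[OF k(2) k(1), of i "b' $ i"]) (auto simp: mem_box_cart intro: order_trans)
    qed
  qed
  have int_hyp: "interior {x :: real ^ 'n. x $ i = t} = {}"
    using open_not_negligible negligible_subset[OF negligible_coordinate_hyperplane[of i t] interior_subset] open_interior
        by blast
  have il: "interior (kl \<inter> {x. t \<le> x $ i}) = {}" and iu: "interior (ku \<inter> {x. x $ i \<le> t}) = {}"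
  proof -
    have "kl \<inter> {x. t \<le> x $ i} \<subseteq> {x. x $ i = t}" "ku \<inter> {x. x $ i \<le> t} \<subseteq> {x. x $ i = t}" using kk
        by force+
    then show "interior (kl \<inter> {x. t \<le> x $ i}) = {}" "interior (ku \<inter> {x. x $ i \<le> t}) = {}"
      using int_hyp interior_mono by blast+
  qed
  have cont: "continuous_on X (\<lambda>x :: real ^ 'n. x $ i)" for X by (intro continuous_intros)
  have null: "negligible {x \<in> X. x $ i = c}" for c and X :: "(real ^ 'n) set"
    by (rule negligible_subset[OF negligible_coordinate_hyperplane[of i c]]) auto
  note splitA = measure_split_level[OF cA(1) cont null, of t]
  have VAm: "0 < measure lebesgue {x\<in>A. x $ i \<le> t}"
  proof -
    have "interior kl \<noteq> {}" using d(1) kk(1) by (auto simp: boxfam_def)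
    moreover have "interior kl \<subseteq> {x\<in>A. x $ i \<le> t}"
      using kk(1,3) by (intro subset_trans[OF interior_subset]) (auto simp: A_def)
    ultimately have "\<not> negligible {x\<in>A. x $ i \<le> t}"
      using open_not_negligible[OF open_interior[of kl]] negligible_subset[of "{x\<in>A. x $ i \<le> t}" "interior kl"]
          by blast
    then show ?thesis
      using lmeasurable_compact[OF splitA(1)]
          by (simp add: negligible_iff_measure zero_less_measure_iff)
  qed
  define p where "p = measure lebesgue {x\<in>A. x $ i \<le> t} / measure lebesgue A"
  have p: "0 < p" "p \<le> 1" using VAm VA splitA(3) by (auto simp: p_def)
  obtain R where R: "\<And>y. y \<in> B \<Longrightarrow> norm y \<le> R" using compact_imp_bounded[OF cB(1)]
      by (auto simp: bounded_iff)
  \<comment> \<open>At -1 the sublevel set is empty because \<open>B\<close> lies in the orthant; at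
    the norm bound it is all of \<open>B\<close>.\<close>
  have "\<exists>x\<ge>-1. x \<le> max R 0 \<and> measure lebesgue {y\<in>B. y $ i \<le> x} = p * measure lebesgue B"
  proof (rule IVT')
    have "0 \<le> y $ i" if "y \<in> B" for y using cB(2) that by (auto simp: orthant_def)
    then have "\<not> y $ i \<le> -1" if "y \<in> B" for y using that by force
    then have e: "{y\<in>B. y $ i \<le> -1} = {}" by blast
    show "measure lebesgue {y\<in>B. y $ i \<le> -1} \<le> p * measure lebesgue B" unfolding e using p by simp
    have "y $ i \<le> max R 0" if "y \<in> B" for y
      using R[OF that] component_le_norm_cart[of y i] by linarith
    then have "{y\<in>B. y $ i \<le> max R 0} = B" by blast
    then show "p * measure lebesgue B \<le> measure lebesgue {y\<in>B. y $ i \<le> max R 0}" using p VB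
        by (simp add: mult_left_le_one_le)
    show "continuous_on {-1..max R 0} (\<lambda>x. measure lebesgue {y\<in>B. y $ i \<le> x})"
      by (rule continuous_on_subset[OF level_cdf[OF cB(1) cont null]]) auto
  qed simp
  then obtain t' where t': "measure lebesgue {y\<in>B. y $ i \<le> t'} = p * measure lebesgue B" by blast
  note splitB = measure_split_level[OF cB(1) cont null, of t']
  \<comment> \<open>The cut positions must be nonnegative for powers to be monotone from them
    upwards; this is used for the upper halves below.\<close>
  have t0: "0 \<le> t"
  proof -
    obtain x where "x \<in> kl" using d(1) kk(1) interior_subset by (fastforce simp: boxfam_def)
    then have "0 \<le> x $ i" "x $ i \<le> t" using kk(1,3) d(1) by (auto simp: boxfam_def orthant_def)
    then show ?thesis by simp
  qed
  have t0': "0 \<le> t'"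
  proof -
    have "{y\<in>B. y $ i \<le> t'} \<noteq> {}" using t' p VB by (metis measure_empty mult_pos_pos less_irrefl)
    then obtain y where y: "y \<in> B" "y $ i \<le> t'" by auto
    then have "0 \<le> y $ i" using cB(2) by (auto simp: orthant_def)
    then show ?thesis using y(2) by simp
  qed
  let ?l = "\<lambda>t. {x :: real ^ 'n. x $ i \<le> t}" and ?u = "\<lambda>t. {x :: real ^ 'n. t \<le> x $ i}"
  have cl: "closed (?l s)" "closed (?u s)" for s by (intro closed_Collect_le continuous_intros)+
  note bl1 = boxcut[OF d(1) cbox_Int_halfspace(1)[of _ _ i t] cl(1)]
      and bu1 = boxcut[OF d(1) cbox_Int_halfspace(2)[of _ _ t i] cl(2)]
  note bl2 = boxcut[OF d(2) cbox_Int_halfspace(1)[of _ _ i t'] cl(1)]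
      and bu2 = boxcut[OF d(2) cbox_Int_halfspace(2)[of _ _ t' i] cl(2)]
  define X Y where "X = gprods l (\<Union>(boxcut (?l t) d1)) (\<Union>(boxcut (?l t') d2))"
    and "Y = gprods l (\<Union>(boxcut (?u t) d1)) (\<Union>(boxcut (?u t') d2))"
  have eqs: "\<Union>d1 \<inter> ?l t = {x\<in>A. x $ i \<le> t}" "\<Union>d1 \<inter> ?u t = {x\<in>A. t \<le> x $ i}"
    "\<Union>d2 \<inter> ?l t' = {x\<in>B. x $ i \<le> t'}" "\<Union>d2 \<inter> ?u t' = {x\<in>B. t' \<le> x $ i}"
    by (auto simp: A_def B_def)
  define W where "W = measure lebesgue A powr (1 - l) * measure lebesgue B powr l"
  have "p * W = (p * measure lebesgue A) powr (1 - l) * (p * measure lebesgue B) powr l"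
    unfolding W_def using p by (intro powr_mean_scale[symmetric]) auto
  also have "\<dots> = measure lebesgue (\<Union>(boxcut (?l t) d1)) powr (1 - l) * measure lebesgue (\<Union>(boxcut (?l t') d2)) powr l"
    using VA by (simp add: bl1(5) bl2(5) eqs t') (simp add: p_def)
  also have "\<dots> \<le> measure lebesgue X"
    unfolding X_def using bl1(3)[OF kk(2) iu] bl2(2) by (intro IH bl1(1) bl2(1)) linarith
  finally have X: "p * W \<le> measure lebesgue X" .
  have "(1 - p) * W = ((1 - p) * measure lebesgue A) powr (1 - l) * ((1 - p) * measure lebesgue B) powr l"
    unfolding W_def using p by (intro powr_mean_scale[symmetric]) auto
  also have "\<dots> = measure lebesgue (\<Union>(boxcut (?u t) d1)) powr (1 - l) * measure lebesgue (\<Union>(boxcut (?u t') d2)) powr l"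
  proof -
    have "measure lebesgue {x\<in>A. t \<le> x $ i} = (1 - p) * measure lebesgue A"
      using splitA(3) VA by (simp add: p_def field_simps)
    moreover have "measure lebesgue {x\<in>B. t' \<le> x $ i} = (1 - p) * measure lebesgue B"
      using splitB(3) t' by (simp add: algebra_simps)
    ultimately show ?thesis by (simp add: bu1(5) bu2(5) eqs)
  qed
  also have "\<dots> \<le> measure lebesgue Y"
    unfolding Y_def using bu1(3)[OF kk(1) il] bu2(2) by (intro IH bu1(1) bu2(1)) linarith
  finally have Y: "(1 - p) * W \<le> measure lebesgue Y" .
  have comp: "compact X" "compact Y" "compact (gprods l A B)"
    unfolding X_def Y_def
    using l boxfam_compact bl1(1) bl2(1) bu1(1) bu2(1) cA cB by (auto intro!: compact_gprods)
  have sub: "X \<subseteq> gprods l A B" "Y \<subseteq> gprods l A B"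
    unfolding X_def Y_def A_def B_def using bl1(4) bl2(4) bu1(4) bu2(4) by (intro gprods_mono; blast)+
  have "X \<inter> Y \<subseteq> {z. z $ i = t powr (1 - l) * t' powr l}"
  proof
    fix z assume "z \<in> X \<inter> Y"
    then have z: "z \<in> gprods l (A \<inter> ?l t) (B \<inter> ?l t')" "z \<in> gprods l (A \<inter> ?u t) (B \<inter> ?u t')"
      unfolding X_def Y_def A_def B_def
      using gprods_mono[OF bl1(4) bl2(4)] gprods_mono[OF bu1(4) bu2(4)] by blast+
    obtain x y where xy1: "x \<in> A \<inter> ?l t" "y \<in> B \<inter> ?l t'" "z = gprod l x y"
      using z(1) by (rule gprodsE)
    obtain x' y' where xy2: "x' \<in> A \<inter> ?u t" "y' \<in> B \<inter> ?u t'" "z = gprod l x' y'"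
      using z(2) by (rule gprodsE)
    note xy = xy1 xy2
    have "z $ i \<le> t powr (1 - l) * t' powr l"
      using xy(1,2,3) cA cB l by (auto simp: orthant_def intro!: mult_mono powr_mono2)
    moreover have "t powr (1 - l) * t' powr l \<le> z $ i"
      using xy(4-6) t0 t0' l by (auto intro!: mult_mono powr_mono2)
    ultimately show "z \<in> {z. z $ i = t powr (1 - l) * t' powr l}" by simp
  qed
  then have "negligible (X \<inter> Y)" using negligible_coordinate_hyperplane negligible_subset by blast
  then have "measure lebesgue X + measure lebesgue Y \<le> measure lebesgue (gprods l A B)"
    using comp sub by (intro measure_Un_le_negligible) (auto intro: lmeasurable_compact)
  with X Y have "W \<le> measure lebesgue (gprods l A B)" by (simp add: algebra_simps)
  then show ?thesis by (simp add: W_def A_def B_def)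
qed

text \<open>The induction runs over all \<open>l\<close> at once: if only the second family has
  several boxes, the families are exchanged, which replaces \<open>l\<close> by
  \<open>1 - l\<close>.\<close>

lemma measure_gprods_boxfam:
  fixes d1 d2 :: "(real ^ 'n) set set"
  assumes "0 < l" "l < 1" "boxfam d1" "boxfam d2"
  shows "measure lebesgue (\<Union>d1) powr (1 - l) * measure lebesgue (\<Union>d2) powr l \<le> measure lebesgue (gprods l (\<Union>d1) (\<Union>d2))"
  using assms
proof (induction "card d1 + card d2" arbitrary: l d1 d2 rule: less_induct)
  case less
  note l = less.prems(1,2) and d = less.prems(3,4)
  have fin: "finite d1" "finite d2" using d by (auto simp: boxfam_def)
  show ?case
  proof (cases "d1 = {} \<or> d2 = {}")
    case True
    then show ?thesis using l by auto
  next
    case False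
    then have ge: "1 \<le> card d1" "1 \<le> card d2" using fin by (auto simp: Suc_le_eq card_gt_0_iff)
    consider "1 < card d1" | "1 < card d2" | "card d1 = 1" "card d2 = 1" using ge by linarith
    then show ?thesis
    proof cases
      case 1
      show ?thesis
      proof (rule gprods_boxfam_step[OF l d])
        show "measure lebesgue (\<Union>e1) powr (1 - l) * measure lebesgue (\<Union>e2) powr l \<le> measure lebesgue (gprods l (\<Union>e1) (\<Union>e2))"
          if "boxfam e1" "boxfam e2" "card e1 + card e2 < card d1 + card d2"
              for e1 e2 :: "(real ^ 'n) set set"
          using less.hyps[OF that(3) l that(1,2)] .
      qed (use False 1 in auto)
    next
      case 2
      have "measure lebesgue (\<Union>d2) powr (1 - (1 - l)) * measure lebesgue (\<Union>d1) powr (1 - l)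
          \<le> measure lebesgue (gprods (1 - l) (\<Union>d2) (\<Union>d1))"
      proof (rule gprods_boxfam_step)
        show "measure lebesgue (\<Union>e1) powr (1 - (1 - l)) * measure lebesgue (\<Union>e2) powr (1 - l)
           \<le> measure lebesgue (gprods (1 - l) (\<Union>e1) (\<Union>e2))"
          if "boxfam e1" "boxfam e2" "card e1 + card e2 < card d2 + card d1"
              for e1 e2 :: "(real ^ 'n) set set"
          using less.hyps[of e1 e2 "1 - l"] l that by (simp add: add.commute)
      qed (use l d False 2 in auto)
      then show ?thesis using gprods_swap[of l "\<Union>d1" "\<Union>d2"] by (simp add: mult.commute)
    next
      case 3
      then obtain k1 k2 where k: "d1 = {k1}" "d2 = {k2}" by (auto simp: card_1_singleton_iff)
      then obtain a b where ab: "k1 = cbox a b" "box a b \<noteq> {}" "cbox a b \<subseteq> orthant"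
        using boxfamE[OF d(1)] k by blast
      obtain c e where ce: "k2 = cbox c e" "box c e \<noteq> {}" "cbox c e \<subseteq> orthant"
        using boxfamE[OF d(2)] k by blast
      have lt: "\<And>i. a $ i < b $ i" "\<And>i. c $ i < e $ i" using ab ce
          by (auto simp: interval_ne_empty_cart)
      then have "a \<in> cbox a b" "c \<in> cbox c e" by (auto simp: mem_box_cart less_imp_le)
      then have "0 \<le> a $ i \<and> a $ i \<le> b $ i" "0 \<le> c $ i \<and> c $ i \<le> e $ i" for i
        using lt[of i] ab(3) ce(3) by (auto simp: orthant_def less_imp_le)
      then show ?thesis using measure_gprods_box[of l a b c e] l k ab ce by simp
    qed
  qed
qed

text \<open>Finitely many small cubes around points of \<open>A\<close> are refined to boxes with
  disjoint interiors. Truncating their lower corners at 0 keeps them in the orthant and loses no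
  point of \<open>A\<close>. The factor in \<open>r\<close> turns a bound on every coordinate into
  the bound \<open>e\<close> for the norm.\<close>

lemma boxfam_cover:
  fixes A :: "(real ^ 'n) set"
  assumes A: "compact A" "A \<subseteq> orthant" and e: "0 < e"
  obtains d where "boxfam d" "\<Union>d \<subseteq> {x. infdist x A \<le> e}" "measure lebesgue A \<le> measure lebesgue (\<Union>d)"
proof (cases "A = {}")
  case True
  then show ?thesis using that[of "{}"] by (simp add: boxfam_def)
next
  case False
  define r where "r = e / (real CARD('n) + 1)"
  have r: "0 < r" using e by (simp add: r_def)
  define lo hi where "lo x = (\<chi> i. max 0 (x $ i - r))" and "hi x = (\<chi> i. x $ i + r)"
      for x :: "real ^ 'n"
  have near: "cbox (lo x) (hi x) \<subseteq> cball x e" for x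
  proof
    fix y assume y: "y \<in> cbox (lo x) (hi x)"
    then have "\<bar>(x - y) $ i\<bar> \<le> r" for i
        by (auto simp: mem_box_cart lo_def hi_def abs_le_iff) (smt (verit))+
    then have "(\<Sum>i\<in>UNIV. \<bar>(x - y) $ i\<bar>) \<le> (\<Sum>i\<in>(UNIV :: 'n set). r)" by (intro sum_mono)
    then have "norm (x - y) \<le> real CARD('n) * r" using norm_le_l1_cart[of "x - y"] by simp
    also have "\<dots> \<le> e" using e by (simp add: r_def field_simps)
    finally show "y \<in> cball x e" by (simp add: dist_norm)
  qed
  obtain C where C: "finite C" "C \<subseteq> A" "A \<subseteq> (\<Union>x\<in>C. ball x r)"
    using compactE_image[OF A(1), of A "\<lambda>x. ball x r"] r
        by (metis UN_I centre_in_ball open_ball subsetI)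
  have cov: "A \<subseteq> (\<Union>x\<in>C. cbox (lo x) (hi x))"
  proof
    fix y assume y: "y \<in> A"
    then obtain x where x: "x \<in> C" "dist x y < r" using C by (auto simp: subset_iff)
    have "\<bar>x $ i - y $ i\<bar> < r" for i
      using component_le_norm_cart[of "x - y" i] x(2) by (simp add: dist_norm)
    then have "y \<in> cbox (lo x) (hi x)"
      using y A(2) by (auto simp: mem_box_cart lo_def hi_def orthant_def abs_less_iff) (smt (verit))+
    then show "y \<in> (\<Union>x\<in>C. cbox (lo x) (hi x))" using x by auto
  qed
  obtain p where p: "p division_of (\<Union>((\<lambda>x. cbox (lo x) (hi x)) ` C))"
    using elementary_unions_intervals[of "(\<lambda>x. cbox (lo x) (hi x)) ` C"] C(1) by auto
  define d where "d = {k\<in>p. interior k \<noteq> {}}"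
  note pD = division_ofD[OF p]
  have orth: "cbox (lo x) (hi x) \<subseteq> orthant" for x
    by (auto simp: mem_box_cart lo_def orthant_def)
  have bf: "boxfam d"
    unfolding boxfam_def
  proof (intro conjI ballI)
    show "finite d" using pD(1) by (simp add: d_def)
    show "pairwise (\<lambda>k k'. interior k \<inter> interior k' = {}) d" using pD(5)
        by (auto simp: pairwise_def d_def)
    fix k assume k: "k \<in> d"
    then show "\<exists>a b. k = cbox a b" using pD(4) by (auto simp: d_def)
    show "interior k \<noteq> {}" using k by (simp add: d_def)
    show "k \<subseteq> orthant" using k pD(2)[of k] orth by (auto simp: d_def)
  qed
  have "\<Union>p - \<Union>d \<subseteq> \<Union>{k\<in>p. interior k = {}}" by (auto simp: d_def)
  moreover have "negligible (\<Union>{k\<in>p. interior k = {}})"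
  proof (rule negligible_Union)
    fix t assume t: "t \<in> {k\<in>p. interior k = {}}"
    then obtain a b where "t = cbox a b" using pD(4) by blast
    then show "negligible t" using t by (simp add: negligible_interval)
  qed (use pD(1) in auto)
  ultimately have n1: "negligible (\<Union>p - \<Union>d)" by (rule negligible_subset[rotated])
  have cp: "compact (\<Union>p)" using pD(6) C(1) by auto
  have "measure lebesgue (\<Union>p) = measure lebesgue (\<Union>d)"
    using n1 boxfam_compact(1)[OF bf] cp
    by (intro measure_negligible_symdiff lmeasurable_compact) (auto simp: d_def intro: negligible_subset[of "{}"])
  moreover have "measure lebesgue A \<le> measure lebesgue (\<Union>p)"
    using cov pD(6) A(1) cp
        by (intro measure_mono_fmeasurable) (auto simp: lmeasurable_compact fmeasurableD)
  moreover have "\<Union>d \<subseteq> {x. infdist x A \<le> e}"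
  proof
    fix y assume "y \<in> \<Union>d"
    then have "y \<in> \<Union>p" by (auto simp: d_def)
    then obtain x where "x \<in> C" "y \<in> cbox (lo x) (hi x)" using pD(6) by auto
    then have "x \<in> A" "y \<in> cball x e" using C(2) near[of x] by auto
    then have "x \<in> A" "dist y x \<le> e" by (auto simp: dist_commute)
    then show "y \<in> {x. infdist x A \<le> e}" using infdist_le2 by blast
  qed
  ultimately show ?thesis using bf that by simp
qed

text \<open>Outer approximation: an open set \<open>T\<close> around the product exceeds it by
  little volume. Unions of boxes close to \<open>A\<close> and \<open>B\<close> have, by uniform
  continuity of \<open>gprod\<close> on a compact part of the orthant, a product inside
  \<open>T\<close>, and for them the inequality is known.\<close>

theorem measure_gprods:
  fixes A B :: "(real ^ 'n) set"
  assumes l: "0 < l" "l < 1" and A: "compact A" "A \<subseteq> orthant" and B: "compact B" "B \<subseteq> orthant"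
  shows "measure lebesgue A powr (1 - l) * measure lebesgue B powr l \<le> measure lebesgue (gprods l A B)"
proof (cases "A = {} \<or> B = {}")
  case True
  then show ?thesis using l by auto
next
  case False
  define P where "P = gprods l A B"
  have P: "compact P" unfolding P_def using l A B by (intro compact_gprods)
  have neP: "P \<noteq> {}" using False by (auto simp: P_def gprods_def)
  show ?thesis
    unfolding P_def[symmetric]
  proof (rule field_le_epsilon)
    fix e :: real assume e: "0 < e"
    have Pl: "P \<in> sets lebesgue" using P lmeasurable_compact fmeasurableD by blast
    obtain T where T: "open T" "P \<subseteq> T" "T - P \<in> lmeasurable" "emeasure lebesgue (T - P) < ennreal e"
      by (rule sets_lebesgue_outer_open[OF Pl e])
    obtain s where s: "0 < s" "{x. infdist x P \<le> s} \<subseteq> T"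
      using compact_in_open_separated[OF neP P T(1,2)] by metis
    obtain R where R: "\<And>x. x \<in> A \<union> B \<Longrightarrow> norm x \<le> R"
      using compact_imp_bounded[OF compact_Un[OF A(1) B(1)]] unfolding bounded_iff by metis
    define Q where "Q = (orthant \<inter> cball 0 (R + 1) :: (real ^ 'n) set)"
    have Q: "compact Q" by (simp add: Q_def closed_Int_compact)
    have "uniformly_continuous_on (Q \<times> Q) (\<lambda>p. gprod l (fst p) (snd p))"
      using l Q
          by (intro compact_uniformly_continuous continuous_on_subset[OF continuous_on_gprod] compact_Times) (auto simp: Q_def)
    then obtain t where t: "0 < t" "\<And>p q. p \<in> Q \<times> Q \<Longrightarrow> q \<in> Q \<times> Q \<Longrightarrow> dist q p < t \<Longrightarrow>
        dist (gprod l (fst q) (snd q)) (gprod l (fst p) (snd p)) < s"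
      using s(1) unfolding uniformly_continuous_on_def by metis
    \<comment> \<open>The bound 1 keeps the approximating boxes inside \<open>Q\<close>; with a
      third of \<open>t\<close>, two errors of size \<open>r\<close> stay below \<open>t\<close> in
      the product space.\<close>
    define r where "r = min 1 (t / 3)"
    have r: "0 < r" "r \<le> 1" "3 * r \<le> t" using t by (auto simp: r_def)
    obtain d1 where d1: "boxfam d1" "\<Union>d1 \<subseteq> {x. infdist x A \<le> r}"
        "measure lebesgue A \<le> measure lebesgue (\<Union>d1)"
      by (rule boxfam_cover[OF A r(1)])
    obtain d2 where d2: "boxfam d2" "\<Union>d2 \<subseteq> {x. infdist x B \<le> r}"
        "measure lebesgue B \<le> measure lebesgue (\<Union>d2)"
      by (rule boxfam_cover[OF B r(1)])
    have sub: "gprods l (\<Union>d1) (\<Union>d2) \<subseteq> T"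
    proof
      fix z assume "z \<in> gprods l (\<Union>d1) (\<Union>d2)"
      then obtain x y where z: "x \<in> \<Union>d1" "y \<in> \<Union>d2" "z = gprod l x y" by (rule gprodsE)
      obtain x' where x': "x' \<in> A" "infdist x A = dist x x'"
        using infdist_attains_inf[of A x] A(1) False compact_imp_closed by blast
      obtain y' where y': "y' \<in> B" "infdist y B = dist y y'"
        using infdist_attains_inf[of B y] B(1) False compact_imp_closed by blast
      have dx: "dist x x' \<le> r" "dist y y' \<le> r" using z d1(2) d2(2) x' y' by auto
      have "norm x \<le> R + 1" "norm y \<le> R + 1"
        using dx R[of x'] R[of y'] x' y' r(2) norm_triangle_sub[of x x'] norm_triangle_sub[of y y']
            by (auto simp: dist_norm)
      then have "(x, y) \<in> Q \<times> Q" "(x', y') \<in> Q \<times> Q"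
        using z boxfam_compact(2)[OF d1(1)] boxfam_compact(2)[OF d2(1)] x' y' R[of x'] R[of y'] A B
        by (auto simp: Q_def)
      moreover have "dist (x, y) (x', y') < t"
        using dx r sqrt_sum_squares_le_sum[of "dist x x'" "dist y y'"] by (simp add: dist_Pair_Pair)
      ultimately have "dist z (gprod l x' y') < s" using t(2)[of "(x', y')" "(x, y)"] z by simp
      moreover have "gprod l x' y' \<in> P" using x' y' by (auto simp: P_def intro: gprod_in_gprods)
      ultimately have "infdist z P \<le> s" by (meson infdist_le2 less_imp_le)
      then show "z \<in> T" using s by auto
    qed
    have TU: "T = P \<union> (T - P)" using T(2) by auto
    have Tl: "T \<in> lmeasurable"
      using T(3) P TU by (metis fmeasurable.Un lmeasurable_compact)
    have "measure lebesgue A powr (1 - l) * measure lebesgue B powr l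
       \<le> measure lebesgue (\<Union>d1) powr (1 - l) * measure lebesgue (\<Union>d2) powr l"
      using d1(3) d2(3) l by (intro mult_mono powr_mono2) auto
    also have "\<dots> \<le> measure lebesgue (gprods l (\<Union>d1) (\<Union>d2))"
        by (rule measure_gprods_boxfam[OF l d1(1) d2(1)])
    also have "\<dots> \<le> measure lebesgue T"
      using sub Tl lmeasurable_compact[OF compact_gprods[OF l boxfam_compact(1)[OF d1(1)] boxfam_compact(1)[OF d2(1)] boxfam_compact(2)[OF d1(1)] boxfam_compact(2)[OF d2(1)]]]
      by (intro measure_mono_fmeasurable fmeasurableD)
    also have "\<dots> \<le> measure lebesgue P + measure lebesgue (T - P)"
      using TU measure_Un_le[of P lebesgue "T - P"] Pl T(3) by auto
    also have "measure lebesgue (T - P) \<le> e"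
      using T(3,4) e by (simp add: emeasure_eq_measure2 ennreal_less_iff less_imp_le)
    finally show "measure lebesgue A powr (1 - l) * measure lebesgue B powr l \<le> measure lebesgue P + e"
        by simp
  qed
qed

section \<open>The equality case for geometric products\<close>

text \<open>The hypothesis says that \<open>(1 - l) * x t + l * y s\<close>, under a fixed mean of
  \<open>t\<close> and \<open>s\<close>, is least at \<open>t = s\<close>; for differentiable
  functions this would give equal derivatives. As \<open>x\<close> and \<open>y\<close> are only
  continuous, the inequality is first integrated over the mean from \<open>u\<close> to
  \<open>v\<close>. The increment of \<open>W h\<close> over this interval is differentiable in
  \<open>h\<close> and minimal at \<open>h = 0\<close>, and its vanishing derivative there is the
  claim.\<close>

lemma quantile_rigidity:
  fixes x y :: "real \<Rightarrow> real"
  assumes l: "0 < l" "l < 1" and x: "continuous_on {..<0} x" and y: "continuous_on {..<0} y"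
    and ineq: "\<And>s t. s < 0 \<Longrightarrow> t < 0 \<Longrightarrow>
      (1 - l) * x ((1 - l) * t + l * s) + l * y ((1 - l) * t + l * s) \<le> (1 - l) * x t + l * y s"
    and uv: "u < v" "v < 0"
  shows "x v - x u = y v - y u"
proof -
  \<comment> \<open>A slightly larger interval on the negative axis leaves room for the shifts by
    \<open>l * h\<close> and \<open>(1 - l) * h\<close>.\<close>
  define a b where "a = u - 1" and "b = v / 2"
  have ab: "a < u" "v < b" "b < 0" using uv by (auto simp: a_def b_def)
  define X Y where "X z = integral {a..z} x" and "Y z = integral {a..z} y" for z
  have der: "((\<lambda>z. integral {a..z} f) has_real_derivative f z) (at z)" if "continuous_on {..<0} f"
      "a < z" "z < b" for f :: "real \<Rightarrow> real" and z
  proof -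
    have "continuous_on {a..b} f" using that(1) ab by (rule_tac continuous_on_subset) auto
    then have "((\<lambda>z. integral {a..z} f) has_real_derivative f z) (at z within {a..b})"
      using that by (intro integral_has_real_derivative) auto
    then show ?thesis using that by (simp add: at_within_Icc_at)
  qed
  have X: "(X has_real_derivative x z) (at z)" and Y: "(Y has_real_derivative y z) (at z)" if "a < z"
      "z < b" for z
    unfolding X_def Y_def using der x y that by auto
  define W where "W h z = (1 - l) * (X (z + l * h) - X z) - l * (Y z - Y (z - (1 - l) * h))" for h z
  define r where "r = min (u - a) (b - v)"
  have r: "0 < r" using ab by (auto simp: r_def)
  have lh: "\<bar>l * h\<bar> < r" "\<bar>(1 - l) * h\<bar> < r" if "\<bar>h\<bar> < r" for h
  proof -
    have "l * \<bar>h\<bar> \<le> \<bar>h\<bar>" "(1 - l) * \<bar>h\<bar> \<le> \<bar>h\<bar>" using l by (auto intro!: mult_left_le_one_le)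
    then show "\<bar>l * h\<bar> < r" "\<bar>(1 - l) * h\<bar> < r" using that l by (auto simp: abs_mult)
  qed
  have rng: "a < z" "z < b" "a < z + l * h" "z + l * h < b" "a < z - (1 - l) * h" "z - (1 - l) * h < b"
    if "u \<le> z" "z \<le> v" "\<bar>h\<bar> < r" for z h
    using lh[OF that(3)] that(1,2) ab unfolding r_def abs_less_iff by linarith+
  have mono: "W h u \<le> W h v" if h: "\<bar>h\<bar> < r" for h
  proof (rule DERIV_nonneg_imp_nondecreasing[where f = "W h" and a = u and b = v])
    fix z assume z: "u \<le> z" "z \<le> v"
    let ?d = "(1 - l) * (x (z + l * h) - x z) - l * (y z - y (z - (1 - l) * h))"
    have "(W h has_real_derivative ?d) (at z)"
      unfolding W_def using rng[OF z h]
      by (auto intro!: derivative_eq_intros DERIV_chain2[of X] DERIV_chain2[of Y] X Y)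
    moreover have "0 \<le> ?d"
    proof -
      have "(1 - l) * (z + l * h) + l * (z - (1 - l) * h) = z" by (simp add: algebra_simps)
      then show ?thesis using ineq[of "z - (1 - l) * h" "z + l * h"] rng[OF z h] ab
          by (simp add: algebra_simps)
    qed
    ultimately show "\<exists>d. (W h has_real_derivative d) (at z) \<and> 0 \<le> d" by blast
  qed (use uv in simp)
  have DX: "((\<lambda>h. X (z + l * h)) has_real_derivative l * x z) (at 0)" if "a < z" "z < b" for z
    by (rule DERIV_chain2[of X "x z" "\<lambda>h. z + l * h" 0 l UNIV, THEN DERIV_cong]) (use X that in \<open>auto intro!: derivative_eq_intros\<close>)
  have DY: "((\<lambda>h. Y (z - (1 - l) * h)) has_real_derivative - (1 - l) * y z) (at 0)" if "a < z" "z < b"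
      for z
    by (rule DERIV_chain2[of Y "y z" "\<lambda>h. z - (1 - l) * h" 0 "-(1 - l)" UNIV, THEN DERIV_cong]) (use Y that in \<open>auto intro!: derivative_eq_intros\<close>)
  have DW: "((\<lambda>h. W h z) has_real_derivative ((1 - l) * (l * x z) - l * ((1 - l) * y z))) (at 0)"
      if "a < z" "z < b" for z
    unfolding W_def
    by (rule DERIV_cong[OF DERIV_diff[OF DERIV_cmult[OF DERIV_diff[OF DX[OF that] DERIV_const]] DERIV_cmult[OF DERIV_diff[OF DERIV_const DY[OF that]]]]])
      (simp add: algebra_simps)
  have D: "((\<lambda>h. W h v - W h u) has_real_derivative
      ((1 - l) * (l * x v) - l * ((1 - l) * y v)) - ((1 - l) * (l * x u) - l * ((1 - l) * y u))) (at 0)"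
    using ab uv by (intro DERIV_diff DW) auto
  have "((1 - l) * (l * x v) - l * ((1 - l) * y v)) - ((1 - l) * (l * x u) - l * ((1 - l) * y u)) = 0"
  proof (rule DERIV_local_min[OF D r], intro allI impI)
    fix h assume "\<bar>0 - h\<bar> < r"
    then show "W 0 v - W 0 u \<le> W h v - W h u" using mono[of h] by (simp add: W_def)
  qed
  then have "(l * (1 - l)) * ((x v - x u) - (y v - y u)) = 0" by (simp add: algebra_simps)
  then show ?thesis using l by auto
qed

section \<open>Down-closed bodies in the orthant and the distribution of monomials on them\<close>

definition lower_body :: "(real ^ 'n) set \<Rightarrow> bool" where
  "lower_body A \<longleftrightarrow> compact A \<and> A \<subseteq> orthant \<and> (\<forall>x\<in>A. \<forall>y\<in>orthant. (\<forall>i. y $ i \<le> x $ i) \<longrightarrow> y \<in> A) \<and>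
     (\<exists>x\<in>A. \<forall>i. 0 < x $ i)"

text \<open>Monomials with real exponents. They are multiplicative under \<open>gprod\<close>, so
  cuts of \<open>A\<close> and \<open>B\<close> at levels \<open>a\<close> and \<open>b\<close>
  correspond to a cut of the product at the geometric mean of \<open>a\<close> and
  \<open>b\<close>.\<close>

definition power_prod :: "('n \<Rightarrow> real) \<Rightarrow> real ^ 'n \<Rightarrow> real" where
  "power_prod \<theta> x = (\<Prod>i\<in>UNIV. x $ i powr \<theta> i)"

lemma lower_bodyD:
  assumes "lower_body A"
  shows "compact A" "A \<subseteq> orthant" "\<And>x i. x \<in> A \<Longrightarrow> 0 \<le> x $ i"
    "\<And>x y. x \<in> A \<Longrightarrow> (\<And>i. 0 \<le> y $ i) \<Longrightarrow> (\<And>i. y $ i \<le> x $ i) \<Longrightarrow> y \<in> A"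
    "\<exists>x\<in>A. \<forall>i. 0 < x $ i"
proof -
  note a = assms[unfolded lower_body_def]
  note A = a[THEN conjunct1] a[THEN conjunct2, THEN conjunct1]
    a[THEN conjunct2, THEN conjunct2, THEN conjunct1] a[THEN conjunct2, THEN conjunct2, THEN conjunct2]
  show "compact A" "A \<subseteq> orthant" "\<exists>x\<in>A. \<forall>i. 0 < x $ i" by fact+
  show "0 \<le> x $ i" if "x \<in> A" for x i using subsetD[OF A(2) that] by (simp add: orthant_def)
  show "y \<in> A" if "x \<in> A" "\<And>i. 0 \<le> y $ i" "\<And>i. y $ i \<le> x $ i" for x y
    using bspec[OF bspec[OF A(3) that(1)], of y] that by (simp add: orthant_def)
qed

lemma cbox_measure_pos:
  fixes a b :: "real ^ 'n"
  assumes "\<And>i. a $ i < b $ i" "cbox a b \<subseteq> A" "A \<in> lmeasurable"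
  shows "0 < measure lebesgue A"
proof -
  have "cbox a b \<noteq> {}" using assms(1) by (simp add: interval_ne_empty_cart less_imp_le)
  then have "0 < measure lebesgue (cbox a b)"
    using assms(1) by (simp add: content_cbox_cart prod_pos)
  also have "\<dots> \<le> measure lebesgue A" using assms by (intro measure_mono_fmeasurable) auto
  finally show ?thesis .
qed

lemma lower_body_measure_pos:
  assumes "lower_body A" shows "0 < measure lebesgue A"
proof -
  obtain x where x: "x \<in> A" "\<And>i. 0 < x $ i" using lower_bodyD(5)[OF assms] by auto
  have "cbox 0 x \<subseteq> A" using lower_bodyD(4)[OF assms x(1)] by (auto simp: mem_box_cart)
  then show ?thesis using x lower_bodyD(1)[OF assms]
      by (intro cbox_measure_pos[of 0 x]) (auto intro: lmeasurable_compact)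
qed

lemma power_prod_nonneg [simp]: "0 \<le> power_prod \<theta> x"
  by (simp add: power_prod_def prod_nonneg)

lemma power_prod_measurable [measurable]: "power_prod \<theta> \<in> borel_measurable borel"
  unfolding power_prod_def by measurable

lemma continuous_on_power_prod:
  assumes "\<And>i. 0 < \<theta> i" "X \<subseteq> orthant" shows "continuous_on X (power_prod \<theta>)"
  unfolding power_prod_def using assms
  by (intro continuous_on_prod continuous_on_powr' continuous_intros) (auto simp: orthant_def)

lemma power_prod_mono:
  assumes "\<And>i. 0 < \<theta> i" "\<And>i. 0 \<le> x $ i" "\<And>i. x $ i \<le> y $ i" shows "power_prod \<theta> x \<le> power_prod \<theta> y"
  unfolding power_prod_def using assms by (intro prod_mono) (simp add: powr_mono2 less_imp_le)

lemma power_prod_pos_iff: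
  assumes "\<And>i. 0 \<le> x $ i" shows "0 < power_prod \<theta> x \<longleftrightarrow> (\<forall>i. 0 < x $ i)"
proof
  assume "0 < power_prod \<theta> x"
  then have "x $ i powr \<theta> i \<noteq> 0" for i unfolding power_prod_def
      by (metis UNIV_I finite less_irrefl prod_zero)
  then have "x $ i \<noteq> 0" for i by (metis powr_0 powr_eq_0_iff)
  then show "\<forall>i. 0 < x $ i" using assms by (simp add: order_less_le)
next
  assume "\<forall>i. 0 < x $ i"
  then show "0 < power_prod \<theta> x" unfolding power_prod_def
      by (intro prod_pos ballI) (metis powr_gt_zero less_irrefl)
qed

lemma power_prod_scale:
  assumes "0 \<le> s" "\<And>i. 0 \<le> x $ i"
      shows "power_prod \<theta> (s *\<^sub>R x) = s powr (\<Sum>i\<in>UNIV. \<theta> i) * power_prod \<theta> x"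
  using assms
      by (cases "s = 0") (auto simp: power_prod_def powr_mult prod.distrib powr_sum prod_zero_iff)

lemma power_prod_gprod:
  assumes "\<And>i. 0 \<le> x $ i" "\<And>i. 0 \<le> y $ i"
  shows "power_prod \<theta> (gprod l x y) = power_prod \<theta> x powr (1 - l) * power_prod \<theta> y powr l"
  using assms
      by (simp add: power_prod_def powr_mult prod.distrib prod_powr_distrib powr_powr mult.commute)

text \<open>For \<open>c > 0\<close>, homogeneity of positive degree lets every ray from the origin
  meet the level set at most once; otherwise the level set lies in the coordinate
  hyperplanes.\<close>

lemma power_prod_level_negligible:
  assumes A: "lower_body A" and \<theta>: "\<And>i. 0 < \<theta> i"
  shows "negligible {x\<in>A. power_prod \<theta> x = c}"
proof (cases "0 < c")
  case True
  have cl: "compact {x\<in>A. power_prod \<theta> x = c}"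
    using continuous_closed_preimage[OF continuous_on_power_prod[OF \<theta> lower_bodyD(2)[OF A]] compact_imp_closed[OF lower_bodyD(1)[OF A]], of "{c}"]
    by (intro compact_eq_bounded_closed[THEN iffD2] conjI bounded_subset[OF compact_imp_bounded[OF lower_bodyD(1)[OF A]]])
      (auto simp: Int_def vimage_def)
  show ?thesis
  proof (rule starlike_negligible[where a = 0])
    show "closed {x\<in>A. power_prod \<theta> x = c}" using cl compact_imp_closed by blast
    fix s x assume "(0 + s *\<^sub>R x) \<in> {x\<in>A. power_prod \<theta> x = c}" "0 \<le> s"
        "0 + x \<in> {x\<in>A. power_prod \<theta> x = c}"
    then have "power_prod \<theta> (s *\<^sub>R x) = c" "power_prod \<theta> x = c" "x \<in> A" "0 \<le> s" by auto
    then have e: "s powr (\<Sum>i\<in>UNIV. \<theta> i) = 1" using power_prod_scale[of s x \<theta>] lower_bodyD(3)[OF A] True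
        by auto
    have S: "0 < (\<Sum>i\<in>UNIV. \<theta> i)" using \<theta> by (intro sum_pos) auto
    have "s = (s powr (\<Sum>i\<in>UNIV. \<theta> i)) powr (1 / (\<Sum>i\<in>UNIV. \<theta> i))"
      using S \<open>0 \<le> s\<close> by (simp add: powr_powr)
    then show "s = 1" using e by simp
  qed
next
  case False
  have "{x\<in>A. power_prod \<theta> x = c} \<subseteq> (\<Union>i. {x. x $ i = 0})"
  proof
    fix x assume x: "x \<in> {x\<in>A. power_prod \<theta> x = c}"
    then have "\<not> 0 < power_prod \<theta> x" using False by simp
    then obtain i where "\<not> 0 < x $ i" using power_prod_pos_iff[of x \<theta>] lower_bodyD(3)[OF A] x by auto
    then show "x \<in> (\<Union>i. {x. x $ i = 0})" using x lower_bodyD(3)[OF A, of x i]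
        by (auto intro!: exI[of _ i])
  qed
  moreover have "negligible (\<Union>i. {x :: real ^ 'a. x $ i = 0})"
    by (intro negligible_Union) (auto simp: negligible_coordinate_hyperplane)
  ultimately show ?thesis using negligible_subset by blast
qed

text \<open>Between the two levels there is room for a nondegenerate box inside \<open>A\<close>,
  spanned by two multiples of \<open>x0\<close>.\<close>

lemma power_prod_level_strict:
  assumes A: "lower_body A" and \<theta>: "\<And>i. 0 < \<theta> i" and x0: "x0 \<in> A" and c: "0 \<le> c" "c < c'"
      "c' \<le> power_prod \<theta> x0"
  shows "measure lebesgue {x\<in>A. power_prod \<theta> x \<le> c} < measure lebesgue {x\<in>A. power_prod \<theta> x \<le> c'}"
proof -
  define S where "S = (\<Sum>i\<in>UNIV. \<theta> i)"
  have S: "0 < S" unfolding S_def using \<theta> by (intro sum_pos) auto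
  have x0p: "0 < x0 $ i" for i using power_prod_pos_iff[of x0 \<theta>] lower_bodyD(3)[OF A x0] c by auto
  \<comment> \<open>Two intermediate levels, \<open>c < w' < w < c'\<close>. The scalings
    \<open>s\<close> and \<open>\<eta>\<close> below reach them from \<open>x0\<close>; the exponent
    \<open>1 / S\<close> undoes the homogeneity of degree \<open>S\<close>.\<close>
  define m w w' where "m = power_prod \<theta> x0" and "w = (c + c') / 2" and "w' = (c + w) / 2"
  have w: "c < w'" "w' < w" "w < c'" "w < m" "0 < w'" "0 < w" using c unfolding w_def w'_def m_def
      by argo+
  define s \<eta> where "s = (w / m) powr (1 / S)" and "\<eta> = (w' / w) powr (1 / S)"
  have s: "0 < s" "s \<le> 1" and \<eta>: "0 < \<eta>" "\<eta> < 1"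
    using w S powr_less_mono2[of "1 / S" "w' / w" 1] by (auto simp: s_def \<eta>_def intro!: powr_le1)
  define y where "y = s *\<^sub>R x0"
  have sS: "s powr S = w / m" "\<eta> powr S = w' / w" using w S by (auto simp: s_def \<eta>_def powr_powr)
  have yp: "0 < y $ i" for i using s x0p by (simp add: y_def)
  have yA: "y \<in> A" using lower_bodyD(4)[OF A x0, of y] yp s x0p
      by (simp add: y_def mult_left_le_one_le less_imp_le)
  have my: "power_prod \<theta> y = w" unfolding y_def using power_prod_scale[of s x0 \<theta>] s x0p w sS
      by (simp add: S_def m_def less_imp_le)
  have mey: "power_prod \<theta> (\<eta> *\<^sub>R y) = w'" using power_prod_scale[of \<eta> y \<theta>] \<eta> yp w sS my
      by (simp add: S_def less_imp_le)
  define E where "E = {x\<in>A. c' \<ge> power_prod \<theta> x \<and> w' \<le> power_prod \<theta> x}"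
  have cont: "continuous_on A (power_prod \<theta>)"
      by (rule continuous_on_power_prod[OF \<theta> lower_bodyD(2)[OF A]])
  have cE: "compact E"
    using continuous_closed_preimage[OF cont compact_imp_closed[OF lower_bodyD(1)[OF A]], of "{w'..c'}"]
    unfolding E_def
    by (intro compact_eq_bounded_closed[THEN iffD2] conjI bounded_subset[OF compact_imp_bounded[OF lower_bodyD(1)[OF A]]])
      (auto simp: Int_def vimage_def conj_commute)
  have "cbox (\<eta> *\<^sub>R y) y \<subseteq> E"
  proof
    fix x assume x: "x \<in> cbox (\<eta> *\<^sub>R y) y"
    have n: "0 \<le> \<eta> * y $ i" for i using \<eta> yp[of i] by simp
    have xb: "\<eta> * y $ i \<le> x $ i" "x $ i \<le> y $ i" "0 \<le> x $ i" for i
      using x n[of i] order_trans[OF n[of i], of "x $ i"] by (auto simp: mem_box_cart)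
    have "x \<in> A" using lower_bodyD(4)[OF A yA, of x] xb by auto
    moreover have "power_prod \<theta> x \<le> w" using power_prod_mono[of \<theta> x y] \<theta> xb my by auto
    moreover have "w' \<le> power_prod \<theta> x" using power_prod_mono[of \<theta> "\<eta> *\<^sub>R y" x] \<theta> xb n mey by auto
    ultimately show "x \<in> E" using w by (auto simp: E_def)
  qed
  then have Ep: "0 < measure lebesgue E"
    using \<eta> yp cE by (intro cbox_measure_pos[of "\<eta> *\<^sub>R y" y]) (auto intro: lmeasurable_compact)
  note sp = measure_split_level[OF lower_bodyD(1)[OF A] cont power_prod_level_negligible[OF A \<theta>]]
  have "measure lebesgue {x\<in>A. power_prod \<theta> x \<le> c} + measure lebesgue E \<le> measure lebesgue {x\<in>A. power_prod \<theta> x \<le> c'}"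
    using cE sp(1)[of c] sp(1)[of c'] w c
    by (intro measure_Un_le_negligible lmeasurable_compact) (auto simp: E_def intro!: negligible_subset[of "{}"])
  then show ?thesis using Ep by simp
qed

lemma power_prod_attains_max:
  assumes "lower_body A" "\<And>i. 0 < \<theta> i"
  obtains x where "x \<in> A" "\<And>y. y \<in> A \<Longrightarrow> power_prod \<theta> y \<le> power_prod \<theta> x" "0 < power_prod \<theta> x"
proof -
  obtain z where z: "z \<in> A" "\<forall>i. 0 < z $ i" using lower_bodyD(5)[OF assms(1)] by auto
  obtain x where x: "x \<in> A" "\<And>y. y \<in> A \<Longrightarrow> power_prod \<theta> y \<le> power_prod \<theta> x"
    using continuous_attains_sup[OF lower_bodyD(1)[OF assms(1)] _ continuous_on_power_prod[of \<theta>, OF assms(2) lower_bodyD(2)[OF assms(1)]]] z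
        by blast
  have "0 < power_prod \<theta> z" using z power_prod_pos_iff[of z \<theta>] by (auto simp: less_imp_le)
  then show thesis using that x z by (meson order_less_le_trans)
qed

definition max_power_prod :: "('n \<Rightarrow> real) \<Rightarrow> (real ^ 'n) set \<Rightarrow> real" where
  "max_power_prod \<theta> A = Sup (power_prod \<theta> ` A)"

lemma max_power_prod:
  assumes "lower_body A" "\<And>i. 0 < \<theta> i"
  shows "\<And>y. y \<in> A \<Longrightarrow> power_prod \<theta> y \<le> max_power_prod \<theta> A" "\<exists>x\<in>A. power_prod \<theta> x = max_power_prod \<theta> A"
      "0 < max_power_prod \<theta> A"
proof -
  obtain x where x: "x \<in> A" "\<And>y. y \<in> A \<Longrightarrow> power_prod \<theta> y \<le> power_prod \<theta> x" "0 < power_prod \<theta> x"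
    using power_prod_attains_max[of A \<theta>] assms by auto
  then have "max_power_prod \<theta> A = power_prod \<theta> x" unfolding max_power_prod_def
      by (intro cSup_eq_maximum) auto
  then show "\<And>y. y \<in> A \<Longrightarrow> power_prod \<theta> y \<le> max_power_prod \<theta> A"
      "\<exists>x\<in>A. power_prod \<theta> x = max_power_prod \<theta> A" "0 < max_power_prod \<theta> A" using x by auto
qed

definition power_prod_cdf :: "('n \<Rightarrow> real) \<Rightarrow> (real ^ 'n) set \<Rightarrow> real \<Rightarrow> real" where
  "power_prod_cdf \<theta> A c = measure lebesgue {x\<in>A. power_prod \<theta> x \<le> c} / measure lebesgue A"

lemma power_prod_cdf:
  assumes A: "lower_body A" and \<theta>: "\<And>i. 0 < \<theta> i"
  shows "continuous_on UNIV (power_prod_cdf \<theta> A)" "\<And>c. c \<le> 0 \<Longrightarrow> power_prod_cdf \<theta> A c = 0"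
      "\<And>c. max_power_prod \<theta> A \<le> c \<Longrightarrow> power_prod_cdf \<theta> A c = 1"
    "\<And>c c'. 0 \<le> c \<Longrightarrow> c < c' \<Longrightarrow> c' \<le> max_power_prod \<theta> A \<Longrightarrow> power_prod_cdf \<theta> A c < power_prod_cdf \<theta> A c'"
proof -
  note V = lower_body_measure_pos[OF A]
  show "continuous_on UNIV (power_prod_cdf \<theta> A)"
    unfolding power_prod_cdf_def using V
    by (intro continuous_on_divide continuous_on_const level_cdf[OF lower_bodyD(1)[OF A] continuous_on_power_prod[OF \<theta> lower_bodyD(2)[OF A]] power_prod_level_negligible[OF A \<theta>]]) auto
  show "power_prod_cdf \<theta> A c = 0" if "c \<le> 0" for c
  proof -
    have "negligible {x\<in>A. power_prod \<theta> x \<le> c}"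
    proof (rule negligible_subset[OF power_prod_level_negligible[where c = 0, OF A \<theta>]])
      show "{x\<in>A. power_prod \<theta> x \<le> c} \<subseteq> {x\<in>A. power_prod \<theta> x = 0}" using that power_prod_nonneg[of \<theta>]
          by (auto intro: order_antisym order_trans)
    qed
    then show ?thesis by (simp add: power_prod_cdf_def negligible_imp_measure0)
  qed
  show "power_prod_cdf \<theta> A c = 1" if "max_power_prod \<theta> A \<le> c" for c
  proof -
    have "{x\<in>A. power_prod \<theta> x \<le> c} = A" using max_power_prod(1)[of A \<theta>] A \<theta> that
        by (auto intro: order_trans)
    then show ?thesis using V by (simp add: power_prod_cdf_def)
  qed
  show "power_prod_cdf \<theta> A c < power_prod_cdf \<theta> A c'" if "0 \<le> c" "c < c'" "c' \<le> max_power_prod \<theta> A"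
      for c c'
  proof -
    obtain x where "x \<in> A" "power_prod \<theta> x = max_power_prod \<theta> A" using max_power_prod(2)[of A \<theta>] A \<theta>
        by auto
    then show ?thesis unfolding power_prod_cdf_def
        using power_prod_level_strict[OF A \<theta>, of x c c'] that V by (simp add: divide_strict_right_mono)
  qed
qed

text \<open>On \<open>[0, max]\<close> the distribution function is continuous and strictly
  increasing with range \<open>[0, 1]\<close>; \<open>q\<close> is its inverse there.\<close>

lemma power_prod_quantile:
  assumes A: "lower_body A" and \<theta>: "\<And>i. 0 < \<theta> i"
  obtains q where "continuous_on {0..1} q"
      "\<And>p. 0 \<le> p \<Longrightarrow> p \<le> 1 \<Longrightarrow> 0 \<le> q p \<and> q p \<le> max_power_prod \<theta> A \<and> power_prod_cdf \<theta> A (q p) = p"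
    "\<And>c. 0 \<le> c \<Longrightarrow> c \<le> max_power_prod \<theta> A \<Longrightarrow> q (power_prod_cdf \<theta> A c) = c"
proof -
  let ?m = "max_power_prod \<theta> A" and ?F = "power_prod_cdf \<theta> A"
  note F = power_prod_cdf[of A \<theta>, OF A \<theta>] and m = max_power_prod(3)[of A \<theta>, OF A \<theta>]
  have cF: "continuous_on {0..?m} ?F" using F(1) continuous_on_subset by blast
  have inj: "inj_on ?F {0..?m}"
    by (rule linorder_inj_onI') (use F(4) in force)
  have im: "?F ` {0..?m} = {0..1}"
  proof
    have "0 \<le> ?F c \<and> ?F c \<le> 1" if "0 \<le> c" "c \<le> ?m" for c
    proof -
      have "0 \<le> ?F c" unfolding power_prod_cdf_def by simp
      moreover have "?F c \<le> 1" using F(4)[of c ?m] F(3)[of ?m] that by (cases "c = ?m") auto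
      ultimately show ?thesis by simp
    qed
    then show "?F ` {0..?m} \<subseteq> {0..1}" by auto
    show "{0..1} \<subseteq> ?F ` {0..?m}"
    proof
      fix p :: real assume "p \<in> {0..1}"
      then have "\<exists>x\<ge>0. x \<le> ?m \<and> ?F x = p" using F(2)[of 0] F(3)[of ?m] m cF by (intro IVT') auto
      then show "p \<in> ?F ` {0..?m}" by auto
    qed
  qed
  show thesis
  proof
    show "continuous_on {0..1} (inv_into {0..?m} ?F)"
      using continuous_on_inv[OF cF compact_Icc, of "inv_into {0..?m} ?F"] im inv_into_f_f[OF inj]
          by simp
    show "0 \<le> inv_into {0..?m} ?F p \<and> inv_into {0..?m} ?F p \<le> ?m \<and> ?F (inv_into {0..?m} ?F p) = p"
        if "0 \<le> p" "p \<le> 1" for p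
      using inv_into_into[of p ?F "{0..?m}"] f_inv_into_f[of p ?F "{0..?m}"] im that by auto
    show "inv_into {0..?m} ?F (?F c) = c" if "0 \<le> c" "c \<le> ?m" for c
      using inv_into_f_f[OF inj] that by auto
  qed
qed

text \<open>For down-closedness, both factors are shrunk coordinatewise by the same ratio, which
  shrinks their geometric mean by that ratio.\<close>

lemma lower_body_gprods:
  assumes l: "0 < l" "l < 1" and A: "lower_body A" and B: "lower_body B"
  shows "lower_body (gprods l A B)"
  unfolding lower_body_def
proof (intro conjI ballI impI)
  show "compact (gprods l A B)" using l lower_bodyD(1,2)[OF A] lower_bodyD(1,2)[OF B]
      by (intro compact_gprods)
  show "gprods l A B \<subseteq> orthant" by (rule gprods_orthant)
  obtain x y where xy: "x \<in> A" "\<forall>i. 0 < x $ i" "y \<in> B" "\<forall>i. 0 < y $ i"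
      using lower_bodyD(5)[OF A] lower_bodyD(5)[OF B] by auto
  show "\<exists>x\<in>gprods l A B. \<forall>i. 0 < x $ i"
    by (rule bexI[of _ "gprod l x y"]) (use xy in \<open>auto intro!: gprod_in_gprods mult_pos_pos simp: less_imp_neq[THEN not_sym]\<close>)
  fix z w assume z: "z \<in> gprods l A B" and w: "w \<in> orthant" "\<forall>i. w $ i \<le> z $ i"
  from z obtain x y where xy: "x \<in> A" "y \<in> B" "z = gprod l x y" by (rule gprodsE)
  \<comment> \<open>Where \<open>z $ i = 0\<close> also \<open>w $ i = 0\<close>, and division by
    zero yields the ratio 0, which is the right one.\<close>
  define r where "r i = w $ i / z $ i" for i
  have r: "0 \<le> r i" "r i \<le> 1" "r i * z $ i = w $ i" for i
  proof -
    have "0 \<le> w $ i" "w $ i \<le> z $ i" using w by (auto simp: orthant_def)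
    then show "0 \<le> r i" "r i \<le> 1" "r i * z $ i = w $ i" by (auto simp: r_def divide_le_eq_1)
  qed
  define x' y' :: "real ^ 'a" where "x' = (\<chi> i. r i * x $ i)" and "y' = (\<chi> i. r i * y $ i)"
  have "x' \<in> A" "y' \<in> B"
    using lower_bodyD(4)[OF A xy(1), of x'] lower_bodyD(4)[OF B xy(2), of y'] lower_bodyD(3)[OF A xy(1)] lower_bodyD(3)[OF B xy(2)] r
    by (auto simp: x'_def y'_def mult_left_le_one_le)
  moreover have "gprod l x' y' = w"
    using r lower_bodyD(3)[OF A xy(1)] lower_bodyD(3)[OF B xy(2)] xy(3)
    by (simp add: vec_eq_iff x'_def y'_def powr_mean_scale)
  ultimately show "w \<in> gprods l A B" using gprod_in_gprods by metis
qed

text \<open>If equality holds for \<open>A\<close> and \<open>B\<close>, then it also holds for the parts cut off by level sets of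
  \<open>power_prod \<theta>\<close> at equal volume ratio; hence the quantiles of \<open>power_prod \<theta>\<close> on the product are the geometric means of those
  on \<open>A\<close> and \<open>B\<close>.\<close>

lemma power_prod_cdf_gprods:
  assumes l: "0 < l" "l < 1" and A: "lower_body A" and B: "lower_body B" and \<theta>: "\<And>i. 0 < \<theta> i"
    and eq: "measure lebesgue (gprods l A B) = measure lebesgue A powr (1 - l) * measure lebesgue B powr l"
    and ab: "0 \<le> a" "0 \<le> b"
  shows "power_prod_cdf \<theta> A a powr (1 - l) * power_prod_cdf \<theta> B b powr l \<le> power_prod_cdf \<theta> (gprods l A B) (a powr (1 - l) * b powr l)"
    "power_prod_cdf \<theta> A a = power_prod_cdf \<theta> B b \<Longrightarrow> power_prod_cdf \<theta> (gprods l A B) (a powr (1 - l) * b powr l) = power_prod_cdf \<theta> A a"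
proof -
  define P where "P = gprods l A B"
  define c where "c = a powr (1 - l) * b powr l"
  have P: "lower_body P" unfolding P_def by (rule lower_body_gprods[OF l A B])
  note VA = lower_body_measure_pos[OF A] and VB = lower_body_measure_pos[OF B]
      and VP = lower_body_measure_pos[OF P]
  note spA = measure_split_level[OF lower_bodyD(1)[OF A] continuous_on_power_prod[of \<theta>, OF \<theta> lower_bodyD(2)[OF A]] power_prod_level_negligible[of A \<theta>, OF A \<theta>]]
  note spB = measure_split_level[OF lower_bodyD(1)[OF B] continuous_on_power_prod[of \<theta>, OF \<theta> lower_bodyD(2)[OF B]] power_prod_level_negligible[of B \<theta>, OF B \<theta>]]
  note spP = measure_split_level[OF lower_bodyD(1)[OF P] continuous_on_power_prod[of \<theta>, OF \<theta> lower_bodyD(2)[OF P]] power_prod_level_negligible[of P \<theta>, OF P \<theta>]]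
  have sA: "{x\<in>A. Q x} \<subseteq> orthant" and sB: "{x\<in>B. Q x} \<subseteq> orthant" for Q
      using lower_bodyD(2)[OF A] lower_bodyD(2)[OF B] by auto
  have "gprods l {x\<in>A. power_prod \<theta> x \<le> a} {x\<in>B. power_prod \<theta> x \<le> b} \<subseteq> {x\<in>P. power_prod \<theta> x \<le> c}"
  proof
    fix z assume "z \<in> gprods l {x\<in>A. power_prod \<theta> x \<le> a} {x\<in>B. power_prod \<theta> x \<le> b}"
    then obtain x y where xy: "x \<in> A" "power_prod \<theta> x \<le> a" "y \<in> B" "power_prod \<theta> y \<le> b"
        "z = gprod l x y" by (auto elim!: gprodsE)
    have "power_prod \<theta> z \<le> c"
      unfolding xy(5) c_def power_prod_gprod[OF lower_bodyD(3)[OF A xy(1)] lower_bodyD(3)[OF B xy(3)]]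
      using xy l by (intro mult_mono powr_mono2) auto
    then show "z \<in> {x\<in>P. power_prod \<theta> x \<le> c}" using xy by (auto simp: P_def gprod_in_gprods)
  qed
  then have "measure lebesgue (gprods l {x\<in>A. power_prod \<theta> x \<le> a} {x\<in>B. power_prod \<theta> x \<le> b}) \<le> measure lebesgue {x\<in>P. power_prod \<theta> x \<le> c}"
    by (rule measure_mono_fmeasurable[OF _ fmeasurableD[OF lmeasurable_compact[OF compact_gprods[OF l spA(1) spB(1) sA sB]]] lmeasurable_compact[OF spP(1)]])
  with measure_gprods[OF l spA(1) sA spB(1) sB]
  have lo: "measure lebesgue {x\<in>A. power_prod \<theta> x \<le> a} powr (1 - l) * measure lebesgue {x\<in>B. power_prod \<theta> x \<le> b} powr l \<le> measure lebesgue {x\<in>P. power_prod \<theta> x \<le> c}"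
    by (rule order_trans)
  have "gprods l {x\<in>A. a \<le> power_prod \<theta> x} {x\<in>B. b \<le> power_prod \<theta> x} \<subseteq> {x\<in>P. c \<le> power_prod \<theta> x}"
  proof
    fix z assume "z \<in> gprods l {x\<in>A. a \<le> power_prod \<theta> x} {x\<in>B. b \<le> power_prod \<theta> x}"
    then obtain x y where xy: "x \<in> A" "a \<le> power_prod \<theta> x" "y \<in> B" "b \<le> power_prod \<theta> y"
        "z = gprod l x y" by (auto elim!: gprodsE)
    have "c \<le> power_prod \<theta> z"
      unfolding xy(5) c_def power_prod_gprod[OF lower_bodyD(3)[OF A xy(1)] lower_bodyD(3)[OF B xy(3)]]
      using xy l ab by (intro mult_mono powr_mono2) auto
    then show "z \<in> {x\<in>P. c \<le> power_prod \<theta> x}" using xy by (auto simp: P_def gprod_in_gprods)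
  qed
  then have "measure lebesgue (gprods l {x\<in>A. a \<le> power_prod \<theta> x} {x\<in>B. b \<le> power_prod \<theta> x}) \<le> measure lebesgue {x\<in>P. c \<le> power_prod \<theta> x}"
    by (rule measure_mono_fmeasurable[OF _ fmeasurableD[OF lmeasurable_compact[OF compact_gprods[OF l spA(2) spB(2) sA sB]]] lmeasurable_compact[OF spP(2)]])
  with measure_gprods[OF l spA(2) sA spB(2) sB]
  have hi: "measure lebesgue {x\<in>A. a \<le> power_prod \<theta> x} powr (1 - l) * measure lebesgue {x\<in>B. b \<le> power_prod \<theta> x} powr l \<le> measure lebesgue {x\<in>P. c \<le> power_prod \<theta> x}"
    by (rule order_trans)
  have loA: "measure lebesgue {x\<in>A. power_prod \<theta> x \<le> a} = power_prod_cdf \<theta> A a * measure lebesgue A"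
    "measure lebesgue {x\<in>A. a \<le> power_prod \<theta> x} = (1 - power_prod_cdf \<theta> A a) * measure lebesgue A"
    using VA spA(3)[of a] by (auto simp: power_prod_cdf_def field_simps)
  have loB: "measure lebesgue {x\<in>B. power_prod \<theta> x \<le> b} = power_prod_cdf \<theta> B b * measure lebesgue B"
    "measure lebesgue {x\<in>B. b \<le> power_prod \<theta> x} = (1 - power_prod_cdf \<theta> B b) * measure lebesgue B"
    using VB spB(3)[of b] by (auto simp: power_prod_cdf_def field_simps)
  have loP: "measure lebesgue {x\<in>P. power_prod \<theta> x \<le> c} = power_prod_cdf \<theta> P c * measure lebesgue P"
    "measure lebesgue {x\<in>P. c \<le> power_prod \<theta> x} = (1 - power_prod_cdf \<theta> P c) * measure lebesgue P"
    using VP spP(3)[of c] by (auto simp: power_prod_cdf_def field_simps)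
  have n: "0 \<le> power_prod_cdf \<theta> A a" "0 \<le> power_prod_cdf \<theta> B b" "0 \<le> 1 - power_prod_cdf \<theta> A a"
      "0 \<le> 1 - power_prod_cdf \<theta> B b"
    using loA(2) loB(2) VA VB measure_nonneg[of lebesgue "{x\<in>A. a \<le> power_prod \<theta> x}"] measure_nonneg[of lebesgue "{x\<in>B. b \<le> power_prod \<theta> x}"]
    by (auto simp: power_prod_cdf_def zero_le_mult_iff)
  have "(power_prod_cdf \<theta> A a powr (1 - l) * power_prod_cdf \<theta> B b powr l) * measure lebesgue P \<le> power_prod_cdf \<theta> P c * measure lebesgue P"
    using lo n VA VB unfolding loA loB loP by (simp add: powr_mult mult_ac P_def eq)
  then show "power_prod_cdf \<theta> A a powr (1 - l) * power_prod_cdf \<theta> B b powr l \<le> power_prod_cdf \<theta> (gprods l A B) (a powr (1 - l) * b powr l)"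
    using VP by (simp add: P_def c_def)
  show "power_prod_cdf \<theta> (gprods l A B) (a powr (1 - l) * b powr l) = power_prod_cdf \<theta> A a"
      if e: "power_prod_cdf \<theta> A a = power_prod_cdf \<theta> B b"
  proof -
    \<comment> \<open>Lower and upper part of the product each have at least their proportional
      share of its volume; the shares add up to the whole, so both bounds are sharp.\<close>
    let ?p = "power_prod_cdf \<theta> A a"
    have "?p * measure lebesgue P \<le> power_prod_cdf \<theta> P c * measure lebesgue P"
      using lo n unfolding loA loB loP e[symmetric] by (simp add: powr_mean_scale P_def eq)
    moreover have "(1 - ?p) * measure lebesgue P \<le> (1 - power_prod_cdf \<theta> P c) * measure lebesgue P"
      using hi n unfolding loA loB loP e[symmetric] by (simp add: powr_mean_scale P_def eq)
    ultimately show ?thesis using VP by (simp add: P_def c_def)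
  qed
qed

text \<open>The quantile functions \<open>a\<close> and \<open>b\<close> of the monomial on
  \<open>A\<close> and \<open>B\<close> are proportional. In the variable \<open>ln p\<close>, the
  second part of \<open>power_prod_cdf_gprods\<close> identifies the quantile of the product on the
  diagonal, and the first part compares it with the means taken at different arguments. Together
  they give the hypothesis of \<open>quantile_rigidity\<close> for \<open>ln a\<close> and
  \<open>ln b\<close>. The factor of proportionality is read off at \<open>p = 1\<close>.\<close>

lemma power_prod_cdf_rescale:
  assumes l: "0 < l" "l < 1" and A: "lower_body A" and B: "lower_body B" and \<theta>: "\<And>i. 0 < \<theta> i"
    and eq: "measure lebesgue (gprods l A B) = measure lebesgue A powr (1 - l) * measure lebesgue B powr l"
  shows "power_prod_cdf \<theta> B (max_power_prod \<theta> B / max_power_prod \<theta> A * c) = power_prod_cdf \<theta> A c"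
proof -
  define P where "P = gprods l A B"
  have P: "lower_body P" unfolding P_def by (rule lower_body_gprods[OF l A B])
  note FA = power_prod_cdf[of A \<theta>, OF A \<theta>] and FB = power_prod_cdf[of B \<theta>, OF B \<theta>]
      and FP = power_prod_cdf[of P \<theta>, OF P \<theta>]
  note mA = max_power_prod[of A \<theta>, OF A \<theta>] and mB = max_power_prod[of B \<theta>, OF B \<theta>]
      and mP = max_power_prod[of P \<theta>, OF P \<theta>]
  obtain a where a: "continuous_on {0..1} a"
      "\<And>p. 0 \<le> p \<Longrightarrow> p \<le> 1 \<Longrightarrow> 0 \<le> a p \<and> a p \<le> max_power_prod \<theta> A \<and> power_prod_cdf \<theta> A (a p) = p"
    "\<And>c. 0 \<le> c \<Longrightarrow> c \<le> max_power_prod \<theta> A \<Longrightarrow> a (power_prod_cdf \<theta> A c) = c"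
    by (rule power_prod_quantile[of A \<theta>, OF A \<theta>]) blast
  obtain b where b: "continuous_on {0..1} b"
      "\<And>p. 0 \<le> p \<Longrightarrow> p \<le> 1 \<Longrightarrow> 0 \<le> b p \<and> b p \<le> max_power_prod \<theta> B \<and> power_prod_cdf \<theta> B (b p) = p"
    "\<And>c. 0 \<le> c \<Longrightarrow> c \<le> max_power_prod \<theta> B \<Longrightarrow> b (power_prod_cdf \<theta> B c) = c"
    by (rule power_prod_quantile[of B \<theta>, OF B \<theta>]) blast
  have ap: "0 < a p" if "0 < p" "p \<le> 1" for p using a(2)[of p] FA(2)[of "a p"] that
      by (auto simp: order_less_le)
  have bp: "0 < b p" if "0 < p" "p \<le> 1" for p using b(2)[of p] FB(2)[of "b p"] that
      by (auto simp: order_less_le)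
  have exp01: "0 < exp t" "exp t \<le> 1" if "t < 0" for t :: real using that by auto
  have cx: "continuous_on {..<0} (\<lambda>t. ln (a (exp t)))"
    using ap
        by (intro continuous_on_ln continuous_on_compose2[OF a(1)] continuous_intros) (auto simp: less_imp_neq[THEN not_sym])
  have cy: "continuous_on {..<0} (\<lambda>t. ln (b (exp t)))"
    using bp
        by (intro continuous_on_ln continuous_on_compose2[OF b(1)] continuous_intros) (auto simp: less_imp_neq[THEN not_sym])
  have ineq: "(1 - l) * ln (a (exp ((1 - l) * t + l * s))) + l * ln (b (exp ((1 - l) * t + l * s))) \<le> (1 - l) * ln (a (exp t)) + l * ln (b (exp s))"
    if st: "s < 0" "t < 0" for s t
  proof -
    define u where "u = (1 - l) * t + l * s"
    have u: "u < 0" unfolding u_def using l st by (intro add_neg_neg mult_pos_neg) auto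
    define c d where "c = a (exp u) powr (1 - l) * b (exp u) powr l"
        and "d = a (exp t) powr (1 - l) * b (exp s) powr l"
    have pos: "0 < a (exp u)" "0 < b (exp u)" "0 < a (exp t)" "0 < b (exp s)" using ap bp exp01 u st
        by auto
    have "power_prod_cdf \<theta> P c = exp u"
      unfolding P_def c_def
          using power_prod_cdf_gprods(2)[where \<theta>=\<theta> and l=l, OF l A B \<theta> eq, of "a (exp u)" "b (exp u)"] a(2)[of "exp u"] b(2)[of "exp u"] u pos
          by simp
    moreover have "exp u \<le> power_prod_cdf \<theta> P d"
    proof -
      have "exp u = exp t powr (1 - l) * exp s powr l" by (simp add: u_def powr_def exp_add)
      also have "\<dots> = power_prod_cdf \<theta> A (a (exp t)) powr (1 - l) * power_prod_cdf \<theta> B (b (exp s)) powr l"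
          using a(2)[of "exp t"] b(2)[of "exp s"] st by simp
      also have "\<dots> \<le> power_prod_cdf \<theta> P d"
        unfolding P_def d_def using pos by (intro power_prod_cdf_gprods(1)[OF l A B \<theta> eq]) auto
      finally show ?thesis .
    qed
    ultimately have le: "power_prod_cdf \<theta> P c \<le> power_prod_cdf \<theta> P d" by simp
    \<comment> \<open>The distribution function on \<open>P\<close> is strictly increasing only up
      to its maximum, so \<open>c\<close> has to be located below it before \<open>c\<close> and
      \<open>d\<close> can be compared.\<close>
    have cm: "c \<le> max_power_prod \<theta> P"
    proof -
      obtain xa where xa: "xa \<in> A" "power_prod \<theta> xa = max_power_prod \<theta> A" using mA(2) by auto
      obtain xb where xb: "xb \<in> B" "power_prod \<theta> xb = max_power_prod \<theta> B" using mB(2) by auto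
      have "c \<le> max_power_prod \<theta> A powr (1 - l) * max_power_prod \<theta> B powr l"
        unfolding c_def using a(2)[of "exp u"] b(2)[of "exp u"] u l by (intro mult_mono powr_mono2) auto
      also have "\<dots> = power_prod \<theta> (gprod l xa xb)"
        using xa xb power_prod_gprod[OF lower_bodyD(3)[OF A xa(1)] lower_bodyD(3)[OF B xb(1)]] by simp
      also have "\<dots> \<le> max_power_prod \<theta> P" using xa xb by (intro mP(1)) (auto simp: P_def gprod_in_gprods)
      finally show ?thesis .
    qed
    have "c \<le> d"
    proof (rule ccontr)
      assume "\<not> c \<le> d"
      moreover have "0 \<le> d" by (simp add: d_def)
      ultimately show False using FP(4)[of d c] cm le by simp
    qed
    moreover have "0 < c" using pos by (simp add: c_def)
    ultimately have "ln c \<le> ln d" by simp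
    then show ?thesis using pos unfolding u_def[symmetric] by (simp add: c_def d_def ln_mult ln_powr)
  qed
  have rig: "ln (a (exp v)) - ln (a (exp u)) = ln (b (exp v)) - ln (b (exp u))" if "u < v" "v < 0"
      for u v
    by (rule quantile_rigidity[OF l cx cy ineq that])
  have ratio: "b p = b q / a q * a p" if "0 < p" "p < q" "q < 1" for p q
  proof -
    have "ln (a q) - ln (a p) = ln (b q) - ln (b p)" using rig[of "ln p" "ln q"] that by simp
    moreover have "0 < a p" "0 < b p" "0 < a q" "0 < b q" using ap bp that by auto
    ultimately have "ln (b p) = ln (b q / a q * a p)" by (simp add: ln_mult ln_div)
    then show ?thesis using \<open>0 < a p\<close> \<open>0 < b p\<close> \<open>0 < a q\<close> \<open>0 < b q\<close> by (subst (asm) ln_inj_iff) auto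
  qed
  have a1: "a 1 = max_power_prod \<theta> A" and b1: "b 1 = max_power_prod \<theta> B"
    using a(3)[of "max_power_prod \<theta> A"] b(3)[of "max_power_prod \<theta> B"] FA(3)[of "max_power_prod \<theta> A"] FB(3)[of "max_power_prod \<theta> B"] mA(3) mB(3)
        by auto
  have key: "b p = max_power_prod \<theta> B / max_power_prod \<theta> A * a p" if p: "0 < p" "p < 1" for p
  proof -
    \<comment> \<open>The limit of \<open>q\<close> to 1 replaces the unknown ratio
      \<open>b q / a q\<close> by the ratio of the maxima.\<close>
    have nt: "at_left (1::real) \<noteq> bot" by simp
    have ev: "eventually (\<lambda>q. q \<in> {p<..<1}) (at_left (1::real))" using p
        by (intro eventually_at_left_real) auto
    have la: "(a \<longlongrightarrow> a 1) (at_left 1)" and lb: "(b \<longlongrightarrow> b 1) (at_left 1)"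
      using continuous_on_Icc_at_leftD[OF a(1)] continuous_on_Icc_at_leftD[OF b(1)] by auto
    have l1: "((\<lambda>q. b q / a q * a p) \<longlongrightarrow> b 1 / a 1 * a p) (at_left 1)"
      using ap[of 1] by (intro tendsto_intros la lb) auto
    have l2: "((\<lambda>q. b q / a q * a p) \<longlongrightarrow> b p) (at_left 1)"
      by (rule tendsto_eventually[OF eventually_mono[OF ev]]) (use ratio p in force)
    show ?thesis using tendsto_unique[OF nt l2 l1] a1 b1 by simp
  qed
  let ?k = "max_power_prod \<theta> B / max_power_prod \<theta> A"
  have k: "0 < ?k" using mA(3) mB(3) by simp
  consider "c \<le> 0" | "max_power_prod \<theta> A \<le> c" | "0 < c" "c < max_power_prod \<theta> A" by linarith
  then show ?thesis
  proof cases
    case 1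
    then have "?k * c \<le> 0" using mult_nonneg_nonpos[OF less_imp_le[OF k]] by blast
    then show ?thesis using FA(2)[OF 1] FB(2) by simp
  next
    case 2
    then have "max_power_prod \<theta> B \<le> ?k * c" using mA(3) mB(3) by (simp add: field_simps)
    then show ?thesis using FA(3)[OF 2] FB(3) by simp
  next
    case 3
    define p where "p = power_prod_cdf \<theta> A c"
    have p: "0 < p" "p < 1"
        using FA(4)[of 0 c] FA(4)[of c "max_power_prod \<theta> A"] FA(2)[of 0] FA(3)[of "max_power_prod \<theta> A"] 3
        by (auto simp: p_def)
    have "a p = c" using a(3)[of c] 3 by (simp add: p_def)
    then show ?thesis using key[OF p] b(2)[of p] p by (simp add: p_def[symmetric])
  qed
qed

section \<open>Logarithmic moments of the coordinates under the uniform distribution\<close>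

lemma lower_body_uniform:
  assumes A: "lower_body A"
  shows "emeasure lborel A \<noteq> 0" "emeasure lborel A \<noteq> \<infinity>" "A \<in> sets borel"
    "prob_space (uniform_measure lborel A)"
    "AE x in uniform_measure lborel A. x \<in> A \<and> (\<forall>i. 0 < x $ i)"
proof -
  show Ab: "A \<in> sets borel" using lower_bodyD(1)[OF A] by (simp add: borel_compact)
  show fin: "emeasure lborel A \<noteq> \<infinity>" using emeasure_compact_finite[OF lower_bodyD(1)[OF A]] by simp
  show nz: "emeasure lborel A \<noteq> 0"
    using lower_body_measure_pos[OF A] Ab by (auto simp: measure_def)
  show "prob_space (uniform_measure lborel A)" by (rule prob_space_uniform_measure[OF nz fin])
  have "AE x in lborel. (x :: real ^ 'a) $ i \<noteq> 0" for i
  proof (rule AE_I')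
    show "{x :: real ^ 'a. x $ i = 0} \<in> null_sets lborel"
      using negligible_coordinate_hyperplane[of i 0]
      by (simp add: negligible_iff_null_sets null_sets_completion_iff)
  qed auto
  then have "AE x in lborel. \<forall>i\<in>(UNIV :: 'a set). (x :: real ^ 'a) $ i \<noteq> 0"
    by (intro AE_finite_allI) auto
  then have "AE x in lborel. x \<in> A \<longrightarrow> (x \<in> A \<and> (\<forall>i. 0 < x $ i))"
    by eventually_elim (use lower_bodyD(3)[OF A] in \<open>auto simp: order_less_le\<close>)
  then show "AE x in uniform_measure lborel A. x \<in> A \<and> (\<forall>i. 0 < x $ i)"
    using Ab by (intro AE_uniform_measureI) auto
qed

text \<open>\<open>A\<close> lies in a cube of side \<open>R\<close>, so the slab \<open>S k\<close>
  near the coordinate hyperplane has probability at most \<open>C / 2 ^ k\<close>. Since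
  \<open>ln (R / x $ i)\<close> is at most \<open>ln 2\<close> times the number of slabs that
  contain \<open>x\<close>, a geometric series bounds its expectation.\<close>

lemma integrable_ln_coord:
  fixes A :: "(real ^ 'n) set"
  assumes A: "lower_body A"
  shows "integrable (uniform_measure lborel A) (\<lambda>x. ln (x $ i))"
proof -
  let ?U = "uniform_measure lborel A"
  note U = lower_body_uniform[OF A]
  interpret U: prob_space ?U by (rule U(4))
  obtain R0 where R0: "\<And>x. x \<in> A \<Longrightarrow> norm x \<le> R0" using compact_imp_bounded[OF lower_bodyD(1)[OF A]]
      by (auto simp: bounded_iff)
  define R where "R = max R0 1"
  have R: "0 < R" "x $ j \<le> R" if "x \<in> A" for x j
    using R0[OF that] component_le_norm_cart[of x j] by (auto simp: R_def)
  have R0': "0 < R" by (simp add: R_def)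
  define S where "S k = {x \<in> A. x $ i \<le> R / 2 ^ k}" for k :: nat
  have Sb: "S k \<in> sets borel" for k
    unfolding S_def using U(3) by measurable
  define C where "C = R ^ CARD('n) / measure lborel A"
  have C: "0 \<le> C" using R0' by (simp add: C_def)
  have Sm: "emeasure ?U (S k) \<le> ennreal (C * (1 / 2) ^ k)" for k
  proof -
    define b where "b = (\<chi> j. R * (if j = i then (1 / 2) ^ k else 1))"
    have ne: "cbox 0 b \<noteq> {}" using R0' by (auto simp: interval_ne_empty_cart b_def)
    have "measure lborel (cbox 0 b) = (\<Prod>j\<in>UNIV. R * (if j = i then (1 / 2) ^ k else 1))"
      using content_cbox_cart[OF ne] by (simp add: b_def)
    also have "\<dots> = R ^ CARD('n) * (1 / 2) ^ k"
        by (simp only: prod.distrib prod_constant prod.delta finite UNIV_I if_True)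
    finally have mb: "measure lborel (cbox 0 b) = R ^ CARD('n) * (1 / 2) ^ k" .
    have "S k \<subseteq> cbox 0 b"
      using R lower_bodyD(3)[OF A] by (auto simp: S_def mem_box_cart b_def power_one_over field_simps)
    then have "measure lborel (S k) \<le> measure lborel (cbox 0 b)"
      using Sb emeasure_lborel_cbox_finite[of 0 b]
          by (intro measure_mono_fmeasurable) (auto simp: fmeasurable_def less_top)
    then have "measure ?U (S k) \<le> C * (1 / 2) ^ k"
      using Sb U
          by (simp add: measure_uniform_measure mb C_def divide_right_mono S_def Int_absorb1 Int_def)
    then show ?thesis using U.emeasure_eq_measure C by (simp add: ennreal_leI)
  qed
  have pt: "ennreal (ln (R / x $ i)) \<le> (\<Sum>k. ennreal (ln 2) * indicator (S k) x)" if x: "x \<in> A"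
      "0 < x $ i" for x
  proof -
    define K where "K = nat \<lceil>log 2 (R / x $ i)\<rceil>"
    have rat: "1 \<le> R / x $ i" using R(2)[OF x(1), of i] x by simp
    then have l0: "0 \<le> log 2 (R / x $ i)" by simp
    have "indicator (S k) x = (1 :: ennreal)" if "k < K" for k
    proof -
      have "real k < log 2 (R / x $ i)" using that l0 unfolding K_def by linarith
      then have "2 powr real k < R / x $ i" using rat by (subst (asm) less_log_iff) auto
      then have "x $ i \<le> R / 2 ^ k" using x by (simp add: powr_realpow field_simps)
      then show ?thesis using x by (simp add: S_def)
    qed
    then have e: "(\<Sum>k<K. ennreal (ln 2) * indicator (S k) x) = of_nat K * ennreal (ln 2)" by simp
    have "ln (R / x $ i) = log 2 (R / x $ i) * ln 2" by (simp add: log_def)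
    also have "\<dots> \<le> real K * ln 2" unfolding K_def using l0
        by (intro mult_right_mono) (auto simp: le_nat_iff real_nat_ceiling_ge)
    finally have "ennreal (ln (R / x $ i)) \<le> ennreal (real K * ln 2)" by (rule ennreal_leI)
    also have "\<dots> = of_nat K * ennreal (ln 2)" by (simp add: ennreal_mult ennreal_of_nat_eq_real_of_nat)
    also have "\<dots> \<le> (\<Sum>k. ennreal (ln 2) * indicator (S k) x)"
      unfolding e[symmetric] by (rule sum_le_suminf) auto
    finally show ?thesis .
  qed
  have "(\<integral>\<^sup>+x. ennreal \<bar>ln (R / x $ i)\<bar> \<partial>?U) \<le> (\<integral>\<^sup>+x. (\<Sum>k. ennreal (ln 2) * indicator (S k) x) \<partial>?U)"
  proof (rule nn_integral_mono_AE)
    show "AE x in ?U. ennreal \<bar>ln (R / x $ i)\<bar> \<le> (\<Sum>k. ennreal (ln 2) * indicator (S k) x)"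
      using U(5)
    proof eventually_elim
      case (elim x)
      then have "0 \<le> ln (R / x $ i)" using R(2)[of x i] by (auto intro!: ln_ge_zero)
      then show ?case using pt[of x] elim by simp
    qed
  qed
  also have "\<dots> = (\<Sum>k. ennreal (ln 2) * emeasure ?U (S k))"
    using Sb by (subst nn_integral_suminf) (auto simp: nn_integral_cmult_indicator)
  also have "\<dots> \<le> (\<Sum>k. ennreal (ln 2 * (C * (1 / 2) ^ k)))"
    using Sm C by (intro suminf_le) (auto simp: ennreal_mult intro!: mult_left_mono)
  also have "\<dots> < \<infinity>"
  proof -
    have "summable (\<lambda>k. ln 2 * (C * (1 / 2) ^ k :: real))"
        by (intro summable_mult summable_geometric) auto
    then have "(\<Sum>k. ennreal (ln 2 * (C * (1 / 2) ^ k))) = ennreal (\<Sum>k. ln 2 * (C * (1 / 2) ^ k))"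
      using C by (intro suminf_ennreal2) auto
    then show ?thesis by simp
  qed
  finally have "integrable ?U (\<lambda>x. ln (R / x $ i))"
    by (intro integrableI_bounded) auto
  then have "integrable ?U (\<lambda>x. ln R - ln (R / x $ i))"
      by (intro Bochner_Integration.integrable_diff) auto
  moreover have "AE x in ?U. ln R - ln (R / x $ i) = ln (x $ i)"
    using U(5)
  proof eventually_elim
    case (elim x)
    then have "0 < x $ i" by simp
    then show ?case using R0' by (simp add: ln_div)
  qed
  ultimately show ?thesis
    by (subst integrable_cong_AE[where g = "\<lambda>x. ln R - ln (R / x $ i)"]) (auto elim: AE_mp)
qed

lemma ln_power_prod_expectation:
  assumes A: "lower_body A" and k: "0 < k"
  shows "(LINT x|uniform_measure lborel A. ln (k * power_prod \<theta> x)) = ln k + (\<Sum>i\<in>UNIV. \<theta> i * (LINT x|uniform_measure lborel A. ln (x $ i)))"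
proof -
  let ?U = "uniform_measure lborel A"
  interpret U: prob_space ?U by (rule lower_body_uniform(4)[OF A])
  have "(LINT x|?U. ln (k * power_prod \<theta> x)) = (LINT x|?U. ln k + (\<Sum>i\<in>UNIV. \<theta> i * ln (x $ i)))"
  proof (rule integral_cong_AE)
    show "AE x in ?U. ln (k * power_prod \<theta> x) = ln k + (\<Sum>i\<in>UNIV. \<theta> i * ln (x $ i))"
      using lower_body_uniform(5)[OF A]
    proof eventually_elim
      case (elim x)
      then have p: "0 < x $ i powr \<theta> i" for i by (metis powr_gt_zero less_irrefl)
      have m: "0 < power_prod \<theta> x" unfolding power_prod_def using p by (intro prod_pos) auto
      have "ln (power_prod \<theta> x) = (\<Sum>i\<in>UNIV. ln (x $ i powr \<theta> i))"
        unfolding power_prod_def using p by (intro ln_prod) auto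
      also have "\<dots> = (\<Sum>i\<in>UNIV. \<theta> i * ln (x $ i))" by (simp add: ln_powr)
      finally show ?case using k m by (simp add: ln_mult)
    qed
  qed measurable
  also have "\<dots> = ln k + (\<Sum>i\<in>UNIV. \<theta> i * (LINT x|?U. ln (x $ i)))"
    using integrable_ln_coord[OF A] U.prob_space by (simp add: Bochner_Integration.integral_sum)
  finally show ?thesis .
qed

text \<open>By the rescaling identity the monomial on \<open>B\<close> has the same distribution as
  \<open>k\<close> times the monomial on \<open>A\<close>; comparing the expectations of the
  logarithms yields \<open>ln k\<close>. What matters is that the result is linear in
  \<open>\<theta>\<close>.\<close>

lemma max_power_prod_ratio:
  assumes l: "0 < l" "l < 1" and A: "lower_body A" and B: "lower_body B" and \<theta>: "\<And>i. 0 < \<theta> i"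
    and eq: "measure lebesgue (gprods l A B) = measure lebesgue A powr (1 - l) * measure lebesgue B powr l"
  shows "ln (max_power_prod \<theta> B / max_power_prod \<theta> A) =
    (\<Sum>i\<in>UNIV. \<theta> i * ((LINT x|uniform_measure lborel B. ln (x $ i)) - (LINT x|uniform_measure lborel A. ln (x $ i))))"
proof -
  let ?U = "uniform_measure lborel"
  define k where "k = max_power_prod \<theta> B / max_power_prod \<theta> A"
  have k: "0 < k" using max_power_prod(3)[of A \<theta>, OF A \<theta>] max_power_prod(3)[of B \<theta>, OF B \<theta>]
      by (simp add: k_def)
  interpret UA: prob_space "?U A" by (rule lower_body_uniform(4)[OF A])
  interpret UB: prob_space "?U B" by (rule lower_body_uniform(4)[OF B])
  define M1 M2 where "M1 = distr (?U A) borel (\<lambda>x. k * power_prod \<theta> x)"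
      and "M2 = distr (?U B) borel (power_prod \<theta>)"
  have "finite_measure M1" unfolding M1_def by (intro UA.finite_measure_distr) measurable
  then have f1: "finite_borel_measure M1"
      by (simp add: finite_borel_measure_def finite_borel_measure_axioms_def M1_def)
  have "finite_measure M2" unfolding M2_def by (intro UB.finite_measure_distr) measurable
  then have f2: "finite_borel_measure M2"
      by (simp add: finite_borel_measure_def finite_borel_measure_axioms_def M2_def)
  have c: "measure (?U X) {x. power_prod \<theta> x \<le> c} = power_prod_cdf \<theta> X c" if X: "lower_body X" for X c
  proof -
    have "{x. power_prod \<theta> x \<le> c} \<in> sets borel" by measurable
    moreover have "X \<inter> {x. power_prod \<theta> x \<le> c} = {x\<in>X. power_prod \<theta> x \<le> c}" by auto
    moreover have "{x\<in>X. power_prod \<theta> x \<le> c} \<in> sets borel" using lower_body_uniform(3)[OF X]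
        by measurable
    ultimately show ?thesis using lower_body_uniform[OF X]
        by (simp add: measure_uniform_measure power_prod_cdf_def measure_completion)
  qed
  have "cdf M1 = cdf M2"
  proof
    fix c
    have "cdf M1 c = measure (?U A) {x. power_prod \<theta> x \<le> c / k}"
      unfolding cdf_def M1_def using k
          by (subst measure_distr) (auto simp: vimage_def field_simps intro!: arg_cong[where f = "measure (?U A)"])
    also have "\<dots> = power_prod_cdf \<theta> A (c / k)" by (rule c[OF A])
    also have "\<dots> = power_prod_cdf \<theta> B c"
      using power_prod_cdf_rescale[where \<theta> = \<theta> and c = "c / k", OF l A B \<theta> eq] k
          by (simp add: k_def[symmetric])
    also have "\<dots> = measure (?U B) {x. power_prod \<theta> x \<le> c}" by (rule c[OF B, symmetric])
    also have "\<dots> = cdf M2 c"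
      unfolding cdf_def M2_def by (subst measure_distr) (auto simp: vimage_def)
    finally show "cdf M1 c = cdf M2 c" .
  qed
  then have "M1 = M2" by (rule cdf_unique'[OF f1 f2])
  then have "(LINT t|M1. ln t) = (LINT t|M2. ln t)" by simp
  then have "(LINT x|?U A. ln (k * power_prod \<theta> x)) = (LINT x|?U B. ln (1 * power_prod \<theta> x))"
    unfolding M1_def M2_def by (subst (asm) (1 2) integral_distr) auto
  then show ?thesis
    unfolding ln_power_prod_expectation[OF A k] ln_power_prod_expectation[OF B zero_less_one]
    by (simp add: k_def right_diff_distrib sum_subtractf)
qed

text \<open>A point outside a convex \<open>B\<close> is separated by a linear functional with positive coefficients \<open>t i\<close>;
  by the weighted inequality of the means, \<open>power_prod \<theta>\<close> with \<open>\<theta> i\<close> proportional to \<open>t i * y $ i\<close> separates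
  it as well.\<close>

lemma lower_body_subset:
  fixes A B :: "(real ^ 'n) set"
  assumes A: "lower_body A" and B: "lower_body B" and cA: "convex A" and cB: "convex B"
    and le: "\<And>\<theta>. (\<And>i. 0 < \<theta> i) \<Longrightarrow> max_power_prod \<theta> A \<le> max_power_prod \<theta> B"
  shows "A \<subseteq> B"
proof -
  have pos: "y \<in> B" if y: "y \<in> A" "\<And>i. 0 < y $ i" for y
  proof (rule ccontr)
    assume "y \<notin> B"
    then obtain a b where ab: "a \<bullet> y < b" "\<And>x. x \<in> B \<Longrightarrow> b < a \<bullet> x"
      using separating_hyperplane_closed_point[OF cB compact_imp_closed[OF lower_bodyD(1)[OF B]]]
          by metis
    \<comment> \<open>Coefficients of the wrong sign are dropped. The functional still separates,
      because putting the corresponding coordinates of a point to 0 does not leave the down-closed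
      \<open>B\<close>.\<close>
    define t where "t = (\<chi> i. max 0 (- a $ i))"
    have tB: "t \<bullet> x < - b" if "x \<in> B" for x
    proof -
      define x' where "x' = (\<chi> i. if a $ i < 0 then x $ i else 0)"
      have "x' \<in> B" using lower_bodyD(3,4)[OF B that] by (auto simp: x'_def)
      then have "b < a \<bullet> x'" by (rule ab(2))
      moreover have "t \<bullet> x = - (a \<bullet> x')"
        unfolding inner_vec_def sum_negf[symmetric] by (rule sum.cong) (auto simp: t_def x'_def)
      ultimately show ?thesis by simp
    qed
    have ty: "- b < t \<bullet> y"
    proof -
      have "- (a \<bullet> y) \<le> t \<bullet> y"
        unfolding inner_vec_def sum_negf[symmetric]
      proof (rule sum_mono)
        fix i
        show "- (a $ i \<bullet> y $ i) \<le> t $ i \<bullet> y $ i"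
          using y(2)[of i] mult_right_mono[of "- a $ i" "t $ i" "y $ i"] by (simp add: t_def)
      qed
      then show ?thesis using ab(1) by simp
    qed
    obtain R where R: "0 < R" "\<And>x. x \<in> B \<Longrightarrow> (\<Sum>i\<in>UNIV. x $ i) \<le> R"
    proof -
      have "bounded ((\<lambda>x. \<Sum>i\<in>UNIV. x $ i) ` B)"
        using lower_bodyD(1)[OF B]
            by (intro compact_imp_bounded compact_continuous_image continuous_intros) auto
      then obtain R where "0 < R" "\<forall>x\<in>(\<lambda>x. \<Sum>i\<in>UNIV. x $ i) ` B. norm x \<le> R" using bounded_pos by blast
      then show ?thesis using that[of R] by (auto simp: abs_le_iff)
    qed
    \<comment> \<open>The gap of the separation divided by a bound for the coordinate sums: adding
      \<open>e\<close> to every coefficient makes all of them strictly positive without destroying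
      the separation.\<close>
    define e where "e = (t \<bullet> y + b) / R"
    have e: "0 < e" "e * R = t \<bullet> y + b" using ty R by (auto simp: e_def)
    define s where "s = (\<chi> i. t $ i + e)"
    have sp: "0 < s $ i" for i using e by (simp add: s_def t_def add_nonneg_pos)
    have si: "s \<bullet> x = t \<bullet> x + e * (\<Sum>i\<in>UNIV. x $ i)" for x
      by (simp add: s_def inner_vec_def algebra_simps sum.distrib sum_distrib_left)
    have sy: "0 < s \<bullet> y" unfolding inner_vec_def using sp y(2) by (intro sum_pos) auto
    have "t \<bullet> y \<le> s \<bullet> y" unfolding si using e y(2) by (simp add: sum_nonneg less_imp_le)
    moreover have "s \<bullet> x < t \<bullet> y" if "x \<in> B" for x
    proof -
      have "e * (\<Sum>i\<in>UNIV. x $ i) \<le> e * R" using R(2)[OF that] e(1) by (intro mult_left_mono) auto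
      then show ?thesis using tB[OF that] e unfolding si by simp
    qed
    ultimately have sB: "s \<bullet> x < s \<bullet> y" if "x \<in> B" for x using that by force
    \<comment> \<open>With these exponents the gradient of the logarithm of the monomial at
      \<open>y\<close> is parallel to \<open>s\<close>, so concavity of the logarithm turns the
      linear separation into one by the monomial.\<close>
    define \<theta> where "\<theta> i = s $ i * y $ i / (s \<bullet> y)" for i
    have \<theta>: "0 < \<theta> i" for i using sp y(2) sy by (simp add: \<theta>_def)
    have my: "0 < power_prod \<theta> y" using power_prod_pos_iff[of y \<theta>] y(2) by (simp add: less_imp_le)
    have "power_prod \<theta> x < power_prod \<theta> y" if x: "x \<in> B" for x
    proof (cases "\<forall>i. 0 < x $ i")
      case False
      then have "\<not> 0 < power_prod \<theta> x" using power_prod_pos_iff[of x \<theta>] lower_bodyD(3)[OF B x] by simp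
      then show ?thesis using my by simp
    next
      case True
      then have mx: "0 < power_prod \<theta> x" using power_prod_pos_iff[of x \<theta>] by (simp add: less_imp_le)
      have lnm: "ln (power_prod \<theta> z) = (\<Sum>i\<in>UNIV. \<theta> i * ln (z $ i))" if z: "\<forall>i. 0 < z $ i" for z
      proof -
        have "z $ i powr \<theta> i > 0" for i using z by (metis powr_gt_zero less_irrefl)
        then have "ln (power_prod \<theta> z) = (\<Sum>i\<in>UNIV. ln (z $ i powr \<theta> i))" unfolding power_prod_def
            by (intro ln_prod) auto
        then show ?thesis by (simp add: ln_powr)
      qed
      have "ln (power_prod \<theta> x) - ln (power_prod \<theta> y) = (\<Sum>i\<in>UNIV. \<theta> i * ln (x $ i / y $ i))"
      proof -
        have "x $ i \<noteq> 0" "y $ i \<noteq> 0" for i using True y(2) by (metis less_irrefl)+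
        then show ?thesis using True y(2)
            by (simp add: lnm sum_subtractf[symmetric] right_diff_distrib[symmetric] ln_div)
      qed
      also have "\<dots> \<le> (\<Sum>i\<in>UNIV. \<theta> i * (x $ i / y $ i - 1))"
        using True y(2) \<theta> by (intro sum_mono mult_left_mono ln_le_minus_one) (auto simp: less_imp_le)
      also have "\<dots> = (\<Sum>i\<in>UNIV. (s $ i * x $ i - s $ i * y $ i) / (s \<bullet> y))"
      proof (rule sum.cong)
        fix i
        have "y $ i \<noteq> 0" using y(2)[of i] by simp
        then show "\<theta> i * (x $ i / y $ i - 1) = (s $ i * x $ i - s $ i * y $ i) / (s \<bullet> y)"
          using sy by (simp add: \<theta>_def field_simps)
      qed simp
      also have "\<dots> = (s \<bullet> x - s \<bullet> y) / (s \<bullet> y)"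
        unfolding sum_divide_distrib[symmetric] sum_subtractf by (simp add: inner_vec_def)
      also have "\<dots> < 0" using sB[OF x] sy by (simp add: divide_neg_pos)
      finally show ?thesis using mx my by simp
    qed
    then have "max_power_prod \<theta> B < power_prod \<theta> y" using max_power_prod(2)[of B \<theta>, OF B \<theta>] by metis
    also have "power_prod \<theta> y \<le> max_power_prod \<theta> A" by (rule max_power_prod(1)[of A \<theta>, OF A \<theta> y(1)])
    finally show False using le[of \<theta>] \<theta> by force
  qed
  show ?thesis
  proof
    fix y assume y: "y \<in> A"
    obtain z where z: "z \<in> A" "\<And>i. 0 < z $ i" using lower_bodyD(5)[OF A] by auto
    \<comment> \<open>Points with vanishing coordinates are limits of strictly positive points of
      \<open>A\<close>.\<close>
    define f where "f n = (1 - inverse (real (Suc n))) *\<^sub>R y + inverse (real (Suc n)) *\<^sub>R z" for n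
    have "f n \<in> B" for n
    proof (rule pos)
      have n: "0 < inverse (real (Suc n))" "inverse (real (Suc n)) \<le> 1" by (auto simp: inverse_le_1_iff)
      show "f n \<in> A" unfolding f_def using n by (intro convexD[OF cA y z(1)]) auto
      show "0 < f n $ i" for i
        unfolding f_def using n z(2)[of i] lower_bodyD(3)[OF A y, of i] by (simp add: add_nonneg_pos)
    qed
    moreover have "f \<longlonglongrightarrow> (1 - 0) *\<^sub>R y + 0 *\<^sub>R z"
      unfolding f_def by (intro tendsto_intros LIMSEQ_inverse_real_of_nat)
    ultimately show "y \<in> B"
      using compact_imp_closed[OF lower_bodyD(1)[OF B]] closed_sequentially[of B f y] by simp
  qed
qed

section \<open>Diagonal images and the equality case\<close>

definition diag_scale :: "('n \<Rightarrow> real) \<Rightarrow> real ^ 'n \<Rightarrow> real ^ 'n" where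
  "diag_scale d x = (\<chi> i. d i * x $ i)"

lemma diag_scale_nth [simp]: "diag_scale d x $ i = d i * x $ i"
  by (simp add: diag_scale_def)

lemma linear_diag_scale: "linear (diag_scale d)"
  by (rule linearI) (auto simp: vec_eq_iff algebra_simps)

lemma lower_body_diag_scale:
  fixes A :: "(real ^ 'n) set"
  assumes A: "lower_body A" and d: "\<And>i. 0 < d i"
  shows "lower_body (diag_scale d ` A)"
    "\<And>\<theta>. (\<And>i. 0 < \<theta> i) \<Longrightarrow> max_power_prod \<theta> (diag_scale d ` A) = (\<Prod>i\<in>UNIV. d i powr \<theta> i) * max_power_prod \<theta> A"
proof -
  show D: "lower_body (diag_scale d ` A)"
    unfolding lower_body_def
  proof (intro conjI ballI impI)
    show "compact (diag_scale d ` A)"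
      using lower_bodyD(1)[OF A] linear_diag_scale[of d]
      by (intro compact_continuous_image linear_continuous_on) (auto simp: linear_conv_bounded_linear)
    show "diag_scale d ` A \<subseteq> orthant" using lower_bodyD(3)[OF A] d
        by (auto simp: orthant_def less_imp_le)
    obtain z where z: "z \<in> A" "\<And>i. 0 < z $ i" using lower_bodyD(5)[OF A] by auto
    then show "\<exists>x\<in>diag_scale d ` A. \<forall>i. 0 < x $ i" using d by (intro bexI[of _ "diag_scale d z"]) auto
    fix x y assume x: "x \<in> diag_scale d ` A" and y: "y \<in> orthant" "\<forall>i. y $ i \<le> x $ i"
    from x obtain x' where x': "x' \<in> A" "x = diag_scale d x'" by auto
    have dn: "d i \<noteq> 0" for i using d[of i] by simp
    have "y = diag_scale d (diag_scale (\<lambda>i. inverse (d i)) y)" using dn by (simp add: vec_eq_iff)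
    moreover have "diag_scale (\<lambda>i. inverse (d i)) y \<in> A"
    proof (rule lower_bodyD(4)[OF A x'(1)])
      fix i
      show "0 \<le> diag_scale (\<lambda>i. inverse (d i)) y $ i" using y(1) d[of i] by (simp add: orthant_def)
      show "diag_scale (\<lambda>i. inverse (d i)) y $ i \<le> x' $ i" using y(2) d[of i] x'(2)
          by (simp add: field_simps)
    qed
    ultimately show "y \<in> diag_scale d ` A" by blast
  qed
  fix \<theta> :: "'n \<Rightarrow> real" assume th: "\<And>i. 0 < \<theta> i"
  have ms: "power_prod \<theta> (diag_scale d x) = (\<Prod>i\<in>UNIV. d i powr \<theta> i) * power_prod \<theta> x" if "x \<in> A" for x
    using d lower_bodyD(3)[OF A that] by (simp add: power_prod_def powr_mult less_imp_le prod.distrib)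
  have p: "0 \<le> (\<Prod>i\<in>UNIV. d i powr \<theta> i)" by (intro prod_nonneg) auto
  obtain x where x: "x \<in> A" "power_prod \<theta> x = max_power_prod \<theta> A"
      using max_power_prod(2)[of A \<theta>, OF A th] by auto
  show "max_power_prod \<theta> (diag_scale d ` A) = (\<Prod>i\<in>UNIV. d i powr \<theta> i) * max_power_prod \<theta> A"
  proof (rule antisym)
    obtain z where "z \<in> A" "power_prod \<theta> (diag_scale d z) = max_power_prod \<theta> (diag_scale d ` A)"
        using max_power_prod(2)[of "diag_scale d ` A" \<theta>, OF D th] by auto
    then show "max_power_prod \<theta> (diag_scale d ` A) \<le> (\<Prod>i\<in>UNIV. d i powr \<theta> i) * max_power_prod \<theta> A"
      using ms[of z] max_power_prod(1)[of A \<theta>, OF A th, of z] p by (metis mult_left_mono)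
    show "(\<Prod>i\<in>UNIV. d i powr \<theta> i) * max_power_prod \<theta> A \<le> max_power_prod \<theta> (diag_scale d ` A)"
      using max_power_prod(1)[of "diag_scale d ` A" \<theta>, OF D th, of "diag_scale d x"] x ms[of x] by auto
  qed
qed

text \<open>\<open>d i\<close> is the exponential of the difference of the mean logarithms of the
  \<open>i\<close>-th coordinate on \<open>B\<close> and on \<open>A\<close>. By
  \<open>max_power_prod_ratio\<close>, \<open>B\<close> and the image of \<open>A\<close> under this
  diagonal map have the same maxima of all monomials, and \<open>lower_body_subset\<close> gives
  both inclusions.\<close>

theorem gprods_equality:
  fixes A B :: "(real ^ 'n) set"
  assumes l: "0 < l" "l < 1" and A: "lower_body A" "convex A" and B: "lower_body B" "convex B"
    and eq: "measure lebesgue (gprods l A B) = measure lebesgue A powr (1 - l) * measure lebesgue B powr l"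
  obtains d where "\<And>i. 0 < d i" "B = diag_scale d ` A"
proof -
  define d where "d i = exp ((LINT x|uniform_measure lborel B. ln (x $ i)) - (LINT x|uniform_measure lborel A. ln (x $ i)))"
      for i
  have d: "0 < d i" for i by (simp add: d_def)
  have m: "max_power_prod \<theta> (diag_scale d ` A) = max_power_prod \<theta> B" if \<theta>: "\<And>i. 0 < \<theta> i" for \<theta>
  proof -
    have mp: "0 < max_power_prod \<theta> A" "0 < max_power_prod \<theta> B"
        using max_power_prod(3)[of _ \<theta>, OF _ \<theta>] A B by auto
    have "max_power_prod \<theta> B / max_power_prod \<theta> A = exp (ln (max_power_prod \<theta> B / max_power_prod \<theta> A))"
        using mp by simp
    also have "\<dots> = (\<Prod>i\<in>UNIV. d i powr \<theta> i)"
      unfolding max_power_prod_ratio[OF l A(1) B(1) \<theta> eq]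
          by (simp add: exp_sum d_def powr_def mult.commute)
    finally show ?thesis using lower_body_diag_scale(2)[OF A(1) d, of \<theta>] \<theta> mp by (simp add: field_simps)
  qed
  have D: "lower_body (diag_scale d ` A)" by (rule lower_body_diag_scale(1)[OF A(1) d])
  have cD: "convex (diag_scale d ` A)" using A(2) linear_diag_scale
      by (rule convex_linear_image[rotated])
  have "B = diag_scale d ` A"
  proof
    show "B \<subseteq> diag_scale d ` A" by (rule lower_body_subset[OF B(1) D B(2) cD]) (simp add: m)
    show "diag_scale d ` A \<subseteq> B" by (rule lower_body_subset[OF D B(1) cD B(2)]) (simp add: m)
  qed
  with d show thesis using that by blast
qed

section \<open>Finite root systems and chambers\<close>

definition reflect :: "real ^ 'n \<Rightarrow> real ^ 'n \<Rightarrow> real ^ 'n" where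
  "reflect u x = x - (2 * (u \<bullet> x)) *\<^sub>R u"

lemma linear_reflect: "linear (reflect u)"
  by (rule linearI) (auto simp: reflect_def inner_right_distrib algebra_simps)

lemma reflect_reflect [simp]: "norm u = 1 \<Longrightarrow> reflect u (reflect u x) = x"
  by (simp add: reflect_def inner_diff_right norm_eq_1 algebra_simps)

lemma reflect_image_eqI: "norm u = 1 \<Longrightarrow> (\<And>x. x \<in> X \<Longrightarrow> reflect u x \<in> X) \<Longrightarrow> reflect u ` X = X"
  by (metis (no_types, opaque_lifting) image_iff image_subsetI reflect_reflect subsetI subset_antisym)

lemma inner_reflect: "reflect u x \<bullet> y = x \<bullet> reflect u y"
  by (simp add: reflect_def inner_diff_right inner_diff_left inner_commute)

lemma orthogonal_reflect: "norm u = 1 \<Longrightarrow> orthogonal_transformation (reflect u)"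
  by (simp add: orthogonal_transformation_def linear_reflect inner_reflect)

lemma reflect_self: "norm u = 1 \<Longrightarrow> reflect u u = - u"
  by (simp add: reflect_def norm_eq_1 scaleR_2)

lemma reflect_conj: "norm u = 1 \<Longrightarrow> reflect (reflect u w) x = reflect u (reflect w (reflect u x))"
proof -
  assume u: "norm u = 1"
  have "reflect u (reflect w (reflect u x)) = reflect u (reflect u x) - (2 * (w \<bullet> reflect u x)) *\<^sub>R reflect u w"
    by (simp add: reflect_def[of w] linear_diff[OF linear_reflect] linear_cmul[OF linear_reflect])
  then show ?thesis using u by (simp add: reflect_def[of "reflect u w"] inner_reflect)
qed

text \<open>Normalised root systems, possibly infinite and without any integrality condition. They
  contain \<open>- u\<close> along with \<open>u\<close>, because \<open>u\<close> reflects itself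
  to its negative.\<close>

definition root_set :: "(real ^ 'n) set \<Rightarrow> bool" where
  "root_set R \<longleftrightarrow> (\<forall>u\<in>R. norm u = 1) \<and> (\<forall>u\<in>R. \<forall>w\<in>R. reflect u w \<in> R)"

lemma root_setD:
  assumes "root_set R"
  shows "u \<in> R \<Longrightarrow> norm u = 1" "u \<in> R \<Longrightarrow> w \<in> R \<Longrightarrow> reflect u w \<in> R" "u \<in> R \<Longrightarrow> - u \<in> R"
  using assms reflect_self[of u] unfolding root_set_def by metis+

definition poscone :: "(real ^ 'n) set \<Rightarrow> (real ^ 'n) set" where
  "poscone D = {x. \<exists>c. (\<forall>w\<in>D. 0 \<le> c w) \<and> x = (\<Sum>w\<in>D. c w *\<^sub>R w)}"

lemma poscone_add: "x \<in> poscone D \<Longrightarrow> y \<in> poscone D \<Longrightarrow> x + y \<in> poscone D"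
proof -
  assume "x \<in> poscone D" "y \<in> poscone D"
  then obtain c d where "\<forall>w\<in>D. 0 \<le> c w" "x = (\<Sum>w\<in>D. c w *\<^sub>R w)" "\<forall>w\<in>D. 0 \<le> d w" "y = (\<Sum>w\<in>D. d w *\<^sub>R w)"
    by (auto simp: poscone_def)
  then show ?thesis
    by (auto simp: poscone_def scaleR_left_distrib sum.distrib intro!: exI[of _ "\<lambda>w. c w + d w"])
qed

lemma poscone_scaleR: "x \<in> poscone D \<Longrightarrow> 0 \<le> a \<Longrightarrow> a *\<^sub>R x \<in> poscone D"
proof -
  assume "x \<in> poscone D" "0 \<le> a"
  then obtain c where "\<forall>w\<in>D. 0 \<le> c w" "x = (\<Sum>w\<in>D. c w *\<^sub>R w)" by (auto simp: poscone_def)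
  then show ?thesis using \<open>0 \<le> a\<close>
    by (auto simp: poscone_def scaleR_sum_right intro!: exI[of _ "\<lambda>w. a * c w"])
qed

lemma poscone_mem: "finite D \<Longrightarrow> u \<in> D \<Longrightarrow> u \<in> poscone D"
proof -
  assume D: "finite D" "u \<in> D"
  have "(\<Sum>w\<in>D. (if w = u then 1 else 0) *\<^sub>R w) = (\<Sum>w\<in>D. if w = u then u else 0)" by (rule sum.cong) auto
  also have "\<dots> = u" using D by simp
  finally show ?thesis unfolding poscone_def by (auto intro!: exI[of _ "\<lambda>w. if w = u then 1 else 0"])
qed

lemma poscone_remove:
  assumes "finite D" "w \<in> D" "x \<in> poscone D"
  obtains c y where "0 \<le> c" "y \<in> poscone (D - {w})" "x = c *\<^sub>R w + y"
proof -
  obtain c where c: "\<forall>w\<in>D. 0 \<le> c w" "x = (\<Sum>w\<in>D. c w *\<^sub>R w)" using assms(3) by (auto simp: poscone_def)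
  show thesis
  proof
    show "x = c w *\<^sub>R w + (\<Sum>w\<in>D - {w}. c w *\<^sub>R w)" using c assms by (simp add: sum.remove)
  qed (use c assms in \<open>auto simp: poscone_def\<close>)
qed

lemma poscone_inner_nonneg: "x \<in> poscone D \<Longrightarrow> (\<And>w. w \<in> D \<Longrightarrow> 0 \<le> w \<bullet> z) \<Longrightarrow> 0 \<le> x \<bullet> z"
  by (auto simp: poscone_def inner_sum_left intro!: sum_nonneg)

lemma poscone_subset_span: "poscone D \<subseteq> span D"
  unfolding poscone_def by (auto intro: span_sum span_scale span_base)

text \<open>A linear relation is split by the signs of its coefficients into \<open>x = y\<close>,
  with nonnegative coefficients on disjoint supports. Obtuse angles give
  \<open>x \<bullet> y \<le> 0\<close>, hence \<open>x = 0\<close>, and pairing with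
  \<open>z\<close> then kills every coefficient.\<close>

lemma obtuse_independent:
  fixes D :: "(real ^ 'n) set"
  assumes D: "finite D" and obt: "\<And>w w'. w \<in> D \<Longrightarrow> w' \<in> D \<Longrightarrow> w \<noteq> w' \<Longrightarrow> w \<bullet> w' \<le> 0"
      and pos: "\<And>w. w \<in> D \<Longrightarrow> 0 < w \<bullet> z"
  shows "independent D"
  unfolding independent_explicit_finite_subsets
proof (rule ccontr)
  assume "\<not> (\<forall>S\<subseteq>D. finite S \<longrightarrow> (\<forall>c. (\<Sum>w\<in>S. c w *\<^sub>R w) = 0 \<longrightarrow> (\<forall>w\<in>S. c w = 0)))"
  then obtain S c w0 where S: "S \<subseteq> D" "finite S" "(\<Sum>w\<in>S. c w *\<^sub>R w) = 0" "w0 \<in> S" "c w0 \<noteq> 0" by blast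
  define p q where "p w = max 0 (c w)" and "q w = max 0 (- c w)" for w
  have pq: "0 \<le> p w" "0 \<le> q w" "p w * q w = 0" "c w = p w - q w" for w
      by (auto simp: p_def q_def max_def)
  define x y where "x = (\<Sum>w\<in>S. p w *\<^sub>R w)" and "y = (\<Sum>w\<in>S. q w *\<^sub>R w)"
  have "x - y = 0" using S(3) by (simp add: x_def y_def pq(4) scaleR_left_diff_distrib sum_subtractf)
  then have xy: "x = y" by simp
  have "x \<bullet> y = (\<Sum>w\<in>S. \<Sum>w'\<in>S. p w * q w' * (w \<bullet> w'))"
    by (simp add: x_def inner_sum_left) (simp add: y_def inner_sum_right sum_distrib_left mult.assoc)
  also have "\<dots> \<le> 0"
  proof (intro sum_nonpos)
    fix w w' assume w: "w \<in> S" "w' \<in> S"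
    show "p w * q w' * (w \<bullet> w') \<le> 0"
    proof (cases "w = w'")
      case True
      then show ?thesis using pq(3)[of w] by auto
    next
      case False
      then have "w \<bullet> w' \<le> 0" using obt S(1) w by blast
      then show ?thesis using pq(1,2) by (intro mult_nonneg_nonpos mult_nonneg_nonneg)
    qed
  qed
  finally have "x \<bullet> x \<le> 0" using xy by simp
  then have "x \<bullet> x = 0" using inner_ge_zero[of x] by linarith
  then have x0: "x = 0" "y = 0" using xy by simp_all
  have "(\<Sum>w\<in>S. p w * (w \<bullet> z)) = 0" "(\<Sum>w\<in>S. q w * (w \<bullet> z)) = 0"
    using arg_cong[OF x0(1), of "\<lambda>x. x \<bullet> z"] arg_cong[OF x0(2), of "\<lambda>x. x \<bullet> z"]
        by (simp_all add: x_def y_def inner_sum_left)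
  moreover have nn: "0 \<le> p w * (w \<bullet> z)" "0 \<le> q w * (w \<bullet> z)" if "w \<in> S" for w
    using pq pos[of w] S(1) that by (auto intro!: mult_nonneg_nonneg)
  ultimately have "p w0 * (w0 \<bullet> z) = 0" "q w0 * (w0 \<bullet> z) = 0"
    using S(2,4) by (simp_all add: sum_nonneg_eq_0_iff)
  moreover have "w0 \<bullet> z \<noteq> 0" using pos[of w0] S by auto
  ultimately show False using pq(4)[of w0] S(5) by simp
qed

lemma inner_nonzero_exists:
  fixes R :: "(real ^ 'n) set"
  assumes "finite R" "0 \<notin> R"
  obtains z where "\<And>w. w \<in> R \<Longrightarrow> w \<bullet> z \<noteq> 0"
proof -
  have "negligible (\<Union>w\<in>R. {z. w \<bullet> z = 0})"
  proof (rule negligible_Union)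
    fix t assume "t \<in> (\<lambda>w. {z. w \<bullet> z = 0}) ` R"
    then obtain w where "w \<in> R" "t = {z. w \<bullet> z = 0}" by auto
    moreover have "w \<noteq> 0" using calculation assms(2) by auto
    ultimately show "negligible t" using negligible_hyperplane[of w 0] by simp
  qed (use assms in auto)
  moreover have "\<not> negligible (UNIV :: (real ^ 'n) set)" by simp
  ultimately have "(\<Union>w\<in>R. {z. w \<bullet> z = 0}) \<noteq> UNIV" by metis
  then show thesis using that by blast
qed

text \<open>A vector \<open>z\<close> off all root hyperplanes selects the positive roots; a
  smallest set \<open>D\<close> of positive roots whose cone contains all of them is simple. If two
  members \<open>u\<close>, \<open>w\<close> made an acute angle, then \<open>reflect u w\<close> or
  its negative would be a positive root, and expanding it over \<open>D\<close> would express
  \<open>w\<close> or \<open>u\<close> by the other members, against minimality.\<close>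

lemma simple_system_exists:
  fixes R :: "(real ^ 'n) set"
  assumes fin: "finite R" and R: "root_set R" and span: "span R = UNIV"
  obtains D z where "D \<subseteq> R" "independent D" "card D = CARD('n)" "span D = UNIV"
    "\<And>w w'. w \<in> D \<Longrightarrow> w' \<in> D \<Longrightarrow> w \<noteq> w' \<Longrightarrow> w \<bullet> w' \<le> 0"
    "\<And>w. w \<in> R \<Longrightarrow> w \<in> poscone D \<or> - w \<in> poscone D"
proof -
  have R0: "0 \<notin> R" using root_setD(1)[OF R, of 0] by auto
  obtain z where z: "\<And>w. w \<in> R \<Longrightarrow> w \<bullet> z \<noteq> 0" by (rule inner_nonzero_exists[OF fin R0]) blast
  define Rp where "Rp = {w\<in>R. 0 < w \<bullet> z}"
  have finp: "finite Rp" using fin by (simp add: Rp_def)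
  have "Rp \<subseteq> Rp \<and> Rp \<subseteq> poscone Rp" using poscone_mem[OF finp] by auto
  then obtain D where D0: "D \<subseteq> Rp \<and> Rp \<subseteq> poscone D"
      and min0: "\<And>E. E \<subseteq> Rp \<and> Rp \<subseteq> poscone E \<longrightarrow> card D \<le> card E"
    by (elim exE[OF ex_has_least_nat[of "\<lambda>D. D \<subseteq> Rp \<and> Rp \<subseteq> poscone D" Rp card]] conjE) metis
  note D = D0[THEN conjunct1] D0[THEN conjunct2]
  have min: "card D \<le> card E" if "E \<subseteq> Rp" "Rp \<subseteq> poscone E" for E using min0[of E] that by simp
  have finD: "finite D" using D finp finite_subset by blast
  have Dz: "0 < w \<bullet> z" if "w \<in> D" for w using D that by (auto simp: Rp_def)
  have indec: "w \<notin> poscone (D - {w})" if w: "w \<in> D" for w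
  proof
    assume a: "w \<in> poscone (D - {w})"
    have "Rp \<subseteq> poscone (D - {w})"
    proof
      fix x assume "x \<in> Rp"
      then obtain c y where "0 \<le> c" "y \<in> poscone (D - {w})" "x = c *\<^sub>R w + y"
        using poscone_remove[OF finD w] D(2) by blast
      then show "x \<in> poscone (D - {w})" using a by (auto intro: poscone_add poscone_scaleR)
    qed
    then have "card D \<le> card (D - {w})" using D(1) by (intro min) auto
    then show False using finD w by (metis card_Diff1_less not_less)
  qed
  \<comment> \<open>Pairing with \<open>z\<close> shows that \<open>a\<close> is positive, so
    dividing by it puts \<open>w\<close> itself into the cone of the other members.\<close>
  have contra: False if w: "w \<in> D" and y: "y \<in> poscone (D - {w})" "0 < y \<bullet> z" "a *\<^sub>R w = y" for w y a
  proof -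
    have "0 < a * (w \<bullet> z)" using y(2) unfolding y(3)[symmetric] by simp
    then have "0 < a" using Dz[OF w] by (simp add: zero_less_mult_iff)
    then have "w = inverse a *\<^sub>R y" unfolding y(3)[symmetric] by simp
    then show False using indec[OF w] poscone_scaleR[OF y(1), of "inverse a"] \<open>0 < a\<close> by simp
  qed
  have obt: "w \<bullet> u \<le> 0" if u: "u \<in> D" and w: "w \<in> D" and ne: "w \<noteq> u" for u w
  proof (rule ccontr)
    assume "\<not> w \<bullet> u \<le> 0"
    define k where "k = 2 * (u \<bullet> w)"
    have k: "0 < k" using \<open>\<not> w \<bullet> u \<le> 0\<close> by (simp add: k_def inner_commute)
    define r where "r = reflect u w"
    have r: "r = w - k *\<^sub>R u" by (simp add: r_def reflect_def k_def)
    have uw: "u \<in> R" "w \<in> R" using u w D by (auto simp: Rp_def)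
    have rR: "r \<in> R" "- r \<in> R" unfolding r_def using root_setD[OF R] uw by auto
    show False
    proof (cases "0 < r \<bullet> z")
      case True
      then have "r \<in> Rp" using rR by (simp add: Rp_def)
      then have "r \<in> poscone D" using D(2) by blast
      then obtain c y where c: "0 \<le> c" "y \<in> poscone (D - {w})" "r = c *\<^sub>R w + y"
        using poscone_remove[OF finD w] by metis
      have "u \<in> poscone (D - {w})" using finD u ne by (intro poscone_mem) auto
      then have "k *\<^sub>R u + y \<in> poscone (D - {w})" using c k by (intro poscone_add poscone_scaleR) auto
      moreover have "0 < (k *\<^sub>R u + y) \<bullet> z"
        using poscone_inner_nonneg[OF c(2), of z] Dz[OF u] Dz k
            by (simp add: inner_add_left add_pos_nonneg less_imp_le)
      moreover have "(1 - c) *\<^sub>R w = k *\<^sub>R u + y" using c(3) r by (simp add: algebra_simps)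
      ultimately show False by (rule contra[OF w])
    next
      case False
      then have "- r \<in> Rp" using rR z[OF rR(1)] by (simp add: Rp_def)
      then have "- r \<in> poscone D" using D(2) by blast
      then obtain c y where c: "0 \<le> c" "y \<in> poscone (D - {u})" "- r = c *\<^sub>R u + y"
        using poscone_remove[OF finD u] by metis
      have "w \<in> poscone (D - {u})" using finD w ne by (intro poscone_mem) auto
      then have "w + y \<in> poscone (D - {u})" using c by (intro poscone_add) auto
      moreover have "0 < (w + y) \<bullet> z"
        using poscone_inner_nonneg[OF c(2), of z] Dz[OF w] Dz
            by (simp add: inner_add_left add_pos_nonneg less_imp_le)
      moreover have "(k - c) *\<^sub>R u = w + y" using c(3) r by (simp add: algebra_simps)
      ultimately show False by (rule contra[OF u])
    qed
  qed
  have ind: "independent D" by (rule obtuse_independent[OF finD obt Dz])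
  have alt: "w \<in> poscone D \<or> - w \<in> poscone D" if "w \<in> R" for w
  proof (cases "0 < w \<bullet> z")
    case True
    then have "w \<in> Rp" using that by (simp add: Rp_def)
    then show ?thesis using D(2) by blast
  next
    case False
    then have "- w \<in> Rp" using that z[OF that] root_setD(3)[OF R that] by (simp add: Rp_def)
    then show ?thesis using D(2) by blast
  qed
  have "R \<subseteq> span D"
  proof
    fix w assume "w \<in> R"
    then have "w \<in> span D \<or> - w \<in> span D" using alt poscone_subset_span by blast
    then show "w \<in> span D" using span_neg[of "- w" D] by auto
  qed
  then have sp: "span D = UNIV" using span by (metis span_minimal subspace_span top.extremum_uniqueI)
  have "card D = CARD('n)" using ind sp
      by (metis dim_UNIV dim_eq_card_independent dim_span DIM_cart DIM_real mult.right_neutral)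
  show thesis
    by (rule that[of D]) (use D obt ind sp alt \<open>card D = CARD('n)\<close> in \<open>auto simp: Rp_def\<close>)
qed

text \<open>\<open>u\<close> are the simple roots, indexed by the coordinates, and \<open>v\<close>
  is the dual basis (fundamental weights up to scaling). Since \<open>w \<bullet> v i\<close> is the
  coefficient of \<open>w\<close> at \<open>u i\<close>, \<open>signs\<close> says that every root
  is a nonnegative or a nonpositive combination of simple roots.\<close>

locale simple_roots =
  fixes R :: "(real ^ 'n) set" and u v :: "'n \<Rightarrow> real ^ 'n"
  assumes finR: "finite R" and rootR: "root_set R" and uR: "u i \<in> R"
    and dual: "v i \<bullet> u j = (if i = j then 1 else 0)"
    and obtuse: "i \<noteq> j \<Longrightarrow> u i \<bullet> u j \<le> 0"
    and signs: "w \<in> R \<Longrightarrow> (\<forall>i. 0 \<le> w \<bullet> v i) \<or> (\<forall>i. w \<bullet> v i \<le> 0)"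

lemma simple_roots_exist:
  fixes R :: "(real ^ 'n) set"
  assumes fin: "finite R" and R: "root_set R" and span: "span R = UNIV"
  obtains u v where "simple_roots R u v"
proof -
  obtain D where D: "D \<subseteq> R" "independent D" "card D = CARD('n)" "span D = UNIV"
    "\<And>w w'. w \<in> D \<Longrightarrow> w' \<in> D \<Longrightarrow> w \<noteq> w' \<Longrightarrow> w \<bullet> w' \<le> 0"
    "\<And>w. w \<in> R \<Longrightarrow> w \<in> poscone D \<or> - w \<in> poscone D"
    by (rule simple_system_exists[OF assms]) metis
  have finD: "finite D" using D(1) fin finite_subset by blast
  obtain u where u: "bij_betw u (UNIV :: 'n set) D"
    using finite_same_card_bij[of "UNIV :: 'n set" D] finD D(3) by auto
  have uD: "u i \<in> D" for i using u by (auto simp: bij_betw_def)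
  have uinj: "u i = u j \<longleftrightarrow> i = j" for i j using u by (auto simp: bij_betw_def inj_on_def)
  have "\<exists>v. \<forall>j. v \<bullet> u j = (if i = j then 1 else 0)" for i
  proof -
    obtain f :: "real ^ 'n \<Rightarrow> real" where f: "linear f" "\<And>w. w \<in> D \<Longrightarrow> f w = (if w = u i then 1 else 0)"
      using linear_independent_extend[OF D(2), of "\<lambda>w. if w = u i then 1 else 0"] by blast
    have "adjoint f 1 \<bullet> u j = f (u j)" for j
      using adjoint_works[OF f(1), of "u j" 1] by (simp add: inner_commute)
    then show ?thesis using f(2)[OF uD] uinj by (metis (full_types))
  qed
  then obtain v where v: "\<And>i j. v i \<bullet> u j = (if i = j then 1 else 0)" by metis
  have pc: "0 \<le> w \<bullet> v i" if "w \<in> poscone D" for w i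
  proof (rule poscone_inner_nonneg[OF that])
    fix w assume "w \<in> D"
    then obtain j where "w = u j" using u by (auto simp: bij_betw_def)
    then show "0 \<le> w \<bullet> v i" using v[of i j] by (simp add: inner_commute)
  qed
  have "simple_roots R u v"
  proof
    show "finite R" "root_set R" by fact+
    show "u i \<in> R" for i using uD D(1) by auto
    show "v i \<bullet> u j = (if i = j then 1 else 0)" for i j by (rule v)
    show "u i \<bullet> u j \<le> 0" if "i \<noteq> j" for i j using D(5)[OF uD uD] uinj that by auto
    show "(\<forall>i. 0 \<le> w \<bullet> v i) \<or> (\<forall>i. w \<bullet> v i \<le> 0)" if "w \<in> R" for w
      using D(6)[OF that] pc[of w] pc[of "- w"] by auto
  qed
  then show thesis by (rule that)
qed

lemma linear_image_measure_lebesgue: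
  fixes f g :: "'a::euclidean_space \<Rightarrow> 'a"
  assumes f: "linear f" and g: "linear g" and fg: "\<And>x. f (g x) = x" and gf: "\<And>x. g (f x) = x"
  obtains c where "0 < c" and "\<And>A. A \<in> sets borel \<Longrightarrow> f ` A \<in> sets borel"
    and "\<And>A. A \<in> sets borel \<Longrightarrow> measure lebesgue (f ` A) = c * measure lebesgue A"
proof -
  obtain c where c: "0 < c" "\<And>A. A \<in> sets borel \<Longrightarrow> f ` A \<in> sets borel"
    "\<And>A. A \<in> sets borel \<Longrightarrow> emeasure lborel (f ` A) = ennreal c * emeasure lborel A"
    by (rule linear_image_measure[OF assms]) blast
  show thesis
  proof (rule that[OF c(1,2)])
    show "measure lebesgue (f ` A) = c * measure lebesgue A" if "A \<in> sets borel" for A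
      using c(1) c(2,3)[OF that] that by (simp add: measure_completion measure_def enn2real_mult)
  qed
qed

text \<open>The volume factor of a linear map is 1 as soon as the map preserves the unit
  ball.\<close>

lemma measure_orthogonal_borel:
  fixes g :: "real ^ 'n \<Rightarrow> real ^ 'n"
  assumes g: "orthogonal_transformation g" and X: "X \<in> sets borel"
  shows "g ` X \<in> sets borel" "measure lebesgue (g ` X) = measure lebesgue X"
proof -
  have l: "linear g" "linear (inv g)" and b: "\<And>x. g (inv g x) = x" "\<And>x. inv g (g x) = x"
    using g orthogonal_transformation_inv[OF g] orthogonal_transformation_bij[OF g]
    by (auto simp: orthogonal_transformation_linear bij_is_inj bij_is_surj surj_f_inv_f)
  obtain c where c: "0 < c" "\<And>A. A \<in> sets borel \<Longrightarrow> g ` A \<in> sets borel"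
    "\<And>A. A \<in> sets borel \<Longrightarrow> measure lebesgue (g ` A) = c * measure lebesgue A"
    by (rule linear_image_measure_lebesgue[OF l b]) blast
  have "g ` ball 0 1 = ball 0 1"
    using image_orthogonal_transformation_ball[OF g, of 0 1] linear_0[OF l(1)] by simp
  then have "measure lebesgue (ball (0 :: real ^ 'n) 1) = c * measure lebesgue (ball (0 :: real ^ 'n) 1)"
    using c(3)[of "ball 0 1"] by simp
  moreover have "0 < measure lebesgue (ball (0 :: real ^ 'n) 1)" by (simp add: content_ball_pos)
  ultimately have "c = 1" by simp
  then show "g ` X \<in> sets borel" "measure lebesgue (g ` X) = measure lebesgue X" using c X by auto
qed

section \<open>Coordinates with respect to the dual basis\<close>

context simple_roots
begin

lemma norm_u: "norm (u i) = 1" using root_setD(1)[OF rootR uR] .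

definition Psi :: "real ^ 'n \<Rightarrow> real ^ 'n" where "Psi y = (\<Sum>i\<in>UNIV. y $ i *\<^sub>R v i)"

definition Phi :: "real ^ 'n \<Rightarrow> real ^ 'n" where "Phi x = (\<chi> i. u i \<bullet> x)"

lemma linear_Psi: "linear Psi"
  by (rule linearI) (auto simp: Psi_def scaleR_left_distrib sum.distrib scaleR_sum_right)

lemma linear_Phi: "linear Phi"
  by (rule linearI) (auto simp: Phi_def vec_eq_iff inner_right_distrib)

lemma Phi_nth [simp]: "Phi x $ i = u i \<bullet> x" by (simp add: Phi_def)

lemma Phi_Psi [simp]: "Phi (Psi y) = y"
proof -
  have "u i \<bullet> Psi y = (\<Sum>j\<in>UNIV. if j = i then y $ j else 0)" for i
    unfolding Psi_def inner_sum_right by (rule sum.cong) (auto simp: inner_commute[of "u i"] dual)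
  then show ?thesis by (simp add: vec_eq_iff)
qed

lemma Psi_Phi [simp]: "Psi (Phi x) = x"
proof -
  have "Phi \<circ> Psi = id" by (simp add: fun_eq_iff)
  then have "Psi \<circ> Phi = id" using linear_inverse_left[OF linear_Phi linear_Psi] by simp
  then show ?thesis by (simp add: fun_eq_iff)
qed

lemma expand_v: "x = (\<Sum>i\<in>UNIV. (u i \<bullet> x) *\<^sub>R v i)"
  using Psi_Phi[of x] by (simp add: Psi_def)

lemma inner_expand: "x \<bullet> y = (\<Sum>i\<in>UNIV. (u i \<bullet> x) * (v i \<bullet> y))"
  by (subst expand_v[of x]) (simp add: inner_sum_left)

lemma expand_u: "y = (\<Sum>i\<in>UNIV. (v i \<bullet> y) *\<^sub>R u i)"
proof -
  have "x \<bullet> y = x \<bullet> (\<Sum>i\<in>UNIV. (v i \<bullet> y) *\<^sub>R u i)" for x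
    unfolding inner_expand[of x y] inner_sum_right by (rule sum.cong) (auto simp: inner_commute)
  then have "\<forall>x. x \<bullet> y = x \<bullet> (\<Sum>i\<in>UNIV. (v i \<bullet> y) *\<^sub>R u i)" by blast
  then show ?thesis by (simp only: vector_eq_ldot)
qed

text \<open>The closed chamber lies in the cone of the simple roots. Write \<open>x = z - y\<close>
  by the signs of its coefficients at the simple roots: obtuseness gives
  \<open>z \<bullet> y \<le> 0\<close>, while \<open>x \<bullet> y \<ge> 0\<close> by hypothesis, so
  \<open>y = 0\<close>.\<close>

lemma dual_nonneg_expand:
  assumes "\<And>j. 0 \<le> x \<bullet> u j" shows "0 \<le> v i \<bullet> x"
proof -
  define c where "c j = v j \<bullet> x" for j
  define p q where "p j = max 0 (c j)" and "q j = max 0 (- c j)" for j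
  have pq: "0 \<le> p j" "0 \<le> q j" "p j * q j = 0" "c j = p j - q j" for j
      by (auto simp: p_def q_def max_def)
  define y where "y = (\<Sum>j\<in>UNIV. q j *\<^sub>R u j)"
  define z where "z = (\<Sum>j\<in>UNIV. p j *\<^sub>R u j)"
  have x: "x = z - y"
    by (subst expand_u) (simp add: y_def z_def c_def[symmetric] pq(4) scaleR_left_diff_distrib sum_subtractf)
  have "z \<bullet> y = (\<Sum>j\<in>UNIV. \<Sum>k\<in>UNIV. p j * q k * (u j \<bullet> u k))"
    by (simp add: z_def inner_sum_left) (simp add: y_def inner_sum_right sum_distrib_left mult.assoc)
  also have "\<dots> \<le> 0"
  proof (intro sum_nonpos)
    fix j k
    show "p j * q k * (u j \<bullet> u k) \<le> 0"
    proof (cases "j = k")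
      case True
      then show ?thesis using pq(3)[of j] by auto
    next
      case False
      then show ?thesis using pq(1,2) obtuse by (intro mult_nonneg_nonpos mult_nonneg_nonneg)
    qed
  qed
  finally have zy: "z \<bullet> y \<le> 0" .
  have "0 \<le> x \<bullet> y" unfolding y_def inner_sum_right using pq(2) assms by (auto intro!: sum_nonneg)
  then have "y \<bullet> y \<le> 0" using zy by (simp add: x inner_diff_left)
  then have "y \<bullet> y = 0" using inner_ge_zero[of y] by linarith
  then have "y = 0" by simp
  moreover have "v i \<bullet> y = q i"
  proof -
    have "v i \<bullet> y = (\<Sum>j\<in>UNIV. if j = i then q j else 0)"
      unfolding y_def inner_sum_right by (rule sum.cong) (auto simp: dual)
    then show ?thesis by simp
  qed
  ultimately have "q i = 0" by simp
  then show ?thesis using pq(1,4)[of i] by (simp add: c_def)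
qed

lemma v_nonneg: "0 \<le> v i \<bullet> v j"
  using dual_nonneg_expand[of "v j" i] by (simp add: dual)

text \<open>The simple roots that occur in the expansion of \<open>v i\<close> are orthogonal to those that do not.\<close>

lemma v_transitive:
  assumes ij: "v i \<bullet> v j \<noteq> 0" and jk: "v j \<bullet> v k \<noteq> 0"
  shows "v i \<bullet> v k \<noteq> 0"
proof
  assume ik: "v i \<bullet> v k = 0"
  define S where "S = {m. v i \<bullet> v m \<noteq> 0}"
  have iS: "i \<in> S" "j \<in> S" "k \<notin> S"
  proof -
    have "v i \<noteq> 0" using dual[of i i] by auto
    then show "i \<in> S" by (simp add: S_def)
  qed (use ij ik in \<open>auto simp: S_def\<close>)
  have orth: "u m \<bullet> u p = 0" if m: "m \<in> S" and p: "p \<notin> S" for m p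
  proof -
    \<comment> \<open>\<open>v i\<close> is orthogonal to \<open>u p\<close>, and every term of the
      expanded inner product is nonpositive; so each term vanishes.\<close>
    have "(\<Sum>m\<in>UNIV. (v m \<bullet> v i) * (u m \<bullet> u p)) = v i \<bullet> u p"
      by (subst (2) expand_u[of "v i"]) (simp add: inner_sum_left)
    also have "\<dots> = 0" using iS p by (auto simp: dual)
    finally have s: "(\<Sum>m\<in>UNIV. - ((v m \<bullet> v i) * (u m \<bullet> u p))) = 0" by (simp add: sum_negf)
    have "0 \<le> - ((v m \<bullet> v i) * (u m \<bullet> u p))" for m
    proof (cases "m = p")
      case True
      then show ?thesis using p by (simp add: S_def inner_commute)
    next
      case False
      then show ?thesis using v_nonneg[of m i] obtuse[of m p] by (simp add: mult_nonneg_nonpos)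
    qed
    then have "- ((v m \<bullet> v i) * (u m \<bullet> u p)) = 0" using s by (subst (asm) sum_nonneg_eq_0_iff) auto
    then show ?thesis using m by (auto simp: S_def inner_commute)
  qed
  \<comment> \<open>the part of \<open>v k\<close> in the span of the roots with index in \<open>S\<close> vanishes\<close>
  define x where "x = (\<Sum>m\<in>S. (v m \<bullet> v k) *\<^sub>R u m)"
  define y where "y = (\<Sum>m\<in>- S. (v m \<bullet> v k) *\<^sub>R u m)"
  have vk: "v k = x + y"
    unfolding x_def y_def
        by (subst expand_u[of "v k"]) (simp add: sum.union_disjoint[symmetric] Un_commute)
  have xy: "x \<bullet> y = 0"
    unfolding x_def y_def inner_sum_left inner_sum_right using orth by (auto intro!: sum.neutral)
  have "x \<bullet> v k = (\<Sum>m\<in>S. (v m \<bullet> v k) * (u m \<bullet> v k))" by (simp add: x_def inner_sum_left)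
  also have "\<dots> = 0" using iS(3) by (intro sum.neutral) (auto simp: inner_commute[of "u _"] dual)
  finally have "x \<bullet> x = 0" using xy by (simp add: vk inner_add_right)
  then have "x = 0" by simp
  moreover have "v j \<bullet> x = v j \<bullet> v k"
  proof -
    have "v j \<bullet> x = (\<Sum>m\<in>S. if m = j then v m \<bullet> v k else 0)"
      unfolding x_def inner_sum_right by (rule sum.cong) (auto simp: dual)
    then show ?thesis using iS(2) by simp
  qed
  ultimately show False using jk by simp
qed

section \<open>The reflection group and its chamber\<close>

inductive_set W :: "(real ^ 'n \<Rightarrow> real ^ 'n) set" where
  W_id: "id \<in> W"
| W_reflect: "g \<in> W \<Longrightarrow> reflect (u i) \<circ> g \<in> W"

lemma W_orthogonal: "g \<in> W \<Longrightarrow> orthogonal_transformation g"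
proof (induction rule: W.induct)
  case W_id
  show ?case by (simp add: orthogonal_transformation_def id_def linear_iff)
next
  case (W_reflect g i)
  show ?case by (rule orthogonal_transformation_compose[OF orthogonal_reflect[OF norm_u] W_reflect.IH])
qed

lemma W_invariant: "g \<in> W \<Longrightarrow> (\<And>i. reflect (u i) ` X = X) \<Longrightarrow> g ` X = X"
  by (induction rule: W.induct) (simp, metis image_comp)

lemma W_bij:
  assumes "g \<in> W" shows "linear g" "bij g" "g x \<bullet> g y = x \<bullet> y"
  using W_orthogonal[OF assms] orthogonal_transformation_bij[of g]
      by (auto simp: orthogonal_transformation_def)

lemma W_mem_iff: "g \<in> W \<Longrightarrow> (\<And>i. reflect (u i) ` X = X) \<Longrightarrow> g x \<in> X \<longleftrightarrow> x \<in> X"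
  using W_invariant[of g X] W_bij(2)[of g] by (metis bij_is_inj inj_image_mem_iff)

lemma W_commute: "g \<in> W \<Longrightarrow> (\<And>i x. reflect (u i) (f x) = f (reflect (u i) x)) \<Longrightarrow> g (f x) = f (g x)"
  by (induction rule: W.induct) auto

lemma W_R: "g \<in> W \<Longrightarrow> g ` R = R"
  by (erule W_invariant) (rule reflect_image_eqI[OF norm_u root_setD(2)[OF rootR uR]])

text \<open>An element of \<open>W\<close> is determined by the images of the simple roots, which
  lie in the finite set \<open>R\<close>.\<close>

lemma finite_orbit: "finite ((\<lambda>g. g w) ` W)"
proof (rule finite_subset)
  show "(\<lambda>g. g w) ` W \<subseteq> (\<lambda>h. \<Sum>i\<in>UNIV. (v i \<bullet> w) *\<^sub>R h i) ` (UNIV \<rightarrow>\<^sub>E R)"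
  proof
    fix x assume "x \<in> (\<lambda>g. g w) ` W"
    then obtain g where g: "g \<in> W" "x = g w" by auto
    have "x = (\<Sum>i\<in>UNIV. (v i \<bullet> w) *\<^sub>R g (u i))"
      unfolding g(2)
          by (subst expand_u[of w]) (simp add: linear_sum[OF W_bij(1)[OF g(1)]] linear_cmul[OF W_bij(1)[OF g(1)]])
    moreover have "(\<lambda>i. g (u i)) \<in> UNIV \<rightarrow>\<^sub>E R" using W_R[OF g(1)] uR by auto
    ultimately show "x \<in> (\<lambda>h. \<Sum>i\<in>UNIV. (v i \<bullet> w) *\<^sub>R h i) ` (UNIV \<rightarrow>\<^sub>E R)" by (rule image_eqI)
  qed
  show "finite ((\<lambda>h. \<Sum>i\<in>UNIV. (v i \<bullet> w) *\<^sub>R h i) ` (UNIV \<rightarrow>\<^sub>E R))"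
    using finR by (intro finite_imageI finite_PiE) auto
qed

text \<open>In the finite orbit of \<open>w\<close>, first \<open>z \<bullet> s\<close> and then,
  among the maximisers, \<open>r \<bullet> s\<close> is maximised. If some
  \<open>u i \<bullet> s\<close> were negative, reflecting \<open>s\<close> in \<open>u i\<close>
  would not decrease the first value and would increase the second. The second criterion decides
  when \<open>z\<close> lies on a wall.\<close>

lemma chamber_dominance:
  assumes z: "\<And>i. 0 \<le> u i \<bullet> z"
  obtains g where "g \<in> W" "\<And>i. 0 \<le> u i \<bullet> g w" "z \<bullet> w \<le> z \<bullet> g w"
proof -
  define S where "S = (\<lambda>g. g w) ` W"
  have S: "finite S" "w \<in> S" using finite_orbit W_id
      by (auto simp: S_def image_iff intro!: bexI[of _ id])
  define m where "m = Max ((\<lambda>s. z \<bullet> s) ` S)"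
  define S1 where "S1 = {s\<in>S. z \<bullet> s = m}"
  have m: "z \<bullet> s \<le> m" if "s \<in> S" for s unfolding m_def using S that by (intro Max_ge) auto
  have "m \<in> (\<lambda>s. z \<bullet> s) ` S" unfolding m_def using S by (intro Max_in) auto
  then have S1: "finite S1" "S1 \<noteq> {}" using S by (auto simp: S1_def)
  \<comment> \<open>A vector strictly inside the chamber, with inner product 1 with every simple
    root.\<close>
  define r where "r = (\<Sum>i\<in>UNIV. v i)"
  have r: "u i \<bullet> r = 1" for i
  proof -
    have "u i \<bullet> r = (\<Sum>j\<in>UNIV. if j = i then 1 else 0)"
      unfolding r_def inner_sum_right by (rule sum.cong) (auto simp: inner_commute[of "u i"] dual)
    then show ?thesis by simp
  qed
  have "Max ((\<lambda>s. r \<bullet> s) ` S1) \<in> (\<lambda>s. r \<bullet> s) ` S1" using S1 by (intro Max_in) auto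
  then obtain s where s: "s \<in> S1" "r \<bullet> s = Max ((\<lambda>s. r \<bullet> s) ` S1)" by auto
  have rs: "r \<bullet> t \<le> r \<bullet> s" if "t \<in> S1" for t unfolding s(2) using S1 that by (intro Max_ge) auto
  obtain g where g: "g \<in> W" "s = g w" using s(1) by (auto simp: S1_def S_def)
  have "0 \<le> u i \<bullet> g w" for i
  proof (rule ccontr)
    assume neg: "\<not> 0 \<le> u i \<bullet> g w"
    define t where "t = reflect (u i) s"
    have tS: "t \<in> S" unfolding t_def S_def using W_reflect[OF g(1), of i] g(2) by (intro image_eqI) auto
    have zt: "z \<bullet> t = z \<bullet> s - 2 * (u i \<bullet> s) * (u i \<bullet> z)" and rt: "r \<bullet> t = r \<bullet> s - 2 * (u i \<bullet> s)"
      using r[of i] by (simp_all add: t_def reflect_def inner_diff_right inner_commute)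
    have us: "u i \<bullet> s < 0" using neg g by simp
    have "(u i \<bullet> s) * (u i \<bullet> z) \<le> 0" using us z[of i] by (intro mult_nonpos_nonneg) auto
    then have "m \<le> z \<bullet> t" using zt s(1) by (simp add: S1_def)
    then have "t \<in> S1" using m[OF tS] tS by (simp add: S1_def)
    then show False using rs[of t] rt us by simp
  qed
  moreover have "z \<bullet> w \<le> z \<bullet> g w" using m[OF S(2)] s(1) g(2) by (simp add: S1_def)
  ultimately show thesis using that g(1) by blast
qed

definition C :: "(real ^ 'n) set" where "C = {x. \<forall>i. 0 \<le> u i \<bullet> x}"

lemma C_iff: "x \<in> C \<longleftrightarrow> Phi x \<in> orthant"
  by (simp add: C_def orthant_def)

lemma closed_C: "closed C"
  unfolding C_def by (intro closed_Collect_all closed_Collect_le continuous_intros)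

lemma move_to_C: obtains g where "g \<in> W" "g w \<in> C"
  using chamber_dominance[of 0 w] by (auto simp: C_def)

text \<open>The open cell of points with sign pattern \<open>S\<close>: exactly the roots in
  \<open>S\<close> are positive there. The nonempty cells are the open chambers; the pattern
  \<open>Sp\<close> of the positive roots belongs to \<open>C\<close>.\<close>

definition D :: "(real ^ 'n) set \<Rightarrow> (real ^ 'n) set" where
  "D S = {x. \<forall>w\<in>R. if w \<in> S then 0 < w \<bullet> x else w \<bullet> x < 0}"

definition Sp :: "(real ^ 'n) set" where "Sp = {w\<in>R. \<forall>i. 0 \<le> w \<bullet> v i}"

lemma open_D: "open (D S)"
proof -
  have "D S = (\<Inter>w\<in>R. {x. if w \<in> S then 0 < w \<bullet> x else w \<bullet> x < 0})" by (auto simp: D_def)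
  moreover have "open {x. if w \<in> S then 0 < w \<bullet> x else w \<bullet> x < 0}" for w
    by (cases "w \<in> S") (auto intro!: open_Collect_less continuous_intros)
  ultimately show ?thesis using finR by (simp only:) (intro open_INT ballI; assumption)
qed

lemma root_inner:
  assumes w: "w \<in> R" and x: "x \<in> C"
  shows "w \<in> Sp \<Longrightarrow> 0 \<le> w \<bullet> x" "w \<notin> Sp \<Longrightarrow> w \<bullet> x \<le> 0"
proof -
  have e: "w \<bullet> x = (\<Sum>i\<in>UNIV. (u i \<bullet> x) * (w \<bullet> v i))"
    using inner_expand[of x w] by (simp add: inner_commute)
  show "0 \<le> w \<bullet> x" if "w \<in> Sp" unfolding e using that x by (intro sum_nonneg) (auto simp: Sp_def C_def)
  show "w \<bullet> x \<le> 0" if "w \<notin> Sp" unfolding e using that x signs[OF w] w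
      by (intro sum_nonpos mult_nonneg_nonpos) (auto simp: Sp_def C_def)
qed

lemma D_Sp_C: "D Sp \<subseteq> C"
proof
  fix x assume x: "x \<in> D Sp"
  have "u i \<in> Sp" for i using uR[of i] by (auto simp: Sp_def inner_commute[of "u i"] dual)
  then have "0 < u i \<bullet> x" for i using x uR by (auto simp: D_def split: if_splits)
  then show "x \<in> C" by (auto simp: C_def less_imp_le)
qed

lemma D_Sp_nonempty: "D Sp \<noteq> {}"
proof -
  define r where "r = (\<Sum>i\<in>UNIV. v i)"
  have "if w \<in> Sp then 0 < w \<bullet> r else w \<bullet> r < 0" if w: "w \<in> R" for w
  proof -
    have "w \<noteq> 0" using root_setD(1)[OF rootR w] by auto
    moreover have "w = 0" if "\<And>i. w \<bullet> v i = 0"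
      using expand_u[of w] that by (simp add: inner_commute[of "v _" w])
    ultimately obtain i0 where i0: "w \<bullet> v i0 \<noteq> 0" by blast
    have e: "w \<bullet> r = (\<Sum>i\<in>UNIV. w \<bullet> v i)" by (simp add: r_def inner_sum_right)
    show ?thesis
    proof (cases "w \<in> Sp")
      case True
      then have "0 \<le> w \<bullet> v i" for i by (simp add: Sp_def)
      then have "0 < w \<bullet> r" unfolding e using i0
          by (intro sum_pos2[of UNIV i0]) (auto simp: order_less_le)
      then show ?thesis using True by simp
    next
      case False
      then have "w \<bullet> v i \<le> 0" for i using signs[OF w] w by (auto simp: Sp_def)
      then have "0 < (\<Sum>i\<in>UNIV. - (w \<bullet> v i))"
        using i0 by (intro sum_pos2[of UNIV i0]) (auto simp: order_less_le)
      then show ?thesis using False e by (simp add: sum_negf)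
    qed
  qed
  then have "r \<in> D Sp" by (simp add: D_def)
  then show ?thesis by auto
qed

text \<open>\<open>g\<close> permutes the roots and preserves inner products. The sign of a root at
  \<open>y\<close> decides its membership in \<open>S\<close>, and the sign of its image at
  \<open>g y\<close> decides membership in \<open>Sp\<close>; so \<open>g\<close> carries one
  pattern to the other.\<close>

lemma D_image:
  assumes g: "g \<in> W" and y: "y \<in> D S" "g y \<in> C"
  shows "g ` D S = D Sp"
proof -
  note lin = W_bij[OF g]
  have key: "g x \<in> D Sp \<longleftrightarrow> x \<in> D S" for x
  proof -
    have sgn: "w' \<in> S \<longleftrightarrow> g w' \<in> Sp" if w': "w' \<in> R" for w'
    proof -
      have gw: "g w' \<in> R" using W_R[OF g] w' by blast
      have e: "g w' \<bullet> g y = w' \<bullet> y" by (rule lin(3))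
      have "if w' \<in> S then 0 < w' \<bullet> y else w' \<bullet> y < 0" using y(1) w' by (simp add: D_def)
      then show ?thesis using root_inner[OF gw y(2)] e by (auto split: if_splits)
    qed
    have "g x \<in> D Sp \<longleftrightarrow> (\<forall>w\<in>g ` R. if w \<in> Sp then 0 < w \<bullet> g x else w \<bullet> g x < 0)"
      unfolding W_R[OF g] by (simp add: D_def)
    also have "\<dots> \<longleftrightarrow> (\<forall>w\<in>R. if w \<in> S then 0 < w \<bullet> x else w \<bullet> x < 0)"
      using sgn by (simp add: lin(3))
    finally show ?thesis by (simp add: D_def)
  qed
  show ?thesis
  proof
    show "g ` D S \<subseteq> D Sp" using key by auto
    show "D Sp \<subseteq> g ` D S"
    proof
      fix x assume x: "x \<in> D Sp"
      obtain z where "x = g z" using lin(2) by (metis bij_pointE)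
      then show "x \<in> g ` D S" using x key by auto
    qed
  qed
qed

text \<open>\<open>N\<close> is the number of nonempty cells, hence the same for all
  \<open>X\<close>. Each cell is carried onto the one of \<open>C\<close> by an element of
  \<open>W\<close>, which preserves both \<open>X\<close> and volumes; what remains lies in finitely
  many hyperplanes.\<close>

lemma measure_chamber:
  obtains N where "0 < N" "\<And>X. X \<in> sets borel \<Longrightarrow> X \<in> lmeasurable \<Longrightarrow> (\<And>i. reflect (u i) ` X = X) \<Longrightarrow>
    measure lebesgue X = N * measure lebesgue (X \<inter> C)"
proof -
  define \<P> where "\<P> = {S \<in> Pow R. D S \<noteq> {}}"
  have finP: "finite \<P>" using finR by (simp add: \<P>_def)
  define N where "N = real (card \<P>)"
  have "Sp \<in> \<P>" using D_Sp_nonempty by (auto simp: \<P>_def Sp_def)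
  then have N: "0 < N" using finP by (auto simp: N_def card_gt_0_iff)
  define Z where "Z = (\<Union>w\<in>R. {x. w \<bullet> x = 0})"
  have Z: "negligible Z"
    unfolding Z_def
  proof (rule negligible_Union)
    fix t assume "t \<in> (\<lambda>w. {x. w \<bullet> x = 0}) ` R"
    then obtain w where w: "w \<in> R" "t = {x. w \<bullet> x = 0}" by auto
    then have "w \<noteq> 0" using root_setD(1)[OF rootR w(1)] by auto
    then show "negligible t" using negligible_hyperplane[of w 0] w by simp
  qed (use finR in auto)
  have "measure lebesgue X = N * measure lebesgue (X \<inter> C)"
    if X: "X \<in> sets borel" "X \<in> lmeasurable" and inv: "\<And>i. reflect (u i) ` X = X" for X
  proof -
    have XDl: "X \<inter> D S \<in> lmeasurable" "X \<inter> D S \<in> sets borel" for S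
      using X open_D[of S] by (auto intro: fmeasurable_Int_fmeasurable)
    have one: "measure lebesgue (X \<inter> D S) = measure lebesgue (X \<inter> D Sp)" if S: "S \<in> \<P>" for S
    proof -
      obtain y where y: "y \<in> D S" using S by (auto simp: \<P>_def)
      obtain g where g: "g \<in> W" "g y \<in> C" by (rule move_to_C)
      have "g ` (X \<inter> D S) = g ` X \<inter> g ` D S" using W_bij(2)[OF g(1)] by (simp add: bij_is_inj image_Int)
      also have "\<dots> = X \<inter> D Sp" using W_invariant[OF g(1) inv] D_image[OF g(1) y g(2)] by simp
      finally show ?thesis using measure_orthogonal_borel(2)[OF W_orthogonal[OF g(1)] XDl(2)[of S]]
          by simp
    qed
    have pj: "pairwise (\<lambda>S T. negligible (X \<inter> D S \<inter> (X \<inter> D T))) \<P>"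
    proof (rule pairwiseI)
      fix S T assume ST: "S \<in> \<P>" "T \<in> \<P>" "S \<noteq> T"
      then obtain w where "w \<in> R" "(w \<in> S) \<noteq> (w \<in> T)" by (auto simp: \<P>_def)
      then have "X \<inter> D S \<inter> (X \<inter> D T) = {}" by (force simp: D_def split: if_splits)
      then show "negligible (X \<inter> D S \<inter> (X \<inter> D T))" by simp
    qed
    have "X - (\<Union>S\<in>\<P>. X \<inter> D S) \<subseteq> Z"
    proof
      fix x assume x: "x \<in> X - (\<Union>S\<in>\<P>. X \<inter> D S)"
      show "x \<in> Z"
      proof (rule ccontr)
        assume nz: "x \<notin> Z"
        define S where "S = {w\<in>R. 0 < w \<bullet> x}"
        have "w \<bullet> x \<noteq> 0" if "w \<in> R" for w using nz that by (auto simp: Z_def)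
        then have "x \<in> D S" by (force simp: D_def S_def)
        moreover have "S \<in> \<P>" using calculation by (auto simp: \<P>_def S_def)
        ultimately show False using x by auto
      qed
    qed
    then have n1: "negligible (X - (\<Union>S\<in>\<P>. X \<inter> D S))" using Z negligible_subset by blast
    have UL: "(\<Union>S\<in>\<P>. X \<inter> D S) \<in> lmeasurable" using finP XDl by (intro fmeasurable.finite_UN)
    have "measure lebesgue X = measure lebesgue (\<Union>S\<in>\<P>. X \<inter> D S)"
      using n1 UL X by (intro measure_negligible_symdiff) (auto intro: negligible_subset[OF n1])
    also have "\<dots> = (\<Sum>S\<in>\<P>. measure lebesgue (X \<inter> D S))"
      by (rule measure_negligible_finite_Union_image[OF finP XDl(1) pj])
    also have "\<dots> = N * measure lebesgue (X \<inter> D Sp)" using one by (simp add: N_def)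
    also have "measure lebesgue (X \<inter> D Sp) = measure lebesgue (X \<inter> C)"
    proof -
      have "X \<inter> C - X \<inter> D Sp \<subseteq> Z"
      proof
        fix x assume x: "x \<in> X \<inter> C - X \<inter> D Sp"
        then obtain w where w: "w \<in> R" "\<not> (if w \<in> Sp then 0 < w \<bullet> x else w \<bullet> x < 0)"
            by (auto simp: D_def)
        then have "w \<bullet> x = 0" using root_inner[OF w(1), of x] x by (auto split: if_splits)
        then show "x \<in> Z" using w by (auto simp: Z_def)
      qed
      moreover have "X \<inter> D Sp - X \<inter> C = {}" using D_Sp_C by auto
      ultimately have "negligible ((X \<inter> D Sp - X \<inter> C) \<union> (X \<inter> C - X \<inter> D Sp))" using Z negligible_subset
          by (metis Un_empty_left)
      moreover have "X \<inter> C \<in> lmeasurable" using X closed_C by (intro fmeasurable_Int_fmeasurable) auto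
      ultimately show ?thesis using XDl(1)[of Sp]
          by (intro measure_negligible_symdiff) (simp_all add: Un_commute)
    qed
    finally show ?thesis .
  qed
  then show thesis using that N by blast
qed

lemma measure_chamber_coords:
  obtains k where "0 < k" "\<And>X. compact X \<Longrightarrow> (\<And>i. reflect (u i) ` X = X) \<Longrightarrow>
    measure lebesgue X = k * measure lebesgue (Phi ` (X \<inter> C))"
proof -
  obtain N where N: "0 < N" "\<And>X. X \<in> sets borel \<Longrightarrow> X \<in> lmeasurable \<Longrightarrow> (\<And>i. reflect (u i) ` X = X) \<Longrightarrow>
    measure lebesgue X = N * measure lebesgue (X \<inter> C)" by (rule measure_chamber) blast
  obtain c where c: "0 < c" "\<And>A. A \<in> sets borel \<Longrightarrow> measure lebesgue (Phi ` A) = c * measure lebesgue A"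
    by (rule linear_image_measure_lebesgue[OF linear_Phi linear_Psi Phi_Psi Psi_Phi]) blast
  show thesis
  proof
    show "0 < N / c" using N c by simp
    fix X :: "(real ^ 'n) set" assume X: "compact X" "\<And>i. reflect (u i) ` X = X"
    have "X \<inter> C \<in> sets borel" using X closed_C by (intro borel_compact compact_Int_closed)
    then show "measure lebesgue X = N / c * measure lebesgue (Phi ` (X \<inter> C))"
      using N(2)[of X] X c by (simp add: borel_compact lmeasurable_compact)
  qed
qed

end

section \<open>Finite spanning subsystems of closed root systems\<close>

definition circle_at :: "real ^ 'n \<Rightarrow> real ^ 'n \<Rightarrow> real \<Rightarrow> real ^ 'n" where
  "circle_at p q t = cos t *\<^sub>R p + sin t *\<^sub>R q"

text \<open>Reflection in the direction of angle \<open>a\<close> sends the angle \<open>b\<close>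
  to \<open>2 * a - b\<close> up to sign, and \<open>R\<close> is symmetric.\<close>

lemma circle_at_root:
  assumes R: "root_set R" and pq: "norm p = 1" "norm q = 1" "p \<bullet> q = 0"
    and ab: "circle_at p q a \<in> R" "circle_at p q b \<in> R"
  shows "circle_at p q (2 * a - b) \<in> R"
proof -
  have i: "circle_at p q a \<bullet> circle_at p q b = cos (a - b)"
    using pq
        by (simp add: circle_at_def inner_add_left inner_add_right norm_eq_1 inner_commute[of q p] cos_diff)
  define c where "c = a - b"
  have e: "b = a - c" "2 * a - b = a + c" by (simp_all add: c_def)
  have "cos b - 2 * cos (a - b) * cos a = - cos (2 * a - b)"
      "sin b - 2 * cos (a - b) * sin a = - sin (2 * a - b)"
    unfolding c_def[symmetric] e(2) unfolding e(1) cos_diff sin_diff cos_add sin_add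
        by (simp_all add: algebra_simps)
  then have "(cos b - 2 * cos (a - b) * cos a) *\<^sub>R p + (sin b - 2 * cos (a - b) * sin a) *\<^sub>R q = - circle_at p q (2 * a - b)"
    by (simp add: circle_at_def)
  then have "reflect (circle_at p q a) (circle_at p q b) = - circle_at p q (2 * a - b)"
    unfolding reflect_def i by (simp add: circle_at_def algebra_simps)
  then show ?thesis using root_setD(3)[OF R root_setD(2)[OF R ab]] by simp
qed

text \<open>The angle \<open>k * t\<close> is obtained by reflecting \<open>(k - 2) * t\<close> at
  \<open>(k - 1) * t\<close>, hence the induction with two base cases.\<close>

lemma circle_at_multiple:
  assumes R: "root_set R" and pq: "norm p = 1" "norm q = 1" "p \<bullet> q = 0"
    and p: "p \<in> R" and t: "circle_at p q t \<in> R"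
  shows "circle_at p q (real k * t) \<in> R"
proof (induction k rule: less_induct)
  case (less k)
  consider "k = 0" | "k = 1" | j where "k = Suc (Suc j)" by (metis One_nat_def not0_implies_Suc)
  then show ?case
  proof cases
    case 3
    have "circle_at p q (2 * (real (Suc j) * t) - real j * t) \<in> R"
      using 3 by (intro circle_at_root[OF R pq] less) auto
    moreover have "2 * (real (Suc j) * t) - real j * t = real k * t" using 3
        by (simp add: algebra_simps)
    ultimately show ?thesis by simp
  qed (use p t in \<open>auto simp: circle_at_def\<close>)
qed

lemma floor_multiple_le:
  fixes a t :: real assumes "0 \<le> a" "0 < t"
  shows "\<bar>real (nat \<lfloor>a / t\<rfloor>) * t - a\<bar> \<le> t"
proof -
  have "0 \<le> a / t" using assms by simp
  then have "real (nat \<lfloor>a / t\<rfloor>) = real_of_int \<lfloor>a / t\<rfloor>" by simp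
  moreover have "real_of_int \<lfloor>a / t\<rfloor> * t \<le> a / t * t" "a / t * t < (real_of_int \<lfloor>a / t\<rfloor> + 1) * t"
    using assms(2)
        by (auto intro!: mult_right_mono mult_strict_right_mono simp del: nonzero_mult_div_cancel_right times_divide_eq_left)
  then have "real_of_int \<lfloor>a / t\<rfloor> * t \<le> a" "a < real_of_int \<lfloor>a / t\<rfloor> * t + t" using assms(2)
      by (auto simp: distrib_right)
  ultimately show ?thesis by simp
qed

text \<open>The multiples of a small angle \<open>t n\<close> come within \<open>t n\<close> of any
  angle \<open>a\<close>. As the planes of \<open>p\<close> and \<open>q n\<close> converge,
  closedness of \<open>R\<close> puts the point at angle \<open>a\<close> of the limit circle into
  \<open>R\<close>.\<close>

lemma circle_at_all_of_small:
  assumes R: "root_set R" "closed R" and p: "p \<in> R"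
    and q: "q \<longlonglongrightarrow> q0" "\<And>n. norm (q n) = 1" "\<And>n. p \<bullet> q n = 0"
    and t: "t \<longlonglongrightarrow> 0" "\<And>n. 0 < t n" "\<And>n. circle_at p (q n) (t n) \<in> R"
    and a: "0 \<le> a"
  shows "circle_at p q0 a \<in> R"
proof -
  define s where "s n = real (nat \<lfloor>a / t n\<rfloor>) * t n" for n
  have np: "norm p = 1" by (rule root_setD(1)[OF R(1) p])
  have "circle_at p (q n) (s n) \<in> R" for n
    unfolding s_def by (rule circle_at_multiple[OF R(1) np q(2,3) p t(3)])
  moreover have "s \<longlonglongrightarrow> a"
  proof (rule LIM_zero_cancel, rule tendsto_0_le[OF t(1), of _ 1])
    show "\<forall>\<^sub>F n in sequentially. norm (s n - a) \<le> norm (t n) * 1"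
      using floor_multiple_le[OF a t(2)] t(2) by (auto simp: s_def less_imp_le)
  qed
  then have "(\<lambda>n. circle_at p (q n) (s n)) \<longlonglongrightarrow> circle_at p q0 a"
    unfolding circle_at_def by (intro tendsto_intros q(1))
  ultimately show ?thesis by (rule closed_sequentially[OF R(2)])
qed

lemma unit_circle_param:
  assumes pq: "norm p = 1" "norm q = 1" "p \<bullet> q = 0" and x: "norm (c *\<^sub>R p + s *\<^sub>R q) = 1"
  obtains a where "0 \<le> a" "c *\<^sub>R p + s *\<^sub>R q = circle_at p q a"
proof -
  have "c\<^sup>2 + s\<^sup>2 = 1"
    using x pq unfolding norm_eq_1
        by (simp add: inner_add_left inner_add_right inner_commute[of q p] power2_eq_square)
  then obtain a where "0 \<le> a" "c = cos a" "s = sin a" using sincos_total_2pi by metis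
  then show thesis using that by (simp add: circle_at_def)
qed

definition unit_in :: "(real ^ 'n) set \<Rightarrow> (real ^ 'n) set \<Rightarrow> bool" where
  "unit_in U R \<longleftrightarrow> (\<forall>x\<in>U. norm x = 1 \<longrightarrow> x \<in> R)"

text \<open>By compactness the roots accumulate at some \<open>p\<close>. Roots \<open>w n\<close>
  that tend to \<open>p\<close> are written with angles \<open>t n\<close> that tend to 0 and unit
  directions \<open>q n\<close> orthogonal to \<open>p\<close>; along a subsequence the directions
  converge to \<open>q0\<close>, and the whole circle through \<open>p\<close> and \<open>q0\<close>
  lies in \<open>R\<close>.\<close>

lemma infinite_root_circle:
  fixes R :: "(real ^ 'n) set"
  assumes R: "root_set R" "closed R" and inf: "infinite R"
  obtains U where "subspace U" "2 \<le> dim U" "unit_in U R"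
proof -
  have "bounded R" using root_setD(1)[OF R(1)] unfolding bounded_iff by (intro exI[of _ 1]) auto
  then have "compact R" using R(2) compact_eq_bounded_closed by blast
  then obtain p where p: "p islimpt R" using inf unfolding compact_eq_Bolzano_Weierstrass by blast
  have pR: "p \<in> R" using p R(2) closed_limpt by blast
  have np: "norm p = 1" by (rule root_setD(1)[OF R(1) pR])
  then have pp: "p \<bullet> p = 1" by (simp add: norm_eq_1)
  \<comment> \<open>The bound 1 keeps \<open>w n\<close> away from \<open>- p\<close>, so that
    \<open>sin (t n)\<close> is positive and \<open>q n\<close> is well defined.\<close>
  define e where "e n = min 1 (inverse (real (Suc n)))" for n
  have "\<exists>w\<in>R. w \<noteq> p \<and> dist w p < e n" for n
  proof -
    have "0 < e n" by (simp add: e_def)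
    then show ?thesis using p unfolding islimpt_approachable by blast
  qed
  then obtain w where w: "\<And>n. w n \<in> R" "\<And>n. w n \<noteq> p" "\<And>n. dist (w n) p < e n" by metis
  have wlim: "w \<longlonglongrightarrow> p"
  proof (rule LIM_zero_cancel, rule tendsto_0_le[OF LIMSEQ_inverse_real_of_nat, of _ 1])
    show "\<forall>\<^sub>F n in sequentially. norm (w n - p) \<le> norm (inverse (real (Suc n))) * 1"
      using w(3) by (auto simp: e_def dist_norm intro!: always_eventually less_imp_le)
  qed
  define t where "t n = arccos (w n \<bullet> p)" for n
  have nw: "norm (w n) = 1" for n by (rule root_setD(1)[OF R(1) w(1)])
  have wp: "-1 \<le> w n \<bullet> p" "w n \<bullet> p \<le> 1" for n
    using Cauchy_Schwarz_ineq2[of "w n" p] nw[of n] np by (auto simp: abs_le_iff)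
  have wp1: "w n \<bullet> p \<noteq> 1" for n
  proof
    assume "w n \<bullet> p = 1"
    then have "norm (w n - p) ^ 2 = 0" using nw[of n] np
        by (simp add: power2_norm_eq_inner inner_diff_left inner_diff_right inner_commute norm_eq_1)
    then show False using w(2)[of n] by simp
  qed
  have wpm: "w n \<bullet> p \<noteq> -1" for n
  proof
    assume "w n \<bullet> p = -1"
    then have "norm (w n - p) ^ 2 = 4" using nw[of n] np
        by (simp add: power2_norm_eq_inner inner_diff_left inner_diff_right inner_commute norm_eq_1)
    moreover have "norm (w n - p) < 1" using w(3)[of n] by (simp add: e_def dist_norm)
    then have "norm (w n - p) ^ 2 < 1" by (simp add: power_less_one_iff)
    ultimately show False by simp
  qed
  have t: "0 < t n" "cos (t n) = w n \<bullet> p" "t n < pi" for n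
    using wp[of n] wp1[of n] wpm[of n] arccos_lt_bounded[of "w n \<bullet> p"]
        by (auto simp: t_def order_less_le)
  have st: "0 < sin (t n)" for n using t by (intro sin_gt_zero) auto
  define q where "q n = inverse (sin (t n)) *\<^sub>R (w n - (w n \<bullet> p) *\<^sub>R p)" for n
  have wq: "circle_at p (q n) (t n) = w n" for n
    using st[of n] by (simp add: circle_at_def q_def t(2))
  have pq: "p \<bullet> q n = 0" for n
    by (simp add: q_def inner_diff_right pp inner_commute)
  have nq: "norm (q n) = 1" for n
  proof -
    have "(w n - (w n \<bullet> p) *\<^sub>R p) \<bullet> (w n - (w n \<bullet> p) *\<^sub>R p) = 1 - (cos (t n))\<^sup>2"
      using nw[of n] pp
          by (simp add: t(2) inner_diff_left inner_diff_right norm_eq_1 inner_commute power2_eq_square)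
    also have "\<dots> = (sin (t n))\<^sup>2" by (simp add: sin_squared_eq)
    finally have "(norm (w n - (w n \<bullet> p) *\<^sub>R p))\<^sup>2 = (sin (t n))\<^sup>2" by (simp only: power2_norm_eq_inner)
    then have "norm (w n - (w n \<bullet> p) *\<^sub>R p) = sin (t n)" using st[of n]
        by (simp add: power2_eq_iff_nonneg)
    then show ?thesis using st[of n] by (simp add: q_def)
  qed
  have tlim: "t \<longlonglongrightarrow> 0"
  proof -
    have "(\<lambda>n. w n \<bullet> p) \<longlonglongrightarrow> p \<bullet> p" by (intro tendsto_intros wlim)
    then have "(\<lambda>n. arccos (w n \<bullet> p)) \<longlonglongrightarrow> arccos (p \<bullet> p)"
      using wp pp by (intro continuous_on_tendsto_compose[OF continuous_on_arccos']) auto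
    then show ?thesis by (simp add: t_def[abs_def] pp)
  qed
  have "compact (sphere (0 :: real ^ 'n) 1)" by simp
  then obtain q0 r where q0: "strict_mono (r :: nat \<Rightarrow> nat)" "(q \<circ> r) \<longlonglongrightarrow> q0"
    using nq unfolding compact_def by (metis mem_sphere_0)
  have nq0: "norm q0 = 1"
  proof -
    have "(\<lambda>n. norm ((q \<circ> r) n)) \<longlonglongrightarrow> norm q0" by (intro tendsto_norm q0)
    then show ?thesis using nq by (simp add: LIMSEQ_const_iff)
  qed
  have pq0: "p \<bullet> q0 = 0"
  proof -
    have "(\<lambda>n. p \<bullet> (q \<circ> r) n) \<longlonglongrightarrow> p \<bullet> q0" by (intro tendsto_intros q0)
    then show ?thesis using pq by (simp add: LIMSEQ_const_iff)
  qed
  have circR: "circle_at p q0 a \<in> R" if "0 \<le> a" for a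
  proof (rule circle_at_all_of_small[OF R pR q0(2)])
    show "(t \<circ> r) \<longlonglongrightarrow> 0" using LIMSEQ_subseq_LIMSEQ[OF tlim q0(1)] .
  qed (use nq pq t wq w that in auto)
  show thesis
  proof
    show "subspace (span {p, q0})" by simp
    have "q0 \<notin> span {p}"
    proof
      assume "q0 \<in> span {p}"
      then obtain c where "q0 = c *\<^sub>R p" by (auto simp: span_singleton)
      then show False using pq0 pp nq0 by auto
    qed
    then have "independent {q0, p}" "q0 \<noteq> p" using np by (auto simp: independent_insert span_base)
    then have "dim {q0, p} = 2" by (subst dim_eq_card_independent) auto
    then show "2 \<le> dim (span {p, q0})" by (simp add: insert_commute)
    show "unit_in (span {p, q0}) R"
      unfolding unit_in_def
    proof (intro ballI impI)
      fix x assume x: "x \<in> span {p, q0}" "norm x = 1"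
      then obtain c s where xc: "x = c *\<^sub>R p + s *\<^sub>R q0"
        by (auto simp: span_insert span_singleton) (metis diff_eq_eq add.commute)
      obtain a where "0 \<le> a" "x = circle_at p q0 a" using unit_circle_param[OF np nq0 pq0] x(2) xc
          by metis
      then show "x \<in> R" using circR by simp
    qed
  qed
qed

text \<open>Dimension 2 provides a unit vector of \<open>U\<close> orthogonal to \<open>a\<close>,
  which supplies the remaining length.\<close>

lemma unit_with_inner:
  fixes U :: "(real ^ 'n) set"
  assumes U: "subspace U" "2 \<le> dim U" and a: "a \<in> U" "a \<noteq> 0" and c: "\<bar>c\<bar> \<le> norm a"
  obtains q where "q \<in> U" "norm q = 1" "q \<bullet> a = c"
proof -
  have "span {a} \<subset> span U"
  proof
    show "span {a} \<subseteq> span U" using a by (intro span_mono) auto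
    show "span {a} \<noteq> span U"
    proof
      assume "span {a} = span U"
      then have "dim U = dim {a}" by (metis dim_span)
      also have "\<dots> \<le> 1" using dim_le_card'[of "{a}"] by simp
      finally show False using U(2) by simp
    qed
  qed
  then obtain b0 where b0: "b0 \<noteq> 0" "b0 \<in> span U" "\<And>y. y \<in> span {a} \<Longrightarrow> orthogonal b0 y"
    by (rule orthogonal_to_subspace_exists_gen) blast
  define b where "b = inverse (norm b0) *\<^sub>R b0"
  have b: "norm b = 1" "b \<in> U" "b \<bullet> a = 0"
  proof -
    have "b0 \<in> U" using b0(2) U(1) span_eq_iff by blast
    then show "b \<in> U" unfolding b_def by (rule subspace_scale[OF U(1)])
  qed (use b0 in \<open>auto simp: b_def orthogonal_def span_base\<close>)
  define s where "s = c / norm a"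
  have s: "s\<^sup>2 \<le> 1"
  proof -
    have "\<bar>s\<bar> \<le> 1" using c a by (simp add: s_def divide_le_eq_1)
    then show ?thesis by (simp add: abs_square_le_1)
  qed
  define q where "q = (s / norm a) *\<^sub>R a + sqrt (1 - s\<^sup>2) *\<^sub>R b"
  have aa: "a \<bullet> a = norm a * norm a" by (simp add: power2_norm_eq_inner[symmetric] power2_eq_square)
  have "q \<bullet> q = s\<^sup>2 + (1 - s\<^sup>2)"
    using b s a
        by (simp add: q_def inner_add_left inner_add_right inner_commute[of a b] aa norm_eq_1[of b] power2_eq_square)
  then have "norm q = 1" by (simp add: norm_eq_1)
  moreover have "q \<in> U" unfolding q_def using U a b by (intro subspace_add subspace_scale)
  moreover have "q \<bullet> a = c" using a b by (simp add: q_def inner_add_left aa s_def)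
  ultimately show thesis using that by blast
qed

text \<open>Otherwise \<open>w = a + b\<close> with nonzero \<open>a\<close> in \<open>U\<close> and
  \<open>b\<close> orthogonal to \<open>U\<close>. Reflecting suitable unit vectors of
  \<open>U\<close> in \<open>w\<close> gives roots at any small angle above \<open>U\<close>, and a
  reflection within \<open>U\<close> turns their component in \<open>U\<close> into any prescribed
  direction \<open>q\<close>. So \<open>R\<close> contains the full circle through \<open>q\<close>
  and the direction \<open>h\<close> of \<open>b\<close>, for every \<open>q\<close>. These circles
  fill the unit sphere of the span of \<open>U\<close> and \<open>h\<close>, against
  maximality.\<close>

lemma maximal_root_subspace:
  fixes R :: "(real ^ 'n) set"
  assumes R: "root_set R" "closed R" and U: "subspace U" "2 \<le> dim U" "unit_in U R"
    and max: "\<And>V. subspace V \<Longrightarrow> 2 \<le> dim V \<Longrightarrow> unit_in V R \<Longrightarrow> dim V \<le> dim U"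
    and w: "w \<in> R"
  shows "w \<in> U \<or> (\<forall>x\<in>U. x \<bullet> w = 0)"
proof (rule ccontr)
  assume neg: "\<not> ?thesis"
  obtain a b where ab: "a \<in> span U" "\<And>x. x \<in> span U \<Longrightarrow> orthogonal b x" "w = a + b"
    by (rule orthogonal_subspace_decomp_exists[of U w]) blast
  have aU: "a \<in> U" using ab U span_eq_iff by metis
  have bU: "b \<bullet> x = 0" if "x \<in> U" for x using ab(2)[OF span_base[OF that]] by (simp add: orthogonal_def)
  have a0: "a \<noteq> 0" using neg ab(3) bU by (auto simp: inner_commute)
  have b0: "b \<noteq> 0" using neg ab(3) aU by auto
  have nw: "norm w = 1" by (rule root_setD(1)[OF R(1) w])
  define h where "h = inverse (norm b) *\<^sub>R b"
  have h: "norm h = 1" "b = norm b *\<^sub>R h" using b0 by (auto simp: h_def)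
  have hU: "h \<bullet> x = 0" if "x \<in> U" for x using bU[OF that] by (simp add: h_def)
  have small: "circle_at q h t \<in> R" if q: "q \<in> U" "norm q = 1" and t: "0 < t" "t < pi / 2"
      "sin t \<le> 2 * norm a * norm b" for q t
  proof -
    \<comment> \<open>Chosen so that the reflection in \<open>w\<close> of a unit vector
      \<open>q'\<close> with \<open>q' \<bullet> a = c\<close> has \<open>h\<close>-component
      exactly \<open>sin t\<close>.\<close>
    define c where "c = - sin t / (2 * norm b)"
    have st: "0 < sin t" "0 < cos t" using t by (auto intro: sin_gt_zero cos_gt_zero)
    have "\<bar>c\<bar> \<le> norm a" using t(3) st b0 by (simp add: c_def field_simps)
    then obtain q' where q': "q' \<in> U" "norm q' = 1" "q' \<bullet> a = c" using unit_with_inner[OF U(1,2) aU a0]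
        by metis
    define p' where "p' = q' - (2 * c) *\<^sub>R a"
    have p'U: "p' \<in> U" unfolding p'_def using U q' aU by (intro subspace_diff subspace_scale)
    have wq: "w \<bullet> q' = c" using q'(3) bU[OF q'(1)] unfolding ab(3) inner_add_left
        by (simp add: inner_commute)
    have r1: "reflect w q' = p' + sin t *\<^sub>R h"
    proof -
      have "reflect w q' = q' - (2 * c) *\<^sub>R w" by (simp only: reflect_def wq)
      also have "\<dots> = q' - (2 * c) *\<^sub>R a - (2 * c) *\<^sub>R b" unfolding ab(3) by (simp add: algebra_simps)
      also have "(2 * c) *\<^sub>R b = - (sin t *\<^sub>R h)" by (subst h(2)) (use b0 in \<open>simp add: c_def\<close>)
      finally show ?thesis by (simp add: p'_def)
    qed
    have q'R: "q' \<in> R" using U(3) q' by (simp add: unit_in_def)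
    have r1R: "reflect w q' \<in> R" by (rule root_setD(2)[OF R(1) w q'R])
    have np': "norm p' = cos t"
    proof -
      have "norm (p' + sin t *\<^sub>R h) = 1" using root_setD(1)[OF R(1) r1R] r1 by simp
      then have "p' \<bullet> p' = 1 - (sin t)\<^sup>2"
        unfolding norm_eq_1 using hU[OF p'U] h(1)
            by (simp add: inner_add_left inner_add_right inner_commute[of p' h] norm_eq_1[of h] power2_eq_square)
      then have "(norm p')\<^sup>2 = (cos t)\<^sup>2" by (simp add: power2_norm_eq_inner cos_squared_eq)
      then show ?thesis using st by (simp add: power2_eq_iff_nonneg)
    qed
    show ?thesis
    proof (cases "p' = cos t *\<^sub>R q")
      case True
      then show ?thesis using r1R r1 by (simp add: circle_at_def)
    next
      case False
      \<comment> \<open>The vectors \<open>p'\<close> and \<open>cos t *\<^sub>R q\<close> have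
        equal norm, so the reflection in their difference exchanges them; its unit normal lies in
        \<open>U\<close>, hence is a root.\<close>
      define f0 where "f0 = p' - cos t *\<^sub>R q"
      define f where "f = inverse (norm f0) *\<^sub>R f0"
      have f00: "f0 \<noteq> 0" using False by (simp add: f0_def)
      have f0U: "f0 \<in> U" unfolding f0_def using U q p'U by (intro subspace_diff subspace_scale)
      have f: "norm f = 1" "f \<in> U" using f00 f0U U by (auto simp: f_def subspace_scale)
      have fR: "f \<in> R" using U(3) f by (simp add: unit_in_def)
      have e1: "p' \<bullet> p' = (cos t)\<^sup>2" using np' by (metis power2_norm_eq_inner)
      have ff: "f0 \<bullet> f0 = 2 * (f0 \<bullet> p')"
        using e1 q(2)
            by (simp add: f0_def inner_diff_left inner_diff_right inner_commute norm_eq_1 power2_eq_square)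
      have "reflect f p' = p' - (2 * (f0 \<bullet> p') / (f0 \<bullet> f0)) *\<^sub>R f0"
        using f00
            by (simp add: reflect_def f_def power2_norm_eq_inner[symmetric] power2_eq_square field_simps)
      also have "2 * (f0 \<bullet> p') / (f0 \<bullet> f0) = 1" unfolding ff[symmetric] using f00 by simp
      also have "p' - 1 *\<^sub>R f0 = cos t *\<^sub>R q" by (simp add: f0_def)
      finally have "reflect f (reflect w q') = circle_at q h t"
        unfolding r1 linear_add[OF linear_reflect] linear_cmul[OF linear_reflect]
        using hU[OF f(2)] by (simp add: circle_at_def reflect_def[of f h] inner_commute)
      then show ?thesis using root_setD(2)[OF R(1) fR r1R] by simp
    qed
  qed
  \<comment> \<open>Angles that tend to 0, all below \<open>pi / 2\<close> and with sine at most
    \<open>2 * norm a * norm b\<close>, as \<open>small\<close> demands.\<close>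
  define t where "t n = min 1 (arcsin (min 1 (2 * norm a * norm b))) * inverse (real (Suc n))" for n
  have all: "circle_at q h s \<in> R" if q: "q \<in> U" "norm q = 1" and s: "0 \<le> s" for q s
  proof -
    let ?m = "min 1 (2 * norm a * norm b)"
    have m: "0 < ?m" "?m \<le> 1" using a0 b0 by auto
    have as: "0 < arcsin ?m" "arcsin ?m \<le> pi / 2" "sin (arcsin ?m) = ?m"
      using m arcsin_less_arcsin[of 0 ?m] arcsin_bounded[of ?m] by auto
    define t0 where "t0 = min 1 (arcsin ?m)"
    have t0: "0 < t0" "t0 \<le> arcsin ?m" "t0 \<le> 1" using as by (auto simp: t0_def)
    have tn: "0 < t n" "t n \<le> t0" for n
    proof -
      have i: "0 < inverse (real (Suc n))" "inverse (real (Suc n)) \<le> 1" by (auto simp: inverse_le_1_iff)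
      show "0 < t n" "t n \<le> t0" using t0(1) i mult_left_le[of "inverse (real (Suc n))" t0]
          by (auto simp: t_def t0_def[symmetric])
    qed
    have tl: "t \<longlonglongrightarrow> 0"
      unfolding t_def[abs_def] by (rule tendsto_mult_right_zero[OF LIMSEQ_inverse_real_of_nat])
    have tR: "circle_at q h (t n) \<in> R" for n
    proof (rule small[OF q tn(1)])
      show lt: "t n < pi / 2" using tn(2)[of n] t0(3) pi_gt3 by simp
      have "sin (t n) \<le> sin (arcsin ?m)" using tn[of n] t0 as lt by (subst sin_mono_le_eq) auto
      then show "sin (t n) \<le> 2 * norm a * norm b" using as by simp
    qed
    have qR: "q \<in> R" using U(3) q by (simp add: unit_in_def)
    show ?thesis
      by (rule circle_at_all_of_small[OF R qR tendsto_const _ _ tl tn(1) tR s]) (use h hU[OF q(1)] in \<open>auto simp: inner_commute\<close>)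
  qed
  define V where "V = span (insert h U)"
  have hnU: "h \<notin> span U"
  proof
    assume "h \<in> span U"
    then have "h \<in> U" using U(1) span_eq_iff by blast
    then have "h \<bullet> h = 0" by (rule hU)
    then show False using h(1) by (simp add: norm_eq_1)
  qed
  have "dim V = dim U + 1" using dim_insert[of h U] hnU by (simp add: V_def)
  moreover have "unit_in V R"
    unfolding unit_in_def
  proof (intro ballI impI)
    fix x assume x: "x \<in> V" "norm x = 1"
    then obtain k where "x - k *\<^sub>R h \<in> span U" by (auto simp: V_def span_insert)
    then have y: "x - k *\<^sub>R h \<in> U" using U(1) span_eq_iff by metis
    define y where "y = x - k *\<^sub>R h"
    obtain q0 where q0: "q0 \<in> U" "norm q0 = 1" using unit_with_inner[OF U(1,2) aU a0, of 0] by auto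
    obtain q c where q: "q \<in> U" "norm q = 1" "y = c *\<^sub>R q"
    proof (cases "y = 0")
      case True
      then show ?thesis using that[of q0 0] q0 by simp
    next
      case False
      then show ?thesis using that[of "inverse (norm y) *\<^sub>R y" "norm y"] y U(1)
          by (simp add: y_def[symmetric] subspace_scale)
    qed
    have xe: "x = c *\<^sub>R q + k *\<^sub>R h" using q(3) by (simp add: y_def algebra_simps)
    have "q \<bullet> h = 0" using hU[OF q(1)] by (simp add: inner_commute)
    then obtain s where "0 \<le> s" "x = circle_at q h s" using unit_circle_param[OF q(2) h(1)] x(2) xe
        by metis
    then show "x \<in> R" using all[OF q(1,2)] by simp
  qed
  ultimately show False using max[of V] U(2) by (simp add: V_def)
qed

text \<open>Orthogonal union of copies of the rank one system with \<open>S\<close>: reflections in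
  one component fix the others.\<close>

lemma orthonormal_roots:
  fixes B :: "(real ^ 'n) set"
  assumes B: "pairwise orthogonal B" "\<And>x. x \<in> B \<Longrightarrow> norm x = 1" and S: "root_set S"
    and BS: "\<And>b s. b \<in> B \<Longrightarrow> s \<in> S \<Longrightarrow> b \<bullet> s = 0"
  shows "root_set (B \<union> uminus ` B \<union> S)"
proof -
  let ?B = "B \<union> uminus ` B"
  have nB: "norm x = 1" if "x \<in> ?B" for x using that B(2) by auto
  have rBB: "reflect x y \<in> ?B" if xy: "x \<in> ?B" "y \<in> ?B" for x y
  proof (cases "y = x \<or> y = - x")
    case True
    then have "reflect x y = - y"
        using reflect_self[OF nB[OF xy(1)]] linear_neg[OF linear_reflect, of x x] by auto
    then show ?thesis using xy(2) by force
  next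
    case False
    obtain x' y' where x'y': "x' \<in> B" "y' \<in> B" "x = x' \<or> x = - x'" "y = y' \<or> y = - y'" using xy by auto
    then have "x' \<noteq> y'" using False by auto
    then have "x' \<bullet> y' = 0" using B(1) x'y' by (auto simp: pairwise_def orthogonal_def)
    then have "x \<bullet> y = 0" using x'y' by auto
    then show ?thesis using xy by (simp add: reflect_def)
  qed
  have perp: "x \<bullet> s = 0" "s \<bullet> x = 0" if "x \<in> ?B" "s \<in> S" for x s
  proof -
    show "x \<bullet> s = 0" using that BS by auto
    then show "s \<bullet> x = 0" by (simp add: inner_commute)
  qed
  show ?thesis
    unfolding root_set_def
  proof (intro conjI ballI)
    show "norm x = 1" if "x \<in> ?B \<union> S" for x using that nB root_setD(1)[OF S] by blast
    fix x y assume "x \<in> ?B \<union> S" "y \<in> ?B \<union> S"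
    then consider "x \<in> ?B" "y \<in> ?B" | "x \<in> ?B" "y \<in> S" | "x \<in> S" "y \<in> ?B" | "x \<in> S" "y \<in> S" by blast
    then show "reflect x y \<in> ?B \<union> S"
    proof cases
      case 1 then show ?thesis using rBB by blast
    next
      case 2 then show ?thesis using perp(1) by (simp add: reflect_def)
    next
      case 3 then show ?thesis using perp(2)[of y x] by (simp add: reflect_def)
    next
      case 4 then show ?thesis using root_setD(2)[OF S] by blast
    qed
  qed
qed

text \<open>Induction on the dimension of the span. For infinite \<open>R\<close> take
  \<open>U\<close> of largest dimension whose unit sphere lies in \<open>R\<close>; all other roots
  are orthogonal to it. The sphere is replaced by an orthonormal basis of \<open>U\<close> with its
  negatives, and the induction hypothesis handles the roots \<open>R2\<close> orthogonal to
  \<open>U\<close>.\<close>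

theorem finite_root_subset:
  fixes R :: "(real ^ 'n) set"
  assumes "root_set R" "closed R"
  shows "\<exists>R'. R' \<subseteq> R \<and> finite R' \<and> root_set R' \<and> span R' = span R"
  using assms
proof (induction "dim R" arbitrary: R rule: less_induct)
  case less
  note R = less.prems
  show ?case
  proof (cases "finite R")
    case True
    then show ?thesis using R by blast
  next
    case False
    let ?P = "\<lambda>U. subspace U \<and> 2 \<le> dim U \<and> unit_in U R"
    obtain U0 where "subspace U0" "2 \<le> dim U0" "unit_in U0 R" by (rule infinite_root_circle[OF R False])
    then have "?P U0" by blast
    moreover have "\<forall>U. ?P U \<longrightarrow> dim U < CARD('n) + 1"
      using dim_subset_UNIV_cart by (metis Suc_eq_plus1 le_imp_less_Suc)
    ultimately obtain U where U0: "?P U" and max0: "\<forall>V. ?P V \<longrightarrow> dim V \<le> dim U"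
      using ex_has_greatest_nat[of ?P U0 dim "CARD('n) + 1"] by blast
    note U = U0[THEN conjunct1] U0[THEN conjunct2, THEN conjunct1] U0[THEN conjunct2, THEN conjunct2]
    have max: "dim V \<le> dim U" if "subspace V" "2 \<le> dim V" "unit_in V R" for V using max0 that by blast
    define R2 where "R2 = {w\<in>R. \<forall>x\<in>U. x \<bullet> w = 0}"
    have split: "w \<in> U \<or> w \<in> R2" if "w \<in> R" for w
      using maximal_root_subspace[OF R U max that] that by (auto simp: R2_def)
    have R2: "root_set R2"
      unfolding root_set_def
    proof (intro conjI ballI)
      show "norm x = 1" if "x \<in> R2" for x using that root_setD(1)[OF R(1)] by (auto simp: R2_def)
      show "reflect x y \<in> R2" if "x \<in> R2" "y \<in> R2" for x y
        using that root_setD(2)[OF R(1)] by (auto simp: R2_def reflect_def inner_diff_right)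
    qed
    have cR2: "closed R2"
    proof -
      have "R2 = R \<inter> (\<Inter>x\<in>U. {w. x \<bullet> w = 0})" by (auto simp: R2_def)
      then show ?thesis using R(2) by (auto intro!: closed_Int closed_INT closed_hyperplane)
    qed
    obtain B where B: "B \<subseteq> U" "pairwise orthogonal B" "\<And>x. x \<in> B \<Longrightarrow> norm x = 1" "independent B"
        "card B = dim U" "span B = U"
      by (rule orthonormal_basis_subspace[OF U(1)]) blast
    have BR: "B \<subseteq> R" using B U(3) by (auto simp: unit_in_def)
    have UR: "U \<subseteq> span R" using span_mono[OF BR] B(6) by simp
    have perp: "x \<bullet> y = 0" if "x \<in> U" "y \<in> span R2" for x y
      using that(2)
          by (induction rule: span_induct_alt) (use that(1) in \<open>auto simp: R2_def inner_add_right\<close>)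
    have "span R2 \<subset> span R"
    proof
      show "span R2 \<subseteq> span R" by (intro span_mono) (auto simp: R2_def)
      show "span R2 \<noteq> span R"
      proof
        assume "span R2 = span R"
        then have "x = 0" if "x \<in> U" for x using perp[OF that, of x] UR that by auto
        then have "U \<subseteq> {0}" by blast
        then have "dim U = 0" by (simp only: dim_eq_0)
        then show False using U(2) by linarith
      qed
    qed
    then have "dim R2 < dim R" by (rule dim_psubset)
    then obtain S where S: "S \<subseteq> R2" "finite S" "root_set S" "span S = span R2" using less.hyps R2 cR2
        by blast
    define R' where "R' = B \<union> uminus ` B \<union> S"
    have "root_set R'"
      unfolding R'_def using B S by (intro orthonormal_roots) (auto simp: R2_def)
    moreover have sub: "R' \<subseteq> R"
      unfolding R'_def using BR S root_setD(3)[OF R(1)] by (auto simp: R2_def)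
    moreover have "finite R'" unfolding R'_def using B(4) S(2) independent_imp_finite by auto
    moreover have "span R' = span R"
    proof
      show "span R' \<subseteq> span R" by (rule span_mono[OF sub])
      have "R \<subseteq> span R'"
      proof
        fix w assume "w \<in> R"
        from split[OF this] show "w \<in> span R'"
        proof
          assume "w \<in> U"
          then have "w \<in> span B" using B by simp
          then show ?thesis using span_mono[of B R'] by (auto simp: R'_def)
        next
          assume "w \<in> R2"
          then have "w \<in> span S" using S span_base by blast
          then show ?thesis using span_mono[of S R'] by (auto simp: R'_def)
        qed
      qed
      then show "span R \<subseteq> span R'" by (simp add: span_minimal)
    qed
    ultimately show ?thesis by blast
  qed
qed

section \<open>The inequality and its equality case for orthogonal reflections\<close>

lemma sf_bdd: "compact K \<Longrightarrow> bdd_above ((\<bullet>) u ` K)"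
  by (intro bounded_imp_bdd_above compact_imp_bounded compact_continuous_image continuous_intros)

lemma sf_upper: "compact K \<Longrightarrow> y \<in> K \<Longrightarrow> u \<bullet> y \<le> support_function K u"
  unfolding support_function_def by (rule cSUP_upper[OF _ sf_bdd])

lemma sf_least: "K \<noteq> {} \<Longrightarrow> (\<And>y. y \<in> K \<Longrightarrow> u \<bullet> y \<le> c) \<Longrightarrow> support_function K u \<le> c"
  unfolding support_function_def by (rule cSUP_least)

lemma sf_attained:
  assumes "compact K" "K \<noteq> {}" obtains y where "y \<in> K" "u \<bullet> y = support_function K u"
proof -
  have "continuous_on K (\<lambda>z. u \<bullet> z)" by (intro continuous_intros)
  then obtain y where y: "y \<in> K" "\<And>z. z \<in> K \<Longrightarrow> u \<bullet> z \<le> u \<bullet> y"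
    using continuous_attains_sup[OF assms] by metis
  then have "u \<bullet> y = support_function K u"
    using sf_upper[OF assms(1) y(1), of u] sf_least[OF assms(2), of u "u \<bullet> y"]
        by (simp add: order.antisym)
  then show thesis using that y by blast
qed

lemma sf_scale:
  assumes K: "compact K" "K \<noteq> {}" and a: "0 \<le> a"
      shows "support_function K (a *\<^sub>R u) = a * support_function K u"
proof -
  obtain y where y: "y \<in> K" "u \<bullet> y = support_function K u" by (rule sf_attained[OF K])
  obtain z where z: "z \<in> K" "(a *\<^sub>R u) \<bullet> z = support_function K (a *\<^sub>R u)" by (rule sf_attained[OF K])
  have "support_function K (a *\<^sub>R u) \<le> a * support_function K u"
    unfolding z(2)[symmetric] using sf_upper[OF K(1) z(1), of u] a by (simp add: mult_left_mono)
  moreover have "a * support_function K u \<le> support_function K (a *\<^sub>R u)"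
    unfolding y(2)[symmetric] using sf_upper[OF K(1) y(1), of "a *\<^sub>R u"] by simp
  ultimately show ?thesis by simp
qed

lemma sf_image_adjoint:
  assumes "\<And>y. f y \<bullet> u = y \<bullet> w" shows "support_function (f ` K) u = support_function K w"
  unfolding support_function_def image_image using assms by (simp add: inner_commute)

lemma sf_orthogonal:
  assumes "orthogonal_transformation f" "f ` K = K"
      shows "support_function K (f u) = support_function K u"
proof -
  have "support_function (f ` K) (f u) = support_function K u"
    using assms(1) by (intro sf_image_adjoint) (simp add: orthogonal_transformation_def)
  then show ?thesis using assms(2) by simp
qed

lemma sf_lipschitz:
  assumes K: "compact K" "K \<noteq> {}" obtains B where "0 \<le> B"
      "\<And>u w. \<bar>support_function K u - support_function K w\<bar> \<le> B * norm (u - w)"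
proof -
  obtain B where B: "\<And>y. y \<in> K \<Longrightarrow> norm y \<le> B" using compact_imp_bounded[OF K(1)] unfolding bounded_iff
      by metis
  have B0: "0 \<le> B" using B K(2) norm_ge_zero order_trans by blast
  have le: "support_function K u \<le> support_function K w + B * norm (u - w)" for u w
  proof (rule sf_least[OF K(2)])
    fix y assume y: "y \<in> K"
    have "u \<bullet> y = w \<bullet> y + (u - w) \<bullet> y" by (simp add: inner_diff_left)
    also have "(u - w) \<bullet> y \<le> norm (u - w) * norm y" by (rule norm_cauchy_schwarz)
    also have "\<dots> \<le> norm (u - w) * B" using B[OF y] by (intro mult_left_mono) auto
    finally show "u \<bullet> y \<le> support_function K w + B * norm (u - w)" using sf_upper[OF K(1) y, of w]
        by (simp add: mult.commute)
  qed
  have "\<bar>support_function K u - support_function K w\<bar> \<le> B * norm (u - w)" for u w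
    using le[of u w] le[of w u] by (simp add: abs_le_iff norm_minus_commute)
  then show thesis using that B0 by blast
qed

lemma sf_continuous:
  assumes K: "compact K" "K \<noteq> {}" shows "continuous_on S (support_function K)"
proof -
  obtain B where B: "0 \<le> B" "\<And>u w. \<bar>support_function K u - support_function K w\<bar> \<le> B * norm (u - w)"
    by (rule sf_lipschitz[OF K]) blast
  have "B-lipschitz_on S (support_function K)"
    using B by (auto simp: lipschitz_on_def dist_norm)
  then show ?thesis by (rule lipschitz_on_continuous_on)
qed

lemma sf_separate:
  assumes K: "compact K" "convex K" "K \<noteq> {}" and y: "y \<notin> K"
  obtains u where "support_function K u < u \<bullet> y"
proof -
  obtain a b where ab: "a \<bullet> y < b" "\<And>x. x \<in> K \<Longrightarrow> b < a \<bullet> x"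
    using separating_hyperplane_closed_point[OF K(2) compact_imp_closed[OF K(1)] y] by metis
  have "support_function K (- a) \<le> - b" using ab(2) by (intro sf_least[OF K(3)]) (simp add: less_imp_le)
  then show thesis using ab(1) by (intro that[of "- a"]) simp
qed

lemma sf_pos:
  assumes K: "compact K" and z: "0 \<in> interior K" and u: "u \<noteq> 0"
  shows "0 < support_function K u"
proof -
  obtain e where e: "0 < e" "cball 0 e \<subseteq> K" using z by (auto simp: mem_interior_cball)
  define y where "y = (e / norm u) *\<^sub>R u"
  have "norm y = e" using e u by (simp add: y_def)
  then have "y \<in> K" using e by auto
  moreover have "0 < u \<bullet> y" using e u by (simp add: y_def)
  ultimately show ?thesis using sf_upper[OF K, of y u] by simp
qed

lemma sf_zero [simp]: "K \<noteq> {} \<Longrightarrow> support_function K 0 = 0"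
  by (simp add: support_function_def)

text \<open>The bound from the definition of the \<open>L\<^sub>0\<close>-sum, read on all vectors.
  For bodies around the origin it is positively homogeneous of degree 1, so linear images can be
  treated without normalising directions.\<close>

definition L0_bound :: "real \<Rightarrow> (real ^ 'n) set \<Rightarrow> (real ^ 'n) set \<Rightarrow> real ^ 'n \<Rightarrow> real" where
  "L0_bound l K L u = support_function K u powr (1 - l) * support_function L u powr l"

locale L0_pair =
  fixes l :: real and K L :: "(real ^ 'n) set"
  assumes l: "0 < l" "l < 1" and K: "compact K" "convex K" "0 \<in> interior K" and L: "compact L"
      "convex L" "0 \<in> interior L"
begin

lemma ne: "K \<noteq> {}" "L \<noteq> {}" using K L interior_subset by auto

lemma sf_nonneg: "0 \<le> support_function K u" "0 \<le> support_function L u"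
  using sf_pos[OF K(1,3), of u] sf_pos[OF L(1,3), of u] ne by (cases "u = 0"; simp add: less_imp_le)+

lemma bound_scale: "0 \<le> a \<Longrightarrow> L0_bound l K L (a *\<^sub>R u) = a * L0_bound l K L u"
  unfolding L0_bound_def sf_scale[OF K(1) ne(1)] sf_scale[OF L(1) ne(2)]
  using sf_nonneg by (simp add: powr_mean_scale)

lemma L0_iff: "x \<in> L0_sum l K L \<longleftrightarrow> (\<forall>u. x \<bullet> u \<le> L0_bound l K L u)"
proof
  assume x: "x \<in> L0_sum l K L"
  show "\<forall>u. x \<bullet> u \<le> L0_bound l K L u"
  proof
    fix u
    show "x \<bullet> u \<le> L0_bound l K L u"
    proof (cases "u = 0")
      case True
      then show ?thesis by (simp add: L0_bound_def)
    next
      case False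
      have "inverse (norm u) *\<^sub>R u \<in> sphere 0 1" using False by simp
      then have "x \<bullet> (inverse (norm u) *\<^sub>R u) \<le> L0_bound l K L (inverse (norm u) *\<^sub>R u)"
        using x unfolding L0_sum_def L0_bound_def by blast
      then show ?thesis using False by (simp add: bound_scale divide_le_cancel field_simps)
    qed
  qed
qed (simp add: L0_sum_def L0_bound_def)

lemma bound_continuous: "continuous_on S (L0_bound l K L)"
  unfolding L0_bound_def
  using l sf_nonneg
      by (intro continuous_on_mult continuous_on_powr' sf_continuous K L ne continuous_on_const) auto

lemma L0_compact: "compact (L0_sum l K L)"
proof -
  have e: "L0_sum l K L = (\<Inter>u. {x. u \<bullet> x \<le> L0_bound l K L u})"
    using L0_iff by (auto simp: inner_commute)
  have cl: "closed (L0_sum l K L)" unfolding e by (intro closed_INT ballI closed_halfspace_le)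
  define B where "B = (\<Sum>i\<in>Basis. max (L0_bound l K L i) (L0_bound l K L (- i)))"
  have "norm x \<le> B" if x: "x \<in> L0_sum l K L" for x
  proof -
    have "\<bar>x \<bullet> i\<bar> \<le> max (L0_bound l K L i) (L0_bound l K L (- i))" for i
      using x[unfolded L0_iff, rule_format, of i] x[unfolded L0_iff, rule_format, of "- i"]
          by (auto simp: abs_le_iff)
    then have "(\<Sum>i\<in>Basis. \<bar>x \<bullet> i\<bar>) \<le> B" unfolding B_def by (intro sum_mono)
    then show ?thesis using norm_le_l1[of x] by simp
  qed
  then have "bounded (L0_sum l K L)" by (auto simp: bounded_iff)
  then show ?thesis using cl compact_eq_bounded_closed by blast
qed

lemma L0_convex: "convex (L0_sum l K L)"
proof -
  have e: "L0_sum l K L = (\<Inter>u. {x. u \<bullet> x \<le> L0_bound l K L u})"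
    using L0_iff by (auto simp: inner_commute)
  show ?thesis unfolding e by (intro convex_INT convex_halfspace_le)
qed

lemma L0_reflect:
  assumes a: "norm a = 1" and inv: "reflect a ` K = K" "reflect a ` L = L"
  shows "reflect a ` L0_sum l K L = L0_sum l K L" "L0_bound l K L (reflect a w) = L0_bound l K L w"
proof -
  show b: "L0_bound l K L (reflect a w) = L0_bound l K L w" for w
    unfolding L0_bound_def using sf_orthogonal[OF orthogonal_reflect[OF a]] inv by simp
  show "reflect a ` L0_sum l K L = L0_sum l K L"
  proof (rule reflect_image_eqI[OF a])
    fix x assume "x \<in> L0_sum l K L"
    then have "x \<bullet> reflect a w \<le> L0_bound l K L (reflect a w)" for w by (simp add: L0_iff)
    then show "reflect a x \<in> L0_sum l K L" unfolding L0_iff by (simp add: b inner_reflect)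
  qed
qed

end

text \<open>If the origin were not interior, a separating normal could be moved by \<open>W\<close>
  to a vector \<open>w\<close> in the chamber with \<open>w \<bullet> x \<le> 0\<close> on the
  interior of \<open>X\<close>. The interior contains a point \<open>x\<close> of the chamber, and a
  small step along \<open>w\<close> shows even \<open>w \<bullet> x < 0\<close>; but two vectors of
  the chamber have nonnegative inner product.\<close>

lemma convex_body_interior_zero:
  fixes X :: "(real ^ 'n) set"
  assumes sr: "simple_roots R u v" and X: "compact X" "convex X" "interior X \<noteq> {}"
      and inv: "\<And>i. reflect (u i) ` X = X"
  shows "0 \<in> interior X"
proof (rule ccontr)
  interpret simple_roots R u v by fact
  assume "0 \<notin> interior X"
  then obtain a where a: "a \<noteq> 0" "\<And>x. x \<in> interior X \<Longrightarrow> 0 \<le> a \<bullet> x"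
    using separating_hyperplane_set_0[of "interior X"] X(2) convex_interior by blast
  have invI: "reflect (u i) ` interior X = interior X" for i
  proof -
    have "inj (reflect (u i))" by (metis injI norm_u reflect_reflect)
    then show ?thesis using interior_injective_linear_image[OF linear_reflect, of "u i" X] inv by simp
  qed
  obtain g where g: "g \<in> W" "g (- a) \<in> C" by (rule move_to_C)
  define w where "w = g (- a)"
  have w: "w \<bullet> x \<le> 0" if "x \<in> interior X" for x
  proof -
    obtain y where y: "x = g y" using W_bij(2)[OF g(1)] by (metis bij_pointE)
    then have "y \<in> interior X" using that W_mem_iff[OF g(1) invI] by simp
    then have "(- a) \<bullet> y \<le> 0" using a(2)[of y] by simp
    then show ?thesis unfolding y w_def W_bij(3)[OF g(1)] .
  qed
  have w0: "w \<noteq> 0" using a(1) W_bij(3)[OF g(1), of "- a" "- a"] by (auto simp: w_def)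
  obtain x0 where x0: "x0 \<in> interior X" using X(3) by auto
  obtain g' where g': "g' \<in> W" "g' x0 \<in> C" by (rule move_to_C)
  define x where "x = g' x0"
  have x: "x \<in> interior X" "x \<in> C" using W_mem_iff[OF g'(1) invI] x0 g'(2) by (auto simp: x_def)
  obtain e where e: "0 < e" "ball x e \<subseteq> interior X" using x(1) open_contains_ball[of "interior X"]
      by auto
  define y where "y = x + (e / 2 / norm w) *\<^sub>R w"
  have "y \<in> ball x e" using e w0 by (simp add: y_def dist_norm)
  then have "w \<bullet> y \<le> 0" using e w by blast
  moreover have "0 < (e / 2 / norm w) * (w \<bullet> w)" using e w0 by simp
  ultimately have "w \<bullet> x < 0" by (simp add: y_def inner_add_right)
  moreover have "0 \<le> x \<bullet> w"
  proof -
    have "0 \<le> v i \<bullet> w" for i using dual_nonneg_expand[of w i] g(2)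
        by (simp add: C_def w_def inner_commute)
    then show ?thesis unfolding inner_expand[of x w] using x(2) by (intro sum_nonneg) (auto simp: C_def)
  qed
  ultimately show False by (simp add: inner_commute)
qed

section \<open>Invariant bodies in chamber coordinates\<close>

locale L0_roots = simple_roots R u v + L0_pair l K L
  for R :: "(real ^ 'n) set" and u v :: "'n \<Rightarrow> real ^ 'n" and l :: real and K L :: "(real ^ 'n) set" +
  assumes invK: "\<And>i. reflect (u i) ` K = K" and invL: "\<And>i. reflect (u i) ` L = L"
begin

definition coords :: "(real ^ 'n) set \<Rightarrow> (real ^ 'n) set" where "coords X = Phi ` (X \<inter> C)"

lemma coords_iff: "x \<in> coords X \<longleftrightarrow> Psi x \<in> X \<and> x \<in> orthant"
proof
  assume "Psi x \<in> X \<and> x \<in> orthant"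
  then show "x \<in> coords X" using C_iff[of "Psi x"] unfolding coords_def
      by (intro image_eqI[of _ _ "Psi x"]) auto
qed (auto simp: coords_def C_iff)

lemma W_sf: "g \<in> W \<Longrightarrow> (\<And>i. reflect (u i) ` X = X) \<Longrightarrow> support_function X (g w) = support_function X w"
  by (rule sf_orthogonal[OF W_orthogonal W_invariant])

lemma v_inner_nonneg: "w \<in> C \<Longrightarrow> 0 \<le> v i \<bullet> w"
  using dual_nonneg_expand[of w i] by (simp add: C_def inner_commute)

lemma Psi_inner: "Psi y \<bullet> w = (\<Sum>i\<in>UNIV. y $ i * (v i \<bullet> w))"
  by (simp add: Psi_def inner_sum_left)

lemma Psi_in_C: "y \<in> orthant \<Longrightarrow> Psi y \<in> C"
  by (simp add: C_iff)

lemma coords_compact_convex: "compact X \<Longrightarrow> convex X \<Longrightarrow> compact (coords X) \<and> convex (coords X)"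
proof -
  assume X: "compact X" "convex X"
  have "convex C"
  proof -
    have "C = (\<Inter>i. {x. u i \<bullet> x \<ge> 0})" by (auto simp: C_def)
    then show ?thesis by (auto intro!: convex_INT convex_halfspace_ge)
  qed
  then show ?thesis unfolding coords_def
    using X closed_C
        by (auto intro!: compact_continuous_image linear_continuous_on convex_linear_image convex_Int linear_Phi compact_Int_closed
        simp: linear_conv_bounded_linear[symmetric])
qed

text \<open>If \<open>Psi y\<close> were outside \<open>X\<close>, some normal would separate it. By
  \<open>chamber_dominance\<close> the normal may be taken in the chamber: this does not lower its
  value at \<open>Psi y\<close> and keeps the support function of the invariant \<open>X\<close>.
  But on such normals all \<open>v i\<close> have nonnegative values, so the value at
  \<open>Psi y\<close> is at most that at \<open>Psi x\<close>.\<close>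

lemma lower_body_coords:
  assumes X: "compact X" "convex X" "0 \<in> interior X" and inv: "\<And>i. reflect (u i) ` X = X"
  shows "lower_body (coords X)"
  unfolding lower_body_def
proof (intro conjI ballI impI)
  show "compact (coords X)" using coords_compact_convex X by blast
  show "coords X \<subseteq> orthant" by (auto simp: coords_iff)
  obtain e where e: "0 < e" "cball 0 e \<subseteq> X" using X(3) by (auto simp: mem_interior_cball)
  \<comment> \<open>A multiple of the all-ones vector, small enough that its image under
    \<open>Psi\<close> has norm at most \<open>e\<close>.\<close>
  define y where "y = (e / (norm (Psi (\<chi> i. 1)) + 1)) *\<^sub>R ((\<chi> i. 1) :: real ^ 'n)"
  have ep: "0 < e / (norm (Psi (\<chi> i. 1)) + 1)" using e by (auto intro!: divide_pos_pos add_nonneg_pos)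
  have "norm (Psi y) = e / (norm (Psi (\<chi> i. 1)) + 1) * norm (Psi (\<chi> i. 1))"
    using abs_of_pos[OF ep] by (simp only: y_def linear_cmul[OF linear_Psi] norm_scaleR)
  also have "\<dots> \<le> e"
  proof -
    have np: "0 < norm (Psi (\<chi> i. 1)) + 1" by (simp add: add_nonneg_pos)
    have "e / (norm (Psi (\<chi> i. 1)) + 1) * norm (Psi (\<chi> i. 1)) \<le> e / (norm (Psi (\<chi> i. 1)) + 1) * (norm (Psi (\<chi> i. 1)) + 1)"
      using ep by (intro mult_left_mono) (simp_all add: less_imp_le)
    then show ?thesis using np by simp
  qed
  finally have "Psi y \<in> X" using e by auto
  then have "y \<in> coords X" using ep by (simp add: coords_iff orthant_def y_def)
  then show "\<exists>x\<in>coords X. \<forall>i. 0 < x $ i" using ep by (intro bexI[of _ y]) (simp_all add: y_def)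
  fix x y assume x: "x \<in> coords X" and y: "y \<in> orthant" "\<forall>i. y $ i \<le> x $ i"
  have "Psi y \<in> X"
  proof (rule ccontr)
    assume "Psi y \<notin> X"
    moreover have neX: "X \<noteq> {}" using X(3) interior_subset by auto
    ultimately obtain w where w: "support_function X w < w \<bullet> Psi y" using sf_separate[OF X(1,2)]
        by metis
    have zC: "0 \<le> u i \<bullet> Psi y" for i using Psi_in_C[OF y(1)] by (simp add: C_def)
    obtain g where g: "g \<in> W" "\<And>i. 0 \<le> u i \<bullet> g w" "Psi y \<bullet> w \<le> Psi y \<bullet> g w"
      using chamber_dominance[of "Psi y" w] zC by metis
    have gC: "g w \<in> C" using g(2) by (simp add: C_def)
    have "Psi y \<bullet> g w \<le> Psi x \<bullet> g w"
      unfolding Psi_inner using y(2) v_inner_nonneg[OF gC] by (intro sum_mono mult_right_mono) auto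
    also have "\<dots> \<le> support_function X (g w)" using sf_upper[OF X(1), of "Psi x" "g w"] x
        by (simp add: coords_iff inner_commute)
    also have "\<dots> = support_function X w" by (rule W_sf[OF g(1) inv])
    finally show False using w g(3) by (simp add: inner_commute)
  qed
  then show "y \<in> coords X" using y by (simp add: coords_iff)
qed

lemma lower_body_K: "lower_body (coords K)" and lower_body_L: "lower_body (coords L)"
  using lower_body_coords K L invK invL by blast+

lemma inv_L0: "reflect (u i) ` L0_sum l K L = L0_sum l K L"
  by (rule L0_reflect(1)[OF norm_u invK invL])

text \<open>By \<open>chamber_dominance\<close> and invariance it suffices to test normals in the
  chamber. There the values at \<open>Psi a\<close>, \<open>Psi b\<close> and \<open>Psi z\<close>
  are sums with the common nonnegative weights \<open>v i \<bullet> g w\<close>, and Hoelder's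
  inequality applies.\<close>

lemma gprods_subset_L0: "gprods l (coords K) (coords L) \<subseteq> coords (L0_sum l K L)"
proof
  fix z assume "z \<in> gprods l (coords K) (coords L)"
  then obtain a b where ab: "a \<in> coords K" "b \<in> coords L" "z = gprod l a b" by (rule gprodsE)
  have zo: "z \<in> orthant" by (simp add: ab orthant_def)
  have zC: "0 \<le> u i \<bullet> Psi z" for i using Psi_in_C[OF zo] by (simp add: C_def)
  have "Psi z \<bullet> w \<le> L0_bound l K L w" for w
  proof -
    obtain g where g: "g \<in> W" "\<And>i. 0 \<le> u i \<bullet> g w" "Psi z \<bullet> w \<le> Psi z \<bullet> g w"
      using chamber_dominance[of "Psi z" w] zC by metis
    have gC: "g w \<in> C" using g(2) by (simp add: C_def)
    let ?t = "\<lambda>i. v i \<bullet> g w"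
    have t: "0 \<le> ?t i" for i by (rule v_inner_nonneg[OF gC])
    have ab0: "0 \<le> a $ i" "0 \<le> b $ i" for i using ab by (auto simp: coords_iff orthant_def)
    have "Psi z \<bullet> g w = (\<Sum>i\<in>UNIV. (?t i * a $ i) powr (1 - l) * (?t i * b $ i) powr l)"
      unfolding Psi_inner ab(3) using t ab0 by (intro sum.cong) (simp_all add: powr_mean_scale)
    also have "\<dots> \<le> (\<Sum>i\<in>UNIV. ?t i * a $ i) powr (1 - l) * (\<Sum>i\<in>UNIV. ?t i * b $ i) powr l"
      using l t ab0 by (intro sum_powr_mean_le) auto
    also have "\<dots> = (Psi a \<bullet> g w) powr (1 - l) * (Psi b \<bullet> g w) powr l"
      by (simp add: Psi_inner mult.commute)
    also have "\<dots> \<le> support_function K (g w) powr (1 - l) * support_function L (g w) powr l"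
    proof -
      have "0 \<le> Psi a \<bullet> g w" "0 \<le> Psi b \<bullet> g w" unfolding Psi_inner using t ab0
          by (auto intro!: sum_nonneg)
      moreover have "Psi a \<bullet> g w \<le> support_function K (g w)" "Psi b \<bullet> g w \<le> support_function L (g w)"
        using sf_upper[OF K(1), of "Psi a" "g w"] sf_upper[OF L(1), of "Psi b" "g w"] ab
            by (auto simp: coords_iff inner_commute)
      ultimately show ?thesis using l by (intro mult_mono powr_mono2) auto
    qed
    also have "\<dots> = L0_bound l K L w" using W_sf[OF g(1) invK] W_sf[OF g(1) invL]
        by (simp add: L0_bound_def)
    finally show ?thesis using g(3) by simp
  qed
  then show "z \<in> coords (L0_sum l K L)" using zo by (simp add: coords_iff L0_iff)
qed

lemma L0_coords: "compact (coords (L0_sum l K L))" "convex (coords (L0_sum l K L))"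
  using coords_compact_convex[OF L0_compact L0_convex] by auto

lemma measure_coords_le:
  "measure lebesgue (coords K) powr (1 - l) * measure lebesgue (coords L) powr l \<le> measure lebesgue (gprods l (coords K) (coords L))"
  "measure lebesgue (gprods l (coords K) (coords L)) \<le> measure lebesgue (coords (L0_sum l K L))"
proof -
  note A = lower_bodyD(1,2)[OF lower_body_K] and B = lower_bodyD(1,2)[OF lower_body_L]
  show "measure lebesgue (coords K) powr (1 - l) * measure lebesgue (coords L) powr l \<le> measure lebesgue (gprods l (coords K) (coords L))"
    by (rule measure_gprods[OF l A B])
  show "measure lebesgue (gprods l (coords K) (coords L)) \<le> measure lebesgue (coords (L0_sum l K L))"
    using gprods_subset_L0 compact_gprods[OF l A(1) B(1) A(2) B(2)] L0_coords(1)
    by (intro measure_mono_fmeasurable fmeasurableD lmeasurable_compact)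
qed

text \<open>The factor between a body and its chamber part is the same for \<open>K\<close>,
  \<open>L\<close> and the \<open>L\<^sub>0\<close>-sum and cancels by homogeneity. If equality
  holds for the bodies, both inequalities of \<open>measure_coords_le\<close> are
  equalities.\<close>

lemma L0_measure:
  "measure lebesgue K powr (1 - l) * measure lebesgue L powr l \<le> measure lebesgue (L0_sum l K L)"
  "measure lebesgue (L0_sum l K L) = measure lebesgue K powr (1 - l) * measure lebesgue L powr l \<Longrightarrow>
    measure lebesgue (gprods l (coords K) (coords L)) = measure lebesgue (coords K) powr (1 - l) * measure lebesgue (coords L) powr l \<and>
    measure lebesgue (coords (L0_sum l K L)) = measure lebesgue (gprods l (coords K) (coords L))"
proof -
  obtain k where k: "0 < k"
      "\<And>X. compact X \<Longrightarrow> (\<And>i. reflect (u i) ` X = X) \<Longrightarrow> measure lebesgue X = k * measure lebesgue (coords X)"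
    using measure_chamber_coords unfolding coords_def by blast
  have e: "measure lebesgue K powr (1 - l) * measure lebesgue L powr l = k * (measure lebesgue (coords K) powr (1 - l) * measure lebesgue (coords L) powr l)"
    unfolding k(2)[OF K(1) invK] k(2)[OF L(1) invL] using k(1) by (intro powr_mean_scale) auto
  note m = k(2)[OF L0_compact inv_L0]
  show "measure lebesgue K powr (1 - l) * measure lebesgue L powr l \<le> measure lebesgue (L0_sum l K L)"
    unfolding e m using k(1) measure_coords_le by (intro mult_left_mono) auto
  show "measure lebesgue (gprods l (coords K) (coords L)) = measure lebesgue (coords K) powr (1 - l) * measure lebesgue (coords L) powr l \<and>
    measure lebesgue (coords (L0_sum l K L)) = measure lebesgue (gprods l (coords K) (coords L))"
    if "measure lebesgue (L0_sum l K L) = measure lebesgue K powr (1 - l) * measure lebesgue L powr l"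
    using that measure_coords_le k(1) unfolding e m by auto
qed

end

text \<open>Strictness comes from squaring the weak inequality at \<open>sqrt x\<close>: the square
  leaves a surplus of \<open>l * (1 - l) * (y - 1)\<^sup>2\<close>.\<close>

lemma powr_less_tangent:
  fixes x l :: real
  assumes l: "0 < l" "l < 1" and x: "0 < x" "x \<noteq> 1"
  shows "x powr l < 1 + l * (x - 1)"
proof -
  define y where "y = sqrt x"
  have y: "0 < y" "y \<noteq> 1" "x = y * y" using x by (auto simp: y_def)
  have "y powr l \<le> 1 + l * (y - 1)"
    using powr_mean_le[of l 1 y] l y by (simp add: algebra_simps)
  then have "y powr l * y powr l \<le> (1 + l * (y - 1)) * (1 + l * (y - 1))"
    by (intro mult_mono) (auto intro: order_trans[rotated])
  also have "\<dots> = 1 + l * (x - 1) - l * (1 - l) * (y - 1)\<^sup>2"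
    unfolding y(3) by (simp add: algebra_simps power2_eq_square)
  also have "\<dots> < 1 + l * (x - 1)" using l y by simp
  finally show ?thesis unfolding y(3) using y by (simp add: powr_mult)
qed

text \<open>Equality in Hoelder's inequality. With \<open>m\<close> the mean of \<open>d\<close>
  weighted by \<open>a\<close>, each \<open>r i\<close> is the weighted gap between the concave
  power and its tangent at 1, taken at \<open>d i / m\<close>. The gaps are nonnegative and their
  sum is nonpositive by \<open>eq\<close>, so all vanish, and strict concavity gives
  \<open>d i = m\<close> wherever \<open>a i > 0\<close>.\<close>

lemma sum_powr_mean_eq:
  fixes a d :: "'i \<Rightarrow> real"
  assumes l: "0 < l" "l < 1" and fin: "finite I" and a: "\<And>i. i \<in> I \<Longrightarrow> 0 \<le> a i" and d: "\<And>i. 0 < d i"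
    and eq: "(\<Sum>i\<in>I. a i) powr (1 - l) * (\<Sum>i\<in>I. d i * a i) powr l \<le> (\<Sum>i\<in>I. d i powr l * a i)"
    and ij: "i \<in> I" "j \<in> I" "0 < a i" "0 < a j"
  shows "d i = d j"
proof -
  define X Y where "X = (\<Sum>i\<in>I. a i)" and "Y = (\<Sum>i\<in>I. d i * a i)"
  have X: "0 < X" unfolding X_def using ij fin a by (intro sum_pos2[of I i])
  have Y: "0 < Y" unfolding Y_def using ij fin a d by (intro sum_pos2[of I i]) (auto simp: less_imp_le)
  define m where "m = Y / X"
  have m: "0 < m" using X Y by (simp add: m_def)
  define r where "r i = a i * (1 + l * (d i / m - 1) - (d i / m) powr l)" for i
  have r: "0 \<le> r i" if "i \<in> I" for i
    unfolding r_def using powr_mean_le[of l 1 "d i / m"] l d[of i] m a[OF that]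
    by (intro mult_nonneg_nonneg) (simp_all add: algebra_simps)
  have "sum r I = X + l * (Y / m - X) - (\<Sum>i\<in>I. d i powr l * a i) / m powr l"
  proof -
    have "sum r I = (\<Sum>i\<in>I. a i + (l * (d i * a i / m) - l * a i) - d i powr l * a i / m powr l)"
      unfolding r_def using m d
          by (intro sum.cong) (simp_all add: powr_divide algebra_simps less_imp_le)
    also have "\<dots> = X + (l * (Y / m) - l * X) - (\<Sum>i\<in>I. d i powr l * a i) / m powr l"
      unfolding X_def Y_def
          by (simp only: sum_subtractf sum.distrib sum_distrib_left sum_divide_distrib)
    finally show ?thesis by (simp add: algebra_simps)
  qed
  also have "Y / m = X" using X Y by (simp add: m_def)
  also have "X + l * (X - X) - (\<Sum>i\<in>I. d i powr l * a i) / m powr l \<le> 0"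
  proof -
    have "X * m powr l = X powr (1 - l) * Y powr l"
      using X Y by (simp add: m_def powr_divide powr_diff field_simps)
    also have "\<dots> \<le> (\<Sum>i\<in>I. d i powr l * a i)" using eq by (simp add: X_def Y_def)
    finally show ?thesis using m by (simp add: field_simps)
  qed
  finally have "sum r I = 0" using sum_nonneg[of I r] r by (simp add: order.antisym)
  then have r0: "r i = 0" if "i \<in> I" for i using sum_nonneg_eq_0_iff[of I r, OF fin r] that by auto
  have dm: "d i = m" if "i \<in> I" "0 < a i" for i
  proof (rule ccontr)
    assume "d i \<noteq> m"
    then have "(d i / m) powr l < 1 + l * (d i / m - 1)" using l d[of i] m
        by (intro powr_less_tangent) auto
    then have "0 < r i" unfolding r_def using that(2) by simp
    then show False using r0[OF that(1)] by simp
  qed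
  show ?thesis using dm ij by simp
qed

text \<open>A point of \<open>S\<close> outside the compact \<open>P\<close> is a limit of interior
  points of \<open>S\<close>; those outside \<open>P\<close> form a nonempty open set, which would
  have positive volume.\<close>

lemma convex_eq_of_measure_eq:
  fixes S P :: "'a::euclidean_space set"
  assumes S: "compact S" "convex S" and P: "compact P" "P \<subseteq> S" and pos: "0 < measure lebesgue P"
    and eq: "measure lebesgue P = measure lebesgue S"
  shows "P = S"
proof (rule antisym[OF P(2)], rule subsetI)
  fix z assume z: "z \<in> S"
  show "z \<in> P"
  proof (rule ccontr)
    assume zP: "z \<notin> P"
    have iS: "interior S \<noteq> {}"
    proof
      assume "interior S = {}"
      then have "negligible S" using negligible_convex_interior[OF S(2)] by simp
      then show False using pos eq by (simp add: negligible_imp_measure0)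
    qed
    have "z \<in> closure (interior S)"
      using convex_closure_interior[OF S(2) iS] z closure_subset by blast
    moreover have oP: "open (- P)" using P(1) compact_imp_closed by blast
    ultimately have "interior S \<inter> (- P) \<noteq> {}"
      using zP open_Int_closure_eq_empty[OF oP, of "interior S"] by auto
    moreover have "open (interior S \<inter> (- P))" using oP by auto
    ultimately have nn: "\<not> negligible (interior S \<inter> (- P))" by (rule open_not_negligible[rotated])
    have "measure lebesgue (S - P) = 0"
      using measurable_measure_Diff[of S lebesgue P] S(1) P eq
          by (simp add: lmeasurable_compact fmeasurableD)
    then have "negligible (S - P)"
      using S(1) P(1) by (simp add: negligible_iff_measure lmeasurable_compact fmeasurable.Diff)
    moreover have "interior S \<inter> (- P) \<subseteq> S - P" using interior_subset by auto
    ultimately show False using nn negligible_subset by blast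
  qed
qed

text \<open>The product of \<open>A\<close> with itself is \<open>A\<close>: a coordinatewise
  geometric mean lies below the arithmetic mean, which belongs to the convex, down-closed
  \<open>A\<close>.\<close>

lemma gprods_diag_scale:
  assumes l: "0 < l" "l < 1" and A: "lower_body A" "convex A" and d: "\<And>i. 0 < d i"
  shows "gprods l A (diag_scale d ` A) = diag_scale (\<lambda>i. d i powr l) ` A"
proof
  have gp: "gprod l x (diag_scale d y) = diag_scale (\<lambda>i. d i powr l) (gprod l x y)" if "y \<in> A" for x y
    using d lower_bodyD(3)[OF A(1) that] by (simp add: vec_eq_iff powr_mult less_imp_le)
  show "gprods l A (diag_scale d ` A) \<subseteq> diag_scale (\<lambda>i. d i powr l) ` A"
  proof
    fix z assume "z \<in> gprods l A (diag_scale d ` A)"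
    then obtain x y where xy: "x \<in> A" "y \<in> A" "z = gprod l x (diag_scale d y)" by (auto elim!: gprodsE)
    have "(1 - l) *\<^sub>R x + l *\<^sub>R y \<in> A" using l xy by (intro convexD[OF A(2)]) auto
    then have "gprod l x y \<in> A"
      by (rule lower_bodyD(4)[OF A(1)]) (use powr_mean_le l lower_bodyD(3)[OF A(1)] xy in auto)
    then show "z \<in> diag_scale (\<lambda>i. d i powr l) ` A" using gp xy by auto
  qed
  show "diag_scale (\<lambda>i. d i powr l) ` A \<subseteq> gprods l A (diag_scale d ` A)"
  proof
    fix z assume "z \<in> diag_scale (\<lambda>i. d i powr l) ` A"
    then obtain x where x: "x \<in> A" "z = diag_scale (\<lambda>i. d i powr l) x" by auto
    have "gprod l x x = x" using lower_bodyD(3)[OF A(1) x(1)]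
        by (simp add: vec_eq_iff powr_add[symmetric])
    then have "z = gprod l x (diag_scale d x)" using gp[OF x(1)] x(2) by simp
    then show "z \<in> gprods l A (diag_scale d ` A)" using x(1) by (auto intro: gprod_in_gprods)
  qed
qed

section \<open>The structure of pairs with equality\<close>

locale L0_equality = L0_roots R u v l K L
  for R :: "(real ^ 'n) set" and u v :: "'n \<Rightarrow> real ^ 'n" and l :: real and K L :: "(real ^ 'n) set" +
  fixes d :: "'n \<Rightarrow> real"
  assumes d: "\<And>i. 0 < d i" and coords_L: "coords L = diag_scale d ` coords K"
    and coords_L0: "coords (L0_sum l K L) = diag_scale (\<lambda>i. d i powr l) ` coords K"

text \<open>Besides the diagonal map, equality of volumes turns the inclusion
  \<open>gprods_subset_L0\<close> into an equality of sets, so the \<open>L\<^sub>0\<close>-sum is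
  known exactly in coordinates.\<close>

lemma (in L0_roots) L0_equality:
  assumes "measure lebesgue (L0_sum l K L) = measure lebesgue K powr (1 - l) * measure lebesgue L powr l"
  obtains d where "L0_equality R u v l K L d"
proof -
  note m = L0_measure(2)[OF assms]
  have cK: "convex (coords K)" and cL: "convex (coords L)" using coords_compact_convex K L by blast+
  obtain d where d: "\<And>i. 0 < d i" "coords L = diag_scale d ` coords K"
    by (rule gprods_equality[OF l lower_body_K cK lower_body_L cL]) (use m in blast)+
  have "gprods l (coords K) (coords L) = coords (L0_sum l K L)"
  proof (rule convex_eq_of_measure_eq[OF L0_coords _ gprods_subset_L0])
    show "compact (gprods l (coords K) (coords L))"
      using compact_gprods l lower_bodyD(1,2)[OF lower_body_K] lower_bodyD(1,2)[OF lower_body_L]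
          by blast
    show "0 < measure lebesgue (gprods l (coords K) (coords L))"
      by (rule lower_body_measure_pos[OF lower_body_gprods[OF l lower_body_K lower_body_L]])
    show "measure lebesgue (gprods l (coords K) (coords L)) = measure lebesgue (coords (L0_sum l K L))"
        using m by simp
  qed
  then have "coords (L0_sum l K L) = diag_scale (\<lambda>i. d i powr l) ` coords K"
    using gprods_diag_scale[of l "coords K" d, OF l lower_body_K cK d(1)] d(2) by simp
  then have "L0_equality R u v l K L d"
    by unfold_locales (use d in auto)
  then show thesis by (rule that)
qed

context L0_equality
begin

definition dl :: "'n \<Rightarrow> real" where "dl i = d i powr l"

lemma dl_pos: "0 < dl i" using d[of i] by (simp add: dl_def)

lemma diag_inj: "(\<And>i. 0 < e i) \<Longrightarrow> diag_scale e x = diag_scale e y \<longleftrightarrow> x = y"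
proof -
  assume e: "\<And>i. 0 < e i"
  have "e i \<noteq> 0" for i using e[of i] by simp
  then show ?thesis by (simp add: vec_eq_iff)
qed

text \<open>At a boundary point of the \<open>L\<^sub>0\<close>-sum one of the defining inequalities is an equality, and then
  the Hoelder inequality forces \<open>d\<close> to be constant on the support of the normal.\<close>

lemma boundary_normal:
  assumes x: "x \<in> coords K" "\<And>i. 0 < x $ i" and bd: "\<And>s. 1 < s \<Longrightarrow> s *\<^sub>R x \<notin> coords K"
  shows "\<exists>w. w \<noteq> 0 \<and> (\<forall>i. 0 \<le> u i \<bullet> w) \<and> support_function K w = Psi x \<bullet> w \<and>
    (\<forall>i k. 0 < v i \<bullet> w \<longrightarrow> 0 < v k \<bullet> w \<longrightarrow> d i = d k)"
proof -
  define z where "z = Psi (diag_scale dl x)"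
  define M where "M = L0_sum l K L"
  have KCM: "coords M = diag_scale dl ` coords K" using coords_L0 by (simp add: M_def dl_def[abs_def])
  have "diag_scale dl x \<in> coords M" unfolding KCM using x by simp
  then have zM: "z \<in> M" by (simp add: coords_iff z_def)
  have szM: "s *\<^sub>R z \<notin> M" if s: "1 < s" for s
  proof
    assume "s *\<^sub>R z \<in> M"
    moreover have e: "s *\<^sub>R z = Psi (diag_scale dl (s *\<^sub>R x))"
      by (simp add: z_def linear_cmul[OF linear_Psi, symmetric] linear_cmul[OF linear_diag_scale])
    moreover have "diag_scale dl (s *\<^sub>R x) \<in> orthant" using s x(2) dl_pos
        by (simp add: orthant_def less_imp_le)
    ultimately have "diag_scale dl (s *\<^sub>R x) \<in> coords M" by (simp add: coords_iff)
    then have "s *\<^sub>R x \<in> coords K" unfolding KCM using diag_inj[of dl] dl_pos by auto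
    then show False using bd[OF s] by simp
  qed
  let ?f = "L0_bound l K L"
  have zf: "z \<bullet> w \<le> ?f w" for w using zM by (simp add: M_def L0_iff)
  have sph: "compact (sphere (0::real^'n) 1)" "sphere (0::real^'n) 1 \<noteq> {}" by auto
  \<comment> \<open>A direction of least slack. If the slack were positive there, it would be
    bounded below on the sphere, and a slightly larger multiple of \<open>z\<close> would still
    satisfy all constraints.\<close>
  have "continuous_on (sphere 0 1) (\<lambda>w. ?f w - z \<bullet> w)"
    by (intro continuous_intros bound_continuous)
  from continuous_attains_inf[OF sph this]
  obtain w where w: "w \<in> sphere 0 1" "\<And>y. y \<in> sphere 0 1 \<Longrightarrow> ?f w - z \<bullet> w \<le> ?f y - z \<bullet> y"
    by blast
  have w0: "w \<noteq> 0" using w(1) by auto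
  have eq: "z \<bullet> w = ?f w"
  proof (rule ccontr)
    assume "z \<bullet> w \<noteq> ?f w"
    then have del: "0 < ?f w - z \<bullet> w" using zf[of w] by simp
    define s where "s = 1 + (?f w - z \<bullet> w) / (norm z + 1)"
    have np: "0 < norm z + 1" by (simp add: add_nonneg_pos)
    have s: "1 < s" using del np by (simp add: s_def)
    have "s *\<^sub>R z \<in> M"
      unfolding M_def L0_sum_def
    proof (intro CollectI ballI)
      fix y :: "real ^ 'n" assume y: "y \<in> sphere 0 1"
      have "(s - 1) * (z \<bullet> y) \<le> (s - 1) * norm z"
        using norm_cauchy_schwarz[of z y] y s by (intro mult_left_mono) auto
      also have "\<dots> \<le> ?f w - z \<bullet> w"
        using del np by (simp add: s_def field_simps)
      finally have "(s *\<^sub>R z) \<bullet> y \<le> ?f y" using w(2)[OF y] by (simp add: algebra_simps)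
      then show "(s *\<^sub>R z) \<bullet> y \<le> support_function K y powr (1 - l) * support_function L y powr l"
        by (simp add: L0_bound_def)
    qed
    then show False using szM[OF s] by simp
  qed
  have uz: "0 < u i \<bullet> z" for i
  proof -
    have "u i \<bullet> z = diag_scale dl x $ i" unfolding z_def using Phi_nth[of "Psi (diag_scale dl x)" i]
        by simp
    then show ?thesis using dl_pos x(2) by simp
  qed
  \<comment> \<open>The bound is the same at the reflected normal. As \<open>z\<close> pairs
    positively with each simple root, the tight normal cannot lie on the other side of a
    wall.\<close>
  have uw: "0 \<le> u i \<bullet> w" for i
  proof -
    have "z \<bullet> reflect (u i) w \<le> ?f w" using zf[of "reflect (u i) w"] L0_reflect(2)[OF norm_u invK invL]
        by simp
    then have "0 \<le> (u i \<bullet> w) * (u i \<bullet> z)" using eq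
        by (simp add: reflect_def inner_diff_right inner_commute)
    then show ?thesis using uz[of i] by (simp add: zero_le_mult_iff)
  qed
  then have wC: "w \<in> C" by (simp add: C_def)
  define t where "t i = v i \<bullet> w" for i
  have t: "0 \<le> t i" for i unfolding t_def by (rule v_inner_nonneg[OF wC])
  have "\<exists>i. t i \<noteq> 0"
  proof (rule ccontr)
    assume "\<not> (\<exists>i. t i \<noteq> 0)"
    then have "w = 0" by (subst expand_u) (simp add: t_def)
    then show False using w0 by simp
  qed
  then obtain i0 where i0: "0 < t i0" using t by (metis order_less_le)
  define X Y where "X = (\<Sum>i\<in>UNIV. x $ i * t i)" and "Y = (\<Sum>i\<in>UNIV. d i * (x $ i * t i))"
  have X: "X = Psi x \<bullet> w" "X \<le> support_function K w"
  proof -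
    show "X = Psi x \<bullet> w" by (simp add: X_def Psi_inner t_def)
    then show "X \<le> support_function K w" using sf_upper[OF K(1), of "Psi x" w] x(1)
        by (simp add: coords_iff inner_commute)
  qed
  have Y: "Y \<le> support_function L w"
  proof -
    have "diag_scale d x \<in> coords L" using coords_L x by simp
    then have "Psi (diag_scale d x) \<in> L" by (simp add: coords_iff)
    then have "Psi (diag_scale d x) \<bullet> w \<le> support_function L w"
      using sf_upper[OF L(1), of "Psi (diag_scale d x)" w] by (simp add: inner_commute)
    then show ?thesis by (simp add: Y_def t_def Psi_inner mult.assoc)
  qed
  have Xp: "0 < X" unfolding X_def using i0 x(2) t
      by (intro sum_pos2[of UNIV i0]) (auto simp: less_imp_le)
  have Yp: "0 < Y" unfolding Y_def using i0 x(2) t d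
      by (intro sum_pos2[of UNIV i0]) (auto simp: less_imp_le)
  have z: "z \<bullet> w = (\<Sum>i\<in>UNIV. d i powr l * (x $ i * t i))"
    by (simp add: z_def Psi_inner t_def dl_def mult.assoc)
  have hl: "z \<bullet> w \<le> X powr (1 - l) * Y powr l"
  proof -
    have "z \<bullet> w = (\<Sum>i\<in>UNIV. (x $ i * t i) powr (1 - l) * (d i * (x $ i * t i)) powr l)"
      unfolding z
    proof (rule sum.cong)
      fix i
      show "d i powr l * (x $ i * t i) = (x $ i * t i) powr (1 - l) * (d i * (x $ i * t i)) powr l"
        using powr_mean_scale[of 1 "d i" "x $ i * t i" l] d[of i] x(2)[of i] t[of i]
            by (simp add: mult_ac less_imp_le)
    qed simp
    also have "\<dots> \<le> X powr (1 - l) * Y powr l"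
      unfolding X_def Y_def using l d x(2) t by (intro sum_powr_mean_le) (auto simp: less_imp_le)
    finally show ?thesis .
  qed
  have le2: "X powr (1 - l) * Y powr l \<le> ?f w"
    unfolding L0_bound_def using X(2) Y Xp Yp l by (intro mult_mono powr_mono2) auto
  \<comment> \<open>The tight constraint squeezes all inequalities between
    \<open>z \<bullet> w\<close> and the bound, so \<open>X\<close> must already be the support
    value of \<open>K\<close>.\<close>
  have XK: "support_function K w = X"
  proof (rule ccontr)
    assume "support_function K w \<noteq> X"
    then have "X powr (1 - l) < support_function K w powr (1 - l)" using X(2) Xp l
        by (intro powr_less_mono2) auto
    moreover have "Y powr l \<le> support_function L w powr l" "0 < Y powr l" using Y Yp l
        by (auto intro: powr_mono2)
    ultimately have "X powr (1 - l) * Y powr l < ?f w"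
      unfolding L0_bound_def by (intro mult_less_le_imp_less) auto
    then show False using hl eq by simp
  qed
  have dc: "d i = d k" if "0 < t i" "0 < t k" for i k
  proof (rule sum_powr_mean_eq[where I = UNIV and a = "\<lambda>i. x $ i * t i" and l = l])
    show "(\<Sum>i\<in>UNIV. x $ i * t i) powr (1 - l) * (\<Sum>i\<in>UNIV. d i * (x $ i * t i)) powr l \<le> (\<Sum>i\<in>UNIV. d i powr l * (x $ i * t i))"
      using le2 eq z by (simp add: X_def Y_def)
  qed (use l d x(2) t that in \<open>auto simp: less_imp_le\<close>)
  show ?thesis
  proof (intro exI[of _ w] conjI allI impI)
    show "w \<noteq> 0" by fact
    show "0 \<le> u i \<bullet> w" for i by (rule uw)
    show "support_function K w = Psi x \<bullet> w" using XK X(1) by simp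
    show "d i = d k" if "0 < v i \<bullet> w" "0 < v k \<bullet> w" for i k
      by (rule dc) (use that in \<open>simp_all only: t_def\<close>)
  qed
qed

lemma coords_K_cc: "compact (coords K)" "convex (coords K)"
  using coords_compact_convex K by blast+

text \<open>From \<open>x0\<close>, the half of a positive point \<open>p\<close>, move in the
  \<open>i\<close>-th coordinate direction to the boundary. The normal \<open>w\<close> there has
  \<open>v i \<bullet> w > 0\<close>; otherwise its support value would be attained at
  \<open>x0\<close>, although \<open>p\<close> doubles it. Some simple root coordinate
  \<open>j\<close> of \<open>w\<close> with \<open>v j \<bullet> v i \<noteq> 0\<close> contributes
  to this, and by \<open>v_transitive\<close> it also makes \<open>v k \<bullet> w\<close> positive.
  So \<open>boundary_normal\<close> applies to \<open>i\<close> and \<open>k\<close>.\<close>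

lemma v_block:
  assumes ik: "v i \<bullet> v k \<noteq> 0"
  shows "d i = d k"
proof -
  let ?A = "coords K"
  note A = lower_bodyD[OF lower_body_K]
  obtain p where p: "p \<in> ?A" "\<And>i. 0 < p $ i" using A(5) by auto
  define x0 where "x0 = (1 / 2) *\<^sub>R p"
  have x0: "\<And>j. 0 < x0 $ j" "2 *\<^sub>R x0 = p" using p by (simp_all add: x0_def)
  have x0A: "x0 \<in> ?A" by (rule A(4)[OF p(1)]) (use p(2) in \<open>simp_all add: x0_def less_imp_le\<close>)
  define S where "S = {s. 0 \<le> s \<and> x0 + s *\<^sub>R axis i 1 \<in> ?A}"
  have S0: "0 \<in> S" using x0A by (simp add: S_def)
  have "compact S"
  proof -
    have "closed S"
    proof -
      have "S = {0..} \<inter> (\<lambda>s. x0 + s *\<^sub>R axis i 1) -` ?A" by (auto simp: S_def)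
      moreover have "closed ((\<lambda>s. x0 + s *\<^sub>R axis i (1::real)) -` ?A)"
        using A(1) by (intro closed_vimage continuous_intros compact_imp_closed)
      ultimately show ?thesis by auto
    qed
    moreover have "bounded S"
    proof -
      obtain B where B: "\<And>y. y \<in> ?A \<Longrightarrow> norm y \<le> B" using compact_imp_bounded[OF A(1)]
          unfolding bounded_iff by metis
      have "norm s \<le> B" if s: "s \<in> S" for s
      proof -
        have "(x0 + s *\<^sub>R axis i 1) $ i \<le> B"
          using B[of "x0 + s *\<^sub>R axis i 1"] component_le_norm_cart[of "x0 + s *\<^sub>R axis i 1" i] s
              by (simp add: S_def)
        then show ?thesis using x0(1)[of i] s by (simp add: S_def axis_def)
      qed
      then show ?thesis unfolding bounded_iff by blast
    qed
    ultimately show ?thesis using compact_eq_bounded_closed by blast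
  qed
  then obtain s where s: "s \<in> S" "\<And>r. r \<in> S \<Longrightarrow> r \<le> s" using compact_attains_sup[of S] S0 by blast
  define x where "x = x0 + s *\<^sub>R axis i 1"
  have s0: "0 \<le> s" using s(1) by (simp add: S_def)
  have xA: "x \<in> ?A" using s(1) by (simp add: S_def x_def)
  have xn: "x $ j = x0 $ j + (if j = i then s else 0)" for j by (simp add: x_def axis_def)
  have xp: "0 < x $ j" for j using x0(1)[of j] s0 by (simp add: xn add_pos_nonneg)
  have bd: "r *\<^sub>R x \<notin> ?A" if r: "1 < r" for r
  proof
    assume rA: "r *\<^sub>R x \<in> ?A"
    define e where "e = (r - 1) * x $ i"
    have e: "0 < e" using r xp by (simp add: e_def)
    have "x0 + (s + e) *\<^sub>R axis i 1 \<in> ?A"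
    proof (rule A(4)[OF rA])
      fix j
      show "0 \<le> (x0 + (s + e) *\<^sub>R axis i 1) $ j" using x0(1)[of j] s0 e
          by (simp add: axis_def less_imp_le add_nonneg_nonneg)
      show "(x0 + (s + e) *\<^sub>R axis i 1) $ j \<le> (r *\<^sub>R x) $ j"
      proof (cases "j = i")
        case True
        then show ?thesis by (simp add: xn e_def axis_def algebra_simps)
      next
        case False
        then show ?thesis using x0(1)[of j] r by (simp add: xn axis_def)
      qed
    qed
    then have "s + e \<in> S" using s0 e by (simp add: S_def)
    then show False using s(2)[of "s + e"] e by simp
  qed
  obtain w where w: "w \<noteq> 0" "\<And>i. 0 \<le> u i \<bullet> w" "support_function K w = Psi x \<bullet> w"
    "\<And>i k. 0 < v i \<bullet> w \<Longrightarrow> 0 < v k \<bullet> w \<Longrightarrow> d i = d k"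
    using boundary_normal[OF xA xp bd] by blast
  have wC: "w \<in> C" using w(2) by (simp add: C_def)
  have ti: "0 < v i \<bullet> w"
  proof (rule ccontr)
    assume "\<not> 0 < v i \<bullet> w"
    then have t0: "v i \<bullet> w = 0" using v_inner_nonneg[OF wC, of i] by simp
    have "Psi x \<bullet> w = Psi x0 \<bullet> w"
      unfolding Psi_inner by (rule sum.cong) (use t0 in \<open>auto simp: xn\<close>)
    moreover have "Psi p \<bullet> w \<le> support_function K w"
      using sf_upper[OF K(1), of "Psi p" w] p(1) by (simp add: coords_iff inner_commute)
    moreover have "Psi p \<bullet> w = 2 * (Psi x0 \<bullet> w)"
      unfolding x0(2)[symmetric] linear_cmul[OF linear_Psi] by simp
    moreover have "0 < support_function K w" by (rule sf_pos[OF K(1,3) w(1)])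
    ultimately show False using w(3) by simp
  qed
  have vw: "v m \<bullet> w = (\<Sum>j\<in>UNIV. (u j \<bullet> w) * (v j \<bullet> v m))" for m
    using inner_expand[of w "v m"] by (simp add: inner_commute)
  have "\<exists>j. (u j \<bullet> w) * (v j \<bullet> v i) \<noteq> 0" using ti unfolding vw[of i]
      by (metis (no_types, lifting) less_irrefl sum.neutral)
  then obtain j where j: "u j \<bullet> w \<noteq> 0" "v j \<bullet> v i \<noteq> 0" by auto
  have "v j \<bullet> v k \<noteq> 0" by (rule v_transitive[OF j(2) ik])
  then have "0 < (u j \<bullet> w) * (v j \<bullet> v k)" using j(1) w(2)[of j] v_nonneg[of j k] by simp
  then have "0 < v k \<bullet> w"
    unfolding vw[of k] using w(2) v_nonneg by (intro sum_pos2[of UNIV j]) auto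
  then show ?thesis using w(4) ti by blast
qed

text \<open>Projection to the span of the \<open>v i\<close> with \<open>d i = c\<close>, along the
  remaining ones. By \<open>v_block\<close> the blocks are mutually orthogonal, so it is an
  orthogonal projection; if \<open>c\<close> is no value of \<open>d\<close>, it is 0.\<close>

definition block_proj :: "real \<Rightarrow> real ^ 'n \<Rightarrow> real ^ 'n" where
  "block_proj c x = (\<Sum>i\<in>{i\<in>UNIV. d i = c}. (u i \<bullet> x) *\<^sub>R v i)"

lemma linear_block_proj: "linear (block_proj c)"
  by (rule linearI) (auto simp: block_proj_def inner_right_distrib scaleR_left_distrib sum.distrib scaleR_sum_right)

lemma u_block_proj: "u i \<bullet> block_proj c x = (if d i = c then u i \<bullet> x else 0)"
proof -
  have "u i \<bullet> block_proj c x = (\<Sum>j\<in>{j\<in>UNIV. d j = c}. if j = i then u j \<bullet> x else 0)"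
    unfolding block_proj_def inner_sum_right
        by (rule sum.cong) (auto simp: inner_commute[of "u i" "v _"] dual)
  then show ?thesis by simp
qed

lemma sum_block_proj: "(\<Sum>c\<in>range d. block_proj c x) = x"
proof -
  have "(\<Sum>c\<in>range d. block_proj c x) = (\<Sum>i\<in>UNIV. (u i \<bullet> x) *\<^sub>R v i)"
    unfolding block_proj_def by (rule sum.group) auto
  then show ?thesis using expand_v[of x] by simp
qed

lemma block_proj_orth: "c \<noteq> c' \<Longrightarrow> block_proj c x \<bullet> block_proj c' y = 0"
proof -
  assume "c \<noteq> c'"
  then have "v i \<bullet> v j = 0" if "d i = c" "d j = c'" for i j using v_block[of i j] that by auto
  then show ?thesis unfolding block_proj_def inner_sum_left inner_sum_right
      by (auto intro!: sum.neutral)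
qed

lemma block_proj_block_proj: "block_proj c (block_proj c' x) = (if c = c' then block_proj c x else 0)"
proof -
  have "block_proj c (block_proj c' x) = (\<Sum>i\<in>{i\<in>UNIV. d i = c}. (if d i = c' then u i \<bullet> x else 0) *\<^sub>R v i)"
    unfolding block_proj_def[of c "block_proj c' x"] by (simp only: u_block_proj)
  also have "\<dots> = (if c = c' then block_proj c x else 0)"
  proof (cases "c = c'")
    case True
    then show ?thesis by (auto simp: block_proj_def intro!: sum.cong)
  next
    case False
    then show ?thesis by (auto intro!: sum.neutral)
  qed
  finally show ?thesis .
qed

lemma block_proj_inner: "block_proj c x \<bullet> y = block_proj c x \<bullet> block_proj c y"
proof (cases "c \<in> range d")
  case True
  have "block_proj c x \<bullet> y = (\<Sum>c'\<in>range d. block_proj c x \<bullet> block_proj c' y)"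
    by (subst sum_block_proj[of y, symmetric]) (simp add: inner_sum_right)
  also have "\<dots> = (\<Sum>c'\<in>range d. if c' = c then block_proj c x \<bullet> block_proj c y else 0)"
    using block_proj_orth by (intro sum.cong) auto
  finally show ?thesis using True by simp
next
  case False
  then have "{i\<in>UNIV. d i = c} = {}" by auto
  then have "block_proj c x = 0" unfolding block_proj_def by (simp only: sum.empty)
  then show ?thesis by simp
qed

lemma block_proj_sym: "block_proj c x \<bullet> y = x \<bullet> block_proj c y"
  using block_proj_inner[of c x y] block_proj_inner[of c y x] by (simp add: inner_commute)

text \<open>Each simple root lies in its own block, since the remainder \<open>q\<close> is
  orthogonal both to \<open>u i\<close> and to the projection. Hence simple reflections commute with
  the projections.\<close>

lemma block_proj_u: "block_proj c (u i) = (if d i = c then u i else 0)"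
proof -
  define q where "q = u i - block_proj (d i) (u i)"
  have "q \<bullet> block_proj (d i) (u i) = 0"
    using block_proj_sym[of "d i" "u i" "block_proj (d i) (u i)"]
        by (simp add: q_def inner_diff_left block_proj_block_proj)
  moreover have "q \<bullet> u i = 0"
    using u_block_proj[of i "d i" "u i"]
        by (simp add: q_def inner_diff_left inner_commute[of "block_proj _ _"])
  ultimately have "q \<bullet> q = 0" by (subst (2) q_def) (simp add: inner_diff_right)
  then have "block_proj (d i) (u i) = u i" by (simp add: q_def)
  then show ?thesis using block_proj_block_proj[of c "d i" "u i"] by (auto split: if_splits)
qed

lemma block_proj_reflect: "reflect (u i) (block_proj c x) = block_proj c (reflect (u i) x)"
  by (simp add: reflect_def linear_diff[OF linear_block_proj] linear_cmul[OF linear_block_proj] block_proj_u u_block_proj)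

text \<open>For a point in the chamber the projection replaces some coordinates by 0, which is
  allowed by down-closedness; other points are moved there by \<open>W\<close>.\<close>

lemma block_proj_in_K: assumes y: "y \<in> K" shows "block_proj c y \<in> K"
proof -
  obtain g where g: "g \<in> W" "g y \<in> C" by (rule move_to_C)
  have "g y \<in> K" using W_mem_iff[OF g(1) invK] y by simp
  then have "Phi (g y) \<in> coords K" using g(2) by (simp add: coords_iff C_iff)
  then have "Phi (block_proj c (g y)) \<in> coords K"
    by (rule lower_bodyD(4)[OF lower_body_K]) (use g(2) in \<open>auto simp: u_block_proj C_def\<close>)
  then have "block_proj c (g y) \<in> K" by (simp add: coords_iff)
  moreover have "block_proj c (g y) = g (block_proj c y)"
      by (rule W_commute[OF g(1) block_proj_reflect, symmetric])
  ultimately show ?thesis using W_mem_iff[OF g(1) invK] by simp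
qed

text \<open>If \<open>x\<close> were outside, its ray would leave the body at
  \<open>s *\<^sub>R x\<close> with \<open>s < 1\<close>. By \<open>boundary_normal\<close> the
  normal there sees only one block, so its value at \<open>x\<close> is its value at a projection of
  \<open>x\<close>, which lies in \<open>K\<close>. This value is at most the support value, which
  is \<open>s\<close> times itself.\<close>

lemma coords_product_pos:
  assumes x: "\<And>i. 0 < x $ i" and block_proj: "\<And>c. c \<in> range d \<Longrightarrow> block_proj c (Psi x) \<in> K"
  shows "x \<in> coords K"
proof (rule ccontr)
  assume xA: "x \<notin> coords K"
  let ?A = "coords K"
  note A = lower_bodyD[OF lower_body_K]
  define S where "S = {s. 0 \<le> s \<and> s \<le> 1 \<and> s *\<^sub>R x \<in> ?A}"
  have cS: "compact S"
  proof -
    have "S = {0..1} \<inter> (\<lambda>s. s *\<^sub>R x) -` ?A" by (auto simp: S_def)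
    moreover have "closed ((\<lambda>s. s *\<^sub>R x) -` ?A)"
      using A(1) by (intro closed_vimage continuous_intros compact_imp_closed)
    ultimately show ?thesis by (simp add: compact_Int_closed)
  qed
  obtain p where p: "p \<in> ?A" "\<And>i. 0 < p $ i" using A(5) by auto
  obtain e where e: "0 < e" "\<And>i. e * x $ i \<le> p $ i"
  proof -
    define e where "e = Min (range (\<lambda>i. p $ i / x $ i))"
    have "0 < e" unfolding e_def using p(2) x by (subst Min_gr_iff) auto
    moreover have "e * x $ i \<le> p $ i" for i
    proof -
      have "e \<le> p $ i / x $ i" unfolding e_def by (intro Min_le) auto
      then show ?thesis using x[of i] by (simp add: field_simps)
    qed
    ultimately show thesis using that by blast
  qed
  have "min e 1 \<in> S"
  proof -
    have "min e 1 *\<^sub>R x \<in> ?A"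
    proof (rule A(4)[OF p(1)])
      fix i
      show "0 \<le> (min e 1 *\<^sub>R x) $ i" using e(1) x[of i] by simp
      have "min e 1 * x $ i \<le> e * x $ i" using x[of i] by (intro mult_right_mono) auto
      then show "(min e 1 *\<^sub>R x) $ i \<le> p $ i" using e(2)[of i] by simp
    qed
    then show ?thesis using e(1) by (simp add: S_def)
  qed
  then obtain s where s: "s \<in> S" "\<And>r. r \<in> S \<Longrightarrow> r \<le> s" using compact_attains_sup[OF cS] by blast
  have s0: "0 < s" using s(2)[OF \<open>min e 1 \<in> S\<close>] e(1) by simp
  have s1: "s < 1"
  proof (rule ccontr)
    assume "\<not> s < 1"
    then have "s = 1" using s(1) by (simp add: S_def)
    then show False using s(1) xA by (simp add: S_def)
  qed
  have bd: "r *\<^sub>R (s *\<^sub>R x) \<notin> ?A" if r: "1 < r" for r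
  proof
    assume rA: "r *\<^sub>R (s *\<^sub>R x) \<in> ?A"
    show False
    proof (cases "r * s \<le> 1")
      case True
      then have "r * s \<in> S" using rA r s0 by (simp add: S_def)
      then have "r * s \<le> s" by (rule s(2))
      then show False using r s0 by simp
    next
      case False
      have "x \<in> ?A"
      proof (rule A(4)[OF rA])
        fix i
        show "0 \<le> x $ i" using x[of i] by simp
        show "x $ i \<le> (r *\<^sub>R (s *\<^sub>R x)) $ i" using False x[of i] by simp
      qed
      then show False using xA by simp
    qed
  qed
  have sA: "s *\<^sub>R x \<in> ?A" using s(1) by (simp add: S_def)
  have sp: "0 < (s *\<^sub>R x) $ i" for i using s0 x[of i] by simp
  obtain w where w: "w \<noteq> 0" "\<And>i. 0 \<le> u i \<bullet> w" "support_function K w = Psi (s *\<^sub>R x) \<bullet> w"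
    "\<And>i k. 0 < v i \<bullet> w \<Longrightarrow> 0 < v k \<bullet> w \<Longrightarrow> d i = d k"
    using boundary_normal[OF sA sp bd] by blast
  have wC: "w \<in> C" using w(2) by (simp add: C_def)
  have hp: "0 < support_function K w" by (rule sf_pos[OF K(1,3) w(1)])
  have hx: "support_function K w = s * (Psi x \<bullet> w)" unfolding w(3) linear_cmul[OF linear_Psi] by simp
  have "\<exists>i. v i \<bullet> w \<noteq> 0"
  proof (rule ccontr)
    assume "\<not> ?thesis"
    then have "w = 0" by (subst expand_u) simp
    then show False using w(1) by simp
  qed
  then obtain i0 where i0: "0 < v i0 \<bullet> w" using v_inner_nonneg[OF wC] by (metis order_less_le)
  have "Psi x \<bullet> w = block_proj (d i0) (Psi x) \<bullet> w"
  proof -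
    have ux: "u i \<bullet> Psi x = x $ i" for i using Phi_nth[of "Psi x" i] by simp
    have "block_proj (d i0) (Psi x) \<bullet> w = (\<Sum>i\<in>{i\<in>UNIV. d i = d i0}. x $ i * (v i \<bullet> w))"
      by (simp add: block_proj_def inner_sum_left ux)
    also have "\<dots> = (\<Sum>i\<in>UNIV. x $ i * (v i \<bullet> w))"
    proof (rule sum.mono_neutral_left)
      have "v i \<bullet> w = 0" if "d i \<noteq> d i0" for i using w(4)[of i i0] i0 that v_inner_nonneg[OF wC, of i]
          by (auto simp: order_less_le)
      then show "\<forall>i\<in>UNIV - {i\<in>UNIV. d i = d i0}. x $ i * (v i \<bullet> w) = 0" by auto
    qed auto
    finally show ?thesis by (simp add: Psi_inner)
  qed
  also have "\<dots> \<le> support_function K w"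
    using sf_upper[OF K(1) block_proj[of "d i0"], of w] by (simp add: inner_commute)
  finally have "Psi x \<bullet> w \<le> s * (Psi x \<bullet> w)" using hx by simp
  moreover have "0 < Psi x \<bullet> w" using hp hx s0 by (simp add: zero_less_mult_iff)
  ultimately show False using s1 by simp
qed

text \<open>\<open>W\<close> moves the point into the chamber; points on walls are limits of convex
  combinations with a strictly positive point, to which \<open>coords_product_pos\<close>
  applies.\<close>

lemma mem_of_block_proj:
  assumes block_proj: "\<And>c. c \<in> range d \<Longrightarrow> block_proj c z \<in> K"
  shows "z \<in> K"
proof -
  obtain g where g: "g \<in> W" "g z \<in> C" by (rule move_to_C)
  have pg: "block_proj c (g z) \<in> K" if "c \<in> range d" for c
  proof -
    have "block_proj c (g z) = g (block_proj c z)"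
        by (rule W_commute[OF g(1) block_proj_reflect, symmetric])
    then show ?thesis using W_mem_iff[OF g(1) invK] block_proj[OF that] by simp
  qed
  define x where "x = Phi (g z)"
  have x0: "0 \<le> x $ i" for i using g(2) by (simp add: x_def C_def)
  obtain p where p: "p \<in> coords K" "\<And>i. 0 < p $ i" using lower_bodyD(5)[OF lower_body_K] by auto
  define f where "f n = (1 - inverse (real (Suc n))) *\<^sub>R x + inverse (real (Suc n)) *\<^sub>R p" for n
  have "f n \<in> coords K" for n
  proof (rule coords_product_pos)
    have n: "0 < inverse (real (Suc n))" "inverse (real (Suc n)) \<le> 1" by (auto simp: inverse_le_1_iff)
    show "0 < f n $ i" for i unfolding f_def using n p(2)[of i] x0[of i] by (simp add: add_nonneg_pos)
    show "block_proj c (Psi (f n)) \<in> K" if c: "c \<in> range d" for c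
    proof -
      have "block_proj c (Psi p) \<in> K" using p(1) by (intro block_proj_in_K) (simp add: coords_iff)
      moreover have "block_proj c (Psi x) \<in> K" using pg[OF c] by (simp add: x_def)
      ultimately have "(1 - inverse (real (Suc n))) *\<^sub>R block_proj c (Psi x) + inverse (real (Suc n)) *\<^sub>R block_proj c (Psi p) \<in> K"
        using n by (intro convexD[OF K(2)]) auto
      then show ?thesis
        unfolding f_def
            by (simp add: linear_add[OF linear_Psi] linear_cmul[OF linear_Psi] linear_add[OF linear_block_proj] linear_cmul[OF linear_block_proj])
    qed
  qed
  moreover have "f \<longlonglongrightarrow> (1 - 0) *\<^sub>R x + 0 *\<^sub>R p"
    unfolding f_def by (intro tendsto_intros LIMSEQ_inverse_real_of_nat)
  ultimately have "x \<in> coords K"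
    using compact_imp_closed[OF coords_K_cc(1)] closed_sequentially[of "coords K" f x] by simp
  then have "g z \<in> K" by (simp add: coords_iff x_def)
  then show ?thesis using W_mem_iff[OF g(1) invK] by simp
qed

definition Dm :: "real ^ 'n \<Rightarrow> real ^ 'n" where "Dm x = Psi (diag_scale d (Phi x))"

lemma linear_Dm: "linear Dm"
proof -
  have "Dm = Psi \<circ> (diag_scale d \<circ> Phi)" by (auto simp: Dm_def)
  then show ?thesis using linear_compose linear_Psi linear_Phi linear_diag_scale by metis
qed

lemma Dm_block_proj: "block_proj c (Dm x) = c *\<^sub>R block_proj c x"
proof -
  have "u i \<bullet> Dm x = d i * (u i \<bullet> x)" for i
    using Phi_nth[of "Dm x" i] by (simp add: Dm_def)
  then show ?thesis by (auto simp: block_proj_def scaleR_sum_right intro!: sum.cong)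
qed

lemma Dm_sum: "Dm x = (\<Sum>c\<in>range d. c *\<^sub>R block_proj c x)"
  using sum_block_proj[of "Dm x"] by (simp add: Dm_block_proj)

lemma Dm_sym: "Dm x \<bullet> y = x \<bullet> Dm y"
  by (simp add: Dm_sum inner_sum_left inner_sum_right block_proj_sym)

lemma Dm_reflect: "reflect (u i) (Dm x) = Dm (reflect (u i) x)"
  by (simp add: Dm_sum linear_sum[OF linear_reflect] linear_cmul[OF linear_reflect] block_proj_reflect)

text \<open>The identity is known in the chamber, and \<open>Dm\<close> commutes with
  \<open>W\<close> because it acts as a scalar on each block.\<close>

lemma L_eq: "L = Dm ` K"
proof
  show "L \<subseteq> Dm ` K"
  proof
    fix y assume y: "y \<in> L"
    obtain g where g: "g \<in> W" "g y \<in> C" by (rule move_to_C)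
    have "g y \<in> L" using W_mem_iff[OF g(1) invL] y by simp
    then have "Phi (g y) \<in> coords L" using g(2) by (simp add: coords_iff C_iff)
    then obtain a where a: "a \<in> coords K" "Phi (g y) = diag_scale d a" using coords_L by auto
    have "g y = Dm (Psi a)" using arg_cong[OF a(2), of Psi] by (simp add: Dm_def)
    moreover obtain y' where y': "Psi a = g y'" using W_bij(2)[OF g(1)] by (metis bij_pointE)
    moreover have "Dm (g y') = g (Dm y')" by (rule W_commute[OF g(1) Dm_reflect, symmetric])
    ultimately have "y = Dm y'" using W_bij(2)[OF g(1)] by (simp add: bij_is_inj inj_eq)
    moreover have "y' \<in> K" using a(1) y' W_mem_iff[OF g(1) invK, of y'] by (simp add: coords_iff)
    ultimately show "y \<in> Dm ` K" by blast
  qed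
  show "Dm ` K \<subseteq> L"
  proof
    fix y assume "y \<in> Dm ` K"
    then obtain x where x: "x \<in> K" "y = Dm x" by auto
    obtain g where g: "g \<in> W" "g x \<in> C" by (rule move_to_C)
    have "g x \<in> K" using W_mem_iff[OF g(1) invK] x by simp
    then have "Phi (g x) \<in> coords K" using g(2) by (simp add: coords_iff C_iff)
    then have "diag_scale d (Phi (g x)) \<in> coords L" using coords_L by simp
    then have "Dm (g x) \<in> L" by (simp add: coords_iff Dm_def)
    moreover have "Dm (g x) = g (Dm x)" by (rule W_commute[OF g(1) Dm_reflect, symmetric])
    ultimately show "y \<in> L" using W_mem_iff[OF g(1) invL] x(2) by simp
  qed
qed

lemma K_sum: "K = (\<Sum>c\<in>range d. block_proj c ` K)"
proof -
  have "(\<Sum>c\<in>range d. block_proj c ` K) = {sum s (range d) |s. \<forall>c\<in>range d. s c \<in> block_proj c ` K}"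
    by (rule set_sum_alt) simp
  also have "\<dots> = K"
  proof
    show "K \<subseteq> {sum s (range d) |s. \<forall>c\<in>range d. s c \<in> block_proj c ` K}"
      using sum_block_proj by (intro subsetI CollectI exI[of _ "\<lambda>c. block_proj c _"]) auto
    show "{sum s (range d) |s. \<forall>c\<in>range d. s c \<in> block_proj c ` K} \<subseteq> K"
    proof
      fix z assume "z \<in> {sum s (range d) |s. \<forall>c\<in>range d. s c \<in> block_proj c ` K}"
      then obtain s where s: "z = sum s (range d)" "\<forall>c\<in>range d. s c \<in> block_proj c ` K" by blast
      show "z \<in> K"
      proof (rule mem_of_block_proj)
        fix c assume c: "c \<in> range d"
        have "block_proj c z = (\<Sum>c'\<in>range d. block_proj c (s c'))"
            by (simp add: s(1) linear_sum[OF linear_block_proj])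
        also have "\<dots> = (\<Sum>c'\<in>range d. if c' = c then s c else 0)"
        proof (rule sum.cong)
          fix c' assume "c' \<in> range d"
          then obtain y where "s c' = block_proj c' y" using s(2) by blast
          then show "block_proj c (s c') = (if c' = c then s c else 0)"
              by (auto simp: block_proj_block_proj)
        qed simp
        finally have "block_proj c z = s c" using c by simp
        moreover obtain y where "y \<in> K" "s c = block_proj c y" using bspec[OF s(2) c] by (rule imageE)
        then have "s c \<in> K" using block_proj_in_K by simp
        ultimately show "block_proj c z \<in> K" by simp
      qed
    qed
  qed
  finally show ?thesis by simp
qed

lemma sf_K_sum: "support_function K w = (\<Sum>c\<in>range d. support_function K (block_proj c w))"
proof (rule antisym)
  show "support_function K w \<le> (\<Sum>c\<in>range d. support_function K (block_proj c w))"
  proof (rule sf_least[OF ne(1)])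
    fix y assume y: "y \<in> K"
    have "w \<bullet> y = (\<Sum>c\<in>range d. block_proj c w \<bullet> y)"
      by (subst sum_block_proj[of w, symmetric]) (simp add: inner_sum_left)
    also have "\<dots> \<le> (\<Sum>c\<in>range d. support_function K (block_proj c w))"
      by (intro sum_mono sf_upper[OF K(1) y])
    finally show "w \<bullet> y \<le> (\<Sum>c\<in>range d. support_function K (block_proj c w))" .
  qed
  have "\<exists>y. y \<in> K \<and> block_proj c w \<bullet> y = support_function K (block_proj c w)" for c
    by (rule sf_attained[OF K(1) ne(1), of "block_proj c w"]) blast
  then obtain y where y: "\<And>c. y c \<in> K" "\<And>c. block_proj c w \<bullet> y c = support_function K (block_proj c w)"
      by metis
  define z where "z = (\<Sum>c\<in>range d. block_proj c (y c))"
  have "block_proj c z \<in> K" if c: "c \<in> range d" for c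
  proof -
    have "block_proj c z = (\<Sum>c'\<in>range d. if c' = c then block_proj c (y c) else 0)"
      unfolding z_def linear_sum[OF linear_block_proj]
          by (rule sum.cong) (auto simp: block_proj_block_proj)
    then show ?thesis using c block_proj_in_K[OF y(1)] by simp
  qed
  then have "z \<in> K" by (rule mem_of_block_proj)
  then have "w \<bullet> z \<le> support_function K w" by (rule sf_upper[OF K(1)])
  moreover have "w \<bullet> z = (\<Sum>c\<in>range d. support_function K (block_proj c w))"
    by (simp add: z_def inner_sum_right block_proj_sym[symmetric] y(2))
  ultimately show "(\<Sum>c\<in>range d. support_function K (block_proj c w)) \<le> support_function K w" by simp
qed

lemma sf_L_sum: "support_function L w = (\<Sum>c\<in>range d. c * support_function K (block_proj c w))"
proof -
  have "support_function L w = support_function K (Dm w)"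
    unfolding L_eq by (rule sf_image_adjoint) (rule Dm_sym)
  also have "\<dots> = (\<Sum>c\<in>range d. support_function K (c *\<^sub>R block_proj c w))"
      by (simp only: sf_K_sum[of "Dm w"] Dm_block_proj)
  also have "\<dots> = (\<Sum>c\<in>range d. c * support_function K (block_proj c w))"
    using d by (intro sum.cong sf_scale[OF K(1) ne(1)]) (auto simp: less_imp_le)
  finally show ?thesis .
qed

text \<open>Every reflection that preserves \<open>K\<close> and \<open>L\<close> preserves the blocks: on the orthogonal complement of
  the blocks with smaller values, the block of \<open>c\<close> consists of the vectors where the support function of \<open>L\<close> is
  \<open>c\<close> times that of \<open>K\<close>.\<close>

lemma block_proj_commute:
  assumes a: "norm a = 1" and aK: "reflect a ` K = K" and aL: "reflect a ` L = L"
  shows "block_proj c (reflect a x) = reflect a (block_proj c x)"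
proof -
  let ?f = "reflect a" and ?h = "support_function K"
  have hK: "?h (?f w) = ?h w" and hL: "support_function L (?f w) = support_function L w" for w
    by (rule sf_orthogonal[OF orthogonal_reflect[OF a]]; fact)+
  have fin: "finite (range d)" by simp
  \<comment> \<open>Induction over the values of \<open>d\<close> below \<open>c\<close>. The blocks
    of smaller values are already preserved, and so is their orthogonal complement; hence the image
    of \<open>w\<close> has no component in them.\<close>
  have key: "block_proj c (?f w) = ?f w" if "c \<in> range d" "block_proj c w = w" for c w
    using that
  proof (induction "card {c'\<in>range d. c' < c}" arbitrary: c w rule: less_induct)
    case less
    have low: "block_proj c' (?f w) = 0" if c': "c' \<in> range d" "c' < c" for c'
    proof -
      have "{b\<in>range d. b < c'} \<subset> {b\<in>range d. b < c}" using c' by force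
      then have "card {b\<in>range d. b < c'} < card {b\<in>range d. b < c}" by (intro psubset_card_mono) auto
      moreover have "block_proj c' (block_proj c' (?f w)) = block_proj c' (?f w)"
          by (simp add: block_proj_block_proj)
      ultimately have "block_proj c' (?f (block_proj c' (?f w))) = ?f (block_proj c' (?f w))"
          using less.hyps c'(1) by blast
      then have "?f (block_proj c' (?f w)) \<bullet> w = block_proj c' (?f (block_proj c' (?f w))) \<bullet> block_proj c w"
          using less.prems by simp
      also have "\<dots> = 0" using c' by (intro block_proj_orth) auto
      finally have "block_proj c' (?f w) \<bullet> ?f w = 0" by (simp add: inner_reflect)
      then have "block_proj c' (?f w) \<bullet> block_proj c' (?f w) = 0" using block_proj_inner by metis
      then show ?thesis by simp
    qed
    have pw: "block_proj c' w = (if c' = c then w else 0)" for c'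
        using block_proj_block_proj[of c' c w] less.prems(2) by auto
    have "support_function L w = (\<Sum>c'\<in>range d. if c' = c then c * ?h w else 0)"
      unfolding sf_L_sum[of w] by (rule sum.cong) (auto simp: pw ne)
    also have "\<dots> = c * ?h w" using less.prems(1) by simp
    finally have "support_function L (?f w) = c * ?h (?f w)" by (simp add: hK hL)
    then have "(\<Sum>c'\<in>range d. c' * ?h (block_proj c' (?f w))) = (\<Sum>c'\<in>range d. c * ?h (block_proj c' (?f w)))"
      by (simp only: sf_L_sum[of "?f w"] sf_K_sum[of "?f w"] sum_distrib_left)
    \<comment> \<open>Comparing the support functions of \<open>L\<close> and \<open>K\<close> at
      the image of \<open>w\<close>: blocks with smaller values contribute 0, and those with larger
      values contribute nonnegative terms, which must vanish.\<close>
    then have s0: "(\<Sum>c'\<in>range d. (c' - c) * ?h (block_proj c' (?f w))) = 0"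
      by (simp add: left_diff_distrib sum_subtractf)
    have nn: "0 \<le> (c' - c) * ?h (block_proj c' (?f w))" if "c' \<in> range d" for c'
      using low[OF that] sf_nonneg(1) ne by (cases "c' < c") auto
    have hi: "block_proj c' (?f w) = 0" if c': "c' \<in> range d" "c < c'" for c'
    proof (rule ccontr)
      assume "block_proj c' (?f w) \<noteq> 0"
      then have "0 < ?h (block_proj c' (?f w))" by (rule sf_pos[OF K(1,3)])
      moreover have "(c' - c) * ?h (block_proj c' (?f w)) = 0"
        using s0 nn c'(1) sum_nonneg_eq_0_iff[OF fin, of "\<lambda>c'. (c' - c) * ?h (block_proj c' (?f w))"]
            by blast
      ultimately show False using c'(2) by simp
    qed
    have "?f w = (\<Sum>c'\<in>range d. block_proj c' (?f w))" by (rule sum_block_proj[symmetric])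
    also have "\<dots> = (\<Sum>c'\<in>range d. if c' = c then block_proj c (?f w) else 0)"
      using low hi by (intro sum.cong) (auto simp: neq_iff)
    also have "\<dots> = block_proj c (?f w)" using less.prems(1) by simp
    finally show ?case by simp
  qed
  show ?thesis
  proof (cases "c \<in> range d")
    case True
    have kx: "?f (block_proj c' x) = block_proj c' (?f (block_proj c' x))" if "c' \<in> range d" for c'
      using key[OF that, of "block_proj c' x"] by (simp add: block_proj_block_proj)
    have "block_proj c (?f x) = (\<Sum>c'\<in>range d. block_proj c (?f (block_proj c' x)))"
      by (subst sum_block_proj[of x, symmetric]) (simp add: linear_sum[OF linear_reflect] linear_sum[OF linear_block_proj])
    also have "\<dots> = (\<Sum>c'\<in>range d. if c' = c then ?f (block_proj c x) else 0)"
    proof (rule sum.cong)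
      fix c' assume c': "c' \<in> range d"
      have "block_proj c (?f (block_proj c' x)) = block_proj c (block_proj c' (?f (block_proj c' x)))"
          using kx[OF c'] by simp
      also have "\<dots> = (if c' = c then block_proj c' (?f (block_proj c' x)) else 0)"
          unfolding block_proj_block_proj by auto
      also have "\<dots> = (if c' = c then ?f (block_proj c x) else 0)" using kx[OF c'] by auto
      finally show "block_proj c (?f (block_proj c' x)) = (if c' = c then ?f (block_proj c x) else 0)" .
    qed simp
    finally show ?thesis using True by simp
  next
    case False
    then have "{i\<in>UNIV. d i = c} = {}" by auto
    then have "block_proj c y = 0" for y unfolding block_proj_def by (simp only: sum.empty)
    then show ?thesis by (simp add: linear_0[OF linear_reflect])
  qed
qed

lemma v_basis: "inj v" "independent (range v)"
proof -
  show inj: "inj v"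
  proof
    fix i j assume "v i = v j"
    then have "v i \<bullet> u j = v j \<bullet> u j" by simp
    then show "i = j" by (simp add: dual split: if_splits)
  qed
  show "independent (range v)"
  proof (rule card_le_dim_spanning[of _ UNIV])
    show "UNIV \<subseteq> span (range v)"
    proof
      fix x :: "real ^ 'n"
      show "x \<in> span (range v)" by (subst expand_v) (intro span_sum span_scale span_base; simp)
    qed
    show "card (range v) \<le> dim (UNIV :: (real ^ 'n) set)" using inj by (simp add: card_image)
  qed auto
qed

lemma aff_dim_block_proj: "aff_dim (block_proj c ` K) = int (card {i. d i = c})"
proof -
  have "aff_dim (block_proj c ` K) = aff_dim (affine hull (block_proj c ` K))" by simp
  also have "affine hull (block_proj c ` K) = block_proj c ` (affine hull K)"
    using affine_hull_linear_image[of "block_proj c" K] linear_block_proj[of c]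
        by (simp add: linear_conv_bounded_linear)
  also have "affine hull K = UNIV" using affine_hull_nonempty_interior[of K] K(3) by auto
  also have "aff_dim (range (block_proj c)) = int (dim (range (block_proj c)))"
    using linear_0[OF linear_block_proj, of c] by (intro aff_dim_zero hull_inc) (metis rangeI)
  also have "range (block_proj c) = span (v ` {i. d i = c})"
  proof
    show "range (block_proj c) \<subseteq> span (v ` {i. d i = c})"
      unfolding block_proj_def by (auto intro!: span_sum span_scale intro: span_base)
    have "v i \<in> range (block_proj c)" if "d i = c" for i
    proof -
      have "block_proj c (v i) = (\<Sum>j\<in>{j\<in>UNIV. d j = c}. if j = i then v i else 0)"
        unfolding block_proj_def by (rule sum.cong) (auto simp: inner_commute[of "u _" "v _"] dual)
      then have "block_proj c (v i) = v i" using that by simp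
      then show ?thesis by (metis rangeI)
    qed
    then show "span (v ` {i. d i = c}) \<subseteq> range (block_proj c)"
      by (intro span_minimal linear_subspace_image linear_block_proj subspace_UNIV) auto
  qed
  also have "dim (span (v ` {i. d i = c})) = card {i. d i = c}"
  proof -
    have "independent (v ` {i. d i = c})" by (rule independent_mono[OF v_basis(2)]) auto
    then have "dim (span (v ` {i. d i = c})) = card (v ` {i. d i = c})"
        by (simp add: dim_eq_card_independent)
    also have "\<dots> = card {i. d i = c}" using v_basis(1) by (intro card_image) (auto intro: inj_on_subset)
    finally show ?thesis .
  qed
  finally show ?thesis .
qed

end

section \<open>The decomposition into homothetic summands\<close>

lemma set_sum_image:
  fixes f :: "real ^ 'n \<Rightarrow> real ^ 'n"
  assumes f: "linear f"
  shows "f ` (\<Sum>j\<in>I. Xs j) = (\<Sum>j\<in>I. f ` Xs j)"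
proof -
  have "f ` sum Xs I = sum ((\<lambda>X. f ` X) \<circ> Xs) I"
  proof (rule sum_set_linear)
    show "f ` A + f ` B = f ` (A + B)" for A B
      by (auto simp: set_plus_def linear_add[OF f] image_iff) (metis f linear_add)+
    show "f ` {0} = {0}" using linear_0[OF f] by simp
  qed
  then show ?thesis by (simp add: o_def)
qed

text \<open>The condition for equality, with an arbitrary set of maps in place of the given
  matrices, so that it can be transported by a linear change of coordinates.\<close>

definition decomposes :: "(real ^ 'n \<Rightarrow> real ^ 'n) set \<Rightarrow> (real ^ 'n) set \<Rightarrow> (real ^ 'n) set \<Rightarrow> bool" where
  "decomposes F K L \<longleftrightarrow> (\<exists>(m::nat) Ks Ls. m \<ge> 1 \<and> K = (\<Sum>j\<in>{1..m}. Ks j) \<and> L = (\<Sum>j\<in>{1..m}. Ls j)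
    \<and> (\<forall>j\<in>{1..m}. compact (Ks j) \<and> convex (Ks j) \<and> aff_dim (Ks j) \<ge> 1
        \<and> compact (Ls j) \<and> convex (Ls j) \<and> aff_dim (Ls j) \<ge> 1
        \<and> (\<forall>f\<in>F. f ` Ks j = Ks j \<and> f ` Ls j = Ls j) \<and> homothetic (Ks j) (Ls j))
    \<and> (\<Sum>j\<in>{1..m}. aff_dim (Ks j)) = int CARD('n))"

lemma (in L0_equality) decomposition:
  assumes F: "\<And>f. f \<in> F \<Longrightarrow> \<exists>a. norm a = 1 \<and> f = reflect a" and FK: "\<And>f. f \<in> F \<Longrightarrow> f ` K = K"
      and FL: "\<And>f. f \<in> F \<Longrightarrow> f ` L = L"
  shows "decomposes F K L"
proof -
  define m where "m = card (range d)"
  obtain b where b: "bij_betw b {1..m} (range d)"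
    using ex_bij_betw_nat_finite_1[of "range d"] by (auto simp: m_def)
  have br: "b j \<in> range d" if "j \<in> {1..m}" for j using b that by (auto simp: bij_betw_def)
  have bp: "0 < b j" if "j \<in> {1..m}" for j using br[OF that] d by auto
  define Ks where "Ks j = block_proj (b j) ` K" for j
  define Ls where "Ls j = (\<lambda>x. b j *\<^sub>R x) ` Ks j" for j
  have reidx: "(\<Sum>j\<in>{1..m}. h (b j)) = (\<Sum>c\<in>range d. h c)" for h :: "real \<Rightarrow> 'b::comm_monoid_add"
    by (rule sum.reindex_bij_betw[OF b])
  have "1 \<le> m" by (simp add: m_def Suc_le_eq card_gt_0_iff)
  moreover have "K = (\<Sum>j\<in>{1..m}. Ks j)"
    using K_sum reidx[of "\<lambda>c. block_proj c ` K"] by (simp only: Ks_def)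
  moreover have "L = (\<Sum>j\<in>{1..m}. Ls j)"
  proof -
    have "L = Dm ` (\<Sum>c\<in>range d. block_proj c ` K)" using L_eq K_sum by simp
    also have "\<dots> = (\<Sum>c\<in>range d. Dm ` (block_proj c ` K))" by (rule set_sum_image[OF linear_Dm])
    also have "\<dots> = (\<Sum>c\<in>range d. (\<lambda>x. c *\<^sub>R x) ` (block_proj c ` K))"
    proof (rule sum.cong)
      fix c assume c: "c \<in> range d"
      have "Dm (block_proj c x) = c *\<^sub>R block_proj c x" for x
      proof -
        have "Dm (block_proj c x) = (\<Sum>c'\<in>range d. if c' = c then c *\<^sub>R block_proj c x else 0)"
          unfolding Dm_sum by (rule sum.cong) (auto simp: block_proj_block_proj)
        then show ?thesis using c by simp
      qed
      then show "Dm ` (block_proj c ` K) = (\<lambda>x. c *\<^sub>R x) ` (block_proj c ` K)"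
          by (simp add: image_image)
    qed simp
    finally show ?thesis unfolding Ls_def Ks_def reidx[of "\<lambda>c. (\<lambda>x. c *\<^sub>R x) ` (block_proj c ` K)"] .
  qed
  moreover have "\<forall>j\<in>{1..m}. compact (Ks j) \<and> convex (Ks j) \<and> aff_dim (Ks j) \<ge> 1
        \<and> compact (Ls j) \<and> convex (Ls j) \<and> aff_dim (Ls j) \<ge> 1
        \<and> (\<forall>f\<in>F. f ` Ks j = Ks j \<and> f ` Ls j = Ls j) \<and> homothetic (Ks j) (Ls j)"
  proof
    fix j assume j: "j \<in> {1..m}"
    have cK: "compact (Ks j)" unfolding Ks_def
      using K(1) linear_block_proj
          by (intro compact_continuous_image linear_continuous_on) (auto simp: linear_conv_bounded_linear)
    have vK: "convex (Ks j)" unfolding Ks_def by (rule convex_linear_image[OF linear_block_proj K(2)])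
    obtain i where i: "d i = b j" using br[OF j] by auto
    then have "card {i. d i = b j} \<noteq> 0" by auto
    then have aK: "aff_dim (Ks j) \<ge> 1" unfolding Ks_def aff_dim_block_proj by linarith
    have cL: "compact (Ls j)" unfolding Ls_def by (rule compact_scaling[OF cK])
    have vL: "convex (Ls j)" unfolding Ls_def by (rule convex_scaling[OF vK])
    have "aff_dim (Ls j) = aff_dim (Ks j)"
      unfolding Ls_def using bp[OF j]
          by (intro aff_dim_injective_linear_image linear_scale_self) (auto simp: inj_on_def)
    then have aL: "aff_dim (Ls j) \<ge> 1" using aK by simp
    have inv: "f ` Ks j = Ks j \<and> f ` Ls j = Ls j" if f: "f \<in> F" for f
    proof -
      obtain a where a: "norm a = 1" "f = reflect a" using F[OF f] by blast
      have "f ` Ks j = block_proj (b j) ` (f ` K)"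
        unfolding Ks_def image_image using block_proj_commute[OF a(1)] FK[OF f] FL[OF f] a(2) by simp
      then have fK: "f ` Ks j = Ks j" using FK[OF f] by (simp add: Ks_def)
      have "f ` Ls j = (\<lambda>x. b j *\<^sub>R x) ` (f ` Ks j)"
        unfolding Ls_def image_image a(2) by (simp add: linear_cmul[OF linear_reflect])
      then show ?thesis using fK by (simp add: Ls_def)
    qed
    have "homothetic (Ks j) (Ls j)" unfolding homothetic_def
      using bp[OF j] by (intro exI[of _ "b j"] conjI exI[of _ 0]) (auto simp: Ls_def)
    then show "compact (Ks j) \<and> convex (Ks j) \<and> aff_dim (Ks j) \<ge> 1
        \<and> compact (Ls j) \<and> convex (Ls j) \<and> aff_dim (Ls j) \<ge> 1
        \<and> (\<forall>f\<in>F. f ` Ks j = Ks j \<and> f ` Ls j = Ls j) \<and> homothetic (Ks j) (Ls j)"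
      using cK vK aK cL vL aL inv by blast
  qed
  moreover have "(\<Sum>j\<in>{1..m}. aff_dim (Ks j)) = int CARD('n)"
  proof -
    have "(\<Sum>j\<in>{1..m}. aff_dim (Ks j)) = (\<Sum>c\<in>range d. int (card {i. d i = c}))"
      unfolding Ks_def aff_dim_block_proj reidx[of "\<lambda>c. int (card {i. d i = c})"] ..
    also have "\<dots> = (\<Sum>c\<in>range d. \<Sum>i\<in>{i\<in>UNIV. d i = c}. 1)" by simp
    also have "\<dots> = (\<Sum>i\<in>(UNIV :: 'n set). 1)" by (rule sum.group) auto
    finally show ?thesis by simp
  qed
  ultimately show ?thesis unfolding decomposes_def by blast
qed

section \<open>Sufficiency of the decomposition\<close>

text \<open>The reflection in a reflected normal is a conjugate of reflections, so it preserves
  \<open>K\<close> and \<open>L\<close> if they do. Closedness rests on the fact that an involution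
  that maps a set into itself maps it onto itself.\<close>

lemma symmetry_root_set:
  fixes K L :: "(real ^ 'n) set"
  assumes "closed K" "closed L"
  shows "root_set {a. norm a = 1 \<and> reflect a ` K = K \<and> reflect a ` L = L}" (is "root_set ?R")
    "closed {a. norm a = 1 \<and> reflect a ` K = K \<and> reflect a ` L = L}"
proof -
  show "root_set ?R"
    unfolding root_set_def
  proof (intro conjI ballI)
    show "norm u = 1" if "u \<in> ?R" for u using that by simp
    fix u w assume u: "u \<in> ?R" and w: "w \<in> ?R"
    have "reflect (reflect u w) ` X = reflect u ` (reflect w ` (reflect u ` X))" for X
      using u by (simp add: image_image reflect_conj)
    moreover have "norm (reflect u w) = 1"
        using orthogonal_transformation_norm[OF orthogonal_reflect, of u w] u w by simp
    ultimately show "reflect u w \<in> ?R" using u w by simp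
  qed
  have e: "reflect a ` X = X \<longleftrightarrow> (\<forall>x\<in>X. reflect a x \<in> X)" if "norm a = 1" for a and X :: "(real ^ 'n) set"
    using reflect_image_eqI[OF that, of X] by blast
  have cl: "closed {a. reflect a x \<in> X}" if "closed X" for X and x :: "real ^ 'n"
  proof -
    have "closed ((\<lambda>a. reflect a x) -` X)" using that unfolding reflect_def
        by (intro closed_vimage continuous_intros)
    then show ?thesis by (simp add: vimage_def)
  qed
  have "?R = sphere 0 1 \<inter> (\<Inter>x\<in>K. {a. reflect a x \<in> K}) \<inter> (\<Inter>x\<in>L. {a. reflect a x \<in> L})"
  proof (rule set_eqI)
    fix a
    show "a \<in> ?R \<longleftrightarrow> a \<in> sphere 0 1 \<inter> (\<Inter>x\<in>K. {a. reflect a x \<in> K}) \<inter> (\<Inter>x\<in>L. {a. reflect a x \<in> L})"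
      by (cases "norm a = 1") (simp_all add: e)
  qed
  then show "closed ?R" using cl assms by (auto intro!: closed_Int closed_INT)
qed

section \<open>Bodies invariant under orthogonal reflections with spanning normals\<close>

locale reflection_setting =
  fixes As :: "(real ^ 'n) set" and l :: real
  assumes unit: "a \<in> As \<Longrightarrow> norm a = 1" and spanning: "span As = UNIV" and l: "0 < l" "l < 1"
begin

definition body :: "(real ^ 'n) set \<Rightarrow> bool" where
  "body X \<longleftrightarrow> convex_body X \<and> (\<forall>a\<in>As. reflect a ` X = X)"

lemma bodyD: "body X \<Longrightarrow> compact X" "body X \<Longrightarrow> convex X" "body X \<Longrightarrow> a \<in> As \<Longrightarrow> reflect a ` X = X"
  by (auto simp: body_def convex_body_def)

text \<open>The finite root system is extracted from the common symmetries of this pair, and so may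
  be a different one for each pair of bodies.\<close>

lemma bodies_roots:
  assumes K: "body K" and L: "body L"
  obtains R u v where "L0_roots R u v l K L"
proof -
  let ?R = "{a. norm a = 1 \<and> reflect a ` K = K \<and> reflect a ` L = L}"
  note rs = symmetry_root_set[OF compact_imp_closed[OF bodyD(1)[OF K]] compact_imp_closed[OF bodyD(1)[OF L]]]
  obtain R where R: "R \<subseteq> ?R" "finite R" "root_set R" "span R = span ?R"
    using finite_root_subset[OF rs] by blast
  have "As \<subseteq> ?R" using unit bodyD(3)[OF K] bodyD(3)[OF L] by blast
  then have "span As \<subseteq> span ?R" by (rule span_mono)
  then have "span R = UNIV" using spanning R(4) by auto
  then obtain u v where sr: "simple_roots R u v" using simple_roots_exist[OF R(2,3)] by blast
  interpret simple_roots R u v by fact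
  have inv: "reflect (u i) ` K = K" "reflect (u i) ` L = L" for i
    using subsetD[OF R(1) uR[of i]] by simp_all
  have z: "0 \<in> interior K" "0 \<in> interior L"
    using K L convex_body_interior_zero[OF sr _ _ _ inv(1)] convex_body_interior_zero[OF sr _ _ _ inv(2)]
    by (simp_all add: body_def convex_body_def)
  have "L0_roots R u v l K L"
    using z inv bodyD[OF K] bodyD[OF L] l by unfold_locales auto
  then show thesis by (rule that)
qed

lemma body_pair: assumes "body K" "body L" shows "L0_pair l K L"
proof -
  obtain R u v where "L0_roots R u v l K L" by (rule bodies_roots[OF assms])
  then interpret L0_roots R u v l K L .
  show ?thesis by unfold_locales
qed

lemma body_inequality:
  assumes "body K" "body L"
  shows "measure lebesgue K powr (1 - l) * measure lebesgue L powr l \<le> measure lebesgue (L0_sum l K L)"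
proof -
  obtain R u v where "L0_roots R u v l K L" by (rule bodies_roots[OF assms])
  then interpret L0_roots R u v l K L .
  show ?thesis by (rule L0_measure(1))
qed

lemma body_equality_imp:
  assumes "body K" "body L"
    and eq: "measure lebesgue (L0_sum l K L) = measure lebesgue K powr (1 - l) * measure lebesgue L powr l"
  shows "decomposes (reflect ` As) K L"
proof -
  obtain R u v where "L0_roots R u v l K L" by (rule bodies_roots[OF assms(1,2)])
  then interpret L0_roots R u v l K L .
  obtain d where "L0_equality R u v l K L d" by (rule L0_equality[OF eq])
  then interpret L0_equality R u v l K L d .
  show ?thesis
    by (rule decomposition) (use unit bodyD(3)[OF assms(1)] bodyD(3)[OF assms(2)] in blast)+
qed

lemma fixed_zero: "(\<And>a. a \<in> As \<Longrightarrow> reflect a x = x) \<Longrightarrow> x = 0"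
proof -
  assume fx: "\<And>a. a \<in> As \<Longrightarrow> reflect a x = x"
  have xa: "x \<bullet> a = 0" if "a \<in> As" for a
  proof -
    have "(2 * (a \<bullet> x)) *\<^sub>R a = 0" using fx[OF that] by (simp add: reflect_def)
    moreover have "a \<noteq> 0" using unit[OF that] by auto
    ultimately show ?thesis by (simp add: inner_commute)
  qed
  have "x \<bullet> y = 0" if "y \<in> span As" for y
    using that
  proof (induction rule: span_induct_alt)
    case (step c a y)
    then show ?case using xa by (simp add: inner_add_right)
  qed simp
  then have "x \<bullet> x = 0" using spanning by simp
  then show "x = 0" by simp
qed

text \<open>The point nearest to the origin is unique, hence fixed by all the reflections, hence the
  origin.\<close>

lemma zero_in_invariant:
  assumes X: "compact X" "convex X" "X \<noteq> {}" and inv: "\<And>a. a \<in> As \<Longrightarrow> reflect a ` X = X"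
  shows "0 \<in> X"
proof -
  have cX: "closed X" using X(1) by (rule compact_imp_closed)
  define p where "p = closest_point X 0"
  have p: "p \<in> X" "\<And>y. y \<in> X \<Longrightarrow> dist 0 p \<le> dist 0 y"
    using closest_point_exists[OF cX X(3), of 0] by (auto simp: p_def)
  have "reflect a p = p" if a: "a \<in> As" for a
  proof -
    have "reflect a p \<in> X" using inv[OF a] p(1) by blast
    moreover have "norm (reflect a p) = norm p"
        using orthogonal_transformation_norm[OF orthogonal_reflect[OF unit[OF a]]] .
    ultimately show ?thesis
      unfolding p_def[symmetric]
      using closest_point_unique[OF X(2) cX, of "reflect a p" 0] p(2) by (simp add: p_def[symmetric])
  qed
  then have "p = 0" by (rule fixed_zero)
  then show ?thesis using p(1) by simp
qed

lemma translate_zero: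
  fixes X :: "(real ^ 'n) set"
  assumes X: "compact X" "X \<noteq> {}" and t: "(\<lambda>y. y + t) ` X = X" shows "t = 0"
proof -
  obtain y where y: "y \<in> X" "t \<bullet> y = support_function X t" by (rule sf_attained[OF X])
  have "y + t \<in> X" using t y(1) by blast
  then have "t \<bullet> (y + t) \<le> t \<bullet> y" unfolding y(2) by (rule sf_upper[OF X(1)])
  then have "t \<bullet> t \<le> 0" by (simp add: inner_add_right)
  then have "t \<bullet> t = 0" using inner_ge_zero[of t] by linarith
  then show "t = 0" by simp
qed

text \<open>Reflecting \<open>Y\<close> replaces the translation vector by its reflection. As a
  nonempty compact set equals none of its proper translates, the vector is fixed by all the
  reflections and so is 0.\<close>

lemma homothetic_dilate:
  assumes X: "compact X" "X \<noteq> {}" and inv: "\<And>a. a \<in> As \<Longrightarrow> reflect a ` X = X"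
      "\<And>a. a \<in> As \<Longrightarrow> reflect a ` Y = Y"
    and h: "homothetic X Y"
  obtains c where "0 < c" "Y = (\<lambda>x. c *\<^sub>R x) ` X"
proof -
  obtain c x where c: "0 < c" "Y = (\<lambda>y. c *\<^sub>R y + x) ` X" using h by (auto simp: homothetic_def)
  have "reflect a x = x" if a: "a \<in> As" for a
  proof -
    have "reflect a ` Y = (\<lambda>y. c *\<^sub>R y + reflect a x) ` (reflect a ` X)"
      unfolding c(2) image_image
          by (simp add: linear_add[OF linear_reflect] linear_cmul[OF linear_reflect])
    then have "(\<lambda>y. c *\<^sub>R y + x) ` X = (\<lambda>y. c *\<^sub>R y + reflect a x) ` X" using inv[OF a] c(2) by simp
    then have "(\<lambda>y. y + (reflect a x - x)) ` Y = (\<lambda>y. c *\<^sub>R y + reflect a x) ` X"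
      unfolding c(2) image_image by (simp add: algebra_simps)
    also have "\<dots> = Y" using \<open>(\<lambda>y. c *\<^sub>R y + x) ` X = _\<close> c(2) by simp
    finally have "(\<lambda>y. y + (reflect a x - x)) ` Y = Y" .
    moreover have "compact Y" unfolding c(2) using X(1)
        by (intro compact_continuous_image continuous_intros)
    moreover have "Y \<noteq> {}" using X(2) c(2) by simp
    ultimately have "reflect a x - x = 0" by (intro translate_zero)
    then show ?thesis by simp
  qed
  then have "x = 0" by (rule fixed_zero)
  then show thesis using that c by simp
qed

end

lemma sf_set_sum:
  fixes Xs :: "'i \<Rightarrow> (real ^ 'n) set"
  assumes I: "finite I" and X: "\<And>j. j \<in> I \<Longrightarrow> compact (Xs j)" "\<And>j. j \<in> I \<Longrightarrow> Xs j \<noteq> {}"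
    and S: "compact (\<Sum>j\<in>I. Xs j)"
  shows "support_function (\<Sum>j\<in>I. Xs j) w = (\<Sum>j\<in>I. support_function (Xs j) w)"
proof (rule antisym)
  have e: "(\<Sum>j\<in>I. Xs j) = {sum s I |s. \<forall>j\<in>I. s j \<in> Xs j}" by (rule set_sum_alt[OF I])
  have "\<exists>y. y \<in> Xs j \<and> w \<bullet> y = support_function (Xs j) w" if "j \<in> I" for j
    by (rule sf_attained[OF X[OF that]]) blast
  then obtain y where y: "\<And>j. j \<in> I \<Longrightarrow> y j \<in> Xs j" "\<And>j. j \<in> I \<Longrightarrow> w \<bullet> y j = support_function (Xs j) w"
      by metis
  have yS: "sum y I \<in> (\<Sum>j\<in>I. Xs j)" unfolding e using y(1) by blast
  have "(\<Sum>j\<in>I. support_function (Xs j) w) = w \<bullet> sum y I" using y(2) by (simp add: inner_sum_right)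
  then show "(\<Sum>j\<in>I. support_function (Xs j) w) \<le> support_function (\<Sum>j\<in>I. Xs j) w"
    using sf_upper[OF S yS, of w] by simp
  show "support_function (\<Sum>j\<in>I. Xs j) w \<le> (\<Sum>j\<in>I. support_function (Xs j) w)"
  proof (rule sf_least)
    show "(\<Sum>j\<in>I. Xs j) \<noteq> {}" using yS by auto
    fix z assume "z \<in> (\<Sum>j\<in>I. Xs j)"
    then obtain s where s: "z = sum s I" "\<forall>j\<in>I. s j \<in> Xs j" unfolding e by blast
    show "w \<bullet> z \<le> (\<Sum>j\<in>I. support_function (Xs j) w)"
      unfolding s(1) inner_sum_right using s(2) X(1) by (intro sum_mono sf_upper) auto
  qed
qed

section \<open>Direct sums and dilations of their summands\<close>

locale direct_sum_body = reflection_setting As l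
  for As :: "(real ^ 'n) set" and l :: real +
  fixes K :: "(real ^ 'n) set" and m :: nat and Ks :: "nat \<Rightarrow> (real ^ 'n) set"
  assumes bK: "body K" and K_sum: "K = (\<Sum>j\<in>{1..m}. Ks j)"
    and Ks: "\<And>j. j \<in> {1..m} \<Longrightarrow> compact (Ks j)" "\<And>j. j \<in> {1..m} \<Longrightarrow> convex (Ks j)"
        "\<And>j. j \<in> {1..m} \<Longrightarrow> Ks j \<noteq> {}"
    and Ks_inv: "\<And>j a. j \<in> {1..m} \<Longrightarrow> a \<in> As \<Longrightarrow> reflect a ` Ks j = Ks j"
    and dims: "(\<Sum>j\<in>{1..m}. aff_dim (Ks j)) = int CARD('n)"
begin

lemma zero_Ks: "j \<in> {1..m} \<Longrightarrow> 0 \<in> Ks j"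
  by (rule zero_in_invariant[OF Ks Ks_inv])

text \<open>The summands contain the origin, so their affine dimensions are dimensions of linear
  spans, and bases chosen inside them have \<open>CARD('n)\<close> vectors in total. Together they
  span because \<open>K\<close> has interior points; counting makes them disjoint and
  independent.\<close>

lemma basis:
  obtains B :: "(real ^ 'n) set" and J where "independent B" "span B = UNIV"
    "\<And>b. b \<in> B \<Longrightarrow> J b \<in> {1..m} \<and> b \<in> Ks (J b)" "\<And>j. j \<in> {1..m} \<Longrightarrow> Ks j \<subseteq> span {b\<in>B. J b = j}"
proof -
  have "\<exists>B. B \<subseteq> Ks j \<and> independent B \<and> Ks j \<subseteq> span B \<and> card B = dim (Ks j)" for j
    using basis_exists[of "Ks j"] by metis
  then obtain B where B: "\<And>j. B j \<subseteq> Ks j" "\<And>j. independent (B j)" "\<And>j. Ks j \<subseteq> span (B j)"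
      "\<And>j. card (B j) = dim (Ks j)"
    by metis
  have finB: "finite (B j)" for j using B(2) independent_imp_finite by blast
  define U where "U = (\<Union>j\<in>{1..m}. B j)"
  have finU: "finite U" using finB by (simp add: U_def)
  have cardB: "(\<Sum>j\<in>{1..m}. card (B j)) = CARD('n)"
  proof -
    have "int (card (B j)) = aff_dim (Ks j)" if "j \<in> {1..m}" for j
      using aff_dim_zero[of "Ks j"] zero_Ks[OF that] B(4)[of j] hull_inc[of 0 "Ks j"] by simp
    then have "int (\<Sum>j\<in>{1..m}. card (B j)) = int CARD('n)" using dims by simp
    then show ?thesis by linarith
  qed
  have "K \<subseteq> span U"
  proof
    fix x assume "x \<in> K"
    then obtain s where s: "x = sum s {1..m}" "\<forall>j\<in>{1..m}. s j \<in> Ks j" using set_sum_alt[of "{1..m}" Ks]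
        unfolding K_sum by auto
    have "s j \<in> span U" if "j \<in> {1..m}" for j
    proof -
      have "s j \<in> span (B j)" using bspec[OF s(2) that] B(3)[of j] by blast
      moreover have "span (B j) \<subseteq> span U" using that by (intro span_mono) (auto simp: U_def)
      ultimately show ?thesis by blast
    qed
    then show "x \<in> span U" unfolding s(1) by (intro span_sum)
  qed
  moreover have "span K = UNIV"
  proof -
    have iK: "interior K \<noteq> {}" using bK by (simp add: body_def convex_body_def)
    then have "affine hull K = UNIV" by (rule affine_hull_nonempty_interior)
    then show ?thesis using affine_hull_subset_span[of K] by auto
  qed
  ultimately have spU: "span U = UNIV" by (metis span_minimal subspace_span top.extremum_uniqueI)
  have cU: "CARD('n) \<le> card U"
    using dim_le_card[of UNIV U] spU finU by simp
  have indU: "independent U"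
  proof (rule card_le_dim_spanning[of _ UNIV])
    have "card U \<le> (\<Sum>j\<in>{1..m}. card (B j))" unfolding U_def by (rule card_UN_le) simp
    then show "card U \<le> dim (UNIV :: (real ^ 'n) set)" using cardB by simp
  qed (use spU finU in auto)
  have disj: "i = j" if "i \<in> {1..m}" "j \<in> {1..m}" "b \<in> B i" "b \<in> B j" for i j b
  proof (rule ccontr)
    assume ne: "i \<noteq> j"
    \<comment> \<open>If \<open>b\<close> occurred in two of the bases, removing it from one would
      leave a spanning union with fewer than \<open>CARD('n)\<close> vectors.\<close>
    define B' where "B' k = (if k = i then B i - {b} else B k)" for k
    have "U \<subseteq> (\<Union>k\<in>{1..m}. B' k)"
    proof
      fix x assume "x \<in> U"
      then obtain k where k: "k \<in> {1..m}" "x \<in> B k" by (auto simp: U_def)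
      show "x \<in> (\<Union>k\<in>{1..m}. B' k)"
      proof (cases "x = b")
        case True
        then have "x \<in> B' j" using that(4) ne by (simp add: B'_def)
        then show ?thesis using that(2) by blast
      next
        case False
        then have "x \<in> B' k" using k by (auto simp: B'_def)
        then show ?thesis using k by blast
      qed
    qed
    then have "card U \<le> card (\<Union>k\<in>{1..m}. B' k)" using finB by (intro card_mono) (auto simp: B'_def)
    also have "\<dots> \<le> (\<Sum>k\<in>{1..m}. card (B' k))" by (rule card_UN_le) simp
    also have "\<dots> < (\<Sum>k\<in>{1..m}. card (B k))"
    proof (rule sum_strict_mono_ex1)
      show "\<forall>k\<in>{1..m}. card (B' k) \<le> card (B k)" using finB by (auto simp: B'_def intro!: card_mono)
      show "\<exists>k\<in>{1..m}. card (B' k) < card (B k)"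
        using that card_Diff1_less[OF finB that(3)]
            by (intro bexI[of _ i]) (simp_all only: B'_def simp_thms if_True)
    qed simp
    finally show False using cardB cU by simp
  qed
  define J where "J b = (SOME j. j \<in> {1..m} \<and> b \<in> B j)" for b
  have J: "J b \<in> {1..m} \<and> b \<in> B (J b)" if "b \<in> U" for b
    unfolding J_def by (rule someI_ex) (use that in \<open>auto simp: U_def\<close>)
  show thesis
  proof (rule that[OF indU spU])
    show "J b \<in> {1..m} \<and> b \<in> Ks (J b)" if "b \<in> U" for b using J[OF that] B(1) by blast
    fix j assume j: "j \<in> {1..m}"
    have "B j \<subseteq> {b\<in>U. J b = j}"
    proof
      fix b assume b: "b \<in> B j"
      then have bU: "b \<in> U" using j by (auto simp: U_def)
      have "J b = j" using disj[of "J b" j b] J[OF bU] j b by blast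
      then show "b \<in> {b\<in>U. J b = j}" using bU by simp
    qed
    then show "Ks j \<subseteq> span {b\<in>U. J b = j}" using B(3)[of j] span_mono by blast
  qed
qed

lemma linear_ext:
  assumes f: "linear f" and g: "linear g" and eq: "\<And>j y. j \<in> {1..m} \<Longrightarrow> y \<in> Ks j \<Longrightarrow> f y = g y"
  shows "f x = (g x :: real ^ 'n)"
proof -
  obtain B J where B: "independent B" "span B = UNIV"
    "\<And>b. b \<in> B \<Longrightarrow> J b \<in> {1..m} \<and> b \<in> Ks (J b)" "\<And>j. j \<in> {1..m} \<Longrightarrow> Ks j \<subseteq> span {b\<in>B. J b = j}"
    by (rule basis) blast
  have "x \<in> span B" using B(2) by simp
  then show ?thesis using linear_eq_on_span[OF f g, of B x] eq B(3) by blast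
qed

lemma T_exists: "\<exists>f :: real ^ 'n \<Rightarrow> real ^ 'n. linear f \<and> (\<forall>j\<in>{1..m}. \<forall>y\<in>Ks j. f y = e j *\<^sub>R y)"
proof -
  obtain B J where B: "independent B" "span B = UNIV"
    "\<And>b. b \<in> B \<Longrightarrow> J b \<in> {1..m} \<and> b \<in> Ks (J b)" "\<And>j. j \<in> {1..m} \<Longrightarrow> Ks j \<subseteq> span {b\<in>B. J b = j}"
    by (rule basis) blast
  obtain f :: "real ^ 'n \<Rightarrow> real ^ 'n" where f: "linear f" "\<And>b. b \<in> B \<Longrightarrow> f b = e (J b) *\<^sub>R b"
    using linear_independent_extend[OF B(1), of "\<lambda>b. e (J b) *\<^sub>R b"] by blast
  have "f y = e j *\<^sub>R y" if j: "j \<in> {1..m}" and y: "y \<in> Ks j" for j y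
    by (rule linear_eq_on_span[OF f(1) linear_scale_self, of "{b\<in>B. J b = j}"]) (use f(2) B(4)[OF j] y in auto)
  then show ?thesis using f(1) by blast
qed

definition T :: "(nat \<Rightarrow> real) \<Rightarrow> real ^ 'n \<Rightarrow> real ^ 'n" where
  "T e = (SOME f. linear f \<and> (\<forall>j\<in>{1..m}. \<forall>y\<in>Ks j. f y = e j *\<^sub>R y))"

lemma T: "linear (T e)" "j \<in> {1..m} \<Longrightarrow> y \<in> Ks j \<Longrightarrow> T e y = e j *\<^sub>R y"
proof -
  have "linear (T e) \<and> (\<forall>j\<in>{1..m}. \<forall>y\<in>Ks j. T e y = e j *\<^sub>R y)"
    unfolding T_def by (rule someI_ex[OF T_exists])
  note t = this[THEN conjunct1] this[THEN conjunct2]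
  show "linear (T e)" by (rule t(1))
  show "T e y = e j *\<^sub>R y" if "j \<in> {1..m}" "y \<in> Ks j" using bspec[OF bspec[OF t(2) that(1)] that(2)] .
qed

lemma T_mult: "T e (T e' x) = T (\<lambda>j. e j * e' j) x"
proof (rule linear_ext[where f = "\<lambda>x. T e (T e' x)"])
  show "linear (\<lambda>x. T e (T e' x))" using linear_compose[OF T(1) T(1), of e e'] by (simp add: o_def)
  show "linear (T (\<lambda>j. e j * e' j))" by (rule T(1))
  show "T e (T e' y) = T (\<lambda>j. e j * e' j) y" if "j \<in> {1..m}" "y \<in> Ks j" for j y
    using T(2)[OF that] linear_cmul[OF T(1), of e] by (simp add: mult.commute)
qed

lemma T_one: "(\<And>j. j \<in> {1..m} \<Longrightarrow> e j = 1) \<Longrightarrow> T e x = x"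
  by (rule linear_ext[OF T(1) linear_ident]) (simp add: T(2))

lemma T_inverse: "(\<And>j. 0 < e j) \<Longrightarrow> T e (T (\<lambda>j. inverse (e j)) x) = x"
    "(\<And>j. 0 < e j) \<Longrightarrow> T (\<lambda>j. inverse (e j)) (T e x) = x"
  unfolding T_mult by (rule T_one; simp add: less_imp_neq[THEN not_sym])+

lemma T_reflect: "a \<in> As \<Longrightarrow> reflect a (T e x) = T e (reflect a x)"
proof -
  assume a: "a \<in> As"
  show "reflect a (T e x) = T e (reflect a x)"
  proof (rule linear_ext[where f = "\<lambda>x. reflect a (T e x)" and g = "\<lambda>x. T e (reflect a x)"])
    show "linear (\<lambda>x. reflect a (T e x))" using linear_compose[OF T(1) linear_reflect]
        by (simp add: o_def)
    show "linear (\<lambda>x. T e (reflect a x))" using linear_compose[OF linear_reflect T(1)]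
        by (simp add: o_def)
    show "reflect a (T e y) = T e (reflect a y)" if "j \<in> {1..m}" "y \<in> Ks j" for j y
    proof -
      have "reflect a y \<in> Ks j" using Ks_inv[OF that(1) a] that(2) by blast
      then show ?thesis using T(2)[OF that(1)] that(2) linear_cmul[OF linear_reflect] by simp
    qed
  qed
qed

lemma T_image: "T e ` K = (\<Sum>j\<in>{1..m}. (\<lambda>x. e j *\<^sub>R x) ` Ks j)"
proof -
  have "T e ` K = (\<Sum>j\<in>{1..m}. T e ` Ks j)" by (subst (1) K_sum) (rule set_sum_image[OF T(1)])
  also have "\<dots> = (\<Sum>j\<in>{1..m}. (\<lambda>x. e j *\<^sub>R x) ` Ks j)" by (intro sum.cong image_cong) (auto simp: T(2))
  finally show ?thesis .
qed

lemma T_body: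
  assumes e: "\<And>j. 0 < e j" shows "body (T e ` K)"
  unfolding body_def convex_body_def
proof (intro conjI ballI)
  show "compact (T e ` K)"
    using bodyD(1)[OF bK] T(1)
        by (intro compact_continuous_image linear_continuous_on) (auto simp: linear_conv_bounded_linear)
  show "convex (T e ` K)" by (rule convex_linear_image[OF T(1) bodyD(2)[OF bK]])
  have "inj (T e)" by (rule inj_on_inverseI[of _ "T (\<lambda>j. inverse (e j))"]) (rule T_inverse(2)[OF e])
  then have "interior (T e ` K) = T e ` interior K" by (rule interior_injective_linear_image[OF T(1)])
  then show "interior (T e ` K) \<noteq> {}" using bK by (simp add: body_def convex_body_def)
  show "reflect a ` T e ` K = T e ` K" if a: "a \<in> As" for a
  proof -
    have "reflect a ` T e ` K = T e ` (reflect a ` K)" by (simp add: image_image T_reflect[OF a])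
    then show ?thesis using bodyD(3)[OF bK a] by simp
  qed
qed

text \<open>Each component of \<open>x\<close> is tested separately. A normal \<open>w\<close>
  pulled back along the projection \<open>P j\<close> sees only the \<open>j\<close>-th summand, so
  the support values of the two bodies are \<open>h\<close> and \<open>e j * h\<close>, and the
  bound is \<open>e j powr l * h\<close>.\<close>

lemma L0_subset:
  assumes e: "\<And>j. 0 < e j"
  shows "L0_sum l K (T e ` K) \<subseteq> T (\<lambda>j. e j powr l) ` K"
proof
  fix x assume x: "x \<in> L0_sum l K (T e ` K)"
  interpret L0_pair l K "T e ` K" by (rule body_pair[OF bK T_body[OF e]])
  define P where "P j = T (\<lambda>k. if k = j then 1 else 0)" for j
  have P: "linear (P j)" "\<And>k y. k \<in> {1..m} \<Longrightarrow> y \<in> Ks k \<Longrightarrow> P j y = (if k = j then y else 0)" for j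
    using T unfolding P_def by auto
  have sumP: "(\<Sum>j\<in>{1..m}. P j x) = x"
  proof (rule linear_ext)
    show "linear (\<lambda>x. \<Sum>j\<in>{1..m}. P j x)" using P(1) by (intro linear_compose_sum) auto
    show "linear (\<lambda>x :: real ^ 'n. x)" by (rule linear_ident)
    fix k y assume "k \<in> {1..m}" "y \<in> Ks k"
    then show "(\<Sum>j\<in>{1..m}. P j y) = y" using P(2)[of k y] by simp
  qed
  have mem: "P j x \<in> (\<lambda>x. (e j powr l) *\<^sub>R x) ` Ks j" if j: "j \<in> {1..m}" for j
  proof (rule ccontr)
    assume nm: "P j x \<notin> (\<lambda>x. (e j powr l) *\<^sub>R x) ` Ks j"
    have "compact ((\<lambda>x. (e j powr l) *\<^sub>R x) ` Ks j)" "convex ((\<lambda>x. (e j powr l) *\<^sub>R x) ` Ks j)"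
        "(\<lambda>x. (e j powr l) *\<^sub>R x) ` Ks j \<noteq> {}"
      using Ks[OF j] by (auto intro: compact_scaling convex_scaling)
    then obtain w where w: "support_function ((\<lambda>x. (e j powr l) *\<^sub>R x) ` Ks j) w < w \<bullet> P j x"
      using sf_separate nm by metis
    define h where "h = support_function (Ks j) w"
    have h0: "0 \<le> h" unfolding h_def using sf_upper[OF Ks(1)[OF j] zero_Ks[OF j], of w] by simp
    have sc: "support_function ((\<lambda>x. c *\<^sub>R x) ` X) y = c * support_function X y" if "0 \<le> c" "compact X"
        "X \<noteq> {}" for c X and y :: "real ^ 'n"
    proof -
      have "support_function ((\<lambda>x. c *\<^sub>R x) ` X) y = support_function X (c *\<^sub>R y)"
          by (rule sf_image_adjoint) simp
      then show ?thesis using sf_scale[OF that(2,3,1)] by simp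
    qed
    define z where "z = adjoint (P j) w"
    have z: "y \<bullet> z = P j y \<bullet> w" for y unfolding z_def by (rule adjoint_works[OF P(1)])
    have sfz: "support_function (Ks k) z = (if k = j then h else 0)" if k: "k \<in> {1..m}" for k
    proof -
      have "support_function (Ks k) z = (SUP y\<in>Ks k. (if k = j then w \<bullet> y else 0))"
        unfolding support_function_def using z P(2)[OF k] by (intro SUP_cong) (auto simp: inner_commute)
      then show ?thesis using Ks(3)[OF k] by (simp add: h_def support_function_def)
    qed
    have hK: "support_function K z = h"
    proof -
      have "support_function K z = (\<Sum>k\<in>{1..m}. support_function (Ks k) z)"
        unfolding K_sum by (rule sf_set_sum) (use Ks bodyD(1)[OF bK, unfolded K_sum] in auto)
      also have "\<dots> = (\<Sum>k\<in>{1..m}. if k = j then h else 0)" using sfz by (intro sum.cong) auto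
      finally show ?thesis using j by simp
    qed
    have hL: "support_function (T e ` K) z = e j * h"
    proof -
      have "support_function (T e ` K) z = (\<Sum>k\<in>{1..m}. support_function ((\<lambda>x. e k *\<^sub>R x) ` Ks k) z)"
        unfolding T_image
            by (rule sf_set_sum) (use Ks L(1)[unfolded T_image] in \<open>auto intro: compact_scaling\<close>)
      also have "\<dots> = (\<Sum>k\<in>{1..m}. if k = j then e j * h else 0)"
        using sc Ks sfz e by (intro sum.cong) (auto simp: less_imp_le)
      finally show ?thesis using j by simp
    qed
    have "w \<bullet> P j x = x \<bullet> z" using z by (simp add: inner_commute)
    also have "\<dots> \<le> L0_bound l K (T e ` K) z" using x L0_iff by blast
    also have "\<dots> = e j powr l * h"
      unfolding L0_bound_def hK hL using powr_mean_scale[of 1 "e j" h l] h0 e[of j]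
          by (simp add: mult.commute less_imp_le)
    also have "\<dots> = support_function ((\<lambda>x. (e j powr l) *\<^sub>R x) ` Ks j) w"
      using sc[of "e j powr l" "Ks j" w] Ks[OF j] by (simp add: h_def)
    finally show False using w by simp
  qed
  have "x \<in> {sum s {1..m} |s. \<forall>j\<in>{1..m}. s j \<in> (\<lambda>x. (e j powr l) *\<^sub>R x) ` Ks j}"
    using mem sumP by (intro CollectI exI[of _ "\<lambda>j. P j x"]) auto
  then show "x \<in> T (\<lambda>j. e j powr l) ` K" unfolding T_image by (subst set_sum_alt) auto
qed

text \<open>Let \<open>dt e\<close> be the volume factor of \<open>T e\<close>. With
  \<open>L0_subset\<close>, the general inequality for \<open>e\<close> gives
  \<open>dt e powr l \<le> dt (\<lambda>j. e j powr l)\<close>. Applied to the inverse factors it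
  gives the opposite bound, because the factors of \<open>T e\<close> and its inverse multiply to
  1.\<close>

lemma T_measure:
  assumes e: "\<And>j. 0 < e j"
  shows "measure lebesgue (L0_sum l K (T e ` K)) \<le> measure lebesgue K powr (1 - l) * measure lebesgue (T e ` K) powr l"
proof -
  have ex: "\<exists>c>0. \<forall>A\<in>sets borel. measure lebesgue (T e ` A) = c * measure lebesgue A"
      if e: "\<And>j. 0 < e j" for e
    by (rule linear_image_measure_lebesgue[OF T(1) T(1) T_inverse(1)[of e, OF e] T_inverse(2)[of e, OF e]]) blast
  define dt where "dt e = (SOME c. 0 < c \<and> (\<forall>A\<in>sets borel. measure lebesgue (T e ` A) = c * measure lebesgue A))"
      for e
  have dt: "0 < dt e" "A \<in> sets borel \<Longrightarrow> measure lebesgue (T e ` A) = dt e * measure lebesgue A"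
      if e: "\<And>j. 0 < e j" for e A
  proof -
    have "0 < dt e \<and> (\<forall>A\<in>sets borel. measure lebesgue (T e ` A) = dt e * measure lebesgue A)"
      unfolding dt_def by (rule someI_ex[OF ex[of e, OF e]])
    then show "0 < dt e" "A \<in> sets borel \<Longrightarrow> measure lebesgue (T e ` A) = dt e * measure lebesgue A"
        by auto
  qed
  have KX: "K \<in> sets borel" "T e ` K \<in> sets borel" if "\<And>j. 0 < e j" for e
    using bodyD(1)[OF bK] bodyD(1)[OF T_body[OF that]] by (auto intro: borel_compact)
  have Vpos: "0 < measure lebesgue K"
  proof -
    have "\<not> negligible K"
        using bK open_not_negligible[of "interior K"] negligible_subset[OF _ interior_subset[of K]]
      by (auto simp: body_def convex_body_def)
    then show ?thesis using bodyD(1)[OF bK]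
        by (simp add: negligible_iff_measure lmeasurable_compact zero_less_measure_iff)
  qed
  have inv: "dt e * dt (\<lambda>j. inverse (e j)) = 1" if e: "\<And>j. 0 < e j" for e
  proof -
    have e': "\<And>j. 0 < inverse (e j)" using e by simp
    have "T e ` (T (\<lambda>j. inverse (e j)) ` K) = K" by (simp add: image_image T_inverse[OF e])
    then have "measure lebesgue K = dt e * (dt (\<lambda>j. inverse (e j)) * measure lebesgue K)"
      using dt(2)[of e, OF e KX(2)[of "\<lambda>j. inverse (e j)", OF e']] dt(2)[of "\<lambda>j. inverse (e j)", OF e' KX(1)[of e, OF e]]
          by simp
    then show ?thesis using Vpos by simp
  qed
  have sub: "measure lebesgue (L0_sum l K (T e ` K)) \<le> dt (\<lambda>j. e j powr l) * measure lebesgue K"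
      if e: "\<And>j. 0 < e j" for e
  proof -
    interpret L0_pair l K "T e ` K" by (rule body_pair[OF bK T_body[OF e]])
    have el: "0 < e j powr l" for j using e[of j] by simp
    have "measure lebesgue (L0_sum l K (T e ` K)) \<le> measure lebesgue (T (\<lambda>j. e j powr l) ` K)"
      using L0_subset[of e, OF e] L0_compact bodyD(1)[OF T_body[of "\<lambda>j. e j powr l", OF el]]
      by (intro measure_mono_fmeasurable fmeasurableD lmeasurable_compact)
    then show ?thesis using dt(2)[of "\<lambda>j. e j powr l", OF el KX(1)[OF e]] by simp
  qed
  have low: "dt e powr l \<le> dt (\<lambda>j. e j powr l)" if e: "\<And>j. 0 < e j" for e
  proof -
    have "measure lebesgue K powr (1 - l) * (dt e * measure lebesgue K) powr l \<le> dt (\<lambda>j. e j powr l) * measure lebesgue K"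
      using body_inequality[OF bK T_body[of e, OF e]] sub[of e, OF e] dt(2)[of e, OF e KX(1)[OF e]]
          by simp
    moreover have "measure lebesgue K powr (1 - l) * (dt e * measure lebesgue K) powr l = dt e powr l * measure lebesgue K"
      using powr_mean_scale[of 1 "dt e" "measure lebesgue K" l] dt(1)[of e, OF e]
          by (simp add: mult.commute less_imp_le)
    ultimately show ?thesis using Vpos by simp
  qed
  let ?i = "\<lambda>j. inverse (e j)"
  have i: "0 < ?i j" for j using e[of j] by simp
  have el: "0 < e j powr l" for j using e[of j] by simp
  have "(\<lambda>j. ?i j powr l) = (\<lambda>j. inverse (e j powr l))" using e by (simp add: inverse_powr less_imp_le)
  then have "dt ?i powr l * dt (\<lambda>j. e j powr l) \<le> 1"
    using low[of ?i, OF i] inv[of "\<lambda>j. e j powr l", OF el] dt(1)[of "\<lambda>j. e j powr l", OF el]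
    by (metis mult.commute mult_right_mono order_less_imp_le)
  moreover have "dt ?i powr l * dt e powr l = 1"
    using inv[of e, OF e] dt(1)[of e, OF e] dt(1)[of ?i, OF i]
        by (simp add: powr_mult[symmetric] mult.commute less_imp_le)
  moreover have "0 < dt ?i powr l" using dt(1)[of ?i, OF i] by simp
  ultimately have "dt (\<lambda>j. e j powr l) \<le> dt e powr l" by (metis mult_le_cancel_left_pos)
  then have "dt (\<lambda>j. e j powr l) * measure lebesgue K \<le> dt e powr l * measure lebesgue K"
      by (intro mult_right_mono) auto
  also have "\<dots> = measure lebesgue K powr (1 - l) * measure lebesgue (T e ` K) powr l"
    unfolding dt(2)[of e, OF e KX(1)[OF e]]
    using powr_mean_scale[of 1 "dt e" "measure lebesgue K" l] dt(1)[of e, OF e]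
        by (simp add: mult.commute less_imp_le)
  finally show ?thesis using sub[of e, OF e] by simp
qed

end

context reflection_setting
begin

lemma body_equality_if:
  assumes K: "body K" and L: "body L" and dec: "decomposes (reflect ` As) K L"
  shows "measure lebesgue (L0_sum l K L) = measure lebesgue K powr (1 - l) * measure lebesgue L powr l"
proof (rule antisym)
  obtain m Ks Ls where D: "K = (\<Sum>j\<in>{1..m::nat}. Ks j)" "L = (\<Sum>j\<in>{1..m}. Ls j)"
    "\<forall>j\<in>{1..m}. compact (Ks j) \<and> convex (Ks j) \<and> aff_dim (Ks j) \<ge> 1
        \<and> compact (Ls j) \<and> convex (Ls j) \<and> aff_dim (Ls j) \<ge> 1
        \<and> (\<forall>f\<in>reflect ` As. f ` Ks j = Ks j \<and> f ` Ls j = Ls j) \<and> homothetic (Ks j) (Ls j)"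
    "(\<Sum>j\<in>{1..m}. aff_dim (Ks j)) = int CARD('n)"
    using dec unfolding decomposes_def by (elim exE conjE) (rule that)
  have kp: "compact (Ks j)" "convex (Ks j)" "Ks j \<noteq> {}" "\<And>a. a \<in> As \<Longrightarrow> reflect a ` Ks j = Ks j"
      "\<And>a. a \<in> As \<Longrightarrow> reflect a ` Ls j = Ls j"
    "homothetic (Ks j) (Ls j)" if "j \<in> {1..m}" for j
    using bspec[OF D(3) that] by auto
  interpret direct_sum_body As l K m Ks
    by unfold_locales (use K D kp in auto)
  have "\<exists>c>0. Ls j = (\<lambda>x. c *\<^sub>R x) ` Ks j" if j: "j \<in> {1..m}" for j
    by (rule homothetic_dilate[OF kp(1,3-6)[OF j]]) blast+
  then obtain c0 where c0: "\<And>j. j \<in> {1..m} \<Longrightarrow> 0 < c0 j \<and> Ls j = (\<lambda>x. c0 j *\<^sub>R x) ` Ks j" by metis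
  \<comment> \<open>The value 1 outside the index range only serves to make all factors positive, as
    the lemmas on \<open>T\<close> demand.\<close>
  define c where "c j = (if j \<in> {1..m} then c0 j else 1)" for j
  have c: "0 < c j" for j using c0 by (simp add: c_def)
  have "L = T c ` K" unfolding D(2) T_image using c0 by (intro sum.cong) (auto simp: c_def)
  then show "measure lebesgue (L0_sum l K L) \<le> measure lebesgue K powr (1 - l) * measure lebesgue L powr l"
    using T_measure[of c, OF c] by simp
  show "measure lebesgue K powr (1 - l) * measure lebesgue L powr l \<le> measure lebesgue (L0_sum l K L)"
    by (rule body_inequality[OF K L])
qed

end

section \<open>Reduction to orthogonal reflections\<close>

text \<open>Gram-Schmidt for the form \<open>S\<close>: fewer than \<open>CARD('n)\<close> vectors
  \<open>f w\<close> that represent \<open>S\<close> at the members of \<open>B\<close> leave a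
  common orthogonal vector \<open>u0\<close>, which positivity allows to normalise.\<close>

lemma orthonormal_family:
  fixes S :: "real ^ 'n \<Rightarrow> real ^ 'n \<Rightarrow> real"
  assumes lin: "\<And>w. linear (\<lambda>x. S x w)" and sym: "\<And>x w. S x w = S w x" and pos: "\<And>x. x \<noteq> 0 \<Longrightarrow> 0 < S x x"
  obtains b :: "'n \<Rightarrow> real ^ 'n" where "\<And>i j. S (b i) (b j) = (if i = j then 1 else 0)"
proof -
  have "\<exists>B. finite B \<and> card B = k \<and> (\<forall>x\<in>B. \<forall>y\<in>B. S x y = (if x = y then 1 else 0))" if "k \<le> CARD('n)"
      for k
    using that
  proof (induction k)
    case 0
    then show ?case by (intro exI[of _ "{}"]) auto
  next
    case (Suc k)
    then obtain B where B: "finite B" "card B = k"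
        "\<And>x y. x \<in> B \<Longrightarrow> y \<in> B \<Longrightarrow> S x y = (if x = y then 1 else 0)" by auto
    define f where "f w = adjoint (\<lambda>x. S x w) 1" for w
    have f: "x \<bullet> f w = S x w" for x w
      using adjoint_works[OF lin, of x w 1] by (simp add: f_def)
    have "dim (f ` B) \<le> card (f ` B)" using B(1) by (intro dim_le_card') auto
    also have "\<dots> \<le> k" using card_image_le[OF B(1), of f] B(2) by simp
    also have "k < DIM(real ^ 'n)" using Suc.prems by simp
    finally obtain u0 where u0: "u0 \<noteq> 0" "\<And>y. y \<in> span (f ` B) \<Longrightarrow> orthogonal u0 y"
      using orthogonal_to_subspace_exists by metis
    have Su0: "S u0 w = 0" if "w \<in> B" for w
      using u0(2)[of "f w"] that f[of u0 w] by (simp add: span_base orthogonal_def)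
    define u where "u = (1 / sqrt (S u0 u0)) *\<^sub>R u0"
    have sc: "S (c *\<^sub>R x) w = c * S x w" for c x w using linear_cmul[OF lin[of w], of c x] by simp
    have sc2: "S x (c *\<^sub>R w) = c * S x w" for c x w using sc[of c w x] sym by metis
    have uu: "S u u = 1" using pos[OF u0(1)] by (simp add: u_def sc sc2)
    have uw: "S u w = 0" "S w u = 0" if "w \<in> B" for w
    proof -
      show "S u w = 0" using Su0[OF that] by (simp add: u_def sc)
      then show "S w u = 0" using sym by metis
    qed
    have "u \<notin> B" using uu uw by force
    then have "card (insert u B) = Suc k" using B by simp
    moreover have "S x y = (if x = y then 1 else 0)" if xy: "x \<in> insert u B" "y \<in> insert u B" for x y
    proof -
      consider "x = u" "y = u" | "x = u" "y \<in> B" | "x \<in> B" "y = u" | "x \<in> B" "y \<in> B" using xy by blast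
      then show ?thesis
      proof cases
        case 1 then show ?thesis using uu by simp
      next
        case 2 then have "x \<noteq> y" using \<open>u \<notin> B\<close> by auto
        then show ?thesis using uw(1) 2 by simp
      next
        case 3 then have "x \<noteq> y" using \<open>u \<notin> B\<close> by auto
        then show ?thesis using uw(2) 3 by simp
      next
        case 4 then show ?thesis using B(3) by simp
      qed
    qed
    ultimately show ?case using B(1) by (intro exI[of _ "insert u B"]) simp
  qed
  from this[of "CARD('n)"] obtain B where B: "finite B" "card B = CARD('n)"
      "\<And>x y. x \<in> B \<Longrightarrow> y \<in> B \<Longrightarrow> S x y = (if x = y then 1 else 0)"
    by auto
  obtain b where b: "bij_betw b (UNIV :: 'n set) B" using finite_same_card_bij[of "UNIV :: 'n set" B] B
      by auto
  then have "b i \<in> B" "b i = b j \<longleftrightarrow> i = j" for i j by (auto simp: bij_betw_def inj_on_def)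
  then show thesis using that[of b] B(3) by simp
qed

text \<open>The second moment form of \<open>K\<close>. Its arguments act as functionals on points
  of \<open>K\<close>, so a linear map of \<open>K\<close> acts on the form through its
  adjoint.\<close>

definition inertia :: "(real ^ 'n) set \<Rightarrow> real ^ 'n \<Rightarrow> real ^ 'n \<Rightarrow> real" where
  "inertia K x w = (LINT z|lborel. indicator K z * ((z \<bullet> x) * (z \<bullet> w)))"

lemma inertia_integrable:
  fixes K :: "(real ^ 'n) set"
  assumes "compact K" shows "integrable lborel (\<lambda>z. indicator K z * ((z \<bullet> x) * (z \<bullet> w)))"
  using borel_integrable_compact[OF assms, of "\<lambda>z. (z \<bullet> x) * (z \<bullet> w)"]
  by (simp add: continuous_on_inner continuous_on_mult continuous_on_id continuous_on_const)

lemma inertia_linear: "compact K \<Longrightarrow> linear (\<lambda>x. inertia K x w)"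
proof (rule linearI)
  assume K: "compact K"
  show "inertia K (x + y) w = inertia K x w + inertia K y w" for x y
    unfolding inertia_def inner_add_right distrib_right distrib_left
    by (rule Bochner_Integration.integral_add) (rule inertia_integrable[OF K])+
  show "inertia K (c *\<^sub>R x) w = c *\<^sub>R inertia K x w" for c x
    unfolding inertia_def by (simp add: mult.left_commute mult.assoc)
qed

lemma inertia_sym: "inertia K x w = inertia K w x"
  by (simp add: inertia_def mult.commute)

text \<open>If the integral vanished, \<open>K\<close> would lie in a hyperplane up to a null set,
  contrary to its interior points.\<close>

lemma inertia_pos:
  assumes K: "compact K" "interior K \<noteq> {}" and x: "x \<noteq> 0"
  shows "0 < inertia K x x"
proof -
  have nn: "0 \<le> inertia K x x" unfolding inertia_def by (intro integral_nonneg_AE) auto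
  have "inertia K x x \<noteq> 0"
  proof
    assume "inertia K x x = 0"
    then have "AE z in lborel. indicator K z * ((z \<bullet> x) * (z \<bullet> x)) = (0::real)"
      unfolding inertia_def using integral_nonneg_eq_0_iff_AE[OF inertia_integrable[OF K(1)], of x x]
          by simp
    then have "AE z in lborel. z \<notin> K - {z. x \<bullet> z = 0}"
      by eventually_elim (auto simp: indicator_def inner_commute split: if_splits)
    moreover have "K - {z. x \<bullet> z = 0} \<in> sets borel"
      using K(1) closed_hyperplane[of x 0] by (auto intro: borel_compact)
    ultimately have "K - {z. x \<bullet> z = 0} \<in> null_sets lborel"
      by (subst AE_iff_null_sets) auto
    then have "negligible (K - {z. x \<bullet> z = 0})"
      by (simp add: negligible_iff_null_sets null_sets_completionI)
    then have "negligible ((K - {z. x \<bullet> z = 0}) \<union> {z. x \<bullet> z = 0})"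
      using negligible_hyperplane[of x 0] x by (intro negligible_Un) auto
    then have "negligible (interior K)"
      using interior_subset[of K] by (rule_tac negligible_subset) auto
    then show False using K(2) open_not_negligible[of "interior K"] by simp
  qed
  then show ?thesis using nn by simp
qed

text \<open>Applying the map twice shows that the square of its volume factor is 1.\<close>

lemma involution_distr:
  fixes f :: "'a::euclidean_space \<Rightarrow> 'a"
  assumes f: "linear f" and ff: "\<And>x. f (f x) = x"
  shows "distr lborel borel f = lborel"
proof -
  obtain c where c: "0 < c" "\<And>A. A \<in> sets borel \<Longrightarrow> f ` A \<in> sets borel"
    "\<And>A. A \<in> sets borel \<Longrightarrow> emeasure lborel (f ` A) = ennreal c * emeasure lborel A"
    by (rule linear_image_measure[OF f f ff ff]) blast
  have im: "f ` A = f -` A" for A using ff by (auto simp: image_iff) metis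
  have [measurable]: "f \<in> borel_measurable borel"
    using f
        by (auto intro!: borel_measurable_continuous_onI linear_continuous_on simp: linear_conv_bounded_linear)
  let ?Q = "cbox (0::'a) One"
  have "f ` (f ` ?Q) = ?Q" by (simp add: image_image ff)
  then have "emeasure lborel ?Q = ennreal c * (ennreal c * emeasure lborel ?Q)"
    using c(3)[of "f ` ?Q"] c(3)[of ?Q] c(2)[of ?Q] by simp
  then have "1 = ennreal c * ennreal c" by (simp add: emeasure_lborel_cbox_eq)
  then have "1 = ennreal (c * c)" using c(1) by (simp add: ennreal_mult)
  then have "c * c = 1" using c(1)
      by (metis ennreal_1 ennreal_inj mult_nonneg_nonneg less_imp_le zero_le_one)
  then have "c = 1" using c(1) by (simp add: square_eq_1_iff)
  then show ?thesis
    using c(3) by (intro measure_eqI) (auto simp: emeasure_distr im[symmetric])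
qed

lemma inertia_invariant:
  fixes f :: "real ^ 'n \<Rightarrow> real ^ 'n"
  assumes f: "linear f" "\<And>x. f (f x) = x" and K: "compact K" "f ` K = K"
  shows "inertia K x w = inertia K (adjoint f x) (adjoint f w)"
proof -
  have [measurable]: "f \<in> borel_measurable borel"
    using f(1)
        by (auto intro!: borel_measurable_continuous_onI linear_continuous_on simp: linear_conv_bounded_linear)
  have [measurable]: "K \<in> sets borel" using K(1) by (rule borel_compact)
  have ind: "indicator K (f z) = (indicator K z :: real)" for z
    using K(2) f(2) by (auto simp: indicator_def) (metis imageI)+
  have "inertia K x w = (LINT z|distr lborel borel f. indicator K z * ((z \<bullet> x) * (z \<bullet> w)))"
    unfolding inertia_def involution_distr[OF f] ..
  also have "\<dots> = (LINT z|lborel. indicator K (f z) * ((f z \<bullet> x) * (f z \<bullet> w)))"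
    by (rule integral_distr) measurable
  also have "\<dots> = inertia K (adjoint f x) (adjoint f w)"
    unfolding inertia_def ind by (simp add: adjoint_works[OF f(1)])
  finally show ?thesis .
qed

lemma linear_coords:
  fixes b :: "'n \<Rightarrow> real ^ 'n"
  shows "linear (\<lambda>x. \<chi> i. b i \<bullet> x)" "(\<chi> i. b i \<bullet> x) \<bullet> e = x \<bullet> (\<Sum>i\<in>UNIV. e $ i *\<^sub>R b i)"
proof -
  show "linear (\<lambda>x. \<chi> i. b i \<bullet> x)" by (rule linearI) (auto simp: vec_eq_iff inner_right_distrib)
  show "(\<chi> i. b i \<bullet> x) \<bullet> e = x \<bullet> (\<Sum>i\<in>UNIV. e $ i *\<^sub>R b i)"
    unfolding inner_sum_right inner_vec_def[of _ e] by (simp add: inner_commute mult.commute)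
qed

text \<open>\<open>T\<close> is the dual of a basis that is orthonormal for the inertia form of \<open>K\<close>, which every linear involution
  that preserves \<open>K\<close> leaves invariant.\<close>

lemma orthogonalize:
  fixes K :: "(real ^ 'n) set"
  assumes K: "compact K" "interior K \<noteq> {}"
  obtains T T' :: "real ^ 'n \<Rightarrow> real ^ 'n" where "linear T" "linear T'" "\<And>x. T (T' x) = x"
      "\<And>x. T' (T x) = x"
    "\<And>f. linear f \<Longrightarrow> (\<And>x. f (f x) = x) \<Longrightarrow> f ` K = K \<Longrightarrow> orthogonal_transformation (\<lambda>x. T (f (T' x)))"
proof -
  obtain b :: "'n \<Rightarrow> real ^ 'n" where b: "\<And>i j. inertia K (b i) (b j) = (if i = j then 1 else 0)"
    using orthonormal_family[of "inertia K"] inertia_linear[OF K(1)] inertia_sym inertia_pos[OF K]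
        by metis
  define T where "T x = (\<chi> i. b i \<bullet> x)" for x
  define S where "S e = (\<Sum>i\<in>UNIV. e $ i *\<^sub>R b i)" for e :: "real ^ 'n"
  have lT: "linear T" and TS: "T x \<bullet> e = x \<bullet> S e" for x e
    using linear_coords[of b] by (simp_all add: T_def[abs_def] S_def)
  have lS: "linear S" unfolding S_def
      by (rule linearI) (auto simp: scaleR_left_distrib sum.distrib scaleR_sum_right)
  have bS: "inertia K (S e) (S f) = e \<bullet> f" for e f
  proof -
    have l1: "inertia K (S e) w = (\<Sum>i\<in>UNIV. e $ i * inertia K (b i) w)" for e w
      unfolding S_def linear_sum[OF inertia_linear[OF K(1)]]
          by (simp add: linear_cmul[OF inertia_linear[OF K(1)]])
    have "inertia K (b i) (S f) = (\<Sum>j\<in>UNIV. if j = i then f $ j else 0)" for i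
      unfolding inertia_sym[of K "b i"] l1 by (rule sum.cong) (auto simp: b)
    then show ?thesis by (simp add: l1 inner_vec_def)
  qed
  have "inj S"
  proof (rule linear_injective_0[OF lS, THEN iffD2], intro allI impI)
    fix e assume "S e = 0"
    then have "e \<bullet> e = inertia K 0 0" using bS[of e e] by simp
    also have "\<dots> = 0" using linear_0[OF inertia_linear[OF K(1), of 0]] by simp
    finally show "e = 0" by simp
  qed
  then have "surj S" using linear_injective_imp_surjective[OF lS] by blast
  have "inj T"
  proof (rule linear_injective_0[OF lT, THEN iffD2], intro allI impI)
    fix x assume "T x = 0"
    then have "x \<bullet> S e = 0" for e using TS[of x e] by simp
    moreover obtain e where "x = S e" using \<open>surj S\<close> by (metis surjD)
    ultimately show "x = 0" by (metis inner_eq_zero_iff)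
  qed
  then obtain T' where T': "linear T'" "\<And>x. T' (T x) = x" "\<And>x. T (T' x) = x"
    using linear_injective_isomorphism[OF lT] by blast
  show thesis
  proof (rule that[OF lT T'(1,3,2)])
    fix f :: "real ^ 'n \<Rightarrow> real ^ 'n" assume f: "linear f" "\<And>x. f (f x) = x" "f ` K = K"
    define N where "N x = T (f (T' x))" for x
    have lN: "linear N" unfolding N_def using linear_compose[OF linear_compose[OF T'(1) f(1)] lT]
        by (simp add: o_def)
    have NN: "N (N x) = x" for x by (simp add: N_def T' f(2))
    define M where "M = adjoint N"
    have M: "x \<bullet> M y = N x \<bullet> y" for x y unfolding M_def by (rule adjoint_works[OF lN])
    have MM: "M (M y) = y" for y
    proof -
      have "x \<bullet> M (M y) = x \<bullet> y" for x by (simp add: M NN)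
      then show ?thesis by (metis vector_eq_ldot)
    qed
    \<comment> \<open>\<open>S\<close> is the adjoint of \<open>T\<close> and carries the standard
      inner product to the inertia form. It turns \<open>M\<close> into the adjoint of
      \<open>f\<close>, so invariance of the form makes \<open>M\<close> an isometry.\<close>
    have SM: "S (M e) = adjoint f (S e)" for e
    proof -
      have "x \<bullet> S (M e) = x \<bullet> adjoint f (S e)" for x
      proof -
        have "x \<bullet> S (M e) = N (T x) \<bullet> e" by (simp add: TS[symmetric] M)
        also have "\<dots> = f x \<bullet> S e" by (simp add: N_def T' TS)
        finally show ?thesis by (simp add: adjoint_works[OF f(1)])
      qed
      then show ?thesis by (metis vector_eq_ldot)
    qed
    have iso: "M e \<bullet> M g = e \<bullet> g" for e g
      using inertia_invariant[OF f(1,2) K(1) f(3), of "S e" "S g"] bS[of "M e" "M g"] bS[of e g]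
          by (simp add: SM)
    \<comment> \<open>An isometric involution is its own adjoint, hence \<open>N\<close> is
      self-adjoint; as an involution it is then orthogonal.\<close>
    have "N x \<bullet> y = x \<bullet> N y" for x y
    proof -
      have "N x \<bullet> y = x \<bullet> M y" by (simp add: M)
      also have "\<dots> = M x \<bullet> y" using iso[of x "M y"] by (simp add: MM)
      also have "\<dots> = x \<bullet> N y" by (simp add: M inner_commute[of _ y] inner_commute[of x])
      finally show ?thesis .
    qed
    then have "N x \<bullet> N y = x \<bullet> y" for x y by (metis NN)
    then show "orthogonal_transformation (\<lambda>x. T (f (T' x)))"
      unfolding N_def[symmetric] using lN by (simp add: orthogonal_transformation_def)
  qed
qed

text \<open>An orthogonal map that fixes a hyperplane pointwise sends its unit normal to a multiple
  \<open>k\<close> of itself. Being an involution gives \<open>k * k = 1\<close>, and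
  \<open>k = 1\<close> would give the identity.\<close>

lemma orthogonal_involution_reflect:
  fixes N :: "real ^ 'n \<Rightarrow> real ^ 'n"
  assumes N: "orthogonal_transformation N" "\<And>x. N (N x) = x" "N \<noteq> id"
    and H: "subspace H" "dim H = CARD('n) - 1" "\<And>x. x \<in> H \<Longrightarrow> N x = x"
  obtains a where "norm a = 1" "N = reflect a" "H = {x. a \<bullet> x = 0}"
proof -
  note lN = orthogonal_transformation_linear[OF N(1)]
  have NI: "N x \<bullet> N y = x \<bullet> y" for x y using N(1) by (simp add: orthogonal_transformation_def)
  have "dim H < DIM(real ^ 'n)" using H(2) by simp
  then obtain a0 where a0: "a0 \<noteq> 0" "\<And>y. y \<in> span H \<Longrightarrow> orthogonal a0 y"
      using orthogonal_to_subspace_exists by metis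
  define a where "a = inverse (norm a0) *\<^sub>R a0"
  have a1: "norm a = 1" using a0(1) by (simp add: a_def)
  have a: "norm a = 1" "a \<bullet> a = 1" using a1 by (simp_all only: norm_eq_1[symmetric])
  have aH: "a \<bullet> x = 0" if "x \<in> H" for x using a0(2)[OF span_base[OF that]]
      by (simp add: a_def orthogonal_def)
  have He: "H = {x. a \<bullet> x = 0}"
  proof (rule subspace_dim_equal[OF H(1) subspace_hyperplane])
    show "H \<subseteq> {x. a \<bullet> x = 0}" using aH by auto
    show "dim {x. a \<bullet> x = 0} \<le> dim H" using dim_hyperplane[of a] a(1) H(2) by (cases "a = 0") auto
  qed
  have dec: "x - (a \<bullet> x) *\<^sub>R a \<in> H" for x unfolding He by (simp add: inner_diff_right a)
  define k where "k = a \<bullet> N a"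
  define r where "r = N a - k *\<^sub>R a"
  have rH: "r \<in> H" unfolding r_def k_def by (rule dec)
  have "r \<bullet> r = N a \<bullet> r" using aH[OF rH] by (simp add: r_def[of] inner_diff_left)
  also have "\<dots> = N a \<bullet> N r" using H(3)[OF rH] by simp
  also have "\<dots> = 0" using aH[OF rH] by (simp add: NI)
  finally have Na: "N a = k *\<^sub>R a" by (simp add: r_def)
  have Nx: "N x = (x - (a \<bullet> x) *\<^sub>R a) + ((a \<bullet> x) * k) *\<^sub>R a" for x
  proof -
    have "N x = N (x - (a \<bullet> x) *\<^sub>R a) + (a \<bullet> x) *\<^sub>R N a"
      by (simp add: linear_diff[OF lN] linear_cmul[OF lN])
    then show ?thesis using H(3)[OF dec[of x]] Na by simp
  qed
  have "N (N a) = (k * k) *\<^sub>R a" by (simp add: Na linear_cmul[OF lN])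
  then have "a \<bullet> a = (k * k) * (a \<bullet> a)" using N(2)[of a] by (metis inner_scaleR_right)
  then have "k * k = 1" using a by simp
  moreover have "k \<noteq> 1"
  proof
    assume "k = 1"
    then have "N = id" using Nx by (auto simp: fun_eq_iff)
    then show False using N(3) by simp
  qed
  ultimately have km: "k = -1" by (auto simp: square_eq_1_iff)
  have "N x = reflect a x" for x
    unfolding Nx reflect_def km mult_2 scaleR_left_distrib by simp
  then have "N = reflect a" by (simp add: fun_eq_iff)
  then show thesis using that a(1) He by blast
qed

section \<open>Transport by a linear change of coordinates\<close>

lemma decomposes_image:
  fixes T T' :: "real ^ 'n \<Rightarrow> real ^ 'n"
  assumes T: "linear T" "\<And>x. T' (T x) = x" and dec: "decomposes F K L"
    and F: "\<And>f'. f' \<in> F' \<Longrightarrow> \<exists>f\<in>F. \<forall>x. f' (T x) = T (f x)"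
  shows "decomposes F' (T ` K) (T ` L)"
proof -
  obtain m Ks Ls where D: "1 \<le> m" "K = (\<Sum>j\<in>{1..m::nat}. Ks j)" "L = (\<Sum>j\<in>{1..m}. Ls j)"
    "\<forall>j\<in>{1..m}. compact (Ks j) \<and> convex (Ks j) \<and> aff_dim (Ks j) \<ge> 1
        \<and> compact (Ls j) \<and> convex (Ls j) \<and> aff_dim (Ls j) \<ge> 1
        \<and> (\<forall>f\<in>F. f ` Ks j = Ks j \<and> f ` Ls j = Ls j) \<and> homothetic (Ks j) (Ls j)"
    "(\<Sum>j\<in>{1..m}. aff_dim (Ks j)) = int CARD('n)"
    using dec unfolding decomposes_def by (elim exE conjE) (rule that)
  have injT: "inj T" by (rule inj_on_inverseI[of _ T']) (rule T(2))
  have ad: "aff_dim (T ` X) = aff_dim X" for X by (rule aff_dim_injective_linear_image[OF T(1) injT])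
  have co: "compact (T ` X)" if "compact X" for X
    using that T(1)
        by (intro compact_continuous_image linear_continuous_on) (auto simp: linear_conv_bounded_linear)
  have hom: "homothetic (T ` X) (T ` Y)" if h: "homothetic X Y" for X Y
  proof -
    obtain c x where c: "0 < c" "Y = (\<lambda>y. c *\<^sub>R y + x) ` X" using h by (auto simp: homothetic_def)
    have "T ` Y = (\<lambda>y. c *\<^sub>R y + T x) ` (T ` X)"
      unfolding c(2) image_image by (simp add: linear_add[OF T(1)] linear_cmul[OF T(1)])
    then show ?thesis unfolding homothetic_def using c(1) by blast
  qed
  have inv: "f' ` T ` X = T ` X" if f': "f' \<in> F'" and X: "\<And>f. f \<in> F \<Longrightarrow> f ` X = X" for f' X
  proof -
    obtain f where f: "f \<in> F" "\<And>x. f' (T x) = T (f x)" using F[OF f'] by blast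
    have "f' ` T ` X = T ` (f ` X)" by (simp add: image_image f(2))
    then show ?thesis using X[OF f(1)] by simp
  qed
  show ?thesis
    unfolding decomposes_def
  proof (rule exI[of _ m], rule exI[of _ "\<lambda>j. T ` Ks j"], rule exI[of _ "\<lambda>j. T ` Ls j"], intro conjI)
    show "1 \<le> m" by fact
    show "T ` K = (\<Sum>j = 1..m. T ` Ks j)" unfolding D(2) by (rule set_sum_image[OF T(1)])
    show "T ` L = (\<Sum>j = 1..m. T ` Ls j)" unfolding D(3) by (rule set_sum_image[OF T(1)])
    show "(\<Sum>j\<in>{1..m}. aff_dim (T ` Ks j)) = int CARD('n)" unfolding ad by (rule D(5))
    show "\<forall>j\<in>{1..m}. compact (T ` Ks j) \<and> convex (T ` Ks j) \<and> aff_dim (T ` Ks j) \<ge> 1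
        \<and> compact (T ` Ls j) \<and> convex (T ` Ls j) \<and> aff_dim (T ` Ls j) \<ge> 1
        \<and> (\<forall>f\<in>F'. f ` T ` Ks j = T ` Ks j \<and> f ` T ` Ls j = T ` Ls j) \<and> homothetic (T ` Ks j) (T ` Ls j)"
    proof
      fix j assume "j \<in> {1..m}"
      note Dj = bspec[OF D(4) this]
      show "compact (T ` Ks j) \<and> convex (T ` Ks j) \<and> aff_dim (T ` Ks j) \<ge> 1
        \<and> compact (T ` Ls j) \<and> convex (T ` Ls j) \<and> aff_dim (T ` Ls j) \<ge> 1
        \<and> (\<forall>f\<in>F'. f ` T ` Ks j = T ` Ks j \<and> f ` T ` Ls j = T ` Ls j) \<and> homothetic (T ` Ks j) (T ` Ls j)"
        unfolding ad using Dj by (intro conjI ballI co hom inv convex_linear_image[OF T(1)]) auto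
    qed
  qed
qed

lemma interior_zero_image:
  fixes T T' :: "real ^ 'n \<Rightarrow> real ^ 'n"
  assumes "linear T" "\<And>x. T' (T x) = x" "0 \<in> interior X" shows "0 \<in> interior (T ` X)"
proof -
  have "inj T" by (rule inj_on_inverseI[of _ T']) (rule assms(2))
  then have "interior (T ` X) = T ` interior X" by (rule interior_injective_linear_image[OF assms(1)])
  then show ?thesis using assms(3) linear_0[OF assms(1)] by force
qed

text \<open>The support function of the image at \<open>w\<close> is the old one at
  \<open>adjoint T w\<close>, and the adjoint is surjective. It does not map the sphere to itself,
  which is why the bound is tested on all vectors.\<close>

lemma L0_sum_image:
  fixes T T' :: "real ^ 'n \<Rightarrow> real ^ 'n"
  assumes T: "linear T" "linear T'" "\<And>x. T (T' x) = x" "\<And>x. T' (T x) = x" and KL: "L0_pair l K L"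
  shows "L0_sum l (T ` K) (T ` L) = T ` L0_sum l K L"
proof -
  interpret A: L0_pair l K L by fact
  have im: "compact (T ` X)" "convex (T ` X)" "0 \<in> interior (T ` X)" if "compact X" "convex X"
      "0 \<in> interior X" for X
    using that T(1) interior_zero_image[OF T(1,4)]
    by (auto intro!: compact_continuous_image linear_continuous_on convex_linear_image simp: linear_conv_bounded_linear)
  interpret B: L0_pair l "T ` K" "T ` L"
    using A.l im[OF A.K] im[OF A.L] by unfold_locales
  have ad: "x \<bullet> adjoint T w = T x \<bullet> w" for x w by (rule adjoint_works[OF T(1)])
  have sf: "support_function (T ` X) w = support_function X (adjoint T w)" for X w
    by (rule sf_image_adjoint) (simp add: ad)
  have bd: "L0_bound l (T ` K) (T ` L) w = L0_bound l K L (adjoint T w)" for w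
    by (simp add: L0_bound_def sf)
  have sur: "adjoint T (adjoint T' w) = w" for w
  proof -
    have "x \<bullet> adjoint T (adjoint T' w) = x \<bullet> w" for x by (simp add: ad adjoint_works[OF T(2)] T)
    then show ?thesis by (metis vector_eq_ldot)
  qed
  have "T x \<in> L0_sum l (T ` K) (T ` L) \<longleftrightarrow> x \<in> L0_sum l K L" for x
  proof -
    have "T x \<in> L0_sum l (T ` K) (T ` L) \<longleftrightarrow> (\<forall>w. x \<bullet> adjoint T w \<le> L0_bound l K L (adjoint T w))"
      unfolding B.L0_iff by (simp add: bd ad)
    also have "\<dots> \<longleftrightarrow> (\<forall>w. x \<bullet> w \<le> L0_bound l K L w)" using sur by metis
    finally show ?thesis by (simp add: A.L0_iff)
  qed
  then show ?thesis using T(3) by (auto simp: image_iff) metis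
qed

theorem theorem2:
  fixes l :: real
    and A :: "nat \<Rightarrow> real ^ 'n ^ 'n"
    and H :: "nat \<Rightarrow> (real ^ 'n) set"
    and K L :: "(real ^ 'n) set"
  assumes "0 < l" and "l < 1"
    and "\<forall>i\<in>{1..CARD('n)}. linear_reflection (A i) (H i)"
    and "(\<Inter>i\<in>{1..CARD('n)}. H i) = {0}"
    and "convex_body K" and "convex_body L"
    and "\<forall>i\<in>{1..CARD('n)}. invariant_under (A i) K"
    and "\<forall>i\<in>{1..CARD('n)}. invariant_under (A i) L"
  shows "measure lebesgue (L0_sum l K L)
           \<ge> measure lebesgue K powr (1 - l) * measure lebesgue L powr l
       \<and> (measure lebesgue (L0_sum l K L)
           = measure lebesgue K powr (1 - l) * measure lebesgue L powr l
          \<longleftrightarrow>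
          (\<exists>(m::nat) (Ks :: nat \<Rightarrow> (real ^ 'n) set) (Ls :: nat \<Rightarrow> (real ^ 'n) set).
             m \<ge> 1
           \<and> K = (\<Sum>j\<in>{1..m}. Ks j)
           \<and> L = (\<Sum>j\<in>{1..m}. Ls j)
           \<and> (\<forall>j\<in>{1..m}.
                 compact (Ks j) \<and> convex (Ks j) \<and> aff_dim (Ks j) \<ge> 1
               \<and> compact (Ls j) \<and> convex (Ls j) \<and> aff_dim (Ls j) \<ge> 1
               \<and> (\<forall>i\<in>{1..CARD('n)}. invariant_under (A i) (Ks j)
                                    \<and> invariant_under (A i) (Ls j))
               \<and> homothetic (Ks j) (Ls j))
           \<and> (\<Sum>j\<in>{1..m}. aff_dim (Ks j)) = int CARD('n)))"
proof -
  let ?I = "{1..CARD('n)}"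
  define f where "f i x = A i *v x" for i x
  have lf: "linear (f i)" for i unfolding f_def by (rule matrix_vector_mul_linear)
  have fR: "f i (f i x) = x" "f i \<noteq> id" "subspace (H i)" "dim (H i) = CARD('n) - 1"
      "x \<in> H i \<Longrightarrow> f i x = x" if "i \<in> ?I" for i x
  proof -
    have r: "linear_reflection (A i) (H i)" using assms(3) that by blast
    show "f i (f i x) = x" using r by (simp add: f_def linear_reflection_def matrix_vector_mul_assoc)
    show "subspace (H i)" "dim (H i) = CARD('n) - 1" "x \<in> H i \<Longrightarrow> f i x = x" using r
        by (simp_all add: f_def linear_reflection_def)
    show "f i \<noteq> id"
    proof
      assume "f i = id"
      then have "A i *v x = mat 1 *v x" for x by (simp add: f_def fun_eq_iff)
      then have "A i = mat 1" by (metis matrix_eq)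
      then show False using r by (simp add: linear_reflection_def)
    qed
  qed
  have fK: "f i ` K = K" "f i ` L = L" if "i \<in> ?I" for i
    using assms(7,8) that by (simp_all add: invariant_under_def f_def[abs_def])
  have cK: "compact K" "convex K" "interior K \<noteq> {}" and cL: "compact L" "convex L" "interior L \<noteq> {}"
    using assms(5,6) by (simp_all add: convex_body_def)
  obtain T T' :: "real ^ 'n \<Rightarrow> real ^ 'n" where T: "linear T" "linear T'" "\<And>x. T (T' x) = x"
      "\<And>x. T' (T x) = x"
    and orth: "\<And>f. linear f \<Longrightarrow> (\<And>x. f (f x) = x) \<Longrightarrow> f ` K = K \<Longrightarrow> orthogonal_transformation (\<lambda>x. T (f (T' x)))"
    by (rule orthogonalize[OF cK(1,3)]) blast
  have injT: "inj T" by (rule inj_on_inverseI[of _ T']) (rule T(4))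
  have "\<exists>a. norm a = 1 \<and> (\<forall>x. T (f i (T' x)) = reflect a x) \<and> T ` H i = {x. a \<bullet> x = 0}" if i: "i \<in> ?I"
      for i
  proof -
    have "\<exists>a. norm a = 1 \<and> (\<lambda>x. T (f i (T' x))) = reflect a \<and> T ` H i = {x. a \<bullet> x = 0}"
    proof (rule orthogonal_involution_reflect[of "\<lambda>x. T (f i (T' x))" "T ` H i"])
      show "orthogonal_transformation (\<lambda>x. T (f i (T' x)))"
          by (rule orth[OF lf fR(1)[OF i] fK(1)[OF i]])
      show "T (f i (T' (T (f i (T' x))))) = x" for x by (simp add: T fR(1)[OF i])
      show "(\<lambda>x. T (f i (T' x))) \<noteq> id"
      proof
        assume id: "(\<lambda>x. T (f i (T' x))) = id"
        have "f i x = x" for x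
        proof -
          have "T (f i (T' (T x))) = T x" using fun_cong[OF id, of "T x"] by simp
          then show ?thesis using T(4) by metis
        qed
        then show False using fR(2)[OF i] by auto
      qed
      show "subspace (T ` H i)" by (rule linear_subspace_image[OF T(1) fR(3)[OF i]])
      show "dim (T ` H i) = CARD('n) - 1" using dim_image_eq[OF T(1), of "H i"] injT fR(4)[OF i]
          by (simp add: inj_on_subset)
      show "T (f i (T' x)) = x" if "x \<in> T ` H i" for x using that fR(5)[OF i] by (auto simp: T)
    qed blast
    then show ?thesis by (metis (no_types, lifting))
  qed
  then obtain a where a: "\<And>i. i \<in> ?I \<Longrightarrow> norm (a i) = 1" "\<And>i x. i \<in> ?I \<Longrightarrow> T (f i (T' x)) = reflect (a i) x"
    "\<And>i. i \<in> ?I \<Longrightarrow> T ` H i = {x. a i \<bullet> x = 0}" by metis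
  have aT: "reflect (a i) (T x) = T (f i x)" "f i (T' x) = T' (reflect (a i) x)" if "i \<in> ?I" for i x
    using a(2)[OF that, of "T x"] a(2)[OF that, of x] T by metis+
  define As where "As = a ` ?I"
  \<comment> \<open>A vector orthogonal to all normals would lie, after \<open>T'\<close>, in every
    \<open>H i\<close>, and their intersection is trivial.\<close>
  have span: "span As = UNIV"
  proof (rule ccontr)
    assume "span As \<noteq> UNIV"
    then have "span As \<subset> span UNIV" by auto
    then obtain x where x: "x \<noteq> 0" "\<And>y. y \<in> span As \<Longrightarrow> orthogonal x y"
      by (rule orthogonal_to_subspace_exists_gen) blast
    have "T' x \<in> H i" if i: "i \<in> ?I" for i
    proof -
      have "a i \<bullet> x = 0" using x(2)[of "a i"] i
          by (auto simp: As_def span_base orthogonal_def inner_commute)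
      then have "x \<in> T ` H i" using a(3)[OF i] by simp
      then show ?thesis using T(4) by auto
    qed
    then have "T' x \<in> (\<Inter>i\<in>?I. H i)" by blast
    then have "T' x = 0" unfolding assms(4) by simp
    then have "x = 0" using T(3)[of x] linear_0[OF T(1)] by simp
    then show False using x(1) by simp
  qed
  interpret reflection_setting As l
    using assms(1,2) span a(1) by unfold_locales (auto simp: As_def)
  have body: "body (T ` X)" if X: "compact X" "convex X" "interior X \<noteq> {}" "\<And>i. i \<in> ?I \<Longrightarrow> f i ` X = X"
      for X
    unfolding body_def convex_body_def
  proof (intro conjI ballI)
    show "compact (T ` X)"
      using X(1) T(1)
          by (intro compact_continuous_image linear_continuous_on) (auto simp: linear_conv_bounded_linear)
    show "convex (T ` X)" by (rule convex_linear_image[OF T(1) X(2)])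
    show "interior (T ` X) \<noteq> {}" using interior_injective_linear_image[OF T(1) injT] X(3) by simp
    fix b assume "b \<in> As"
    then obtain i where i: "i \<in> ?I" "b = a i" by (auto simp: As_def)
    have "reflect b ` T ` X = T ` (f i ` X)" unfolding i(2) image_image using aT(1)[OF i(1)] by simp
    then show "reflect b ` T ` X = T ` X" using X(4)[OF i(1)] by simp
  qed
  have bK: "body (T ` K)" and bL: "body (T ` L)" using body cK cL fK by blast+
  have TT: "T' ` T ` X = X" for X by (simp add: image_image T)
  have pair: "L0_pair l K L"
  proof -
    interpret P: L0_pair l "T ` K" "T ` L" by (rule body_pair[OF bK bL])
    show ?thesis
      using assms(1,2) cK cL interior_zero_image[OF T(2,3) P.K(3)] interior_zero_image[OF T(2,3) P.L(3)]
      by unfold_locales (simp_all add: TT)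
  qed
  obtain c where c: "0 < c" "\<And>X. X \<in> sets borel \<Longrightarrow> measure lebesgue (T ` X) = c * measure lebesgue X"
    by (rule linear_image_measure_lebesgue[OF T]) blast
  have V: "measure lebesgue (T ` K) = c * measure lebesgue K"
      "measure lebesgue (T ` L) = c * measure lebesgue L"
    "measure lebesgue (L0_sum l (T ` K) (T ` L)) = c * measure lebesgue (L0_sum l K L)"
    unfolding L0_sum_image[OF T pair] using c(2) cK(1) cL(1) L0_pair.L0_compact[OF pair]
        by (simp_all add: borel_compact)
  have Vm: "measure lebesgue (T ` K) powr (1 - l) * measure lebesgue (T ` L) powr l = c * (measure lebesgue K powr (1 - l) * measure lebesgue L powr l)"
    unfolding V using c(1) by (intro powr_mean_scale) auto
  have ineq: "measure lebesgue K powr (1 - l) * measure lebesgue L powr l \<le> measure lebesgue (L0_sum l K L)"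
    using body_inequality[OF bK bL] c(1) unfolding Vm V(3) by simp
  have "measure lebesgue (L0_sum l K L) = measure lebesgue K powr (1 - l) * measure lebesgue L powr l
    \<longleftrightarrow> measure lebesgue (L0_sum l (T ` K) (T ` L)) = measure lebesgue (T ` K) powr (1 - l) * measure lebesgue (T ` L) powr l"
    using c(1) unfolding Vm V(3) by simp
  also have "\<dots> \<longleftrightarrow> decomposes (reflect ` As) (T ` K) (T ` L)"
    using body_equality_imp[OF bK bL] body_equality_if[OF bK bL] by blast
  also have "\<dots> \<longleftrightarrow> decomposes (f ` ?I) K L"
  proof
    assume "decomposes (reflect ` As) (T ` K) (T ` L)"
    then have "decomposes (f ` ?I) (T' ` T ` K) (T' ` T ` L)"
    proof (rule decomposes_image[OF T(2,3)])
      fix g assume "g \<in> f ` ?I"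
      then obtain i where i: "i \<in> ?I" "g = f i" by blast
      then show "\<exists>h\<in>reflect ` As. \<forall>x. g (T' x) = T' (h x)" using aT(2)[OF i(1)] by (auto simp: As_def)
    qed
    then show "decomposes (f ` ?I) K L" by (simp only: TT)
  next
    assume "decomposes (f ` ?I) K L"
    then show "decomposes (reflect ` As) (T ` K) (T ` L)"
    proof (rule decomposes_image[OF T(1,4)])
      fix g assume "g \<in> reflect ` As"
      then obtain i where i: "i \<in> ?I" "g = reflect (a i)" by (auto simp: As_def)
      then show "\<exists>h\<in>f ` ?I. \<forall>x. g (T x) = T (h x)" using aT(1)[OF i(1)] by blast
    qed
  qed
  also have "\<dots> \<longleftrightarrow> (\<exists>(m::nat) (Ks :: nat \<Rightarrow> (real ^ 'n) set) (Ls :: nat \<Rightarrow> (real ^ 'n) set).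
             m \<ge> 1
           \<and> K = (\<Sum>j\<in>{1..m}. Ks j)
           \<and> L = (\<Sum>j\<in>{1..m}. Ls j)
           \<and> (\<forall>j\<in>{1..m}.
                 compact (Ks j) \<and> convex (Ks j) \<and> aff_dim (Ks j) \<ge> 1
               \<and> compact (Ls j) \<and> convex (Ls j) \<and> aff_dim (Ls j) \<ge> 1
               \<and> (\<forall>i\<in>{1..CARD('n)}. invariant_under (A i) (Ks j)
                                    \<and> invariant_under (A i) (Ls j))
               \<and> homothetic (Ks j) (Ls j))
           \<and> (\<Sum>j\<in>{1..m}. aff_dim (Ks j)) = int CARD('n))"
    unfolding decomposes_def invariant_under_def f_def[abs_def] by (simp only: ball_simps)
  finally show ?thesis using ineq by blast
qed

end
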